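(* Assume that the data $(H,f,g,m_0)$ satisfy Assumptions (M), (H), (F), (G), (SE) (listed in the context), and let $(u,m)\in C^3(\overline{Q_T})\times C^2(\overline{Q_T})$ be a solution to the mean field games system (MFG). Then there exist constants $L,L_1,K,K_1$, with \[ L=L\left(L_1,\,|g_1f_0^{-1}(L_1)|,\,|g_0f_1^{-1}(-L_1)|,\,g_0^{-1}g_1f_0^{-1}(L_1),\,\frac{1}{g_1^{-1}g_0f_1^{-1}(-L_1)}\right),\qquad L_1=L_1(C_0,T), \] \[ K=K(K_1,\beta_{K_1}),\qquad K_1=K_1\left(L,\frac1T,\frac1{1-\tau},f_0\left(\frac1L\right)^-\right), \] such that \[ \|u\|_{C^0(\overline{Q_T})}+\|m(\cdot,T)\|_{C^0(\mathbb{T}^d)}+\left\|\frac1{m(\cdot,T)}\right\|_{C^0(\mathbb{T}^d)}\le L\qquad\text{and}\qquad\|Du\|_{C^0(\overline{Q_T})}\le K. \]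
   Context: Setting. $d\ge 1$ is an integer, $T>0$, $\mathbb{T}^d=\mathbb{R}^d/\mathbb{Z}^d$, $Q_T=\mathbb{T}^d\times(0,T)$. The data are $H:\mathbb{T}^d\times\mathbb{R}^d\to\mathbb{R}$, $f,g:\mathbb{T}^d\times[0,\infty)\to[-\infty,\infty)$, and $m_0:\mathbb{T}^d\to\mathbb{R}$. The system (MFG) is \[-u_t+H(x,D_xu)=f(x,m),\quad m_t-\mathrm{div}(mD_pH(x,D_xu))=0\ \text{ in }Q_T,\qquad m(\cdot,0)=m_0,\ u(\cdot,T)=g(\cdot,m(\cdot,T))\ \text{ on }\mathbb{T}^d.\] $Du=(D_xu,u_t)$ is the full space-time gradient; $a^-$ is the negative part of $a$. Assumptions. $C_0>0$ and $0\le\tau<1$ are fixed constants. For each $x$, $f^{-1}(x,\cdot)$ is the inverse function of $f(x,\cdot)$; $\chi(x,w)=f^{-1}(x,w)\,f_m(x,f^{-1}(x,w))$ and $h=\sqrt\chi$. (M) $m_0\in C^4(\mathbb{T}^d)$, $m_0>0$, $\int_{\mathbb{T}^d}m_0=1$. (H) $H$, $D_pH$, $D^2_{pp}H$ are four times continuously differentiable and, for all $(x,p)$: $\frac1{C_0}I\le D^2_{pp}H\le C_0I$; $D_pH\cdot p\ge 2H-C_0$; $|D^3_{ppp}H|\le C_0(1+|p|)^{-1}$; $|D^3_{xxp}H|\le C_0(1+|p|)^{\tau}$; $|D^3_{xpp}H|\le C_0(1+|p|)^{\tau-1}$. (F) $f$ is continuous on $\mathbb{T}^d\times[0,\infty)$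 (with values in $[-\infty,\infty)$), four times continuously differentiable on $\mathbb{T}^d\times(0,\infty)$, strictly increasing in $m$ with $f_m>0$; $\liminf_{x\in\mathbb{T}^d,\,m\to\infty}mf_m(x,m)>0$; $|\chi_w|\le C_0$ (equivalently, up to changing the constant, $|mf_{mm}|\le C_0f_m$); $|m(D_xf)_m|\le C_0|D_xf|$; and $|D_xf|,|D^2_{xx}f|\le C_0(1+|f|^{\tau/2}+|mf_m|^{(1+\tau)/2})$. (G) $g$ is continuous on $\mathbb{T}^d\times[0,\infty)$, four times continuously differentiable on $\mathbb{T}^d\times(0,\infty)$, strictly increasing in $m$ with $g_m>0$, and for each $x$, $\lim_{m\to\infty}g(x,m)=\sup g$ and $g(x,0)=\inf g$ (sup and inf over $\mathbb{T}^d\times[0,\infty)$). (SE) $f(x,0)=-\infty$ for all $x\in\mathbb{T}^d$. Convention on $C_0$: $C_0$ is taken large enough that also $\frac1{C_0}|p|^2-C_0\le H\le C_0|p|^2+C_0$, $|D_pH|\le C_0(1+|p|)$, $|D_xH|,|D^2_{xx}H|\le C_0(1+|p|^{1+\tau})$, $|D^2_{xp}H|\le C_0(1+|p|)^\tau$, and $\|\chi(\cdot,0)\|_{C^0(\mathbb{T}^d)}+\|m_0\|_{C^1(\mathbb{T}^d)}+\|f\|_{C^2(\mathbb{T}^d\times[\min m_0,\max m_0])}\le C_0$. Notation. $f_0(m)=\min_{\mathbb{T}^d}f(\cdot,m)$, $f_1(m)=\max_{\mathbb{T}^d}f(\cdot,m)$, $g_0(m)=\min_{\mathbb{T}^d}g(\cdot,m)$,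 $g_1(m)=\max_{\mathbb{T}^d}g(\cdot,m)$ for $m>0$; these are continuous and strictly increasing, and juxtaposition such as $g_1f_0^{-1}(c)$ denotes composition $g_1(f_0^{-1}(c))$. For $K>0$, \[\beta_K=\|f\|_{C^1(\mathbb{T}^d\times[\frac1K,K])}+\|D_xg\|_{C^1(\mathbb{T}^d\times[\frac1K,K])}+\left\|\tfrac1\chi\right\|_{C^0(\mathbb{T}^d\times[-K,\infty))}+\|h_w\|_{C^0(\mathbb{T}^d\times[-K,\infty))}.\] Writing $C=C(K_1,\dots,K_M)$ means that $C$ is a positive constant depending (only, with $d$ fixed) monotonically on the nonnegative quantities $K_1,\dots,K_M$. *)

theory Defs
  imports "HOL-Analysis.Analysis"
begin

text \<open>
  Points of the torus are represented by points of \<open>real^'n\<close> (so that \<open>d = CARD('n)\<close>), and functions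
  on the torus by functions that have period 1 in each coordinate. The time variable, the density
  variable and the momentum variable form the second component of a pair.
\<close>

definition periodic :: "(real^'n \<Rightarrow> 'b) \<Rightarrow> bool" where
  "periodic F \<longleftrightarrow> (\<forall>x i. F (x + axis i 1) = F x)"

definition periodic_fst :: "'c set \<Rightarrow> ((real^'n) \<times> 'c \<Rightarrow> 'b) \<Rightarrow> bool" where
  "periodic_fst Y F \<longleftrightarrow> (\<forall>y\<in>Y. periodic (\<lambda>x. F (x, y)))"

section \<open>Derivatives, \<open>C\<^sup>k\<close> functions and norms\<close>

text \<open>
  Derivatives are taken within a set \<open>S\<close>. The sets \<open>S\<close> below are either open or of the form
  \<open>UNIV \<times> {0..T}\<close> with \<open>T > 0\<close>, and in both cases the derivative within \<open>S\<close> is unique. In the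
  second case \<open>Ck_on k S\<close> describes functions that are \<open>C\<^sup>k\<close> up to the boundary.
\<close>

primrec Ck_on :: "nat \<Rightarrow> 'a::euclidean_space set \<Rightarrow> ('a \<Rightarrow> 'b::real_normed_vector) \<Rightarrow> bool" where
  "Ck_on 0 S F \<longleftrightarrow> continuous_on S F"
| "Ck_on (Suc k) S F \<longleftrightarrow> F differentiable_on S \<and>
     (\<forall>b\<in>Basis. Ck_on k S (\<lambda>z. frechet_derivative F (at z within S) b))"

text \<open>
  Gradients in the first and in the second vector variable, and the derivative in a scalar second
  variable. Iterating the gradients yields arrays of type \<open>real^'n^'n\<close>, \<open>real^'n^'n^'n\<close>, whose
  library norm is the Euclidean (Frobenius) norm of the array of partial derivatives.
\<close>

definition D_fst ::
    "((real^'n) \<times> 'c::euclidean_space) set \<Rightarrow> ((real^'n) \<times> 'c \<Rightarrow> 'b::real_normed_vector)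
      \<Rightarrow> (real^'n) \<times> 'c \<Rightarrow> 'b^'n" where
  "D_fst S F z = (\<chi> i. frechet_derivative F (at z within S) (axis i 1, 0))"

definition D_snd ::
    "('c::euclidean_space \<times> (real^'n)) set \<Rightarrow> ('c \<times> (real^'n) \<Rightarrow> 'b::real_normed_vector)
      \<Rightarrow> 'c \<times> (real^'n) \<Rightarrow> 'b^'n" where
  "D_snd S F z = (\<chi> i. frechet_derivative F (at z within S) (0, axis i 1))"

definition d_snd ::
    "('c::euclidean_space \<times> real) set \<Rightarrow> ('c \<times> real \<Rightarrow> 'b::real_normed_vector)
      \<Rightarrow> 'c \<times> real \<Rightarrow> 'b" where
  "d_snd S F z = frechet_derivative F (at z within S) (0, 1)"

text \<open>Squared Euclidean norm of the array of all partial derivatives of order \<open>j\<close>.\<close>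

primrec deriv_norm_sq ::
    "nat \<Rightarrow> 'a::euclidean_space set \<Rightarrow> ('a \<Rightarrow> 'b::real_normed_vector) \<Rightarrow> 'a \<Rightarrow> real" where
  "deriv_norm_sq 0 S F z = (norm (F z))\<^sup>2"
| "deriv_norm_sq (Suc j) S F z =
     (\<Sum>b\<in>Basis. deriv_norm_sq j S (\<lambda>y. frechet_derivative F (at y within S) b) z)"

text \<open>
  Norms are \<open>ennreal\<close>-valued, so that they are also meaningful for unbounded functions.
  In \<open>Ck_norm k S A F\<close> the derivatives of \<open>F\<close> within \<open>S\<close> are evaluated on \<open>A \<subseteq> S\<close>.
\<close>

definition C0_norm :: "'a set \<Rightarrow> ('a \<Rightarrow> 'b::real_normed_vector) \<Rightarrow> ennreal" where
  "C0_norm A F = (SUP z\<in>A. ennreal (norm (F z)))"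

definition Ck_norm ::
    "nat \<Rightarrow> 'a::euclidean_space set \<Rightarrow> 'a set \<Rightarrow> ('a \<Rightarrow> 'b::real_normed_vector) \<Rightarrow> ennreal" where
  "Ck_norm k S A F = (\<Sum>j\<le>k. C0_norm A (\<lambda>z. sqrt (deriv_norm_sq j S F z)))"

section \<open>The data\<close>

type_synonym 'n hamiltonian = "(real^'n) \<times> (real^'n) \<Rightarrow> real"

text \<open>
  Couplings take values in \<open>[-\<infinity>, \<infinity>)\<close>; they are only relevant for density values \<open>m \<ge> 0\<close>, and are
  real-valued for \<open>m > 0\<close>.
\<close>

type_synonym 'n coupling = "(real^'n) \<times> real \<Rightarrow> ereal"

definition pos_dom :: "((real^'n) \<times> real) set" where
  "pos_dom = UNIV \<times> {0<..}"

definition nonneg_dom :: "((real^'n) \<times> real) set" where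
  "nonneg_dom = UNIV \<times> {0..}"

abbreviation re :: "'n coupling \<Rightarrow> (real^'n) \<times> real \<Rightarrow> real" where
  "re f \<equiv> \<lambda>z. real_of_ereal (f z)"

definition f_inv :: "'n::finite coupling \<Rightarrow> real^'n \<Rightarrow> real \<Rightarrow> real" where
  "f_inv f x w = the_inv_into {0..} (\<lambda>m. f (x, m)) (ereal w)"

definition chi_of :: "'n::finite coupling \<Rightarrow> (real^'n) \<times> real \<Rightarrow> real" where
  "chi_of f = (\<lambda>(x, w). f_inv f x w * d_snd pos_dom (re f) (x, f_inv f x w))"

definition h_of :: "'n::finite coupling \<Rightarrow> (real^'n) \<times> real \<Rightarrow> real" where
  "h_of f z = sqrt (chi_of f z)"

definition assumption_M :: "(real^'n \<Rightarrow> real) \<Rightarrow> bool" where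
  "assumption_M m0 \<longleftrightarrow>
     periodic m0 \<and> Ck_on 4 UNIV m0 \<and> (\<forall>x. m0 x > 0) \<and> (m0 has_integral 1) (cbox 0 1)"

abbreviation Dx :: "((real^'n) \<times> (real^'n) \<Rightarrow> 'b::real_normed_vector) \<Rightarrow> (real^'n) \<times> (real^'n) \<Rightarrow> 'b^'n"
  where "Dx \<equiv> D_fst UNIV"

abbreviation Dp :: "((real^'n) \<times> (real^'n) \<Rightarrow> 'b::real_normed_vector) \<Rightarrow> (real^'n) \<times> (real^'n) \<Rightarrow> 'b^'n"
  where "Dp \<equiv> D_snd UNIV"

definition assumption_H :: "real \<Rightarrow> real \<Rightarrow> 'n::finite hamiltonian \<Rightarrow> bool" where
  "assumption_H C0 \<tau> H \<longleftrightarrow>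
     periodic_fst UNIV H \<and>
     Ck_on 4 UNIV H \<and> Ck_on 4 UNIV (Dp H) \<and> Ck_on 4 UNIV (Dp (Dp H)) \<and>
     (\<forall>x p.
        (\<forall>v. (1 / C0) * (v \<bullet> v) \<le> v \<bullet> (Dp (Dp H) (x, p) *v v) \<and>
             v \<bullet> (Dp (Dp H) (x, p) *v v) \<le> C0 * (v \<bullet> v)) \<and>
        Dp H (x, p) \<bullet> p \<ge> 2 * H (x, p) - C0 \<and>
        norm (Dp (Dp (Dp H)) (x, p)) \<le> C0 * (1 + norm p) powr (-1) \<and>
        norm (Dx (Dx (Dp H)) (x, p)) \<le> C0 * (1 + norm p) powr \<tau> \<and>
        norm (Dx (Dp (Dp H)) (x, p)) \<le> C0 * (1 + norm p) powr (\<tau> - 1))"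

definition regular_coupling :: "'n::finite coupling \<Rightarrow> bool" where
  "regular_coupling f \<longleftrightarrow>
     periodic_fst {0..} f \<and>
     (\<forall>z\<in>nonneg_dom. f z < \<infinity>) \<and> (\<forall>z\<in>pos_dom. \<bar>f z\<bar> \<noteq> \<infinity>) \<and>
     continuous_on nonneg_dom f \<and> Ck_on 4 pos_dom (re f) \<and>
     (\<forall>x. strict_mono_on {0..} (\<lambda>m. f (x, m))) \<and>
     (\<forall>z\<in>pos_dom. d_snd pos_dom (re f) z > 0)"

text \<open>
  The term \<open>|f|\<^bsup>\<tau>/2\<^esup>\<close> is 1 for \<open>\<tau> = 0\<close>, also where \<open>f = 0\<close>; but \<open>0 powr 0 = 0\<close>, hence the case
  distinction.
\<close>

definition F_growth :: "real \<Rightarrow> 'n::finite coupling \<Rightarrow> (real^'n) \<times> real \<Rightarrow> real" where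
  "F_growth \<tau> f z =
     1 + (if \<tau> = 0 then 1 else \<bar>re f z\<bar> powr (\<tau> / 2))
       + \<bar>snd z * d_snd pos_dom (re f) z\<bar> powr ((1 + \<tau>) / 2)"

text \<open>
  The function \<open>\<chi>\<close> is defined for \<open>w\<close> in the range of \<open>f(x, \<cdot>)\<close> on positive densities, which explains
  the argument \<open>(x, f(x, m))\<close> of \<open>\<chi>\<^sub>w\<close>.
\<close>

definition assumption_F :: "real \<Rightarrow> real \<Rightarrow> 'n::finite coupling \<Rightarrow> bool" where
  "assumption_F C0 \<tau> f \<longleftrightarrow>
     regular_coupling f \<and>
     Liminf (principal UNIV \<times>\<^sub>F at_top) (\<lambda>z. ereal (snd z * d_snd pos_dom (re f) z)) > 0 \<and>
     (\<forall>x. \<forall>m>0.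
        \<bar>d_snd UNIV (chi_of f) (x, re f (x, m))\<bar> \<le> C0 \<and>
        norm (m *\<^sub>R d_snd pos_dom (D_fst pos_dom (re f)) (x, m))
          \<le> C0 * norm (D_fst pos_dom (re f) (x, m)) \<and>
        norm (D_fst pos_dom (re f) (x, m)) \<le> C0 * F_growth \<tau> f (x, m) \<and>
        norm (D_fst pos_dom (D_fst pos_dom (re f)) (x, m)) \<le> C0 * F_growth \<tau> f (x, m))"

definition assumption_G :: "'n::finite coupling \<Rightarrow> bool" where
  "assumption_G g \<longleftrightarrow>
     regular_coupling g \<and>
     (\<forall>x. ((\<lambda>m. g (x, m)) \<longlongrightarrow> (SUP z\<in>nonneg_dom. g z)) at_top \<and>
          g (x, 0) = (INF z\<in>nonneg_dom. g z))"

definition assumption_SE :: "'n::finite coupling \<Rightarrow> bool" where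
  "assumption_SE f \<longleftrightarrow> (\<forall>x. f (x, 0) = -\<infinity>)"

text \<open>The further bounds that the standing convention on the constant \<open>C\<^sub>0\<close> provides.\<close>

definition C0_convention ::
    "real \<Rightarrow> real \<Rightarrow> 'n::finite hamiltonian \<Rightarrow> 'n coupling \<Rightarrow> (real^'n \<Rightarrow> real) \<Rightarrow> bool" where
  "C0_convention C0 \<tau> H f m0 \<longleftrightarrow>
     (\<forall>x p.
        (1 / C0) * (norm p)\<^sup>2 - C0 \<le> H (x, p) \<and> H (x, p) \<le> C0 * (norm p)\<^sup>2 + C0 \<and>
        norm (Dp H (x, p)) \<le> C0 * (1 + norm p) \<and>
        norm (Dx H (x, p)) \<le> C0 * (1 + norm p powr (1 + \<tau>)) \<and>
        norm (Dx (Dx H) (x, p)) \<le> C0 * (1 + norm p powr (1 + \<tau>)) \<and>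
        norm (Dx (Dp H) (x, p)) \<le> C0 * (1 + norm p) powr \<tau>) \<and>
     C0_norm UNIV (\<lambda>x. chi_of f (x, 0)) + Ck_norm 1 UNIV UNIV m0
       + Ck_norm 2 pos_dom (UNIV \<times> {(INF x. m0 x)..(SUP x. m0 x)}) (re f) \<le> ennreal C0"

section \<open>The mean field games system\<close>

definition QT_closure :: "real \<Rightarrow> ((real^'n) \<times> real) set" where
  "QT_closure T = UNIV \<times> {0..T}"

definition D_full :: "real \<Rightarrow> ((real^'n) \<times> real \<Rightarrow> real) \<Rightarrow> (real^'n) \<times> real \<Rightarrow> (real^'n) \<times> real" where
  "D_full T u z = (D_fst (QT_closure T) u z, d_snd (QT_closure T) u z)"

text \<open>
  The condition \<open>m \<ge> 0\<close> is implicit in the system, because \<open>f\<close> and \<open>g\<close> are defined for nonnegative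
  densities only. The divergence is the trace of the Jacobian matrix in \<open>x\<close>.
\<close>

definition MFG_solution ::
    "real \<Rightarrow> 'n::finite hamiltonian \<Rightarrow> 'n coupling \<Rightarrow> 'n coupling \<Rightarrow> (real^'n \<Rightarrow> real)
      \<Rightarrow> ((real^'n) \<times> real \<Rightarrow> real) \<Rightarrow> ((real^'n) \<times> real \<Rightarrow> real) \<Rightarrow> bool" where
  "MFG_solution T H f g m0 u m \<longleftrightarrow>
     (let Q = QT_closure T in
       periodic_fst {0..T} u \<and> periodic_fst {0..T} m \<and>
       Ck_on 3 Q u \<and> Ck_on 2 Q m \<and> (\<forall>z\<in>Q. m z \<ge> 0) \<and>
       (\<forall>x. \<forall>t\<in>{0<..<T}.
          ereal (- d_snd Q u (x, t) + H (x, D_fst Q u (x, t))) = f (x, m (x, t)) \<and>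
          d_snd Q m (x, t)
            - trace (D_fst Q (\<lambda>z. m z *\<^sub>R Dp H (fst z, D_fst Q u z)) (x, t)) = 0) \<and>
       (\<forall>x. m (x, 0) = m0 x \<and> ereal (u (x, T)) = g (x, m (x, T))))"

section \<open>The quantities on which the constants depend\<close>

definition x_min :: "'n::finite coupling \<Rightarrow> real \<Rightarrow> real" where
  "x_min f m = (INF x. re f (x, m))"

definition x_max :: "'n::finite coupling \<Rightarrow> real \<Rightarrow> real" where
  "x_max f m = (SUP x. re f (x, m))"

definition inv_pos :: "(real \<Rightarrow> real) \<Rightarrow> real \<Rightarrow> real" where
  "inv_pos \<phi> = the_inv_into {0<..} \<phi>"

definition beta :: "'n::finite coupling \<Rightarrow> 'n coupling \<Rightarrow> real \<Rightarrow> ennreal" where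
  "beta f g K =
     Ck_norm 1 pos_dom (UNIV \<times> {1/K..K}) (re f)
     + Ck_norm 1 pos_dom (UNIV \<times> {1/K..K}) (D_fst pos_dom (re g))
     + C0_norm (UNIV \<times> {-K..}) (\<lambda>z. 1 / chi_of f z)
     + C0_norm (UNIV \<times> {-K..}) (d_snd UNIV (h_of f))"

text \<open>
  A constant \<open>C = C(K\<^sub>1, \<dots>, K\<^sub>M)\<close> is a positive function of the tuple \<open>(K\<^sub>1, \<dots>, K\<^sub>M)\<close> of nonnegative
  reals that is nondecreasing in each variable; the order on tuples is the componentwise one.
\<close>

definition monotone_constant :: "('a::{order, zero} \<Rightarrow> real) \<Rightarrow> bool" where
  "monotone_constant C \<longleftrightarrow> (\<forall>a\<ge>0. C a > 0) \<and> mono_on {0..} C"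

end

theory Submission
  imports Defs
begin

text \<open>
  Write \<open>h = H(x, Du)\<close>, \<open>w = f(x, m) = h - u\<^sub>t\<close>, \<open>b = D\<^sub>pH(x, Du)\<close>. Eliminating \<open>m\<close> turns the system into
  the quasilinear elliptic equation
  \<open>u\<^sub>t\<^sub>t - 2 b \<cdot> Du\<^sub>t + b \<cdot> D\<^sup>2u b + \<chi> tr(H\<^sub>p\<^sub>p D\<^sup>2u) + \<chi> tr(H\<^sub>x\<^sub>p) + b \<cdot> (H\<^sub>x - f\<^sub>x) = 0\<close>,
  elliptic because \<open>\<chi> > 0\<close>. The function \<open>\<plusminus>u\<close> minus an exponential in time can only have its maximum
  at \<open>t = T\<close>, where it controls \<open>m\<close>; this bounds \<open>u\<close> and \<open>m(\<cdot>, T)\<close>. Since the coefficients do not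
  depend on time explicitly, \<open>u\<^sub>t\<close> is extremal at \<open>t = 0\<close> or \<open>t = T\<close>. The gradient is bounded at a
  maximum of \<open>V = h + k \<phi>\<^sup>2 / 2\<close>, where \<open>\<phi>\<close> is \<open>u\<close> plus an affine function of time with
  \<open>\<phi> \<le> -1\<close> at \<open>t = 0\<close> and \<open>\<phi> \<ge> 1\<close> at \<open>t = T\<close>: by the principle for \<open>u\<^sub>t\<close>, \<open>w\<close> is bounded below there,
  hence \<open>1 / \<chi>\<close> is bounded. In the interior the second order condition for \<open>V\<close> and the elliptic
  equation differentiated in the direction \<open>b\<close> give, with \<open>y\<^sup>2 = 1 + |Du|\<^sup>2 + |w|\<close>, an estimate
  \<open>y \<le> C y\<^sup>\<tau>\<close>. At the two ends the sign of \<open>\<phi>\<close> gives the estimate from the first order condition.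
\<close>

section \<open>Directional derivatives within a set\<close>

text \<open>\<open>V\<close> involves only first derivatives of \<open>u\<close>, and
  \<open>b\<close> is the derivative of \<open>h\<close> in \<open>Du\<close>. So the third
  derivatives in the second order condition for \<open>V\<close> add up to the
  \<open>b\<close>-derivative of the principal part of the elliptic equation, and one
  differentiation of that equation removes them; \<open>u\<close> in \<open>C^3\<close> is enough.
  The principal part is handled as the second derivative along \<open>(- b, 1)\<close> plus
  \<open>\<chi>\<close> times pure second derivatives along vectors \<open>v j\<close> whose squares
  \<open>v j v j^T\<close> add up to \<open>H\<^sub>p\<^sub>p\<close>, so that a maximum is
  exploited one direction at a time. The good term comes from \<open>\<phi>\<^sup>2\<close>: the
  derivative of \<open>\<phi>\<close> along \<open>(- b, 1)\<close> is of size
  \<open>- y\<^sup>2\<close> for large \<open>y\<close>, and its square enters with the factor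
  \<open>k\<close>. This \<open>k\<close> has to be small, because \<open>k \<phi> D\<phi>\<close>
  also perturbs the first order condition and returns squared. At \<open>t = T\<close> the gradient
  of \<open>m\<close> is known only through that of \<open>g\<close>, with a factor
  \<open>f\<^sub>m / g\<^sub>m\<close> for which the constants provide no bound; a case distinction
  on the sign of its cofactor replaces such a bound.\<close>

definition dd :: "'a::euclidean_space set \<Rightarrow> 'a \<Rightarrow> ('a \<Rightarrow> 'b::real_normed_vector) \<Rightarrow> 'a \<Rightarrow> 'b" where
  "dd S v F z = frechet_derivative F (at z within S) v"

text \<open>The sets in which derivatives are unique, by \<open>frechet_derivative_unique_within\<close>.\<close>

definition thick :: "'a::euclidean_space set \<Rightarrow> bool" where
  "thick S \<longleftrightarrow> (\<forall>x\<in>S. \<forall>i\<in>Basis. \<forall>e>0. \<exists>d. 0 < \<bar>d\<bar> \<and> \<bar>d\<bar> < e \<and> x + d *\<^sub>R i \<in> S)"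

lemma thick_open:
  fixes S :: "'a::euclidean_space set"
  assumes "open S" shows "thick S"
  unfolding thick_def
proof (intro ballI allI impI)
  fix x i :: 'a and e :: real assume "x \<in> S" "i \<in> Basis" "e > 0"
  obtain r where r: "r > 0" "ball x r \<subseteq> S" using assms \<open>x \<in> S\<close> open_contains_ball by blast
  define d where "d = min (r/2) (e/2)"
  have d: "0 < d" "d < e" "d < r" using r \<open>e > 0\<close> by (auto simp: d_def)
  moreover have "x + d *\<^sub>R i \<in> ball x r" using d \<open>i \<in> Basis\<close> by (simp add: dist_norm)
  ultimately show "\<exists>d. 0 < \<bar>d\<bar> \<and> \<bar>d\<bar> < e \<and> x + d *\<^sub>R i \<in> S" using r by (intro exI[of _ d]) auto
qed

lemma thick_QT:
  assumes "T > 0" shows "thick (QT_closure T :: ((real^'n) \<times> real) set)"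
  unfolding thick_def
proof (intro ballI allI impI)
  fix x i :: "(real^'n) \<times> real" and e :: real
  assume x: "x \<in> QT_closure T" and i: "i \<in> Basis" and e: "e > 0"
  have t: "0 \<le> snd x" "snd x \<le> T" using x by (auto simp: QT_closure_def)
  show "\<exists>d. 0 < \<bar>d\<bar> \<and> \<bar>d\<bar> < e \<and> x + d *\<^sub>R i \<in> QT_closure T"
  proof (cases "snd i = 0")
    case True
    then show ?thesis using e t by (intro exI[of _ "e/2"]) (auto simp: QT_closure_def mem_Times_iff)
  next
    case False
    then have i1: "snd i = 1" using i by (auto simp: Basis_prod_def)
    \<comment> \<open>At the final time only a backward step stays in the set; elsewhere a forward
      step does.\<close>
    define d where "d = (if snd x < T then min (e/2) (T - snd x) else - min (e/2) T)"
    show ?thesis using e t i1 assms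
      by (intro exI[of _ d]) (auto simp: QT_closure_def mem_Times_iff d_def min_def)
  qed
qed

lemma dd_eq:
  assumes "thick S" "z \<in> S" "(F has_derivative F') (at z within S)"
  shows "dd S v F z = F' v"
proof -
  have "(F has_derivative frechet_derivative F (at z within S)) (at z within S)"
    using assms(3) differentiable_def frechet_derivative_works by blast
  from frechet_derivative_unique_within[OF this assms(3)] assms(1,2)
  show ?thesis unfolding dd_def thick_def by metis
qed

lemma dd_has_derivative:
  "F differentiable (at z within S) \<Longrightarrow> (F has_derivative (\<lambda>v. dd S v F z)) (at z within S)"
  unfolding dd_def by (simp add: frechet_derivative_works)

lemma dd_linear: "F differentiable (at z within S) \<Longrightarrow> linear (\<lambda>v. dd S v F z)"
  using dd_has_derivative has_derivative_linear by blast

lemma dd_expand: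
  assumes "F differentiable (at z within S)"
  shows "dd S v F z = (\<Sum>b\<in>Basis. (v \<bullet> b) *\<^sub>R dd S b F z)"
proof -
  have "dd S (\<Sum>b\<in>Basis. (v \<bullet> b) *\<^sub>R b) F z = (\<Sum>b\<in>Basis. (v \<bullet> b) *\<^sub>R dd S b F z)"
    using linear_sum[OF dd_linear[OF assms], of "\<lambda>b. (v \<bullet> b) *\<^sub>R b" Basis]
    by (simp add: linear_scale[OF dd_linear[OF assms]])
  then show ?thesis by (simp add: euclidean_representation)
qed

lemma dd_cong:
  assumes S: "thick S" "z \<in> S" and eq: "\<And>y. y \<in> S \<Longrightarrow> F y = G y"
    and d: "F differentiable (at z within S)"
  shows "dd S v F z = dd S v G z" "G differentiable (at z within S)"
proof -
  have "(G has_derivative (\<lambda>v. dd S v F z)) (at z within S)"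
    using has_derivative_transform[OF S(2) _ dd_has_derivative[OF d]] eq by auto
  note G = this
  from dd_eq[OF S G] show "dd S v F z = dd S v G z" by simp
  from G show "G differentiable (at z within S)" unfolding differentiable_def by blast
qed

lemma dd_add:
  assumes "thick S" "z \<in> S" "F differentiable (at z within S)" "G differentiable (at z within S)"
  shows "dd S v (\<lambda>y. F y + G y) z = dd S v F z + dd S v G z"
  by (rule dd_eq[OF assms(1,2)]) (auto intro!: has_derivative_add dd_has_derivative assms)

lemma dd_scaleR:
  assumes "thick S" "z \<in> S" "F differentiable (at z within S)"
  shows "dd S v (\<lambda>y. c *\<^sub>R F y) z = c *\<^sub>R dd S v F z"
  by (rule dd_eq[OF assms(1,2)]) (auto intro!: has_derivative_scaleR_right dd_has_derivative assms)

section \<open>Calculus of functions that are k times continuously differentiable within a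
  set\<close>

lemma Ck_on_Suc_iff:
  "Ck_on (Suc k) S F \<longleftrightarrow> F differentiable_on S \<and> (\<forall>b\<in>Basis. Ck_on k S (dd S b F))"
  by (simp add: dd_def[abs_def])

declare Ck_on.simps(2)[simp del]

lemma Ck_on_differentiable: "Ck_on (Suc k) S F \<Longrightarrow> z \<in> S \<Longrightarrow> F differentiable (at z within S)"
  by (auto simp: Ck_on_Suc_iff differentiable_on_def)

lemma Ck_on_cong:
  assumes S: "thick S" and "\<And>y. y \<in> S \<Longrightarrow> F y = G y" "Ck_on k S F"
  shows "Ck_on k S G"
  using assms(2,3)
proof (induction k arbitrary: F G)
  case 0
  then show ?case using continuous_on_cong by fastforce
next
  case (Suc k)
  have "\<And>z. z \<in> S \<Longrightarrow> G differentiable (at z within S)"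
    using dd_cong(2)[OF S] Suc.prems(1) Ck_on_differentiable[OF Suc.prems(2)] by blast
  moreover have "Ck_on k S (dd S b G)" if "b \<in> Basis" for b
  proof (rule Suc.IH[of "dd S b F"])
    show "Ck_on k S (dd S b F)" using Suc.prems that by (auto simp: Ck_on_Suc_iff)
    show "dd S b F y = dd S b G y" if "y \<in> S" for y
      using dd_cong(1)[OF S that] Suc.prems(1) Ck_on_differentiable[OF Suc.prems(2) that] by blast
  qed
  ultimately show ?case by (auto simp: Ck_on_Suc_iff differentiable_on_def)
qed

lemma Ck_on_add:
  assumes S: "thick S" and "Ck_on k S F" "Ck_on k S G"
  shows "Ck_on k S (\<lambda>y. F y + G y)"
  using assms(2,3)
proof (induction k arbitrary: F G)
  case 0
  then show ?case by (auto intro: continuous_on_add)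
next
  case (Suc k)
  have "Ck_on k S (dd S b (\<lambda>y. F y + G y))" if "b \<in> Basis" for b
  proof (rule Ck_on_cong[OF S])
    show "Ck_on k S (\<lambda>y. dd S b F y + dd S b G y)"
      using Suc that by (auto simp: Ck_on_Suc_iff)
    show "dd S b F y + dd S b G y = dd S b (\<lambda>y. F y + G y) y" if "y \<in> S" for y
      using dd_add[OF S that] Ck_on_differentiable Suc.prems that by metis
  qed
  then show ?case using Suc.prems by (auto simp: Ck_on_Suc_iff)
qed

lemma Ck_on_scaleR:
  assumes S: "thick S" and "Ck_on k S F"
  shows "Ck_on k S (\<lambda>y. c *\<^sub>R F y)"
  using assms(2)
proof (induction k arbitrary: F)
  case 0
  then show ?case by (auto intro: continuous_intros)
next
  case (Suc k)
  have "Ck_on k S (dd S b (\<lambda>y. c *\<^sub>R F y))" if "b \<in> Basis" for b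
  proof (rule Ck_on_cong[OF S])
    show "Ck_on k S (\<lambda>y. c *\<^sub>R dd S b F y)"
      using Suc that by (auto simp: Ck_on_Suc_iff)
    show "c *\<^sub>R dd S b F y = dd S b (\<lambda>y. c *\<^sub>R F y) y" if "y \<in> S" for y
      using dd_scaleR[OF S that] Ck_on_differentiable Suc.prems that by metis
  qed
  then show ?case using Suc.prems by (auto simp: Ck_on_Suc_iff differentiable_on_def)
qed

lemma Ck_on_zero: "thick S \<Longrightarrow> Ck_on k S (\<lambda>_. 0 :: 'b::real_normed_vector)"
proof (induction k)
  case (Suc k)
  have "dd S b (\<lambda>_. 0 :: 'b) y = 0" if "y \<in> S" for b y
    using dd_eq[OF Suc.prems that has_derivative_const] .
  then have "Ck_on k S (dd S b (\<lambda>_. 0 :: 'b))" for b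
    by (intro Ck_on_cong[OF Suc.prems _ Suc.IH[OF Suc.prems]]) simp
  then show ?case by (auto simp: Ck_on_Suc_iff)
qed auto

lemma Ck_on_sum:
  assumes S: "thick S" and "\<And>i. i \<in> I \<Longrightarrow> Ck_on k S (F i)"
  shows "Ck_on k S (\<lambda>y. \<Sum>i\<in>I. F i y)"
  using assms(2)
  by (induction I rule: infinite_finite_induct) (auto intro!: Ck_on_zero[OF S] Ck_on_add[OF S])

text \<open>\<open>Ck_on\<close> speaks of basis directions only. For a constant direction
  \<open>v\<close> the derivative is a fixed linear combination of those, so it inherits their
  regularity.\<close>

lemma Ck_on_dd:
  assumes S: "thick S" and "Ck_on (Suc k) S F"
  shows "Ck_on k S (dd S v F)"
proof (rule Ck_on_cong[OF S])
  show "Ck_on k S (\<lambda>y. \<Sum>b\<in>Basis. (v \<bullet> b) *\<^sub>R dd S b F y)"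
    using assms by (intro Ck_on_sum Ck_on_scaleR) (auto simp: Ck_on_Suc_iff)
  show "(\<Sum>b\<in>Basis. (v \<bullet> b) *\<^sub>R dd S b F y) = dd S v F y" if "y \<in> S" for y
    using dd_expand Ck_on_differentiable[OF assms(2) that] by metis
qed

lemma Ck_on_continuous: "Ck_on k S F \<Longrightarrow> continuous_on S F"
  by (cases k) (auto simp: Ck_on_Suc_iff differentiable_imp_continuous_on)

lemma Ck_on_mono: "Ck_on k S F \<Longrightarrow> j \<le> k \<Longrightarrow> Ck_on j S F"
proof (induction j arbitrary: k F)
  case 0 then show ?case using Ck_on_continuous by auto
next
  case (Suc j)
  then obtain k' where "k = Suc k'" using Suc_le_D by blast
  then show ?case using Suc by (auto simp: Ck_on_Suc_iff)
qed

lemma dd_continuous: "thick S \<Longrightarrow> Ck_on (Suc k) S F \<Longrightarrow> continuous_on S (dd S v F)"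
  using Ck_on_dd Ck_on_continuous by blast

section \<open>Restriction to lines: conditions at interior maxima and symmetry of second
  derivatives\<close>

lemma dd_line:
  fixes F :: "'a::euclidean_space \<Rightarrow> real"
  assumes "z + s *\<^sub>R v \<in> interior S" "F differentiable (at (z + s *\<^sub>R v) within S)"
  shows "((\<lambda>s. F (z + s *\<^sub>R v)) has_real_derivative dd S v F (z + s *\<^sub>R v)) (at s)"
proof -
  have 1: "(F has_derivative (\<lambda>w. dd S w F (z + s *\<^sub>R v))) (at (z + s *\<^sub>R v))"
    using dd_has_derivative[OF assms(2)] at_within_interior[OF assms(1)] by metis
  have 2: "((\<lambda>s. z + s *\<^sub>R v) has_derivative (\<lambda>s. s *\<^sub>R v)) (at s)"
    by (auto intro!: derivative_eq_intros)
  have "((\<lambda>s. F (z + s *\<^sub>R v)) has_derivative (\<lambda>r. dd S (r *\<^sub>R v) F (z + s *\<^sub>R v))) (at s)"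
    using has_derivative_compose[OF 2 1] by simp
  then show ?thesis unfolding has_field_derivative_def
    by (simp add: linear_scale[OF dd_linear[OF assms(2)]] mult.commute[of _ "dd S v F (z + s *\<^sub>R v)"])
qed

lemma dd_line0:
  fixes F :: "'a::euclidean_space \<Rightarrow> real"
  assumes "z \<in> interior S" "F differentiable (at z within S)"
  shows "((\<lambda>s. F (z + s *\<^sub>R v)) has_real_derivative dd S v F z) (at 0)"
  using dd_line[of z 0 v S F] assms by simp

lemma line_in_interior:
  fixes z v :: "'a::euclidean_space"
  assumes "z \<in> interior S"
  obtains e where "e > 0" "\<And>s. \<bar>s\<bar> < e \<Longrightarrow> z + s *\<^sub>R v \<in> interior S"
proof -
  obtain r where r: "r > 0" "ball z r \<subseteq> interior S"
    using assms open_contains_ball[of "interior S"] by auto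
  show ?thesis
  proof (rule that[of "r / (1 + norm v)"])
    show "r / (1 + norm v) > 0" using r by (simp add: add_pos_nonneg)
    fix s assume "\<bar>s\<bar> < r / (1 + norm v)"
    then have "\<bar>s\<bar> * (1 + norm v) < r" by (simp add: pos_less_divide_eq add_pos_nonneg)
    then have "\<bar>s\<bar> * norm v < r" by (smt (verit) abs_ge_zero distrib_left mult_cancel_left1)
    then show "z + s *\<^sub>R v \<in> interior S" using r by (auto simp: dist_norm)
  qed
qed

lemma interior_max_first:
  fixes F :: "'a::euclidean_space \<Rightarrow> real"
  assumes z: "z \<in> interior S" and max: "\<And>y. y \<in> S \<Longrightarrow> F y \<le> F z"
    and d: "F differentiable (at z within S)"
  shows "dd S v F z = 0"
proof -
  obtain e where e: "e > 0" "\<And>s. \<bar>s\<bar> < e \<Longrightarrow> z + s *\<^sub>R v \<in> interior S"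
    using line_in_interior[OF z] by blast
  show ?thesis
    by (rule DERIV_local_max[OF dd_line0[OF z d] e(1)])
       (use max e interior_subset in auto)
qed

text \<open>The second derivative is assumed to exist at \<open>z\<close> only, so the argument
  avoids a Taylor expansion: a positive second derivative makes the first derivative positive just
  beyond \<open>z\<close>, and the mean value theorem then produces a value above the
  maximum.\<close>

lemma interior_max_second:
  fixes F :: "'a::euclidean_space \<Rightarrow> real"
  assumes z: "z \<in> interior S" and max: "\<And>y. y \<in> S \<Longrightarrow> F y \<le> F z"
    and d: "\<And>y. y \<in> interior S \<Longrightarrow> F differentiable (at y within S)"
    and d2: "dd S v F differentiable (at z within S)"
  shows "dd S v (dd S v F) z \<le> 0"
proof (rule ccontr)
  assume "\<not> ?thesis"
  then have pos: "dd S v (dd S v F) z > 0" by simp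
  obtain e where e: "e > 0" "\<And>s. \<bar>s\<bar> < e \<Longrightarrow> z + s *\<^sub>R v \<in> interior S"
    using line_in_interior[OF z] by blast
  obtain d' where d': "d' > 0" "\<And>h. 0 < h \<Longrightarrow> h < d' \<Longrightarrow> dd S v F z < dd S v F (z + h *\<^sub>R v)"
    using DERIV_pos_inc_right[OF dd_line0[OF z d2] pos] by auto
  have zero: "dd S v F z = 0" using interior_max_first[OF z max d[OF z]] .
  define r where "r = min e d' / 2"
  have r: "0 < r" "r < e" "r < d'" using e d' by (auto simp: r_def)
  obtain s where s: "0 < s" "s < r" "F (z + r *\<^sub>R v) - F (z + 0 *\<^sub>R v) = (r - 0) * dd S v F (z + s *\<^sub>R v)"
  proof -
    have "((\<lambda>s. F (z + s *\<^sub>R v)) has_real_derivative dd S v F (z + s *\<^sub>R v)) (at s)"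
      if "0 \<le> s" "s \<le> r" for s
      using that e(2)[of s] r by (intro dd_line d) auto
    from MVT2[OF r(1) this] show ?thesis using that by blast
  qed
  have "dd S v F (z + s *\<^sub>R v) > 0" using d'(2)[of s] s r zero by simp
  then have "r * dd S v F (z + s *\<^sub>R v) > 0" using r(1) by simp
  then have "F (z + r *\<^sub>R v) > F z" using s(3) by simp
  moreover have "z + r *\<^sub>R v \<in> S" using e r interior_subset by fastforce
  ultimately show False using max by fastforce
qed

text \<open>Schwarz's theorem. The second difference of \<open>F\<close> over the parallelogram
  spanned by \<open>h a\<close> and \<open>h b\<close> is \<open>h\<^sup>2\<close> times either
  mixed derivative, each taken at some point of the parallelogram. As the parallelogram shrinks,
  continuity identifies the two values at \<open>z\<close>.\<close>

lemma dd_commute: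
  fixes F :: "'a::euclidean_space \<Rightarrow> real"
  assumes S: "thick S" and z: "z \<in> interior S" and F: "Ck_on 2 S F"
  shows "dd S a (dd S b F) z = dd S b (dd S a F) z"
proof -
  have F2: "Ck_on (Suc (Suc 0)) S F" using F by (simp add: numeral_2_eq_2)
  have F1: "Ck_on (Suc 0) S (dd S c F)" for c using Ck_on_dd[OF S F2] .
  have dF: "y \<in> interior S \<Longrightarrow> F differentiable (at y within S)" for y
    using Ck_on_differentiable[OF F2] interior_subset by blast
  have dF1: "y \<in> interior S \<Longrightarrow> dd S c F differentiable (at y within S)" for y c
    using Ck_on_differentiable[OF F1] interior_subset by blast
  have cont: "isCont (dd S c (dd S c' F)) z" for c c'
    using Ck_on_continuous[OF Ck_on_dd[OF S F1]] z continuous_on_interior by blast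
  have *: "\<exists>y w. dist y z < e \<and> dist w z < e \<and> dd S a (dd S b F) y = dd S b (dd S a F) w" if "e > 0" for e
  proof -
    obtain r where r: "r > 0" "ball z r \<subseteq> interior S"
      using z open_contains_ball[of "interior S"] by auto
    \<comment> \<open>With this step length the whole parallelogram lies within distance
      \<open>min r e / 2\<close> of \<open>z\<close>.\<close>
    define h where "h = (min r e / 2) / (1 + norm a + norm b)"
    have h: "h > 0" using r that by (auto simp: h_def add_pos_nonneg)
    have "1 + norm a + norm b \<noteq> 0" by (smt (verit) norm_ge_zero)
    moreover have "c / N * N = c" if "N \<noteq> 0" for c N :: real using that by simp
    ultimately have hab: "h * (1 + norm a + norm b) = min r e / 2" unfolding h_def by blast
    have near: "dist (z + s *\<^sub>R a + t *\<^sub>R b) z < min r e" if "0 \<le> s" "s \<le> h" "0 \<le> t" "t \<le> h" for s t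
    proof -
      have "dist (z + s *\<^sub>R a + t *\<^sub>R b) z = norm (s *\<^sub>R a + t *\<^sub>R b)" by (simp add: dist_norm)
      also have "\<dots> \<le> s * norm a + t * norm b" using norm_triangle_ineq[of "s *\<^sub>R a" "t *\<^sub>R b"] that by simp
      also have "\<dots> \<le> h * norm a + h * norm b" using that by (intro add_mono mult_right_mono) auto
      also have "\<dots> \<le> h * (1 + norm a + norm b)" using h by (simp add: algebra_simps)
      finally show ?thesis using hab r(1) \<open>e > 0\<close> by linarith
    qed
    have inn: "z + s *\<^sub>R a + t *\<^sub>R b \<in> interior S" if "0 \<le> s" "s \<le> h" "0 \<le> t" "t \<le> h" for s t
      using near[OF that] r(2) by (auto simp: dist_commute)
    \<comment> \<open>Two mean value theorems: the increment in direction \<open>b'\<close> is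
      regarded as a function along \<open>a'\<close>, and then the \<open>a'\<close>-derivative as a
      function along \<open>b'\<close>. It is stated for arbitrary directions so that it can be used
      in both orders.\<close>
    have key: "\<exists>s t. 0 \<le> s \<and> s \<le> h \<and> 0 \<le> t \<and> t \<le> h \<and>
        F (z + h *\<^sub>R a' + h *\<^sub>R b') - F (z + h *\<^sub>R a') - F (z + h *\<^sub>R b') + F z
         = h * h * dd S b' (dd S a' F) (z + s *\<^sub>R a' + t *\<^sub>R b')"
      if I: "\<And>s t. \<lbrakk>0 \<le> s; s \<le> h; 0 \<le> t; t \<le> h\<rbrakk> \<Longrightarrow> z + s *\<^sub>R a' + t *\<^sub>R b' \<in> interior S" for a' b'
    proof -
      define g where "g s = F (z + h *\<^sub>R b' + s *\<^sub>R a') - F (z + s *\<^sub>R a')" for s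
      define g' where "g' s = dd S a' F (z + h *\<^sub>R b' + s *\<^sub>R a') - dd S a' F (z + s *\<^sub>R a')" for s
      have Dg: "DERIV g s :> g' s" if "0 \<le> s" "s \<le> h" for s
        unfolding g_def g'_def using I[of s h] I[of s 0] that h
        by (intro DERIV_diff dd_line dF) (auto simp: algebra_simps)
      obtain s where s: "0 < s" "s < h" "g h - g 0 = (h - 0) * g' s"
        using MVT2[OF h Dg] by blast
      define k where "k t = dd S a' F (z + s *\<^sub>R a' + t *\<^sub>R b')" for t
      define k' where "k' t = dd S b' (dd S a' F) (z + s *\<^sub>R a' + t *\<^sub>R b')" for t
      have Dk: "DERIV k t :> k' t" if "0 \<le> t" "t \<le> h" for t
        unfolding k_def k'_def using I[of s t] that h s by (intro dd_line dF1) auto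
      obtain t where t: "0 < t" "t < h" "k h - k 0 = (h - 0) * k' t"
        using MVT2[OF h Dk] by blast
      have "g' s = k h - k 0" by (simp add: g'_def k_def algebra_simps)
      then have gg: "g h - g 0 = h * h * k' t" using s(3) t(3) by simp
      have cm: "z + h *\<^sub>R b' + h *\<^sub>R a' = z + h *\<^sub>R a' + h *\<^sub>R b'" by (simp add: algebra_simps)
      have "g h - g 0 = F (z + h *\<^sub>R a' + h *\<^sub>R b') - F (z + h *\<^sub>R a') - F (z + h *\<^sub>R b') + F z"
        unfolding g_def cm by simp
      then show ?thesis using s t gg unfolding k'_def by (intro exI[of _ s] exI[of _ t]) auto
    qed
    obtain s t where st: "0 \<le> s" "s \<le> h" "0 \<le> t" "t \<le> h"
        "F (z + h *\<^sub>R a + h *\<^sub>R b) - F (z + h *\<^sub>R a) - F (z + h *\<^sub>R b) + F z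
         = h * h * dd S b (dd S a F) (z + s *\<^sub>R a + t *\<^sub>R b)"
      using key[of a b] inn by blast
    have inn': "z + s *\<^sub>R b + t *\<^sub>R a \<in> interior S" if "0 \<le> s" "s \<le> h" "0 \<le> t" "t \<le> h" for s t
      using inn[of t s] that by (simp add: algebra_simps)
    obtain s' t' where st': "0 \<le> s'" "s' \<le> h" "0 \<le> t'" "t' \<le> h"
        "F (z + h *\<^sub>R b + h *\<^sub>R a) - F (z + h *\<^sub>R b) - F (z + h *\<^sub>R a) + F z
         = h * h * dd S a (dd S b F) (z + s' *\<^sub>R b + t' *\<^sub>R a)"
      using key[of b a] inn' by blast
    have sw: "z + h *\<^sub>R b + h *\<^sub>R a = z + h *\<^sub>R a + h *\<^sub>R b" by (simp add: algebra_simps)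
    have eqh: "h * h * dd S b (dd S a F) (z + s *\<^sub>R a + t *\<^sub>R b) = h * h * dd S a (dd S b F) (z + s' *\<^sub>R b + t' *\<^sub>R a)"
      using st(5) st'(5) unfolding sw by linarith
    then have "dd S b (dd S a F) (z + s *\<^sub>R a + t *\<^sub>R b) = dd S a (dd S b F) (z + s' *\<^sub>R b + t' *\<^sub>R a)"
      using h by simp
    moreover have "z + s' *\<^sub>R b + t' *\<^sub>R a = z + t' *\<^sub>R a + s' *\<^sub>R b" by (simp add: algebra_simps)
    ultimately show ?thesis using near[of s t] near[of t' s'] st st' r(1) that
      by (metis min_less_iff_conj)
  qed
  show ?thesis
  proof (rule ccontr)
    let ?P = "dd S a (dd S b F)" and ?Q = "dd S b (dd S a F)"
    assume "?P z \<noteq> ?Q z"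
    define e where "e = \<bar>?P z - ?Q z\<bar> / 2"
    have e: "e > 0" using \<open>?P z \<noteq> ?Q z\<close> by (simp add: e_def)
    obtain d1 where d1: "d1 > 0" "\<And>y. dist y z < d1 \<Longrightarrow> dist (?P y) (?P z) < e"
      using cont[of a b] e unfolding continuous_at_eps_delta by (metis dist_commute)
    obtain d2 where d2: "d2 > 0" "\<And>y. dist y z < d2 \<Longrightarrow> dist (?Q y) (?Q z) < e"
      using cont[of b a] e unfolding continuous_at_eps_delta by (metis dist_commute)
    obtain y w where yw: "dist y z < min d1 d2" "dist w z < min d1 d2" "?P y = ?Q w"
      using *[of "min d1 d2"] d1 d2 by auto
    have "dist (?P y) (?P z) < e" "dist (?Q w) (?Q z) < e" using d1(2)[of y] d2(2)[of w] yw(1,2) by simp_all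
    then have "dist (?P z) (?Q z) < e + e"
      using dist_triangle_less_add[of "?P z" "?P y" e "?Q z" e] yw(3) by (simp add: dist_commute)
    then show False by (simp add: e_def dist_real_def)
  qed
qed

section \<open>Chain rule for compositions that keep the space variable, and derivatives of
  arrays\<close>

lemma dd_compose_fst:
  fixes G :: "'a::euclidean_space \<times> 'c::euclidean_space \<Rightarrow> 'd::real_normed_vector"
    and Q :: "'a \<times> 'b::euclidean_space \<Rightarrow> 'c"
  assumes S: "thick S" "z \<in> S" and U: "open U" "(fst z, Q z) \<in> U"
    and G: "G differentiable (at (fst z, Q z) within U)"
    and Q: "Q differentiable (at z within S)"
  shows "(\<lambda>y. G (fst y, Q y)) differentiable (at z within S)"
    and "dd S v (\<lambda>y. G (fst y, Q y)) z = dd U (fst v, dd S v Q z) G (fst z, Q z)"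
proof -
  have 1: "(G has_derivative (\<lambda>w. dd U w G (fst z, Q z))) (at (fst z, Q z))"
    using dd_has_derivative[OF G] U at_within_open by metis
  have 2: "((\<lambda>y. (fst y, Q y)) has_derivative (\<lambda>v. (fst v, dd S v Q z))) (at z within S)"
    by (intro has_derivative_Pair dd_has_derivative Q) (auto intro!: derivative_eq_intros)
  have 3: "((\<lambda>y. G (fst y, Q y)) has_derivative (\<lambda>v. dd U (fst v, dd S v Q z) G (fst z, Q z))) (at z within S)"
    using has_derivative_compose[OF 2 1] .
  show "(\<lambda>y. G (fst y, Q y)) differentiable (at z within S)"
    using 3 unfolding differentiable_def by blast
  show "dd S v (\<lambda>y. G (fst y, Q y)) z = dd U (fst v, dd S v Q z) G (fst z, Q z)"
    by (rule dd_eq[OF S 3])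
qed

lemma vec_expand: "(a :: real^'n) = (\<Sum>i\<in>UNIV. a $ i *\<^sub>R axis i 1)"
  by (metis (no_types, lifting) basis_expansion scalar_mult_eq_scaleR sum.cong)

lemma dd_split_fst:
  fixes G :: "(real^'n) \<times> 'c::euclidean_space \<Rightarrow> real"
  assumes "G differentiable (at z within U)"
  shows "dd U (a, c) G z = (\<Sum>i\<in>UNIV. a $ i * dd U (axis i 1, 0) G z) + dd U (0, c) G z"
proof -
  note L = dd_linear[OF assms]
  have "(a, c) = (\<Sum>i\<in>UNIV. a $ i *\<^sub>R (axis i 1, 0)) + (0, c)"
    by (simp add: prod_eq_iff fst_sum snd_sum vec_expand[symmetric])
  then have "dd U (a, c) G z = dd U ((\<Sum>i\<in>UNIV. a $ i *\<^sub>R (axis i 1, 0)) + (0, c)) G z" by simp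
  also have "\<dots> = (\<Sum>i\<in>UNIV. a $ i * dd U (axis i 1, 0) G z) + dd U (0, c) G z"
    by (simp only: linear_add[OF L] linear_sum[OF L] linear_scale[OF L] real_scaleR_def)
  finally show ?thesis .
qed

lemma dd_split_snd_real:
  fixes G :: "'a::euclidean_space \<times> real \<Rightarrow> real"
  assumes "G differentiable (at z within U)"
  shows "dd U (0, c) G z = c * dd U (0, 1) G z"
  using linear_scale[OF dd_linear[OF assms], of c "(0, 1)"] by simp

lemma dd_split_snd_vec:
  fixes G :: "'a::euclidean_space \<times> (real^'n) \<Rightarrow> real"
  assumes "G differentiable (at z within U)"
  shows "dd U (0, c) G z = (\<Sum>k\<in>UNIV. c $ k * dd U (0, axis k 1) G z)"
proof -
  note L = dd_linear[OF assms]
  have "(0, c) = (\<Sum>k\<in>UNIV. c $ k *\<^sub>R (0 :: 'a, axis k 1))"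
    by (simp add: prod_eq_iff fst_sum snd_sum vec_expand[symmetric])
  then have "dd U (0, c) G z = dd U (\<Sum>k\<in>UNIV. c $ k *\<^sub>R (0, axis k 1)) G z" by simp
  also have "\<dots> = (\<Sum>k\<in>UNIV. c $ k * dd U (0, axis k 1) G z)"
    by (simp only: linear_sum[OF L] linear_scale[OF L] real_scaleR_def)
  finally show ?thesis .
qed

lemma differentiable_vec:
  fixes F :: "'a::euclidean_space \<Rightarrow> 'b::real_normed_vector^'n"
  assumes "\<And>k. (\<lambda>y. F y $ k) differentiable (at z within S)"
  shows "(F has_derivative (\<lambda>v. \<chi> k. dd S v (\<lambda>y. F y $ k) z)) (at z within S)"
    and "F differentiable (at z within S)"
proof -
  have lin: "linear (\<lambda>v. dd S v (\<lambda>y. F y $ k) z)" for k using dd_linear[OF assms] .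
  have "linear (\<lambda>v. \<chi> k. dd S v (\<lambda>y. F y $ k) z)"
    by (rule linearI) (simp_all add: vec_eq_iff linear_add[OF lin] linear_scale[OF lin])
  then have "bounded_linear (\<lambda>v. \<chi> k. dd S v (\<lambda>y. F y $ k) z)"
    by (simp add: linear_conv_bounded_linear)
  moreover have "((\<lambda>y. (1 / norm (y - z)) *\<^sub>R (F y - (F z + (\<chi> k. dd S (y - z) (\<lambda>y. F y $ k) z)))) \<longlongrightarrow> 0) (at z within S)"
  proof (rule vec_tendstoI)
    fix k
    show "((\<lambda>y. ((1 / norm (y - z)) *\<^sub>R (F y - (F z + (\<chi> k. dd S (y - z) (\<lambda>y. F y $ k) z)))) $ k) \<longlongrightarrow> 0 $ k) (at z within S)"
      using dd_has_derivative[OF assms, of k] unfolding has_derivative_within by simp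
  qed
  ultimately show *: "(F has_derivative (\<lambda>v. \<chi> k. dd S v (\<lambda>y. F y $ k) z)) (at z within S)"
    unfolding has_derivative_within by blast
  then show "F differentiable (at z within S)" unfolding differentiable_def by blast
qed

lemma dd_vec_nth:
  fixes F :: "'a::euclidean_space \<Rightarrow> 'b::real_normed_vector^'n"
  assumes "thick S" "z \<in> S" "\<And>k. (\<lambda>y. F y $ k) differentiable (at z within S)"
  shows "dd S v F z $ k = dd S v (\<lambda>y. F y $ k) z"
  using dd_eq[OF assms(1,2) differentiable_vec(1)[OF assms(3)]] by simp

lemma D_fst_nth: "D_fst S F z $ i = dd S (axis i 1, 0) F z"
  by (simp add: D_fst_def dd_def)

lemma D_snd_nth: "D_snd S F z $ i = dd S (0, axis i 1) F z"
  by (simp add: D_snd_def dd_def)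

lemma d_snd_dd: "d_snd S F z = dd S (0, 1) F z"
  by (simp add: d_snd_def dd_def)

section \<open>Positive semidefinite matrices\<close>

lemma sym_matrix_inner:
  fixes P :: "real^'n^'n"
  assumes "\<And>i k. P $ i $ k = P $ k $ i"
  shows "x \<bullet> (P *v y) = y \<bullet> (P *v x)"
proof -
  have "transpose P = P" using assms by (simp add: transpose_def vec_eq_iff)
  then show ?thesis by (metis dot_lmul_matrix inner_commute transpose_matrix_vector)
qed

lemma matrix_vector_axis: "((P :: real^'n^'m) *v axis j 1) $ i = P $ i $ j"
  by (simp add: matrix_vector_mul_component inner_axis)

text \<open>Symmetric Gaussian elimination. The set \<open>A\<close> contains the indices of all
  nonzero rows; each step removes one index \<open>j\<close> by passing to the Schur complement,
  which is again symmetric and positive semidefinite, and records the row \<open>j\<close> divided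
  by the root of its pivot.\<close>

lemma psd_decomposition_on:
  fixes P :: "real^'n^'n"
  assumes "finite A" and sym: "\<And>i k. P $ i $ k = P $ k $ i" and psd: "\<And>x. x \<bullet> (P *v x) \<ge> 0"
    and supp: "\<And>i k. i \<notin> A \<Longrightarrow> P $ i $ k = 0"
  shows "\<exists>v. \<forall>i k. P $ i $ k = (\<Sum>m\<in>A. v m $ i * (v m :: real^'n) $ k)"
  using assms
proof (induction A arbitrary: P rule: finite_induct)
  case empty
  then show ?case by simp
next
  case (insert j A)
  note sym = insert.prems(1) and psd = insert.prems(2) and supp = insert.prems(3)
  have quad: "(x - c *\<^sub>R axis j 1) \<bullet> (P *v (x - c *\<^sub>R axis j 1))
      = x \<bullet> (P *v x) - 2 * c * (P $ j \<bullet> x) + c^2 * P $ j $ j" for x c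
  proof -
    have "axis j 1 \<bullet> (P *v x) = P $ j \<bullet> x"
      by (simp add: inner_axis' matrix_vector_mul_component)
    moreover have "x \<bullet> (P *v axis j 1) = P $ j \<bullet> x"
      using sym_matrix_inner[OF sym] calculation by metis
    moreover have "axis j 1 \<bullet> (P *v axis j 1) = P $ j $ j"
      by (simp add: inner_axis' matrix_vector_axis)
    ultimately show ?thesis
      by (simp add: matrix_vector_mult_diff_distrib inner_diff_left inner_diff_right
          matrix_vector_mult_scaleR power2_eq_square algebra_simps)
  qed
  have jj: "P $ j $ j \<ge> 0" using psd[of "axis j 1"] by (simp add: inner_axis' matrix_vector_axis)
  show ?case
  proof (cases "P $ j $ j = 0")
    case True
    have zero: "P $ j $ k = 0" for k
    proof (rule ccontr)
      assume nz: "P $ j $ k \<noteq> 0"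
      \<comment> \<open>With a vanishing pivot the quadratic form at
        \<open>axis k 1 - c *\<^sub>R axis j 1\<close> is affine in \<open>c\<close>; being
        nonnegative for all \<open>c\<close>, it has slope 0.\<close>
      have "0 \<le> P $ k $ k - 2 * c * P $ j $ k" for c
        using psd[of "axis k 1 - c *\<^sub>R axis j 1"] True
        unfolding quad by (simp add: inner_axis inner_axis' matrix_vector_axis)
      from this[of "(P $ k $ k + 1) / (2 * P $ j $ k)"] nz show False by (simp add: field_simps)
    qed
    have "\<exists>v. \<forall>i k. P $ i $ k = (\<Sum>m\<in>A. v m $ i * (v m :: real^'n) $ k)"
      using zero supp by (intro insert.IH sym psd) (metis insert_iff)
    then obtain v :: "'n \<Rightarrow> real^'n" where "\<forall>i k. P $ i $ k = (\<Sum>m\<in>A. v m $ i * v m $ k)" by blast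
    moreover have "(\<Sum>m\<in>A. (v(j := 0)) m $ i * (v(j := 0)) m $ k) = (\<Sum>m\<in>A. v m $ i * v m $ k)" for i k
      using insert.hyps by (intro sum.cong) auto
    ultimately show ?thesis using insert.hyps by (intro exI[of _ "v(j := 0)"]) simp
  next
    case False
    then have jp: "P $ j $ j > 0" using jj by simp
    define R :: "real^'n^'n" where "R = (\<chi> i k. P $ i $ k - P $ j $ i * P $ j $ k / P $ j $ j)"
    have RR: "x \<bullet> (R *v x) = x \<bullet> (P *v x) - (P $ j \<bullet> x)^2 / P $ j $ j" for x
    proof -
      have "(R *v x) $ i = (P *v x) $ i - P $ j $ i * ((P $ j \<bullet> x) / P $ j $ j)" for i
        unfolding R_def matrix_vector_mult_def inner_vec_def
        by (simp add: algebra_simps sum_subtractf sum_distrib_left sum_divide_distrib)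
      then have "R *v x = P *v x - ((P $ j \<bullet> x) / P $ j $ j) *\<^sub>R P $ j"
        by (simp add: vec_eq_iff mult.commute)
      then show ?thesis by (simp add: inner_diff_right power2_eq_square inner_commute)
    qed
    have "\<exists>v. \<forall>i k. R $ i $ k = (\<Sum>m\<in>A. v m $ i * (v m :: real^'n) $ k)"
    proof (rule insert.IH)
      show "R $ i $ k = R $ k $ i" for i k using sym[of i k] by (simp add: R_def)
      show "0 \<le> x \<bullet> (R *v x)" for x
      proof -
        \<comment> \<open>The form of \<open>R\<close> at \<open>x\<close> is the minimum over
          \<open>c\<close> of the form of \<open>P\<close> at
          \<open>x - c *\<^sub>R axis j 1\<close>, attained at \<open>c = a / d\<close>.\<close>
        define a d where "a = P $ j \<bullet> x" and "d = P $ j $ j"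
        have "0 \<le> x \<bullet> (P *v x) - 2 * (a / d) * a + (a / d)^2 * d"
          using psd[of "x - (a / d) *\<^sub>R axis j 1"] unfolding quad a_def d_def .
        moreover have "2 * (a / d) * a = 2 * (a^2 / d)" by (simp add: power2_eq_square)
        moreover have "(a / d)^2 * d = a^2 / d" using jp by (simp add: power2_eq_square d_def)
        ultimately show ?thesis unfolding RR a_def[symmetric] d_def[symmetric] by linarith
      qed
      show "R $ i $ k = 0" if "i \<notin> A" for i k
      proof (cases "i = j")
        case True then show ?thesis using jp by (simp add: R_def)
      next
        case False
        then have "P $ i $ k' = 0" for k' using supp that by simp
        then show ?thesis using sym[of i j] by (simp add: R_def)
      qed
    qed
    then obtain v :: "'n \<Rightarrow> real^'n" where v: "\<forall>i k. R $ i $ k = (\<Sum>m\<in>A. v m $ i * v m $ k)" by blast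
    define w where "w = v(j := (1 / sqrt (P $ j $ j)) *\<^sub>R P $ j)"
    have e1: "(\<Sum>m\<in>A. w m $ i * w m $ k) = (\<Sum>m\<in>A. v m $ i * v m $ k)" for i k
      using insert.hyps by (intro sum.cong) (auto simp: w_def)
    have e2: "w j $ i * w j $ k = P $ j $ i * P $ j $ k / P $ j $ j" for i k
    proof -
      have "(1 / r * a) * (1 / r * b) = a * b / (r * r)" for r a b :: real by simp
      from this[of "sqrt (P $ j $ j)"] show ?thesis using jp by (simp add: w_def)
    qed
    have e3: "P $ i $ k = P $ j $ i * P $ j $ k / P $ j $ j + R $ i $ k" for i k
      by (simp add: R_def)
    have "(\<Sum>m\<in>insert j A. w m $ i * w m $ k) = w j $ i * w j $ k + (\<Sum>m\<in>A. w m $ i * w m $ k)" for i k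
      using insert.hyps by simp
    then have "P $ i $ k = (\<Sum>m\<in>insert j A. w m $ i * w m $ k)" for i k
      using v e1 e2 e3[of i k] by metis
    then show ?thesis by blast
  qed
qed

text \<open>Applied to \<open>H\<^sub>p\<^sub>p\<close>, this turns the trace of its product with a
  Hessian into a sum of second derivatives along the vectors \<open>v m\<close>, each of which has a
  sign at a maximum.\<close>

lemma psd_decomposition:
  fixes P :: "real^'n^'n"
  assumes "\<And>i k. P $ i $ k = P $ k $ i" "\<And>x. x \<bullet> (P *v x) \<ge> 0"
  obtains v :: "'n \<Rightarrow> real^'n" where "\<And>i k. P $ i $ k = (\<Sum>m\<in>UNIV. v m $ i * v m $ k)"
  using psd_decomposition_on[of UNIV P] assms by auto

section \<open>Periodic functions\<close>

lemma periodic_add_int: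
  assumes "periodic F"
  shows "F (x + of_int n *\<^sub>R axis i 1) = F x"
proof (induction n rule: int_induct[of _ 0])
  case (step1 n)
  have "F (x + of_int (n + 1) *\<^sub>R axis i 1) = F ((x + of_int n *\<^sub>R axis i 1) + axis i 1)"
    by (simp add: algebra_simps)
  then show ?case using step1 assms by (simp add: periodic_def)
next
  case (step2 n)
  have "F (x + of_int n *\<^sub>R axis i 1) = F ((x + of_int (n - 1) *\<^sub>R axis i 1) + axis i 1)"
    by (simp add: algebra_simps)
  then show ?case using step2 assms by (simp add: periodic_def)
qed simp

lemma periodic_frac:
  assumes "periodic F"
  shows "F (\<chi> i. frac (x $ i)) = F (x :: real^'n)"
proof -
  have "F (y + (\<Sum>i\<in>A. of_int \<lfloor>x $ i\<rfloor> *\<^sub>R axis i 1)) = F y" if "finite A" for A :: "'n set" and y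
    using that
  proof (induction A arbitrary: y rule: finite_induct)
    case (insert j A)
    then have "F (y + (\<Sum>i\<in>insert j A. of_int \<lfloor>x $ i\<rfloor> *\<^sub>R axis i 1))
       = F ((y + of_int \<lfloor>x $ j\<rfloor> *\<^sub>R axis j 1) + (\<Sum>i\<in>A. of_int \<lfloor>x $ i\<rfloor> *\<^sub>R axis i 1))"
      by (simp add: algebra_simps)
    then show ?case using insert periodic_add_int[OF assms] by metis
  qed simp
  from this[of UNIV "\<chi> i. frac (x $ i)"]
  have "F ((\<chi> i. frac (x $ i)) + (\<Sum>i\<in>UNIV. of_int \<lfloor>x $ i\<rfloor> *\<^sub>R axis i 1)) = F (\<chi> i. frac (x $ i))"
    by simp
  moreover have "(\<chi> i. frac (x $ i)) + (\<Sum>i\<in>UNIV. of_int \<lfloor>x $ i\<rfloor> *\<^sub>R axis i 1) = x"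
    by (simp add: vec_eq_iff frac_def axis_def if_distrib sum.delta cong: if_cong)
  ultimately show ?thesis by simp
qed

text \<open>Periodicity moves every point into the unit cube, which supplies the compactness of the
  torus.\<close>

lemma periodic_fst_attains_max:
  fixes F :: "(real^'n) \<times> 'c::euclidean_space \<Rightarrow> 'b::linorder_topology"
  assumes Y: "compact Y" "Y \<noteq> {}" and F: "continuous_on (UNIV \<times> Y) F" "periodic_fst Y F"
  obtains z where "z \<in> UNIV \<times> Y" "\<And>y. y \<in> UNIV \<times> Y \<Longrightarrow> F y \<le> F z"
proof -
  let ?K = "cbox 0 1 \<times> Y :: ((real^'n) \<times> 'c) set"
  have cK: "compact ?K" using Y by (intro compact_Times) auto
  have "(0 :: real^'n) \<in> cbox 0 1" by (simp add: mem_box_cart)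
  then have nK: "?K \<noteq> {}" using Y by blast
  have sK: "?K \<subseteq> UNIV \<times> Y" by auto
  obtain z where z: "z \<in> ?K" "\<And>y. y \<in> ?K \<Longrightarrow> F y \<le> F z"
    using continuous_attains_sup[OF cK nK continuous_on_subset[OF F(1) sK]] by blast
  have "F y \<le> F z" if "y \<in> UNIV \<times> Y" for y
  proof -
    have y2: "snd y \<in> Y" using that by (simp add: mem_Times_iff)
    then have "periodic (\<lambda>x. F (x, snd y))" using F(2) unfolding periodic_fst_def by blast
    from periodic_frac[OF this, of "fst y"] have "F y = F (\<chi> i. frac (fst y $ i), snd y)" by simp
    moreover have "(\<chi> i. frac (fst y $ i)) \<in> cbox 0 1"
      unfolding mem_box_cart by (simp add: less_imp_le[OF frac_lt_1])
    then have "F (\<chi> i. frac (fst y $ i), snd y) \<le> F z" using z(2) y2 by blast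
    ultimately show ?thesis by metis
  qed
  moreover have "z \<in> UNIV \<times> Y" using z(1) by (simp add: mem_Times_iff)
  ultimately show ?thesis using that by metis
qed

lemma periodic_fst_bounded:
  fixes F :: "(real^'n) \<times> 'c::euclidean_space \<Rightarrow> 'b::real_normed_vector"
  assumes Y: "compact Y" and F: "continuous_on (UNIV \<times> Y) F" "periodic_fst Y F"
  obtains M where "M > 0" "\<And>y. y \<in> UNIV \<times> Y \<Longrightarrow> norm (F y) \<le> M"
proof (cases "Y = {}")
  case True
  then show ?thesis using that[of 1] by auto
next
  case False
  have "continuous_on (UNIV \<times> Y) (\<lambda>y. norm (F y))" using F by (auto intro: continuous_intros)
  moreover have "periodic_fst Y (\<lambda>y. norm (F y))" using F by (auto simp: periodic_fst_def periodic_def)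
  ultimately obtain z where *: "\<And>y. y \<in> UNIV \<times> Y \<Longrightarrow> norm (F y) \<le> norm (F z)"
    using periodic_fst_attains_max[OF Y False] by blast
  show ?thesis
  proof (rule that)
    fix y :: "(real^'n) \<times> 'c" assume "y \<in> UNIV \<times> Y" then show "norm (F y) \<le> norm (F z) + 1" using * by fastforce
  qed (smt (verit) norm_ge_zero)
qed

lemma periodic_fst_dd:
  fixes F :: "(real^'n) \<times> 'c::euclidean_space \<Rightarrow> 'b::real_normed_vector"
  assumes S: "thick (UNIV \<times> Y :: ((real^'n) \<times> 'c) set)" and F: "periodic_fst Y F" "F differentiable_on (UNIV \<times> Y)"
  shows "periodic_fst Y (dd (UNIV \<times> Y) v F)"
  unfolding periodic_fst_def periodic_def
proof (intro ballI allI)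
  fix y x i assume y: "y \<in> Y"
  let ?S = "UNIV \<times> Y :: ((real^'n) \<times> 'c) set"
  let ?s = "\<lambda>z :: (real^'n) \<times> 'c. z + (axis i 1, 0)"
  have 1: "(F has_derivative (\<lambda>v. dd ?S v F (x + axis i 1, y))) (at (?s (x, y)) within ?S)"
    using F(2) y dd_has_derivative[of F "(x + axis i 1, y)" ?S] by (auto simp: differentiable_on_def)
  have 2: "(F has_derivative (\<lambda>v. dd ?S v F (x + axis i 1, y))) (at (?s (x, y)) within ?s ` ?S)"
    by (rule has_derivative_subset[OF 1]) auto
  have 3: "(?s has_derivative (\<lambda>v. v)) (at (x, y) within ?S)" by (auto intro!: derivative_eq_intros)
  have "((\<lambda>z. F (?s z)) has_derivative (\<lambda>v. dd ?S v F (x + axis i 1, y))) (at (x, y) within ?S)"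
    by (rule has_derivative_in_compose[OF 3 2])
  moreover have "F (?s z) = F z" if "z \<in> ?S" for z
    using F(1) that by (cases z) (auto simp: periodic_fst_def periodic_def)
  ultimately have 4: "(F has_derivative (\<lambda>v. dd ?S v F (x + axis i 1, y))) (at (x, y) within ?S)"
    using y by (intro has_derivative_transform[of "(x,y)" ?S F "\<lambda>z. F (?s z)"]) auto
  have "(x, y) \<in> ?S" using y by simp
  from dd_eq[OF S this 4] show "dd ?S v F (x + axis i 1, y) = dd ?S v F (x, y)" by (rule sym)
qed

section \<open>Couplings\<close>

lemma open_pos_dom: "open (pos_dom :: ((real^'n) \<times> real) set)"
  unfolding pos_dom_def by (intro open_Times) auto

lemma thick_pos_dom: "thick (pos_dom :: ((real^'n) \<times> real) set)"
  by (rule thick_open[OF open_pos_dom])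

lemma mem_pos_dom [simp]: "(x, m) \<in> pos_dom \<longleftrightarrow> 0 < m"
  by (simp add: pos_dom_def)

lemma C0_norm_le: "C0_norm A F \<le> ennreal M" if "\<And>z. z \<in> A \<Longrightarrow> norm (F z) \<le> M"
  unfolding C0_norm_def by (rule SUP_least) (simp add: ennreal_leI that)

lemma C0_norm_bound:
  assumes "C0_norm A F \<le> ennreal M" "z \<in> A" "M \<ge> 0"
  shows "norm (F z) \<le> M"
proof -
  have "ennreal (norm (F z)) \<le> C0_norm A F" unfolding C0_norm_def by (rule SUP_upper[OF assms(2)])
  then show ?thesis using assms(1,3) by (metis ennreal_le_iff order_trans)
qed

lemma C0_norm_finite: "C0_norm A F < \<infinity>" if "\<And>z. z \<in> A \<Longrightarrow> norm (F z) \<le> M"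
proof -
  have "C0_norm A F \<le> ennreal M" by (rule C0_norm_le[OF that])
  also have "\<dots> < \<infinity>" by simp
  finally show ?thesis .
qed

section \<open>Regular couplings: minimum and maximum over the torus as functions of the density,
  and their inverses\<close>

locale coupling =
  fixes f :: "'n::finite coupling"
  assumes regular: "regular_coupling f"
begin

abbreviation F :: "(real^'n) \<times> real \<Rightarrow> real" where "F \<equiv> re f"

lemma Ck4: "Ck_on 4 pos_dom F"
  using regular by (simp add: regular_coupling_def)

lemma Ck_F: "k \<le> 4 \<Longrightarrow> Ck_on k pos_dom F"
  using Ck4 Ck_on_mono by blast

lemma cont_F: "continuous_on pos_dom F"
  using Ck4 Ck_on_continuous by blast

lemma f_eq: "m > 0 \<Longrightarrow> f (x, m) = ereal (F (x, m))"
  using regular unfolding regular_coupling_def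
  by (metis mem_pos_dom ereal_real)

lemma f_strict: "0 \<le> m \<Longrightarrow> m < m' \<Longrightarrow> f (x, m) < f (x, m')"
  using regular unfolding regular_coupling_def strict_mono_on_def by auto

lemma F_strict: "0 < m \<Longrightarrow> m < m' \<Longrightarrow> F (x, m) < F (x, m')"
  using f_strict[of m m' x] f_eq[of m x] f_eq[of m' x]
  by (metis ereal_less(1) ereal_less_eq(3) less_imp_le not_less order.strict_trans)

lemma F_mono: "0 < m \<Longrightarrow> m \<le> m' \<Longrightarrow> F (x, m) \<le> F (x, m')"
  using F_strict[of m m' x] by (cases "m = m'") auto

lemma F_le_iff: "0 < m \<Longrightarrow> 0 < m' \<Longrightarrow> F (x, m) \<le> F (x, m') \<longleftrightarrow> m \<le> m'"
  using F_strict[of m' m x] F_mono[of m m' x] by fastforce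

lemma F_deriv_pos: "0 < m \<Longrightarrow> dd pos_dom (0, 1) F (x, m) > 0"
  using regular unfolding regular_coupling_def d_snd_dd by auto

lemma periodic_f: "periodic_fst {0..} f"
  using regular by (simp add: regular_coupling_def)

lemma periodic_F: "Y \<subseteq> {0..} \<Longrightarrow> periodic_fst Y F"
  using periodic_f unfolding periodic_fst_def periodic_def by (metis subsetD)

lemma cont_slice_x: "m > 0 \<Longrightarrow> continuous_on UNIV (\<lambda>x. F (x, m))"
  by (rule continuous_on_compose2[OF cont_F]) (auto intro!: continuous_intros)

lemma cont_slice_m: "A \<subseteq> {0<..} \<Longrightarrow> continuous_on A (\<lambda>m. F (x, m))"
  by (rule continuous_on_compose2[OF cont_F]) (auto intro!: continuous_intros)

text \<open>The value at density 0 may be infinite. Continuity at 0 in the extended reals carries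
  the strict inequality over to a small positive density, where the coupling is real.\<close>

lemma below_of_zero:
  assumes "f (x, 0) < ereal y"
  shows "\<exists>m>0. F (x, m) < y"
proof -
  have "continuous_on nonneg_dom f" using regular by (simp add: regular_coupling_def)
  then have "continuous_on {0..} (\<lambda>m. f (x, m))"
    by (rule continuous_on_compose2) (auto intro!: continuous_intros simp: nonneg_dom_def)
  then have "((\<lambda>m. f (x, m)) \<longlongrightarrow> f (x, 0)) (at 0 within {0..})"
    by (simp add: continuous_on_def)
  then have "eventually (\<lambda>m. f (x, m) < ereal y) (at 0 within {0..})"
    using assms by (rule order_tendstoD)
  then obtain d where d: "d > 0" "\<And>m. m \<in> {0..} \<Longrightarrow> m \<noteq> 0 \<Longrightarrow> dist m 0 < d \<Longrightarrow> f (x, m) < ereal y"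
    unfolding eventually_at by blast
  have "f (x, d/2) < ereal y" using d by (intro d(2)) auto
  then have "ereal (F (x, d/2)) < ereal y" using f_eq[of "d/2" x] d(1) by (metis half_gt_zero)
  then show ?thesis using d(1) by (intro exI[of _ "d/2"]) (simp only: less_ereal.simps half_gt_zero simp_thms)
qed

lemma min_attained:
  assumes "m > 0"
  obtains x where "x_min f m = F (x, m)" "\<And>y. F (x, m) \<le> F (y, m)"
proof -
  have c: "continuous_on (UNIV \<times> {m}) (\<lambda>z. - F z)"
    using assms by (intro continuous_on_minus continuous_on_subset[OF cont_F]) auto
  have p: "periodic_fst {m} (\<lambda>z. - F z)"
    using periodic_F[of "{m}"] assms unfolding periodic_fst_def periodic_def by simp
  obtain z where z: "z \<in> UNIV \<times> {m}" "\<And>y. y \<in> UNIV \<times> {m} \<Longrightarrow> - F y \<le> - F z"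
    using periodic_fst_attains_max[OF _ _ c p] by auto
  then obtain x where x: "z = (x, m)" by auto
  have "F (x, m) \<le> F (y, m)" for y using z(2)[of "(y, m)"] by (simp add: x)
  then show ?thesis using that unfolding x_min_def by (auto intro!: cInf_eq_minimum)
qed

lemma max_attained:
  assumes "m > 0"
  obtains x where "x_max f m = F (x, m)" "\<And>y. F (y, m) \<le> F (x, m)"
proof -
  have c: "continuous_on (UNIV \<times> {m}) F"
    using assms by (intro continuous_on_subset[OF cont_F]) auto
  have p: "periodic_fst {m} F"
    using periodic_F[of "{m}"] assms by simp
  obtain z where z: "z \<in> UNIV \<times> {m}" "\<And>y. y \<in> UNIV \<times> {m} \<Longrightarrow> F y \<le> F z"
    using periodic_fst_attains_max[OF _ _ c p] by auto
  then obtain x where x: "z = (x, m)" by auto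
  have "F (y, m) \<le> F (x, m)" for y using z(2)[of "(y, m)"] by (simp add: x)
  then show ?thesis using that unfolding x_max_def by (auto intro!: cSup_eq_maximum)
qed

lemma x_min_le: "m > 0 \<Longrightarrow> x_min f m \<le> F (x, m)"
  by (metis min_attained)

lemma x_max_ge: "m > 0 \<Longrightarrow> F (x, m) \<le> x_max f m"
  by (metis max_attained)

lemma x_min_strict: "0 < m \<Longrightarrow> m < m' \<Longrightarrow> x_min f m < x_min f m'"
  by (metis F_strict min_attained order.strict_trans order_le_less_trans x_min_le)

lemma x_max_strict: "0 < m \<Longrightarrow> m < m' \<Longrightarrow> x_max f m < x_max f m'"
  by (metis F_strict max_attained order.strict_trans order_less_le_trans x_max_ge)

lemma F_frac: "m > 0 \<Longrightarrow> F (\<chi> i. frac (x $ i), m) = F (x, m)"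
  using periodic_frac[of "\<lambda>x. F (x, m)" x] periodic_F[of "{m}"] unfolding periodic_fst_def by simp

lemma frac_in_cbox: "(\<chi> i. frac ((x :: real^'n) $ i)) \<in> cbox 0 1"
  unfolding mem_box_cart by (simp add: less_imp_le[OF frac_lt_1])

text \<open>Dini's argument: if no density served all points, the sets of points that fail at
  density \<open>Suc n\<close> would be nonempty, compact (in the unit cube) and decreasing, and a
  common point would contradict the pointwise hypothesis.\<close>

lemma uniform_above:
  assumes "\<And>x. \<exists>m>0. F (x, m) > y"
  shows "\<exists>m>0. \<forall>x. F (x, m) > y"
proof (rule ccontr)
  assume neg: "\<not> ?thesis"
  define S where "S n = cbox 0 1 \<inter> {x. F (x, real (Suc n)) \<le> y}" for n
  have "\<Inter> (range S) \<noteq> {}"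
  proof (rule compact_nest)
    fix n
    have "closed {x. F (x, real (Suc n)) \<le> y}"
      by (rule closed_Collect_le[OF cont_slice_x continuous_on_const]) simp
    then show "compact (S n)" unfolding S_def by (intro compact_Int_closed compact_cbox)
    obtain x where "F (x, real (Suc n)) \<le> y" using neg
      by (metis linorder_not_le of_nat_0_less_iff zero_less_Suc)
    then have "(\<chi> i. frac (x $ i)) \<in> S n" unfolding S_def using F_frac[of "real (Suc n)" x] frac_in_cbox by simp
    then show "S n \<noteq> {}" by blast
  next
    fix k n :: nat assume "k \<le> n"
    then have "F (x, real (Suc k)) \<le> F (x, real (Suc n))" for x by (intro F_mono) auto
    then show "S n \<subseteq> S k" unfolding S_def using order_trans by blast
  qed
  then obtain x where x: "\<And>n. F (x, real (Suc n)) \<le> y" unfolding S_def by blast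
  obtain m where m: "m > 0" "F (x, m) > y" using assms by blast
  obtain n where "m \<le> real n" using real_arch_simple by blast
  then have "F (x, m) \<le> F (x, real (Suc n))" using m by (intro F_mono) auto
  then show False using x[of n] m by linarith
qed

lemma uniform_below:
  assumes "\<And>x. \<exists>m>0. F (x, m) < y"
  shows "\<exists>m>0. \<forall>x. F (x, m) < y"
proof (rule ccontr)
  assume neg: "\<not> ?thesis"
  define S where "S n = cbox 0 1 \<inter> {x. y \<le> F (x, 1 / real (Suc n))}" for n
  have "\<Inter> (range S) \<noteq> {}"
  proof (rule compact_nest)
    fix n
    have "closed {x. y \<le> F (x, 1 / real (Suc n))}"
      by (rule closed_Collect_le[OF continuous_on_const cont_slice_x]) simp
    then show "compact (S n)" unfolding S_def by (intro compact_Int_closed compact_cbox)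
    have "1 / real (Suc n) > 0" by simp
    then obtain x where "y \<le> F (x, 1 / real (Suc n))" using neg by (meson linorder_not_le)
    then have "(\<chi> i. frac (x $ i)) \<in> S n" unfolding S_def using F_frac[of "1 / real (Suc n)" x] frac_in_cbox by simp
    then show "S n \<noteq> {}" by blast
  next
    fix k n :: nat assume "k \<le> n"
    then have "F (x, 1 / real (Suc n)) \<le> F (x, 1 / real (Suc k))" for x
      by (intro F_mono) (auto intro: divide_left_mono)
    then show "S n \<subseteq> S k" unfolding S_def using order_trans by blast
  qed
  then obtain x where x: "\<And>n. y \<le> F (x, 1 / real (Suc n))" unfolding S_def by blast
  obtain m where m: "m > 0" "F (x, m) < y" using assms by blast
  obtain n where "1 / real (Suc n) < m" using m(1) reals_Archimedean by (metis inverse_eq_divide)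
  then have "F (x, 1 / real (Suc n)) \<le> F (x, m)" using m by (intro F_mono) auto
  then show False using x[of n] m by linarith
qed

lemma F_ivt:
  assumes "0 < m1" "m1 \<le> m2" "F (x, m1) \<le> y" "y \<le> F (x, m2)"
  obtains m where "m1 \<le> m" "m \<le> m2" "F (x, m) = y"
proof -
  have "continuous_on {m1..m2} (\<lambda>m. F (x, m))" using assms by (intro cont_slice_m) auto
  from IVT'[OF assms(3,4,2) this] show ?thesis using that by blast
qed

lemma level_compact:
  assumes "0 < m1"
  shows "compact {z \<in> cbox 0 1 \<times> {m1..m2}. F z \<le> y}" "compact {z \<in> cbox 0 1 \<times> {m1..m2}. y \<le> F z}"
proof -
  have K: "compact (cbox (0::real^'n) 1 \<times> {m1..m2})" by (intro compact_Times) auto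
  have c: "continuous_on (cbox (0::real^'n) 1 \<times> {m1..m2}) F"
    using assms by (intro continuous_on_subset[OF cont_F]) auto
  have "closed ({z \<in> cbox 0 1 \<times> {m1..m2}. F z \<in> {..y}})" "closed ({z \<in> cbox 0 1 \<times> {m1..m2}. F z \<in> {y..}})"
    using continuous_closed_preimage[OF c compact_imp_closed[OF K], of "{..y}"]
      continuous_closed_preimage[OF c compact_imp_closed[OF K], of "{y..}"]
    by (auto simp: vimage_def Int_def)
  moreover have "{z \<in> cbox 0 1 \<times> {m1..m2}. F z \<in> {..y}} = (cbox 0 1 \<times> {m1..m2}) \<inter> {z \<in> cbox 0 1 \<times> {m1..m2}. F z \<in> {..y}}"
    "{z \<in> cbox 0 1 \<times> {m1..m2}. F z \<in> {y..}} = (cbox 0 1 \<times> {m1..m2}) \<inter> {z \<in> cbox 0 1 \<times> {m1..m2}. F z \<in> {y..}}" by auto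
  ultimately show "compact {z \<in> cbox 0 1 \<times> {m1..m2}. F z \<le> y}" "compact {z \<in> cbox 0 1 \<times> {m1..m2}. y \<le> F z}"
    using compact_Int_closed[OF K] by (metis (mono_tags, lifting) Collect_cong atMost_iff,
        metis (mono_tags, lifting) Collect_cong atLeast_iff)
qed

text \<open>Obtained without proving continuity of \<open>x_min f\<close>. Among the points of a
  compact strip where \<open>F\<close> is at most \<open>y\<close>, one has the largest density
  \<open>m\<close>. At this density no slice lies strictly below \<open>y\<close>, since otherwise
  the intermediate value theorem in the density would give a point of the set with a larger one.
  Hence the minimum over the torus at \<open>m\<close> is exactly \<open>y\<close>.\<close>

lemma x_min_surj:
  assumes lo: "\<And>x. \<exists>m>0. F (x, m) < y" and hi: "\<And>x. \<exists>m>0. F (x, m) > y"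
  shows "\<exists>m>0. x_min f m = y"
proof -
  obtain m1 m2 where m1: "m1 > 0" "\<And>x. F (x, m1) < y" and m2: "m2 > 0" "\<And>x. F (x, m2) > y"
    using uniform_below[OF lo] uniform_above[OF hi] by blast
  have m12: "m1 < m2" using m1 m2 F_le_iff[of m2 m1 0] by (meson linorder_not_le order.strict_trans order_less_irrefl)
  let ?Z = "{z \<in> cbox 0 1 \<times> {m1..m2}. F z \<le> y}"
  have "(0, m1) \<in> ?Z" using m1(2)[of 0] m12 by (simp add: mem_box_cart less_imp_le)
  then have ne: "?Z \<noteq> {}" by blast
  obtain z where z: "z \<in> ?Z" "\<And>z'. z' \<in> ?Z \<Longrightarrow> snd z' \<le> snd z"
    using continuous_attains_sup[OF level_compact(1)[OF m1(1)] ne continuous_on_snd[OF continuous_on_id]] by blast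
  obtain a m where am: "z = (a, m)" by force
  have m: "m1 \<le> m" "m \<le> m2" "F (a, m) \<le> y" using z(1) am by auto
  have ge: "y \<le> F (x, m)" for x
  proof (rule ccontr)
    assume "\<not> y \<le> F (x, m)"
    then have lt: "F (x, m) < y" by simp
    obtain m' where m': "m \<le> m'" "m' \<le> m2" "F (x, m') = y"
      by (rule F_ivt[of m m2 x y]) (use lt m m1(1) less_imp_le[OF m2(2)[of x]] in auto)
    have "(\<chi> i. frac (x $ i), m') \<in> ?Z"
      using m' m m1(1) F_frac[of m' x] frac_in_cbox[of x] by simp
    then have "snd (\<chi> i. frac (x $ i), m') \<le> snd z" by (rule z(2))
    then have "m' \<le> m" using am by simp
    then show False using m' lt by simp
  qed
  have "x_min f m = F (a, m)" unfolding x_min_def using m(3) ge by (intro cInf_eq_minimum) (auto intro: order_trans)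
  then show ?thesis using m ge[of a] m1(1) by (intro exI[of _ m]) auto
qed

lemma x_max_surj:
  assumes lo: "\<And>x. \<exists>m>0. F (x, m) < y" and hi: "\<And>x. \<exists>m>0. F (x, m) > y"
  shows "\<exists>m>0. x_max f m = y"
proof -
  obtain m1 m2 where m1: "m1 > 0" "\<And>x. F (x, m1) < y" and m2: "m2 > 0" "\<And>x. F (x, m2) > y"
    using uniform_below[OF lo] uniform_above[OF hi] by blast
  have m12: "m1 < m2" using m1 m2 F_le_iff[of m2 m1 0] by (meson linorder_not_le order.strict_trans order_less_irrefl)
  let ?Z = "{z \<in> cbox 0 1 \<times> {m1..m2}. y \<le> F z}"
  have "(0, m2) \<in> ?Z" using m2(2)[of 0] m12 by (simp add: mem_box_cart less_imp_le)
  then have ne: "?Z \<noteq> {}" by blast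
  obtain z where z: "z \<in> ?Z" "\<And>z'. z' \<in> ?Z \<Longrightarrow> snd z \<le> snd z'"
    using continuous_attains_inf[OF level_compact(2)[OF m1(1)] ne continuous_on_snd[OF continuous_on_id]] by blast
  obtain a m where am: "z = (a, m)" by force
  have m: "m1 \<le> m" "m \<le> m2" "y \<le> F (a, m)" using z(1) am by auto
  have le: "F (x, m) \<le> y" for x
  proof (rule ccontr)
    assume "\<not> F (x, m) \<le> y"
    then have lt: "F (x, m) > y" by simp
    obtain m' where m': "m1 \<le> m'" "m' \<le> m" "F (x, m') = y"
      by (rule F_ivt[of m1 m x y]) (use lt m m1(1) less_imp_le[OF m1(2)[of x]] in auto)
    have "(\<chi> i. frac (x $ i), m') \<in> ?Z"
      using m' m m1(1) F_frac[of m' x] frac_in_cbox[of x] by simp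
    then have "snd z \<le> snd (\<chi> i. frac (x $ i), m')" by (rule z(2))
    then have "m \<le> m'" using am by simp
    then show False using m' lt by simp
  qed
  have "x_max f m = F (a, m)" unfolding x_max_def using m(3) le by (intro cSup_eq_maximum) (auto intro: order_trans)
  then show ?thesis using m le[of a] m1(1) by (intro exI[of _ m]) auto
qed

text \<open>\<open>inv_pos\<close> is meaningful only on the range of the function. The two
  hypotheses place \<open>y\<close> strictly inside the range of every slice and therefore in the
  range of the minimum.\<close>

lemma inv_pos_x_min:
  assumes "\<And>x. \<exists>m>0. F (x, m) < y" "\<And>x. \<exists>m>0. F (x, m) > y"
  shows "inv_pos (x_min f) y > 0" "x_min f (inv_pos (x_min f) y) = y"
proof -
  have inj: "inj_on (x_min f) {0<..}"
    by (rule linorder_inj_onI') (use x_min_strict in force)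
  obtain m where "m > 0" "x_min f m = y" using x_min_surj[OF assms] by blast
  then have y: "y \<in> x_min f ` {0<..}" by auto
  show "x_min f (inv_pos (x_min f) y) = y" unfolding inv_pos_def by (rule f_the_inv_into_f[OF inj y])
  show "inv_pos (x_min f) y > 0" unfolding inv_pos_def
    using the_inv_into_into[OF inj y subset_refl] by simp
qed

lemma inv_pos_x_max:
  assumes "\<And>x. \<exists>m>0. F (x, m) < y" "\<And>x. \<exists>m>0. F (x, m) > y"
  shows "inv_pos (x_max f) y > 0" "x_max f (inv_pos (x_max f) y) = y"
proof -
  have inj: "inj_on (x_max f) {0<..}"
    by (rule linorder_inj_onI') (use x_max_strict in force)
  obtain m where "m > 0" "x_max f m = y" using x_max_surj[OF assms] by blast
  then have y: "y \<in> x_max f ` {0<..}" by auto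
  show "x_max f (inv_pos (x_max f) y) = y" unfolding inv_pos_def by (rule f_the_inv_into_f[OF inj y])
  show "inv_pos (x_max f) y > 0" unfolding inv_pos_def
    using the_inv_into_into[OF inj y subset_refl] by simp
qed

lemma x_min_le_iff: "0 < m \<Longrightarrow> 0 < m' \<Longrightarrow> x_min f m \<le> x_min f m' \<longleftrightarrow> m \<le> m'"
  using x_min_strict[of m m'] x_min_strict[of m' m] by (cases m m' rule: linorder_cases) auto

lemma x_max_le_iff: "0 < m \<Longrightarrow> 0 < m' \<Longrightarrow> x_max f m \<le> x_max f m' \<longleftrightarrow> m \<le> m'"
  using x_max_strict[of m m'] x_max_strict[of m' m] by (cases m m' rule: linorder_cases) auto

definition fm :: "(real^'n) \<times> real \<Rightarrow> real" where "fm = dd pos_dom (0, 1) F"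
definition fx :: "'n \<Rightarrow> (real^'n) \<times> real \<Rightarrow> real" where "fx i = dd pos_dom (axis i 1, 0) F"
text \<open>This is \<open>chi_of f\<close> in the variables \<open>(x, m)\<close> instead of
  \<open>(x, w)\<close>, see \<open>chi_F\<close>. In these variables it is an explicit product, so
  the inverse of the coupling need not be differentiated in the estimates.\<close>

definition X :: "(real^'n) \<times> real \<Rightarrow> real" where "X z = snd z * fm z"

lemma Ck_fm: "Ck_on 3 pos_dom fm" and Ck_fx: "Ck_on 3 pos_dom (fx i)"
  unfolding fm_def fx_def using Ck_on_dd[OF thick_pos_dom, of 3 F] Ck4 by (simp_all add: eval_nat_numeral)

lemma diff_fm: "z \<in> pos_dom \<Longrightarrow> fm differentiable (at z within pos_dom)"
  and diff_fx: "z \<in> pos_dom \<Longrightarrow> fx i differentiable (at z within pos_dom)"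
  and diff_F: "z \<in> pos_dom \<Longrightarrow> F differentiable (at z within pos_dom)"
  using Ck_fm Ck_fx[of i] Ck4 Ck_on_differentiable by (auto simp: eval_nat_numeral)

lemma fm_pos: "m > 0 \<Longrightarrow> fm (x, m) > 0"
  using F_deriv_pos by (simp add: fm_def)

lemma X_pos: "m > 0 \<Longrightarrow> X (x, m) > 0"
  using fm_pos by (simp add: X_def)

lemma X_deriv:
  assumes "z \<in> pos_dom"
  shows "X differentiable (at z within pos_dom)"
    and "dd pos_dom v X z = snd v * fm z + snd z * dd pos_dom v fm z"
proof -
  have "((\<lambda>z. snd z * fm z) has_derivative (\<lambda>v. snd z * dd pos_dom v fm z + snd v * fm z)) (at z within pos_dom)"
    by (intro has_derivative_mult dd_has_derivative diff_fm assms has_derivative_snd has_derivative_ident)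
  then have *: "(X has_derivative (\<lambda>v. snd z * dd pos_dom v fm z + snd v * fm z)) (at z within pos_dom)"
    by (simp add: X_def[abs_def])
  then show "X differentiable (at z within pos_dom)" unfolding differentiable_def by blast
  show "dd pos_dom v X z = snd v * fm z + snd z * dd pos_dom v fm z"
    using dd_eq[OF thick_pos_dom assms *] by simp
qed

lemma fxm_commute:
  assumes "z \<in> pos_dom"
  shows "dd pos_dom (axis i 1, 0) fm z = dd pos_dom (0, 1) (fx i) z"
  unfolding fm_def fx_def using assms Ck_F[of 2]
  by (intro dd_commute[OF thick_pos_dom]) (auto simp: interior_open[OF open_pos_dom])

lemma F_DERIV_m: "m > 0 \<Longrightarrow> ((\<lambda>m. F (x, m)) has_real_derivative fm (x, m)) (at m)"
  using dd_line[of "(x, 0)" m "(0, 1)" pos_dom F] diff_F[of "(x, m)"]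
  by (simp add: fm_def interior_open[OF open_pos_dom])

lemma D_fst_F_nth: "D_fst pos_dom F z $ i = fx i z"
  by (simp add: D_fst_nth fx_def)

lemma D_fst_F_deriv:
  assumes "z \<in> pos_dom"
  shows "dd pos_dom v (D_fst pos_dom F) z $ i = dd pos_dom v (fx i) z"
proof -
  have "(\<lambda>y. D_fst pos_dom F y $ i) = fx i" for i by (auto simp: D_fst_F_nth)
  then show ?thesis using dd_vec_nth[OF thick_pos_dom assms, of "D_fst pos_dom F"] diff_fx[OF assms] by simp
qed

lemma X_cont: "continuous_on pos_dom X"
  unfolding X_def[abs_def] using Ck_on_continuous[OF Ck_fm] by (intro continuous_intros)

lemma pos_dom_alt: "pos_dom = UNIV \<times> {0<..}" by (simp add: pos_dom_def)

lemma periodic_fm: "periodic_fst {0<..} fm" and periodic_fx: "periodic_fst {0<..} (fx i)"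
proof -
  have "{0<..} \<subseteq> {0::real..}" by auto
  from periodic_fst_dd[OF thick_pos_dom[unfolded pos_dom_alt] periodic_F[OF this]] diff_F
  show "periodic_fst {0<..} fm" "periodic_fst {0<..} (fx i)"
    unfolding fm_def fx_def pos_dom_alt differentiable_on_def by auto
qed

lemma periodic_X: "periodic_fst {0<..} X"
  using periodic_fm unfolding periodic_fst_def periodic_def X_def by simp

lemma periodic_fst_subset: "periodic_fst Y G \<Longrightarrow> Z \<subseteq> Y \<Longrightarrow> periodic_fst Z G"
  unfolding periodic_fst_def by blast

end

section \<open>Consequences of (F) and (SE): range of the coupling, bounds for
  \<open>\<chi>\<close>, finiteness of \<open>beta\<close>\<close>

locale coupling_F = coupling f for f :: "'n::finite coupling" +
  fixes C0 \<tau> :: real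
  assumes assm_F: "assumption_F C0 \<tau> f" and SE: "assumption_SE f"
begin

lemma X_ge_large: "\<exists>c>0. \<exists>M>0. \<forall>x. \<forall>m\<ge>M. X (x, m) \<ge> c"
proof -
  have "Liminf (principal UNIV \<times>\<^sub>F at_top) (\<lambda>z. ereal (X z)) > 0"
    using assm_F unfolding assumption_F_def X_def fm_def d_snd_dd by simp
  then obtain c where c: "0 < ereal c" "ereal c < Liminf (principal UNIV \<times>\<^sub>F at_top) (\<lambda>z. ereal (X z))"
    using ereal_dense2 by (metis zero_ereal_def)
  from less_LiminfD[OF c(2)] have "eventually (\<lambda>z. c < X z) (principal UNIV \<times>\<^sub>F at_top)" by simp
  then obtain P Q where PQ: "eventually P (principal UNIV)" "eventually Q at_top" "\<And>x y. P x \<Longrightarrow> Q y \<Longrightarrow> c < X (x, y)"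
    unfolding eventually_prod_filter by blast
  obtain N where N: "\<And>n. n \<ge> N \<Longrightarrow> Q n" using PQ(2) unfolding eventually_at_top_linorder by blast
  have "P x" for x using PQ(1) by (simp add: eventually_principal)
  then have "X (x, m) \<ge> c" if "m \<ge> max N 1" for x m using PQ(3)[of x m] N[of m] that by simp
  then show ?thesis using c(1) by (intro exI[of _ c] conjI exI[of _ "max N 1"]) auto
qed

text \<open>Since \<open>m f\<^sub>m\<close> stays above a constant \<open>c\<close> for large
  \<open>m\<close>, the function \<open>f - c ln m\<close> is nondecreasing there, so
  \<open>f\<close> is unbounded above.\<close>

lemma above: "\<exists>m>0. F (x, m) > y"
proof -
  obtain c M where cM: "c > 0" "M > 0" "\<And>x m. m \<ge> M \<Longrightarrow> X (x, m) \<ge> c" using X_ge_large by blast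
  \<comment> \<open>Chosen so that \<open>c * ln m\<close> exceeds \<open>c * ln M\<close> by
    \<open>\<bar>y - F (x, M)\<bar> + c\<close>.\<close>
  define m where "m = M * exp (\<bar>y - F (x, M)\<bar> / c + 1)"
  have e1: "exp (\<bar>y - F (x, M)\<bar> / c + 1) \<ge> 1" using cM by (simp add: one_le_exp_iff)
  have m: "m \<ge> M" "m > 0" unfolding m_def using cM e1 by (simp_all add: mult_le_cancel_left1)
  have "F (x, M) - c * ln M \<le> F (x, m) - c * ln m"
  proof (rule DERIV_nonneg_imp_nondecreasing[OF m(1)])
    fix s assume s: "M \<le> s" "s \<le> m"
    then have s0: "s > 0" using cM by simp
    have "c / s \<le> fm (x, s)" using cM(3)[OF s(1), of x] s0 by (simp add: X_def field_simps)
    moreover have "((\<lambda>s. F (x, s) - c * ln s) has_real_derivative (fm (x, s) - c / s)) (at s)"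
      using s0 by (auto intro!: derivative_eq_intros F_DERIV_m simp: divide_inverse)
    ultimately show "\<exists>y. ((\<lambda>s. F (x, s) - c * ln s) has_real_derivative y) (at s) \<and> 0 \<le> y" by force
  qed
  moreover have "c * ln m = c * ln M + \<bar>y - F (x, M)\<bar> + c"
    unfolding m_def using cM by (simp add: ln_mult algebra_simps)
  ultimately have "F (x, m) > y" using cM by linarith
  then show ?thesis using m by blast
qed

lemma below: "\<exists>m>0. F (x, m) < y"
  using below_of_zero[of x y] SE unfolding assumption_SE_def by simp

text \<open>Every real number is a value of every slice; hence \<open>f_inv\<close> and
  \<open>chi_of f\<close> are genuinely defined for all real \<open>w\<close>.\<close>

lemma F_ex: obtains m where "m > 0" "F (x, m) = w"
proof -
  obtain m1 where m1: "m1 > 0" "F (x, m1) < w" using below by blast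
  obtain m2 where m2: "m2 > 0" "F (x, m2) > w" using above by blast
  have "m1 \<le> m2" using m1 m2 F_le_iff[of m1 m2 x] by linarith
  from F_ivt[OF m1(1) this, of x w] m1 m2 obtain m where "m1 \<le> m" "F (x, m) = w" by auto
  then show ?thesis using that[of m] m1(1) by linarith
qed

lemma f_inv_F: assumes "m > 0" shows "f_inv f x (F (x, m)) = m"
  unfolding f_inv_def
proof (rule the_inv_into_f_eq)
  show "inj_on (\<lambda>m. f (x, m)) {0..}"
  proof (rule linorder_inj_onI')
    fix i j :: real assume "i \<in> {0..}" "i < j"
    then have "f (x, i) < f (x, j)" by (intro f_strict) auto
    then show "f (x, i) \<noteq> f (x, j)" by (rule less_imp_neq)
  qed
  show "f (x, m) = ereal (F (x, m))" by (rule f_eq[OF assms])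
  show "m \<in> {0..}" using assms by simp
qed

lemma F_f_inv: "F (x, f_inv f x w) = w" "f_inv f x w > 0"
proof -
  obtain m where m: "m > 0" "F (x, m) = w" using F_ex by blast
  have "f_inv f x w = m" using f_inv_F[OF m(1), of x] unfolding m(2) .
  then show "F (x, f_inv f x w) = w" "f_inv f x w > 0" using m by (simp_all only:)
qed

lemma chi_eq: "chi_of f (x, w) = X (x, f_inv f x w)"
  unfolding chi_of_def X_def fm_def d_snd_dd by simp

lemma chi_F: "m > 0 \<Longrightarrow> chi_of f (x, F (x, m)) = X (x, m)"
  by (simp add: chi_eq f_inv_F)

lemma chi_pos: "chi_of f z > 0"
  using X_pos[OF F_f_inv(2)] chi_eq by (cases z) simp

text \<open>Inverse function theorem for \<open>(x, m) \<mapsto> (x, f (x, m))\<close>. Its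
  derivative is triangular with diagonal entries 1 and \<open>f\<^sub>m > 0\<close>, which gives the
  inverse derivative explicitly; composing with \<open>X\<close> gives
  \<open>\<chi>\<^sub>w = X\<^sub>m / f\<^sub>m\<close>.\<close>

lemma chi_deriv:
  assumes "m > 0"
  shows "(chi_of f) differentiable (at (x, F (x, m)))"
    and "dd UNIV (0, 1) (chi_of f) (x, F (x, m)) = dd pos_dom (0, 1) X (x, m) / fm (x, m)"
proof -
  define \<Phi> where "\<Phi> z = (fst z, F z)" for z :: "(real^'n) \<times> real"
  define \<Psi> where "\<Psi> z = (fst z, f_inv f (fst z) (snd z))" for z :: "(real^'n) \<times> real"
  let ?z = "(x, m)"
  have z: "?z \<in> pos_dom" using assms by simp
  have fm0: "fm ?z \<noteq> 0" using fm_pos[OF assms, of x] by simp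
  have dF: "(F has_derivative (\<lambda>v. dd pos_dom v F ?z)) (at ?z)"
    using dd_has_derivative[OF diff_F[OF z]] at_within_open[OF z open_pos_dom] by simp
  define D where "D v = dd pos_dom (v, 0) F ?z" for v
  have split: "dd pos_dom (v, c) F ?z = D v + c * fm ?z" for v c
  proof -
    have "dd pos_dom ((v, 0) + c *\<^sub>R (0, 1)) F ?z = D v + c * fm ?z"
      unfolding linear_add[OF dd_linear[OF diff_F[OF z]]] linear_scale[OF dd_linear[OF diff_F[OF z]]]
      by (simp add: D_def fm_def)
    then show ?thesis by simp
  qed
  have d\<Psi>: "(\<Psi> has_derivative (\<lambda>v. (fst v, (snd v - D (fst v)) / fm ?z))) (at (\<Phi> ?z))"
  proof (rule has_derivative_inverse_strong[OF open_pos_dom z])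
    show "continuous_on pos_dom \<Phi>" unfolding \<Phi>_def by (intro continuous_intros cont_F)
    show "\<And>x. x \<in> pos_dom \<Longrightarrow> \<Psi> (\<Phi> x) = x" by (auto simp: \<Phi>_def \<Psi>_def f_inv_F)
    show "(\<Phi> has_derivative (\<lambda>v. (fst v, dd pos_dom v F ?z))) (at ?z)"
      unfolding \<Phi>_def by (intro has_derivative_Pair dF has_derivative_fst has_derivative_ident)
    show "(\<lambda>v. (fst v, dd pos_dom v F ?z)) \<circ> (\<lambda>v. (fst v, (snd v - D (fst v)) / fm ?z)) = id"
      using fm0 by (auto simp: fun_eq_iff split)
  qed
  have dX: "(X has_derivative (\<lambda>v. dd pos_dom v X ?z)) (at ?z)"
    using dd_has_derivative[OF X_deriv(1)[OF z]] at_within_open[OF z open_pos_dom] by simp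
  have P: "\<Psi> (\<Phi> ?z) = ?z" using assms by (simp add: \<Phi>_def \<Psi>_def f_inv_F)
  have comp: "((\<lambda>y. X (\<Psi> y)) has_derivative (\<lambda>v. dd pos_dom (fst v, (snd v - D (fst v)) / fm ?z) X ?z)) (at (\<Phi> ?z))"
    using has_derivative_compose[OF d\<Psi>, of X "\<lambda>v. dd pos_dom v X ?z"] dX unfolding P by simp
  have "(\<lambda>y. X (\<Psi> y)) = chi_of f" by (auto simp: \<Psi>_def chi_eq)
  with comp have *: "(chi_of f has_derivative (\<lambda>v. dd pos_dom (fst v, (snd v - D (fst v)) / fm ?z) X ?z)) (at (x, F (x, m)))"
    by (simp add: \<Phi>_def)
  then show "(chi_of f) differentiable (at (x, F (x, m)))" unfolding differentiable_def by blast
  have D0: "D 0 = 0" unfolding D_def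
    using linear_0[OF dd_linear[OF diff_F[OF z]]] by (simp add: zero_prod_def)
  have "dd UNIV (0, 1) (chi_of f) (x, F (x, m)) = dd pos_dom (0, 1 / fm ?z) X ?z"
    using dd_eq[OF thick_open[OF open_UNIV] UNIV_I *] D0 by simp
  then show "dd UNIV (0, 1) (chi_of f) (x, F (x, m)) = dd pos_dom (0, 1) X ?z / fm ?z"
    using dd_split_snd_real[OF X_deriv(1)[OF z], of "1 / fm ?z"] by simp
qed

lemma chi_w_bound: "\<bar>dd UNIV (0, 1) (chi_of f) (x, w)\<bar> \<le> C0"
proof -
  obtain m where m: "m > 0" "F (x, m) = w" using F_ex by blast
  have "\<bar>dd UNIV (0, 1) (chi_of f) (x, F (x, m))\<bar> \<le> C0"
    using assm_F m(1) unfolding assumption_F_def d_snd_dd by blast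
  then show ?thesis using m(2) by (simp only:)
qed

lemma Xm_bound:
  assumes "m > 0" shows "\<bar>dd pos_dom (0, 1) X (x, m)\<bar> \<le> C0 * fm (x, m)"
  using chi_w_bound[of x "F (x, m)"] chi_deriv(2)[OF assms, of x] fm_pos[OF assms, of x]
  by (simp add: pos_divide_le_eq)

lemma chi_DERIV: "((\<lambda>w. chi_of f (x, w)) has_real_derivative dd UNIV (0, 1) (chi_of f) (x, w)) (at w)"
proof -
  obtain m where m: "m > 0" "F (x, m) = w" using F_ex by blast
  have "chi_of f differentiable (at (x, w))" using chi_deriv(1)[OF m(1), of x] m(2) by (simp only:)
  then show ?thesis using dd_line[of "(x, 0)" w "(0, 1)" UNIV "chi_of f"] by simp
qed

text \<open>The bound on \<open>\<chi>\<^sub>w\<close> is integrated from \<open>w = 0\<close>,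
  where the standing convention controls \<open>\<chi>\<close>.\<close>

lemma X_growth:
  assumes "chi_of f (x, 0) \<le> K" "m > 0"
  shows "X (x, m) \<le> K + C0 * \<bar>F (x, m)\<bar>"
proof -
  have "norm (chi_of f (x, F (x, m)) - chi_of f (x, 0)) \<le> C0 * norm (F (x, m) - 0)"
    using chi_DERIV chi_w_bound
    by (intro field_differentiable_bound[where S = UNIV]) auto
  then show ?thesis using assms chi_F[OF assms(2)] by (simp add: abs_if split: if_splits)
qed

text \<open>Three ranges of the density: above \<open>M\<close> the lower limit in (F) applies,
  below \<open>m1\<close> the coupling is less than \<open>- K\<close>, and in between
  \<open>X\<close> is positive and periodic on a compact range of densities.\<close>

lemma X_lower: "\<exists>c>0. \<forall>x. \<forall>m>0. F (x, m) \<ge> - K \<longrightarrow> X (x, m) \<ge> c"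
proof -
  obtain c M where cM: "c > 0" "M > 0" "\<And>x m. m \<ge> M \<Longrightarrow> X (x, m) \<ge> c" using X_ge_large by blast
  obtain m1 where m1: "m1 > 0" "\<And>x. F (x, m1) < - K" using uniform_below below by blast
  have c: "continuous_on (UNIV \<times> {m1..M}) (\<lambda>z. - X z)"
    using m1 by (intro continuous_on_minus continuous_on_subset[OF X_cont]) auto
  have p: "periodic_fst {m1..M} (\<lambda>z. - X z)"
    using periodic_X m1(1) unfolding periodic_fst_def periodic_def by simp
  have *: "\<exists>c'>0. \<forall>x. \<forall>m\<in>{m1..M}. X (x, m) \<ge> c'"
  proof (cases "m1 \<le> M")
    case True
    then have "{m1..M} \<noteq> {}" by simp
    from periodic_fst_attains_max[OF compact_Icc this c p] obtain z where
      z: "z \<in> UNIV \<times> {m1..M}" "\<And>y. y \<in> UNIV \<times> {m1..M} \<Longrightarrow> - X y \<le> - X z" by blast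
    have "X z > 0" using z(1) m1 X_pos[of "snd z" "fst z"] by auto
    moreover have "X (x, m) \<ge> X z" if "m \<in> {m1..M}" for x m using z(2)[of "(x, m)"] that by simp
    ultimately show ?thesis by blast
  qed (auto intro: exI[of _ 1])
  then obtain c' where c': "c' > 0" "\<And>x m. m \<in> {m1..M} \<Longrightarrow> X (x, m) \<ge> c'" by blast
  have "X (x, m) \<ge> min c c'" if "m > 0" "F (x, m) \<ge> - K" for x m
  proof -
    have "m1 \<le> m" using that m1 F_le_iff[of m1 m x] by (meson less_le_trans less_imp_le)
    then show ?thesis using cM(3)[of m x] c'(2)[of m x] by (cases "m \<ge> M") auto
  qed
  then show ?thesis using cM(1) c'(1) by (intro exI[of _ "min c c'"]) auto
qed

lemma fx_bounds:
  assumes "m > 0"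
  shows "\<bar>fx i (x, m)\<bar> \<le> C0 * F_growth \<tau> f (x, m)"
    and "\<bar>dd pos_dom (axis j 1, 0) (fx i) (x, m)\<bar> \<le> C0 * F_growth \<tau> f (x, m)"
    and "m * \<bar>dd pos_dom (0, 1) (fx i) (x, m)\<bar> \<le> C0 * norm (D_fst pos_dom F (x, m))"
    and "norm (D_fst pos_dom F (x, m)) \<le> C0 * F_growth \<tau> f (x, m)"
proof -
  let ?z = "(x, m)"
  have z: "?z \<in> pos_dom" using assms by simp
  have A: "norm (m *\<^sub>R dd pos_dom (0, 1) (D_fst pos_dom F) ?z) \<le> C0 * norm (D_fst pos_dom F ?z)"
    "norm (D_fst pos_dom F ?z) \<le> C0 * F_growth \<tau> f ?z"
    "norm (D_fst pos_dom (D_fst pos_dom F) ?z) \<le> C0 * F_growth \<tau> f ?z"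
    using assm_F assms unfolding assumption_F_def d_snd_dd by blast+
  show "norm (D_fst pos_dom F (x, m)) \<le> C0 * F_growth \<tau> f (x, m)" by (rule A(2))
  show "\<bar>fx i (x, m)\<bar> \<le> C0 * F_growth \<tau> f (x, m)"
    using component_le_norm_cart[of "D_fst pos_dom F ?z" i] A(2) by (simp add: D_fst_F_nth)
  have "\<bar>(D_fst pos_dom (D_fst pos_dom F) ?z $ j) $ i\<bar> \<le> norm (D_fst pos_dom (D_fst pos_dom F) ?z)"
    by (rule order_trans[OF component_le_norm_cart Finite_Cartesian_Product.norm_nth_le])
  then show "\<bar>dd pos_dom (axis j 1, 0) (fx i) (x, m)\<bar> \<le> C0 * F_growth \<tau> f (x, m)"
    using A(3) D_fst_F_deriv[OF z, of "(axis j 1, 0)" i] D_fst_nth[of pos_dom "D_fst pos_dom F" ?z j] by simp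
  have "\<bar>(m *\<^sub>R dd pos_dom (0, 1) (D_fst pos_dom F) ?z) $ i\<bar> \<le> norm (m *\<^sub>R dd pos_dom (0, 1) (D_fst pos_dom F) ?z)"
    by (rule component_le_norm_cart)
  then show "m * \<bar>dd pos_dom (0, 1) (fx i) (x, m)\<bar> \<le> C0 * norm (D_fst pos_dom F (x, m))"
    using A(1) D_fst_F_deriv[OF z, of "(0, 1)" i] assms
    by (simp add: abs_mult del: norm_scaleR)
qed

lemma Ck_norm1_finite:
  fixes G :: "(real^'n) \<times> real \<Rightarrow> 'b::real_normed_vector"
  assumes G: "Ck_on 1 pos_dom G" "periodic_fst {0<..} G" and K: "K > 0"
  shows "Ck_norm 1 pos_dom (UNIV \<times> {1/K..K}) G < \<infinity>"
proof -
  have sub: "{1/K..K} \<subseteq> {0<..}" using K by (auto intro: less_le_trans[of 0 "1/K"])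
  have b: "\<exists>M. \<forall>z\<in>UNIV \<times> {1/K..K}. norm (E z) \<le> M"
    if "continuous_on pos_dom E" "periodic_fst {0<..} E" for E :: "(real^'n) \<times> real \<Rightarrow> 'b"
  proof -
    have "continuous_on (UNIV \<times> {1/K..K}) E" using that(1) sub by (auto intro: continuous_on_subset simp: pos_dom_def)
    from periodic_fst_bounded[OF compact_Icc this periodic_fst_subset[OF that(2) sub]]
    show ?thesis by metis
  qed
  have G': "Ck_on (Suc 0) pos_dom G" using G(1) by simp
  have dG: "G differentiable_on (UNIV \<times> {0<..})" using G' by (simp add: Ck_on_Suc_iff pos_dom_def)
  have "\<exists>M. \<forall>z\<in>UNIV \<times> {1/K..K}. norm (dd pos_dom v G z) \<le> M" for v
    using dd_continuous[OF thick_pos_dom G'] periodic_fst_dd[OF thick_pos_dom[unfolded pos_dom_alt] G(2) dG]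
    unfolding pos_dom_alt by (rule b[unfolded pos_dom_alt])
  then obtain M where M: "\<And>v z. z \<in> UNIV \<times> {1/K..K} \<Longrightarrow> norm (dd pos_dom v G z) \<le> M v" by metis
  obtain M0 where M0: "\<And>z. z \<in> UNIV \<times> {1/K..K} \<Longrightarrow> norm (G z) \<le> M0"
    using b[OF Ck_on_continuous[OF G'] G(2)] by blast
  have "C0_norm (UNIV \<times> {1/K..K}) (\<lambda>z. sqrt (deriv_norm_sq 0 pos_dom G z)) < \<infinity>"
    using M0 by (intro C0_norm_finite[of _ _ M0]) auto
  moreover have "C0_norm (UNIV \<times> {1/K..K}) (\<lambda>z. sqrt (deriv_norm_sq 1 pos_dom G z)) < \<infinity>"
  proof (rule C0_norm_finite)
    fix z :: "(real^'n) \<times> real" assume z: "z \<in> UNIV \<times> {1/K..K}"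
    have "deriv_norm_sq 1 pos_dom G z = (\<Sum>b\<in>Basis. (norm (dd pos_dom b G z))\<^sup>2)"
      by (simp add: dd_def)
    also have "\<dots> \<le> (\<Sum>b\<in>Basis. (M b)\<^sup>2)" using M[OF z] by (intro sum_mono power_mono) auto
    finally show "norm (sqrt (deriv_norm_sq 1 pos_dom G z)) \<le> sqrt (\<Sum>b\<in>Basis. (M b)\<^sup>2)"
      by (simp add: sum_nonneg)
  qed
  ultimately show ?thesis unfolding Ck_norm_def by (simp add: ennreal_add_eq_top less_top)
qed

lemma h_w_bound:
  assumes "chi_of f (x, w) \<ge> c" "c > 0"
  shows "\<bar>d_snd UNIV (h_of f) (x, w)\<bar> \<le> C0 / (2 * sqrt c)"
proof -
  obtain m where m: "m > 0" "F (x, m) = w" using F_ex by blast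
  have d: "chi_of f differentiable (at (x, w))" using chi_deriv(1)[OF m(1), of x] m(2) by (simp only:)
  have pos: "chi_of f (x, w) > 0" using chi_pos .
  have "((\<lambda>z. sqrt (chi_of f z)) has_derivative (\<lambda>v. dd UNIV v (chi_of f) (x, w) * (inverse (sqrt (chi_of f (x, w))) / 2))) (at (x, w))"
    by (rule DERIV_compose_FDERIV[OF DERIV_real_sqrt[OF pos] dd_has_derivative[OF d]])
  then have *: "(h_of f has_derivative (\<lambda>v. dd UNIV v (chi_of f) (x, w) * (inverse (sqrt (chi_of f (x, w))) / 2))) (at (x, w))"
    by (simp only: h_of_def[abs_def])
  have "d_snd UNIV (h_of f) (x, w) = dd UNIV (0, 1) (chi_of f) (x, w) * (inverse (sqrt (chi_of f (x, w))) / 2)"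
    unfolding d_snd_dd by (rule dd_eq[OF thick_open[OF open_UNIV] UNIV_I *])
  also have "\<dots> = dd UNIV (0, 1) (chi_of f) (x, w) / (2 * sqrt (chi_of f (x, w)))"
    by (simp only: divide_inverse inverse_mult_distrib mult.commute[of "inverse 2"])
  finally have "\<bar>d_snd UNIV (h_of f) (x, w)\<bar> = \<bar>dd UNIV (0, 1) (chi_of f) (x, w)\<bar> / (2 * sqrt (chi_of f (x, w)))"
    using real_sqrt_gt_zero[OF pos] by (simp only: abs_divide abs_mult abs_numeral abs_of_pos)
  also have "\<dots> \<le> C0 / (2 * sqrt c)"
    by (rule frac_le) (use chi_w_bound[of x w] assms in \<open>auto intro: order_trans[OF abs_ge_zero]\<close>)
  finally show ?thesis .
qed

text \<open>\<open>enn2real\<close> sends infinity to 0, so the final constant \<open>K\<close>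
  expresses the norm \<open>beta\<close> only because this norm is finite.\<close>

lemma beta_finite:
  assumes g: "regular_coupling g" and K: "K > 0"
  shows "beta f g K < \<infinity>"
proof -
  interpret g: coupling g by unfold_locales (rule g)
  obtain c where c: "c > 0" "\<And>x m. m > 0 \<Longrightarrow> F (x, m) \<ge> - K \<Longrightarrow> X (x, m) \<ge> c"
    using X_lower[of K] by blast
  have chi_c: "chi_of f (x, w) \<ge> c" if "w \<ge> - K" for x w
    using c(2)[OF F_f_inv(2)[of x w], of x] F_f_inv(1)[of x w] that chi_eq by simp
  have 1: "Ck_norm 1 pos_dom (UNIV \<times> {1/K..K}) F < \<infinity>"
    by (rule Ck_norm1_finite[OF Ck_F periodic_F K]) auto
  have "(\<lambda>z. D_fst pos_dom g.F z $ i) = g.fx i" for i by (auto simp: g.D_fst_F_nth)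
  then have comp: "Ck_on 3 pos_dom (\<lambda>z. D_fst pos_dom g.F z $ i)" for i using g.Ck_fx by simp
  have "Ck_on 1 pos_dom (D_fst pos_dom g.F)"
  proof -
    have d: "D_fst pos_dom g.F differentiable (at z within pos_dom)" if "z \<in> pos_dom" for z
      using differentiable_vec(2)[of "D_fst pos_dom g.F"] g.diff_fx[OF that] by (simp add: g.D_fst_F_nth)
    have "dd pos_dom b (D_fst pos_dom g.F) z = (\<chi> i. dd pos_dom b (g.fx i) z)" if "z \<in> pos_dom" for b z
      using g.D_fst_F_deriv[OF that] by (simp add: vec_eq_iff)
    moreover have "continuous_on pos_dom (\<lambda>z. \<chi> i. dd pos_dom b (g.fx i) z)" for b
      using dd_continuous[OF thick_pos_dom, of 2 "g.fx i" for i] g.Ck_fx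
      by (intro continuous_on_vec_lambda) (simp add: eval_nat_numeral)
    ultimately have "continuous_on pos_dom (dd pos_dom b (D_fst pos_dom g.F))" for b
      using continuous_on_cong by (metis (no_types, lifting))
    then show ?thesis using d by (simp add: Ck_on_Suc_iff differentiable_on_def)
  qed
  moreover have "periodic_fst {0<..} (D_fst pos_dom g.F)"
    using g.periodic_fx unfolding periodic_fst_def periodic_def by (simp add: vec_eq_iff g.D_fst_F_nth)
  ultimately have 2: "Ck_norm 1 pos_dom (UNIV \<times> {1/K..K}) (D_fst pos_dom g.F) < \<infinity>"
    using Ck_norm1_finite K by blast
  have 3: "C0_norm (UNIV \<times> {-K..}) (\<lambda>z. 1 / chi_of f z) < \<infinity>"
    using chi_c c(1) by (intro C0_norm_finite[of _ _ "1 / c"]) (auto intro!: frac_le simp: less_imp_le[OF chi_pos])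
  have 4: "C0_norm (UNIV \<times> {-K..}) (d_snd UNIV (h_of f)) < \<infinity>"
    using h_w_bound chi_c c(1) by (intro C0_norm_finite[of _ _ "C0 / (2 * sqrt c)"]) auto
  show ?thesis unfolding beta_def using 1 2 3 4 by (simp add: ennreal_add_eq_top less_top)
qed

lemma Ck_norm1_bounds:
  assumes "Ck_norm 1 S A G \<le> ennreal B" "B \<ge> 0" "z \<in> A"
  shows "norm (G z) \<le> B" and "b \<in> Basis \<Longrightarrow> norm (dd S b G z) \<le> B"
proof -
  let ?a = "C0_norm A (\<lambda>z. sqrt (deriv_norm_sq 0 S G z))" and ?b = "C0_norm A (\<lambda>z. sqrt (deriv_norm_sq 1 S G z))"
  have "?a + ?b \<le> ennreal B"
    using assms(1) unfolding Ck_norm_def One_nat_def sum.atMost_Suc by simp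
  moreover have "a \<le> a + b" "b \<le> a + b" for a b :: ennreal by (simp_all add: add_increasing add_increasing2)
  ultimately have ab: "?a \<le> ennreal B" "?b \<le> ennreal B" using order_trans by blast+
  have *: "norm (sqrt (deriv_norm_sq 0 S G z)) \<le> B" "norm (sqrt (deriv_norm_sq 1 S G z)) \<le> B"
    by (rule C0_norm_bound[OF ab(1) assms(3,2)], rule C0_norm_bound[OF ab(2) assms(3,2)])
  show "norm (G z) \<le> B" using *(1) by simp
  assume b: "b \<in> Basis"
  have "(norm (dd S b G z))\<^sup>2 \<le> (\<Sum>b\<in>Basis. (norm (dd S b G z))\<^sup>2)"
    using b by (intro member_le_sum) auto
  also have "\<dots> = deriv_norm_sq 1 S G z" by (simp add: dd_def)
  finally have "norm (dd S b G z) \<le> sqrt (deriv_norm_sq 1 S G z)" by (simp add: real_le_rsqrt)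
  then show "norm (dd S b G z) \<le> B" using *(2) by simp
qed

lemma beta_bounds:
  assumes g: "regular_coupling g" and K: "K > 0" and B: "B = enn2real (beta f g K)"
  shows "\<And>x m. m \<in> {1/K..K} \<Longrightarrow> \<bar>F (x, m)\<bar> \<le> B"
    and "\<And>x m. m \<in> {1/K..K} \<Longrightarrow> norm (D_fst pos_dom (re g) (x, m)) \<le> B"
    and "\<And>x m. m > 0 \<Longrightarrow> F (x, m) \<ge> - K \<Longrightarrow> 1 / X (x, m) \<le> B"
    and "B \<ge> 0"
proof -
  show B0: "B \<ge> 0" by (simp add: B)
  have eq: "beta f g K = ennreal B" using beta_finite[OF g K] by (simp add: B less_top)
  have le: "a \<le> a + b + c + d" "b \<le> a + b + c + d" "c \<le> a + b + c + d" for a b c d :: ennreal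
    by (simp_all add: add_increasing add_increasing2 add.assoc)
  have 1: "Ck_norm 1 pos_dom (UNIV \<times> {1/K..K}) F \<le> ennreal B"
    and 2: "Ck_norm 1 pos_dom (UNIV \<times> {1/K..K}) (D_fst pos_dom (re g)) \<le> ennreal B"
    and 3: "C0_norm (UNIV \<times> {-K..}) (\<lambda>z. 1 / chi_of f z) \<le> ennreal B"
    unfolding eq[symmetric] beta_def by (rule le)+
  show "\<bar>F (x, m)\<bar> \<le> B" if "m \<in> {1/K..K}" for x m
    using Ck_norm1_bounds(1)[OF 1 B0, of "(x, m)"] that by simp
  show "norm (D_fst pos_dom (re g) (x, m)) \<le> B" if "m \<in> {1/K..K}" for x m
    using Ck_norm1_bounds(1)[OF 2 B0, of "(x, m)"] that by simp
  show "1 / X (x, m) \<le> B" if "m > 0" "F (x, m) \<ge> - K" for x m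
  proof -
    have "norm (1 / chi_of f (x, F (x, m))) \<le> B" using that by (intro C0_norm_bound[OF 3 _ B0]) simp
    then have "\<bar>1 / X (x, m)\<bar> \<le> B" unfolding chi_F[OF that(1)] real_norm_def .
    then show ?thesis by (rule abs_le_D1)
  qed
qed

end

section \<open>The elliptic equation for the value function\<close>

lemma eq_at_endpoint:
  fixes \<phi> \<psi> :: "real \<Rightarrow> 'b::t2_space"
  assumes "T > 0" "continuous_on {0..T} \<phi>" "continuous_on {0..T} \<psi>"
    and "\<And>t. 0 < t \<Longrightarrow> t < T \<Longrightarrow> \<phi> t = \<psi> t" and s: "s \<in> {0..T}"
  shows "\<phi> s = \<psi> s"
proof -
  have sub: "{0<..<T} \<subseteq> {0..T}" by auto
  have "s \<in> closure {0<..<T}" using s assms(1) by simp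
  then have nt: "at s within {0<..<T} \<noteq> bot \<or> s \<in> {0<..<T}"
    by (metis closure_def Un_iff islimpt_def mem_Collect_eq trivial_limit_within)
  have "(\<phi> \<longlongrightarrow> \<phi> s) (at s within {0<..<T})" "(\<psi> \<longlongrightarrow> \<psi> s) (at s within {0<..<T})"
    using assms(2,3) s sub unfolding continuous_on_def by (meson tendsto_within_subset)+
  moreover have "\<forall>\<^sub>F t in at s within {0<..<T}. \<phi> t = \<psi> t"
    unfolding eventually_at_filter using assms(4) by simp
  ultimately have *: "(\<phi> \<longlongrightarrow> \<phi> s) (at s within {0<..<T})" "(\<phi> \<longlongrightarrow> \<psi> s) (at s within {0<..<T})"
    using tendsto_cong by blast+
  show ?thesis
  proof (cases "s \<in> {0<..<T}")
    case True then show ?thesis using assms(4) by simp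
  next
    case False
    then show ?thesis using nt tendsto_unique[OF _ *] by blast
  qed
qed

lemma dd_matrix_nth:
  fixes A :: "'a::euclidean_space \<Rightarrow> real^'k^'j"
  assumes S: "thick S" "z \<in> S" and d: "\<And>i k. (\<lambda>y. A y $ i $ k) differentiable (at z within S)"
  shows "dd S v A z $ i $ k = dd S v (\<lambda>y. A y $ i $ k) z"
proof -
  have "(\<lambda>y. A y $ i) differentiable (at z within S)" for i
    by (rule differentiable_vec(2)) (rule d)
  from dd_vec_nth[OF S this] show ?thesis using dd_vec_nth[OF S, of "\<lambda>y. A y $ i", OF d] by simp
qed

lemma nth_le_norm3: "\<bar>(A :: real^'k^'j^'i) $ i $ j $ k\<bar> \<le> norm A"
  by (rule order_trans[OF component_le_norm_cart order_trans[OF Finite_Cartesian_Product.norm_nth_le Finite_Cartesian_Product.norm_nth_le]])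

lemma nth_le_norm2: "\<bar>(A :: real^'k^'j) $ i $ j\<bar> \<le> norm A"
  by (rule order_trans[OF component_le_norm_cart Finite_Cartesian_Product.norm_nth_le])

text \<open>The product rule for the elliptic expression along a line, with every coefficient
  replaced by an abstract function of one real variable so that the differentiation rules apply by
  shape. The mixed term is subtracted twice instead of carrying the factor 2.\<close>

lemma elliptic_curve_deriv:
  fixes a x :: "real \<Rightarrow> real" and r b q y k :: "'i::finite \<Rightarrow> real \<Rightarrow> real" and S P :: "'i \<Rightarrow> 'i \<Rightarrow> real \<Rightarrow> real"
  assumes "(a has_real_derivative a') (at 0)" "\<And>i. (r i has_real_derivative r' i) (at 0)"
    "\<And>i. (b i has_real_derivative b' i) (at 0)" "\<And>i. (q i has_real_derivative q' i) (at 0)"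
    "\<And>i. (y i has_real_derivative y' i) (at 0)" "\<And>i. (k i has_real_derivative k' i) (at 0)"
    "\<And>i j. (S i j has_real_derivative S' i j) (at 0)" "\<And>i j. (P i j has_real_derivative P' i j) (at 0)"
    "(x has_real_derivative x') (at 0)"
  shows "((\<lambda>s. a s - (\<Sum>i\<in>UNIV. b i s * r i s) - (\<Sum>i\<in>UNIV. b i s * r i s)
      + (\<Sum>i\<in>UNIV. \<Sum>j\<in>UNIV. b i s * b j s * S i j s) + (\<Sum>i\<in>UNIV. b i s * (q i s - y i s))
      + x s * (\<Sum>i\<in>UNIV. k i s + (\<Sum>j\<in>UNIV. S i j s * P j i s))) has_real_derivative
     (a' - (\<Sum>i\<in>UNIV. b' i * r i 0 + r' i * b i 0) - (\<Sum>i\<in>UNIV. b' i * r i 0 + r' i * b i 0)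
      + (\<Sum>i\<in>UNIV. \<Sum>j\<in>UNIV. (b' i * b j 0 + b' j * b i 0) * S i j 0 + S' i j * (b i 0 * b j 0))
      + (\<Sum>i\<in>UNIV. b' i * (q i 0 - y i 0) + (q' i - y' i) * b i 0)
      + (x' * (\<Sum>i\<in>UNIV. k i 0 + (\<Sum>j\<in>UNIV. S i j 0 * P j i 0))
       + (\<Sum>i\<in>UNIV. k' i + (\<Sum>j\<in>UNIV. S' i j * P j i 0 + P' j i * S i j 0)) * x 0))) (at 0)"
  by (intro DERIV_add DERIV_diff DERIV_sum DERIV_mult assms)

section \<open>The solution on the closed cylinder: positivity of the density and the elliptic
  equation\<close>

locale mfg = coupling_F f C0 \<tau> + g: coupling g
  for f :: "'n::finite coupling" and C0 \<tau> :: real and g :: "'n coupling" +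
  fixes T :: real and H :: "'n hamiltonian" and m0 :: "real^'n \<Rightarrow> real"
    and u m :: "(real^'n) \<times> real \<Rightarrow> real"
  assumes C0_pos: "C0 > 0" and tau: "0 \<le> \<tau>" "\<tau> < 1" and T_pos: "T > 0"
    and assm_M: "assumption_M m0" and assm_H: "assumption_H C0 \<tau> H"
    and assm_G: "assumption_G g" and conv: "C0_convention C0 \<tau> H f m0"
    and sol: "MFG_solution T H f g m0 u m"
begin

abbreviation Q :: "((real^'n) \<times> real) set" where "Q \<equiv> QT_closure T"
abbreviation ex :: "'n \<Rightarrow> (real^'n) \<times> real" where "ex i \<equiv> (axis i 1, 0)"
abbreviation et :: "(real^'n) \<times> real" where "et \<equiv> (0, 1)"

definition HX :: "'n \<Rightarrow> (real^'n) \<times> (real^'n) \<Rightarrow> real" where "HX i = dd UNIV (axis i 1, 0) H"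
definition HP :: "'n \<Rightarrow> (real^'n) \<times> (real^'n) \<Rightarrow> real" where "HP k = dd UNIV (0, axis k 1) H"
definition HXX :: "'n \<Rightarrow> 'n \<Rightarrow> (real^'n) \<times> (real^'n) \<Rightarrow> real" where "HXX i j = dd UNIV (axis i 1, 0) (HX j)"
definition HXP :: "'n \<Rightarrow> 'n \<Rightarrow> (real^'n) \<times> (real^'n) \<Rightarrow> real" where "HXP i k = dd UNIV (axis i 1, 0) (HP k)"
definition HPP :: "'n \<Rightarrow> 'n \<Rightarrow> (real^'n) \<times> (real^'n) \<Rightarrow> real" where "HPP i k = dd UNIV (0, axis i 1) (HP k)"

definition p :: "(real^'n) \<times> real \<Rightarrow> real^'n" where "p z = D_fst Q u z"
definition ut :: "(real^'n) \<times> real \<Rightarrow> real" where "ut = dd Q et u"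
definition zp :: "(real^'n) \<times> real \<Rightarrow> (real^'n) \<times> (real^'n)" where "zp z = (fst z, p z)"
definition mz :: "(real^'n) \<times> real \<Rightarrow> (real^'n) \<times> real" where "mz z = (fst z, m z)"
definition hh :: "(real^'n) \<times> real \<Rightarrow> real" where "hh z = H (zp z)"
definition ww :: "(real^'n) \<times> real \<Rightarrow> real" where "ww z = F (mz z)"
definition U2 :: "(real^'n) \<times> real \<Rightarrow> (real^'n) \<times> real \<Rightarrow> (real^'n) \<times> real \<Rightarrow> real"
  where "U2 a b = dd Q a (dd Q b u)"
definition bb :: "'n \<Rightarrow> (real^'n) \<times> real \<Rightarrow> real" where "bb k z = HP k (zp z)"

lemma thickQ: "thick Q" using thick_QT[OF T_pos] .
lemma thickU: "thick (UNIV :: 'a::euclidean_space set)" by (rule thick_open[OF open_UNIV])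

lemma mem_Q: "(x, t) \<in> Q \<longleftrightarrow> 0 \<le> t \<and> t \<le> T" by (simp add: QT_closure_def)

lemma interior_Q: "interior Q = UNIV \<times> {0<..<T}"
  by (simp add: QT_closure_def interior_Times)

lemma mem_I: "(x, t) \<in> interior Q \<longleftrightarrow> 0 < t \<and> t < T" by (simp add: interior_Q)

lemma I_sub: "z \<in> interior Q \<Longrightarrow> z \<in> Q" using interior_subset by blast

lemma Ck_u: "Ck_on 3 Q u" and Ck_m: "Ck_on 2 Q m"
  using sol unfolding MFG_solution_def Let_def by simp_all

lemma Ck_H: "Ck_on 4 UNIV H" using assm_H by (simp add: assumption_H_def)

lemma Ck_du: "Ck_on 2 Q (dd Q v u)"
  using Ck_on_dd[OF thickQ, of 2 u v] Ck_u by (simp add: eval_nat_numeral)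

lemma Ck_ddu: "Ck_on 1 Q (U2 a v)"
  unfolding U2_def using Ck_on_dd[OF thickQ, of 1 "dd Q v u" a] Ck_du[of v] by (simp add: eval_nat_numeral)

lemma Ck_ut: "Ck_on 2 Q ut" unfolding ut_def by (rule Ck_du)

lemma diff_u: "z \<in> Q \<Longrightarrow> u differentiable (at z within Q)"
  using Ck_u Ck_on_differentiable[of 2 Q u z] by (simp add: eval_nat_numeral)
lemma diff_du: "z \<in> Q \<Longrightarrow> dd Q v u differentiable (at z within Q)"
  using Ck_du[of v] Ck_on_differentiable[of 1 Q "dd Q v u" z] by (simp add: eval_nat_numeral)
lemma diff_ut: "z \<in> Q \<Longrightarrow> ut differentiable (at z within Q)"
  unfolding ut_def by (rule diff_du)
lemma diff_ddu: "z \<in> Q \<Longrightarrow> U2 a v differentiable (at z within Q)"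
  using Ck_ddu[of a v] Ck_on_differentiable[of 0 Q "U2 a v" z] by simp
lemma diff_m: "z \<in> Q \<Longrightarrow> m differentiable (at z within Q)"
  using Ck_m Ck_on_differentiable[of 1 Q m z] by (simp add: eval_nat_numeral)

lemma Ck_HX: "Ck_on 3 UNIV (HX i)" and Ck_HP: "Ck_on 3 UNIV (HP i)"
  unfolding HX_def HP_def using Ck_on_dd[OF thickU, of 3 H] Ck_H by (simp_all add: eval_nat_numeral)
lemma Ck_HXP: "Ck_on 2 UNIV (HXP i j)" and Ck_HPP: "Ck_on 2 UNIV (HPP i j)"
  unfolding HXP_def HPP_def
  using Ck_on_dd[OF thickU, of 2 "HP j"] Ck_HP by (simp_all add: eval_nat_numeral)

lemma Ck1_diff: "Ck_on (Suc k) UNIV G \<Longrightarrow> G differentiable (at z)"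
  using Ck_on_differentiable[of k UNIV G z] by simp

lemma diff_H: "H differentiable (at z)" using Ck1_diff[of 3 H z] Ck_H by (simp add: eval_nat_numeral)
lemma diff_HX: "HX i differentiable (at z)" using Ck1_diff[of 2 "HX i" z] Ck_HX by (simp add: eval_nat_numeral)
lemma diff_HP: "HP i differentiable (at z)" using Ck1_diff[of 2 "HP i" z] Ck_HP by (simp add: eval_nat_numeral)
lemma diff_HXP: "HXP i j differentiable (at z)" using Ck1_diff[of 1 "HXP i j" z] Ck_HXP by (simp add: eval_nat_numeral)
lemma diff_HPP: "HPP i j differentiable (at z)" using Ck1_diff[of 1 "HPP i j" z] Ck_HPP by (simp add: eval_nat_numeral)

lemma H_commute: "Ck_on 2 UNIV G \<Longrightarrow> dd UNIV a (dd UNIV b G) z = dd UNIV b (dd UNIV a G) (z :: (real^'n) \<times> (real^'n))" for G :: "_ \<Rightarrow> real"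
  by (rule dd_commute[OF thickU]) auto

lemma HPP_sym: "HPP i k z = HPP k i z"
  unfolding HPP_def HP_def by (rule H_commute) (rule Ck_on_mono[OF Ck_H], simp)

lemma HPX: "dd UNIV (0, axis l 1) (HX k) z = HXP k l z"
  unfolding HXP_def HP_def HX_def by (rule H_commute) (rule Ck_on_mono[OF Ck_H], simp)

lemma HPXP: "dd UNIV (0, axis l 1) (HXP j k) z = dd UNIV (axis j 1, 0) (HPP l k) z"
  unfolding HXP_def HPP_def by (rule H_commute) (rule Ck_on_mono[OF Ck_HP], simp)

lemma p_nth: "p z $ k = dd Q (ex k) u z" by (simp add: p_def D_fst_nth)

lemma diff_p: "z \<in> Q \<Longrightarrow> p differentiable (at z within Q)"
  by (rule differentiable_vec(2)) (simp add: p_nth diff_du)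

lemma dd_p: "z \<in> Q \<Longrightarrow> dd Q v p z $ k = U2 v (ex k) z"
  using dd_vec_nth[OF thickQ, of z p v k] diff_du by (simp add: p_nth U2_def)

lemma comp_zp:
  fixes G :: "(real^'n) \<times> (real^'n) \<Rightarrow> real"
  assumes z: "z \<in> Q" and G: "G differentiable (at (zp z))"
  shows "(\<lambda>y. G (zp y)) differentiable (at z within Q)"
    and "dd Q v (\<lambda>y. G (zp y)) z = (\<Sum>i\<in>UNIV. fst v $ i * dd UNIV (axis i 1, 0) G (zp z))
      + (\<Sum>k\<in>UNIV. U2 v (ex k) z * dd UNIV (0, axis k 1) G (zp z))"
proof -
  have G': "G differentiable (at (fst z, p z) within UNIV)" using G by (simp add: zp_def)
  note C = dd_compose_fst[OF thickQ z open_UNIV UNIV_I G' diff_p[OF z], folded zp_def]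
  show "(\<lambda>y. G (zp y)) differentiable (at z within Q)" by (rule C(1))
  show "dd Q v (\<lambda>y. G (zp y)) z = (\<Sum>i\<in>UNIV. fst v $ i * dd UNIV (axis i 1, 0) G (zp z))
      + (\<Sum>k\<in>UNIV. U2 v (ex k) z * dd UNIV (0, axis k 1) G (zp z))"
    unfolding C(2) dd_split_fst[OF G, of "fst v" "dd Q v p z"] dd_split_snd_vec[OF G, of "dd Q v p z"] using dd_p[OF z] by simp
qed

lemma comp_mz:
  fixes G :: "(real^'n) \<times> real \<Rightarrow> real"
  assumes z: "z \<in> Q" "m z > 0" and G: "G differentiable (at (mz z) within pos_dom)"
  shows "(\<lambda>y. G (mz y)) differentiable (at z within Q)"
    and "dd Q v (\<lambda>y. G (mz y)) z = (\<Sum>i\<in>UNIV. fst v $ i * dd pos_dom (axis i 1, 0) G (mz z))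
      + dd Q v m z * dd pos_dom (0, 1) G (mz z)"
proof -
  have G': "G differentiable (at (fst z, m z) within pos_dom)" using G by (simp add: mz_def)
  have mem: "(fst z, m z) \<in> pos_dom" using z by simp
  note C = dd_compose_fst[OF thickQ z(1) open_pos_dom mem G' diff_m[OF z(1)], folded mz_def]
  show "(\<lambda>y. G (mz y)) differentiable (at z within Q)" by (rule C(1))
  show "dd Q v (\<lambda>y. G (mz y)) z = (\<Sum>i\<in>UNIV. fst v $ i * dd pos_dom (axis i 1, 0) G (mz z))
      + dd Q v m z * dd pos_dom (0, 1) G (mz z)"
    unfolding C(2) dd_split_fst[OF G, of "fst v" "dd Q v m z"] dd_split_snd_real[OF G, of "dd Q v m z"] ..
qed

lemma zp_cont: "continuous_on Q zp"
proof -
  have "continuous (at z within Q) p" if "z \<in> Q" for z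
    by (rule differentiable_imp_continuous_within[OF diff_p[OF that]])
  then have "continuous_on Q p" by (simp add: continuous_on_eq_continuous_within)
  then show ?thesis unfolding zp_def[abs_def] by (intro continuous_intros)
qed

lemma cont_comp_zp: "continuous_on UNIV G \<Longrightarrow> continuous_on Q (\<lambda>z. G (zp z))"
  by (rule continuous_on_compose2[OF _ zp_cont]) auto

text \<open>The system is posed for times strictly between 0 and \<open>T\<close>; identities
  between continuous quantities reach the two ends along the time lines.\<close>

lemma eq_on_Q:
  fixes A B :: "(real^'n) \<times> real \<Rightarrow> 'b::t2_space"
  assumes A: "continuous_on Q A" and B: "continuous_on Q B" and eq: "\<And>z. z \<in> interior Q \<Longrightarrow> A z = B z" and z: "z \<in> Q"
  shows "A z = B z"
proof -
  obtain x s where xs: "z = (x, s)" by force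
  have s: "s \<in> {0..T}" using z by (simp add: xs mem_Q)
  have c: "continuous_on {0..T} (\<lambda>t. (x, t))" by (intro continuous_intros)
  have im: "(\<lambda>t. (x, t)) ` {0..T} \<subseteq> Q" by (auto simp: mem_Q)
  have "continuous_on {0..T} (\<lambda>t. A (x, t))" "continuous_on {0..T} (\<lambda>t. B (x, t))"
    using continuous_on_compose2[OF A c im] continuous_on_compose2[OF B c im] .
  from eq_at_endpoint[OF T_pos this _ s] eq show ?thesis unfolding xs by (simp add: mem_I)
qed

lemma cont_u: "continuous_on Q u" using Ck_on_continuous[OF Ck_u] .
lemma cont_m: "continuous_on Q m" using Ck_on_continuous[OF Ck_m] .
lemma cont_ut: "continuous_on Q ut" using Ck_on_continuous[OF Ck_ut] .
lemma cont_U2: "continuous_on Q (U2 a b)" using Ck_on_continuous[OF Ck_ddu] .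
lemma cont_H: "continuous_on UNIV H" using Ck_on_continuous[OF Ck_H] .
lemma cont_hh: "continuous_on Q hh" unfolding hh_def[abs_def] by (rule cont_comp_zp[OF cont_H])
lemma cont_mz: "continuous_on Q mz" unfolding mz_def[abs_def] by (intro continuous_intros cont_m)

lemma U2_sym: assumes "z \<in> Q" shows "U2 a b z = U2 b a z"
proof (rule eq_on_Q[OF cont_U2 cont_U2 _ assms])
  fix y assume y: "y \<in> interior Q"
  show "U2 a b y = U2 b a y" unfolding U2_def
    by (rule dd_commute[OF thickQ y]) (rule Ck_on_mono[OF Ck_u], simp)
qed

lemma U3_sym: assumes z: "z \<in> interior Q" shows "dd Q a (U2 b c) z = dd Q b (U2 a c) z"
  unfolding U2_def by (rule dd_commute[OF thickQ z Ck_du])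

lemma U3_sym': assumes z: "z \<in> Q" shows "dd Q a (U2 b c) z = dd Q a (U2 c b) z"
  by (rule dd_cong(1)[OF thickQ z U2_sym diff_ddu[OF z]])

lemma m_nonneg: "z \<in> Q \<Longrightarrow> m z \<ge> 0"
  using sol unfolding MFG_solution_def Let_def by blast

lemma HJ_interior:
  assumes "z \<in> interior Q"
  shows "ereal (hh z - ut z) = f (mz z)"
proof -
  obtain x t where xt: "z = (x, t)" by force
  have "t \<in> {0<..<T}" using assms by (simp add: xt mem_I)
  then have "ereal (- d_snd Q u (x, t) + H (x, D_fst Q u (x, t))) = f (x, m (x, t))"
    using sol unfolding MFG_solution_def Let_def by blast
  then show ?thesis by (simp add: xt hh_def zp_def p_def ut_def mz_def d_snd_dd add.commute)
qed

lemma HJ_ereal: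
  assumes "z \<in> Q"
  shows "ereal (hh z - ut z) = f (mz z)"
proof (rule eq_on_Q[OF _ _ HJ_interior assms])
  show "continuous_on Q (\<lambda>z. ereal (hh z - ut z))"
    by (intro continuous_on_ereal continuous_on_diff cont_hh cont_ut)
  have "continuous_on nonneg_dom f" using regular by (simp add: regular_coupling_def)
  then show "continuous_on Q (\<lambda>z. f (mz z))"
    by (rule continuous_on_compose2[OF _ cont_mz]) (auto simp: mz_def nonneg_dom_def m_nonneg)
qed

text \<open>At a zero of \<open>m\<close> the coupling would be minus infinity by (SE), whereas the
  Hamilton-Jacobi equation, extended to the closed cylinder, equates it with a real number.\<close>

lemma m_pos: assumes "z \<in> Q" shows "m z > 0"
proof (rule ccontr)
  assume "\<not> m z > 0"
  then have "m z = 0" using m_nonneg[OF assms] by simp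
  then have "f (mz z) = - \<infinity>" using SE by (simp add: mz_def assumption_SE_def)
  then show False using HJ_ereal[OF assms] by simp
qed

lemma mz_pos: "z \<in> Q \<Longrightarrow> mz z \<in> pos_dom" using m_pos by (simp add: mz_def)

lemma ww_eq: assumes "z \<in> Q" shows "ww z = hh z - ut z"
proof -
  have "ereal (ww z) = f (mz z)"
    unfolding ww_def mz_def by (rule f_eq[OF m_pos[OF assms], symmetric])
  then have "ereal (ww z) = ereal (hh z - ut z)" using HJ_ereal[OF assms] by (simp only:)
  then show ?thesis by (simp only: ereal.inject)
qed

lemma hh_deriv:
  assumes z: "z \<in> Q"
  shows "hh differentiable (at z within Q)"
    and "dd Q v hh z = (\<Sum>i\<in>UNIV. fst v $ i * HX i (zp z)) + (\<Sum>k\<in>UNIV. U2 v (ex k) z * bb k z)"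
  using comp_zp[OF z diff_H] unfolding hh_def[abs_def] HX_def HP_def bb_def by simp_all

lemma ww_deriv:
  assumes z: "z \<in> Q"
  shows "dd Q v ww z = dd Q v hh z - U2 v et z"
    and "dd Q v ww z = (\<Sum>i\<in>UNIV. fst v $ i * fx i (mz z)) + dd Q v m z * fm (mz z)"
proof -
  have "((\<lambda>z. hh z - ut z) has_derivative (\<lambda>v. dd Q v hh z - dd Q v ut z)) (at z within Q)"
    by (intro has_derivative_diff dd_has_derivative hh_deriv(1)[OF z] diff_ut[OF z])
  from dd_eq[OF thickQ z has_derivative_transform[OF z ww_eq this]] show "dd Q v ww z = dd Q v hh z - U2 v et z" by (simp add: ut_def U2_def)
  show "dd Q v ww z = (\<Sum>i\<in>UNIV. fst v $ i * fx i (mz z)) + dd Q v m z * fm (mz z)"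
    using comp_mz(2)[OF z m_pos[OF z] diff_F[OF mz_pos[OF z]], of v] unfolding ww_def[abs_def] fx_def fm_def .
qed

lemma bb_deriv:
  assumes z: "z \<in> Q"
  shows "bb k differentiable (at z within Q)"
    and "dd Q v (bb k) z = (\<Sum>i\<in>UNIV. fst v $ i * HXP i k (zp z)) + (\<Sum>l\<in>UNIV. U2 v (ex l) z * HPP l k (zp z))"
  using comp_zp[OF z diff_HP[of k]] unfolding bb_def[abs_def] HXP_def HPP_def by simp_all

definition divb :: "(real^'n) \<times> real \<Rightarrow> real" where
  "divb z = (\<Sum>i\<in>UNIV. HXP i i (zp z) + (\<Sum>k\<in>UNIV. U2 (ex i) (ex k) z * HPP k i (zp z)))"

lemma sum_axis: "(\<Sum>i\<in>UNIV. (axis j (1::real) :: real^'n) $ i * G i) = G j"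
proof -
  have "(axis j (1::real) :: real^'n) $ i * G i = (if i = j then G i else 0)" for i by (simp add: axis_def)
  then show ?thesis by (simp only: sum.delta[OF finite] if_True UNIV_I)
qed

lemma divb_eq: "z \<in> Q \<Longrightarrow> divb z = (\<Sum>i\<in>UNIV. dd Q (ex i) (bb i) z)"
  unfolding divb_def by (intro sum.cong refl) (simp add: bb_deriv(2) sum_axis)

lemma continuity:
  assumes z: "z \<in> interior Q"
  shows "dd Q et m z = (\<Sum>i\<in>UNIV. dd Q (ex i) m z * bb i z) + m z * divb z"
proof -
  obtain x t where xt: "z = (x, t)" by force
  have zQ: "z \<in> Q" using I_sub[OF z] .
  have "t \<in> {0<..<T}" using z by (simp add: xt mem_I)
  then have "d_snd Q m (x, t) - trace (D_fst Q (\<lambda>z. m z *\<^sub>R Dp H (fst z, D_fst Q u z)) (x, t)) = 0"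
    using sol unfolding MFG_solution_def Let_def by blast
  then have 1: "dd Q et m z = (\<Sum>i\<in>UNIV. dd Q (ex i) (\<lambda>z. m z *\<^sub>R Dp H (fst z, D_fst Q u z)) z $ i)"
    by (simp add: xt d_snd_dd trace_def D_fst_nth)
  have comp: "(\<lambda>y. (m y *\<^sub>R Dp H (fst y, D_fst Q u y)) $ i) = (\<lambda>y. m y * bb i y)" for i
    by (simp add: D_snd_nth bb_def HP_def zp_def p_def)
  have der: "((\<lambda>y. m y * bb i y) has_derivative (\<lambda>v. m z * dd Q v (bb i) z + dd Q v m z * bb i z)) (at z within Q)" for i
    by (intro has_derivative_mult dd_has_derivative diff_m bb_deriv zQ)
  have dif: "(\<lambda>y. (m y *\<^sub>R Dp H (fst y, D_fst Q u y)) $ i) differentiable (at z within Q)" for i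
    unfolding comp using der unfolding differentiable_def by blast
  have "dd Q (ex i) (\<lambda>z. m z *\<^sub>R Dp H (fst z, D_fst Q u z)) z $ i = m z * dd Q (ex i) (bb i) z + dd Q (ex i) m z * bb i z" for i
    unfolding dd_vec_nth[OF thickQ zQ dif] comp by (rule dd_eq[OF thickQ zQ der])
  then show ?thesis unfolding 1 divb_eq[OF zQ] by (simp add: sum.distrib sum_distrib_left)
qed

definition EE :: "(real^'n) \<times> real \<Rightarrow> real" where
  "EE z = U2 et et z - 2 * (\<Sum>k\<in>UNIV. bb k z * U2 et (ex k) z)
     + (\<Sum>i\<in>UNIV. \<Sum>k\<in>UNIV. bb i z * bb k z * U2 (ex i) (ex k) z)
     + (\<Sum>i\<in>UNIV. bb i z * (HX i (zp z) - fx i (mz z))) + X (mz z) * divb z"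

text \<open>The time derivative of \<open>w\<close> is computed twice. From
  \<open>w = f(x, m)\<close> and the continuity equation, the gradient of \<open>m\<close> is
  eliminated through \<open>f\<^sub>m Dm = Dw - f\<^sub>x\<close> and the factor
  \<open>m f\<^sub>m\<close> becomes \<open>X\<close>; from \<open>w = h - u\<^sub>t\<close> one
  gets second derivatives of \<open>u\<close>. The difference is \<open>EE\<close>.\<close>

lemma EE_zero:
  assumes z: "z \<in> interior Q"
  shows "EE z = 0"
proof -
  have zQ: "z \<in> Q" using I_sub[OF z] .
  define a where "a = fm (mz z)"
  have wt: "dd Q et ww z = dd Q et m z * a" using ww_deriv(2)[OF zQ, of et] by (simp add: a_def)
  have wi: "dd Q (ex i) ww z = fx i (mz z) + dd Q (ex i) m z * a" for i
    using ww_deriv(2)[OF zQ, of "ex i"] by (simp add: a_def sum_axis)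
  have ht: "dd Q et hh z = (\<Sum>k\<in>UNIV. bb k z * U2 et (ex k) z)"
    using hh_deriv(2)[OF zQ, of et] by (simp add: mult.commute)
  have hi: "dd Q (ex i) hh z = HX i (zp z) + (\<Sum>k\<in>UNIV. bb k z * U2 (ex i) (ex k) z)" for i
    using hh_deriv(2)[OF zQ, of "ex i"] by (simp add: sum_axis mult.commute)
  have "dd Q et ww z = (\<Sum>i\<in>UNIV. bb i z * (dd Q (ex i) ww z - fx i (mz z))) + X (mz z) * divb z"
    unfolding wt wi continuity[OF z] by (simp add: X_def mz_def a_def sum_distrib_left sum_distrib_right algebra_simps)
  moreover have "dd Q et ww z = (\<Sum>k\<in>UNIV. bb k z * U2 et (ex k) z) - U2 et et z"
    using ww_deriv(1)[OF zQ, of et] ht by simp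
  moreover have "dd Q (ex i) ww z = HX i (zp z) + (\<Sum>k\<in>UNIV. bb k z * U2 (ex i) (ex k) z) - U2 et (ex i) z" for i
    using ww_deriv(1)[OF zQ, of "ex i"] hi U2_sym[OF zQ, of "ex i" et] by simp
  ultimately have "(\<Sum>k\<in>UNIV. bb k z * U2 et (ex k) z) - U2 et et z =
     (\<Sum>i\<in>UNIV. bb i z * (HX i (zp z) + (\<Sum>k\<in>UNIV. bb k z * U2 (ex i) (ex k) z) - U2 et (ex i) z - fx i (mz z)))
      + X (mz z) * divb z" by simp
  also have "\<dots> = (\<Sum>i\<in>UNIV. bb i z * (HX i (zp z) - fx i (mz z)))
      + (\<Sum>i\<in>UNIV. \<Sum>k\<in>UNIV. bb i z * bb k z * U2 (ex i) (ex k) z)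
      - (\<Sum>k\<in>UNIV. bb k z * U2 et (ex k) z) + X (mz z) * divb z"
    by (simp add: algebra_simps sum.distrib sum_subtractf sum_distrib_left)
  finally show ?thesis unfolding EE_def by linarith
qed

text \<open>\<open>EE\<close> vanishes on a whole neighbourhood of \<open>z\<close>, hence so does
  its derivative along \<open>v\<close>. The derivative exists because \<open>EE\<close> contains at
  most second derivatives of \<open>u\<close>.\<close>

lemma EE_deriv:
  assumes z: "z \<in> interior Q"
  shows "dd Q v (U2 et et) z
     - 2 * (\<Sum>k\<in>UNIV. dd Q v (bb k) z * U2 et (ex k) z + bb k z * dd Q v (U2 et (ex k)) z)
     + (\<Sum>i\<in>UNIV. \<Sum>k\<in>UNIV. (dd Q v (bb i) z * bb k z + bb i z * dd Q v (bb k) z) * U2 (ex i) (ex k) z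
          + bb i z * bb k z * dd Q v (U2 (ex i) (ex k)) z)
     + (\<Sum>i\<in>UNIV. dd Q v (bb i) z * (HX i (zp z) - fx i (mz z))
          + bb i z * (dd Q v (\<lambda>y. HX i (zp y)) z - dd Q v (\<lambda>y. fx i (mz y)) z))
     + (dd Q v (\<lambda>y. X (mz y)) z * divb z
       + X (mz z) * (\<Sum>i\<in>UNIV. dd Q v (\<lambda>y. HXP i i (zp y)) z
          + (\<Sum>k\<in>UNIV. dd Q v (U2 (ex i) (ex k)) z * HPP k i (zp z)
             + U2 (ex i) (ex k) z * dd Q v (\<lambda>y. HPP k i (zp y)) z))) = 0"
    (is "?D = 0")
proof -
  have zQ: "z \<in> Q" using I_sub[OF z] .
  let ?c = "\<lambda>s. z + s *\<^sub>R v"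
  have line: "((\<lambda>s. G (?c s)) has_real_derivative dd Q v G z) (at 0)" if "G differentiable (at z within Q)" for G
    by (rule dd_line0[OF z that])
  note mp = m_pos[OF zQ] and mzp = mz_pos[OF zQ]
  define a where "a s = U2 et et (?c s)" for s
  define r where "r i s = U2 et (ex i) (?c s)" for i s
  define b where "b i s = bb i (?c s)" for i s
  define q where "q i s = HX i (zp (?c s))" for i s
  define y where "y i s = fx i (mz (?c s))" for i s
  define k where "k i s = HXP i i (zp (?c s))" for i s
  define S where "S i j s = U2 (ex i) (ex j) (?c s)" for i j s
  define P where "P i j s = HPP i j (zp (?c s))" for i j s
  define x where "x s = X (mz (?c s))" for s
  note defs = a_def[abs_def] r_def[abs_def] b_def[abs_def] q_def[abs_def] y_def[abs_def] k_def[abs_def]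
    S_def[abs_def] P_def[abs_def] x_def[abs_def]
  have d: "(a has_real_derivative dd Q v (U2 et et) z) (at 0)"
    "\<And>i. (r i has_real_derivative dd Q v (U2 et (ex i)) z) (at 0)"
    "\<And>i. (b i has_real_derivative dd Q v (bb i) z) (at 0)"
    "\<And>i. (q i has_real_derivative dd Q v (\<lambda>y. HX i (zp y)) z) (at 0)"
    "\<And>i. (y i has_real_derivative dd Q v (\<lambda>y. fx i (mz y)) z) (at 0)"
    "\<And>i. (k i has_real_derivative dd Q v (\<lambda>y. HXP i i (zp y)) z) (at 0)"
    "\<And>i j. (S i j has_real_derivative dd Q v (U2 (ex i) (ex j)) z) (at 0)"
    "\<And>i j. (P i j has_real_derivative dd Q v (\<lambda>y. HPP i j (zp y)) z) (at 0)"
    "(x has_real_derivative dd Q v (\<lambda>y. X (mz y)) z) (at 0)"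
    unfolding defs
    by (rule line[OF diff_ddu[OF zQ]] line[OF bb_deriv(1)[OF zQ]] line[OF comp_zp(1)[OF zQ diff_HX]]
      line[OF comp_zp(1)[OF zQ diff_HXP]] line[OF comp_zp(1)[OF zQ diff_HPP]]
      line[OF comp_mz(1)[OF zQ mp diff_fx[OF mzp]]] line[OF comp_mz(1)[OF zQ mp X_deriv(1)[OF mzp]]])+
  have at0: "a 0 = U2 et et z" "\<And>i. r i 0 = U2 et (ex i) z" "\<And>i. b i 0 = bb i z" "\<And>i. q i 0 = HX i (zp z)"
    "\<And>i. y i 0 = fx i (mz z)" "\<And>i. k i 0 = HXP i i (zp z)" "\<And>i j. S i j 0 = U2 (ex i) (ex j) z"
    "\<And>i j. P i j 0 = HPP i j (zp z)" "x 0 = X (mz z)"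
    unfolding defs by simp_all
  have E: "EE (?c s) = a s - (\<Sum>i\<in>UNIV. b i s * r i s) - (\<Sum>i\<in>UNIV. b i s * r i s)
      + (\<Sum>i\<in>UNIV. \<Sum>j\<in>UNIV. b i s * b j s * S i j s) + (\<Sum>i\<in>UNIV. b i s * (q i s - y i s))
      + x s * (\<Sum>i\<in>UNIV. k i s + (\<Sum>j\<in>UNIV. S i j s * P j i s))" for s
    unfolding EE_def divb_def defs by simp
  have D: "((\<lambda>s. EE (?c s)) has_real_derivative ?D) (at 0)"
    unfolding E
    by (rule DERIV_cong[OF elliptic_curve_deriv[OF d]])
      (simp only: at0 divb_def mult_2 diff_diff_eq mult.commute mult.left_commute)
  obtain e where e: "e > 0" "\<And>s. \<bar>s\<bar> < e \<Longrightarrow> ?c s \<in> interior Q" using line_in_interior[OF z] by metis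
  have "((\<lambda>s. EE (?c s)) has_real_derivative 0) (at 0)"
  proof (rule has_field_derivative_transform_within[OF DERIV_const[of 0] e(1) UNIV_I])
    fix s :: real assume "dist s 0 < e"
    then show "0 = EE (?c s)" using EE_zero[OF e(2)[of s]] by simp
  qed
  from DERIV_unique[OF D this] show ?thesis .
qed

end

lemma powr_le_one_plus: "0 \<le> a \<Longrightarrow> a \<le> 1 \<Longrightarrow> 0 \<le> x \<Longrightarrow> x powr a \<le> 1 + (x::real)"
proof (cases "x \<le> 1")
  case True
  assume "0 \<le> a" "a \<le> 1" "0 \<le> x"
  then have "x powr a \<le> 1" using True by (cases "x = 0") (auto intro: powr_le1)
  then show ?thesis using \<open>0 \<le> x\<close> by linarith
next
  case False
  assume "0 \<le> a" "a \<le> 1" "0 \<le> x"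
  then have "x powr a \<le> x powr 1" using False by (intro powr_mono) auto
  then show ?thesis using False by simp
qed

text \<open>Used for the second derivatives of \<open>u\<close> and for their derivatives in a
  further direction; the second identity recognises the part of the equation without
  \<open>\<chi>\<close> as one second derivative along \<open>(- \<beta>, 1)\<close>.\<close>

lemma bilinear_expand:
  fixes B :: "(real^'n) \<times> real \<Rightarrow> (real^'n) \<times> real \<Rightarrow> real"
  assumes l1: "\<And>b. linear (\<lambda>a. B a b)" and l2: "\<And>a. linear (\<lambda>b. B a b)" and sym: "\<And>a b. B a b = B b a"
  shows "B (v, 0) (w, 0) = (\<Sum>i\<in>UNIV. \<Sum>k\<in>UNIV. v $ i * w $ k * B (axis i 1, 0) (axis k 1, 0))"
    and "B (- \<beta>, 1) (- \<beta>, 1) = B (0, 1) (0, 1) - 2 * (\<Sum>k\<in>UNIV. \<beta> $ k * B (0, 1) (axis k 1, 0))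
      + (\<Sum>i\<in>UNIV. \<Sum>k\<in>UNIV. \<beta> $ i * \<beta> $ k * B (axis i 1, 0) (axis k 1, 0))"
proof -
  have vec: "(v, 0) = (\<Sum>i\<in>UNIV. v $ i *\<^sub>R (axis i 1, 0 :: real))" for v :: "real^'n"
    by (simp add: prod_eq_iff fst_sum snd_sum vec_expand[symmetric])
  have e1: "B (v, 0) b = (\<Sum>i\<in>UNIV. v $ i * B (axis i 1, 0) b)" for v b
    unfolding vec[of v] by (simp only: linear_sum[OF l1] linear_scale[OF l1] real_scaleR_def)
  have e2: "B b (v, 0) = (\<Sum>i\<in>UNIV. v $ i * B b (axis i 1, 0))" for v b
    unfolding vec[of v] by (simp only: linear_sum[OF l2] linear_scale[OF l2] real_scaleR_def)
  show 1: "B (v, 0) (w, 0) = (\<Sum>i\<in>UNIV. \<Sum>k\<in>UNIV. v $ i * w $ k * B (axis i 1, 0) (axis k 1, 0))" for v w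
  proof -
    have "B (v, 0) (w, 0) = (\<Sum>i\<in>UNIV. v $ i * (\<Sum>k\<in>UNIV. w $ k * B (axis i 1, 0) (axis k 1, 0)))"
      by (subst e1) (simp only: e2[of _ w])
    then show ?thesis by (simp add: sum_distrib_left mult.assoc)
  qed
  have s: "(- \<beta>, 1) = (0, 1) - (\<beta>, 0 :: real)" by simp
  have "B (- \<beta>, 1) (- \<beta>, 1) = B (0, 1) (0, 1) - B (0, 1) (\<beta>, 0) - (B (\<beta>, 0) (0, 1) - B (\<beta>, 0) (\<beta>, 0))"
    unfolding s by (simp only: linear_diff[OF l1] linear_diff[OF l2])
  also have "\<dots> = B (0, 1) (0, 1) - 2 * B (0, 1) (\<beta>, 0) + B (\<beta>, 0) (\<beta>, 0)"
    unfolding sym[of "(\<beta>, 0)" "(0, 1)"] by linarith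
  finally show "B (- \<beta>, 1) (- \<beta>, 1) = B (0, 1) (0, 1) - 2 * (\<Sum>k\<in>UNIV. \<beta> $ k * B (0, 1) (axis k 1, 0))
      + (\<Sum>i\<in>UNIV. \<Sum>k\<in>UNIV. \<beta> $ i * \<beta> $ k * B (axis i 1, 0) (axis k 1, 0))"
    by (simp only: e2[of "(0, 1)" \<beta>] 1[of \<beta> \<beta>])
qed

text \<open>Only a short segment leaving \<open>z\<close> in direction \<open>v\<close> has to lie
  in \<open>S\<close>, which makes the lemma applicable at the initial and the terminal
  time.\<close>

lemma max_one_sided:
  fixes V :: "'a::euclidean_space \<Rightarrow> real"
  assumes S: "z \<in> S" and d: "V differentiable (at z within S)" and max: "\<And>y. y \<in> S \<Longrightarrow> V y \<le> V z"
    and e: "e > 0" "\<And>s. 0 < s \<Longrightarrow> s < e \<Longrightarrow> z + s *\<^sub>R v \<in> S"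
  shows "dd S v V z \<le> 0"
proof (rule ccontr)
  assume "\<not> ?thesis"
  then have pos: "dd S v V z > 0" by simp
  let ?c = "\<lambda>s. z + s *\<^sub>R v"
  have im: "?c ` {0..<e} \<subseteq> S"
  proof safe
    fix s assume "s \<in> {0..<e}" then show "?c s \<in> S" using e(2)[of s] S by (cases "s = 0") auto
  qed
  have 1: "(V has_derivative (\<lambda>w. dd S w V z)) (at (?c 0) within ?c ` {0..<e})"
    using has_derivative_subset[OF dd_has_derivative[OF d] im] by simp
  have 2: "(?c has_derivative (\<lambda>s. s *\<^sub>R v)) (at 0 within {0..<e})" by (auto intro!: derivative_eq_intros)
  have "((\<lambda>s. V (?c s)) has_derivative (\<lambda>s. dd S (s *\<^sub>R v) V z)) (at 0 within {0..<e})"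
    by (rule has_derivative_in_compose[OF 2 1])
  then have "((\<lambda>s. V (?c s)) has_real_derivative dd S v V z) (at 0 within {0..<e})"
    unfolding has_field_derivative_def
    by (simp add: linear_scale[OF dd_linear[OF d]] mult.commute[of _ "dd S v V z"])
  from has_real_derivative_pos_inc_right[OF this pos] obtain r where
    r: "r > 0" "\<And>h. 0 < h \<Longrightarrow> 0 + h \<in> {0..<e} \<Longrightarrow> h < r \<Longrightarrow> V (?c 0) < V (?c (0 + h))" by blast
  define h where "h = min r e / 2"
  have h: "0 < h" "h < e" "h < r" using r e by (auto simp: h_def)
  have "V z < V (?c h)" using r(2)[of h] h by simp
  moreover have "V (?c h) \<le> V z" using max[of "?c h"] e(2)[of h] h by simp
  ultimately show False by simp
qed

section \<open>Componentwise bounds on the data and the directional form of the elliptic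
  equation\<close>

context mfg
begin

lemma N_ge_1: "real CARD('n) \<ge> 1"
proof -
  have "0 < CARD('n)" by (rule zero_less_card_finite)
  then show ?thesis by linarith
qed

lemma H_bounds:
  "(norm q)\<^sup>2 / C0 - C0 \<le> H (x, q)" "H (x, q) \<le> C0 * (norm q)\<^sup>2 + C0"
  "norm (Dp H (x, q)) \<le> C0 * (1 + norm q)"
  "norm (Dx H (x, q)) \<le> C0 * (1 + norm q powr (1 + \<tau>))"
  "norm (Dx (Dx H) (x, q)) \<le> C0 * (1 + norm q powr (1 + \<tau>))"
  "norm (Dx (Dp H) (x, q)) \<le> C0 * (1 + norm q) powr \<tau>"
  using conv unfolding C0_convention_def by simp_all

lemma Dp_nth: "Dp H z $ k = HP k z" and Dx_nth: "Dx H z $ k = HX k z"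
  by (simp_all add: D_snd_nth D_fst_nth HP_def HX_def)

lemma Dpp_nth: "Dp (Dp H) z $ i $ k = HPP i k z" and Dxp_nth: "Dx (Dp H) z $ i $ k = HXP i k z"
proof -
  have d: "(\<lambda>y. Dp H y $ k) differentiable (at z within UNIV)" for k using diff_HP by (simp add: Dp_nth)
  show "Dp (Dp H) z $ i $ k = HPP i k z" "Dx (Dp H) z $ i $ k = HXP i k z"
    unfolding D_snd_nth[of _ "Dp H"] D_fst_nth[of _ "Dp H"] dd_vec_nth[OF thickU UNIV_I d]
    by (simp_all add: HPP_def HXP_def Dp_nth)
qed

lemma Dxx_nth: "Dx (Dx H) z $ i $ k = HXX i k z"
proof -
  have d: "(\<lambda>y. Dx H y $ k) differentiable (at z within UNIV)" for k using diff_HX by (simp add: Dx_nth)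
  show ?thesis
    unfolding D_fst_nth[of _ "Dx H"] dd_vec_nth[OF thickU UNIV_I d] by (simp add: HXX_def Dx_nth)
qed

lemma third_nth:
  "Dp (Dp (Dp H)) z $ l $ i $ k = dd UNIV (0, axis l 1) (HPP i k) z"
  "Dx (Dp (Dp H)) z $ l $ i $ k = dd UNIV (axis l 1, 0) (HPP i k) z"
  "Dx (Dx (Dp H)) z $ l $ i $ k = dd UNIV (axis l 1, 0) (HXP i k) z"
proof -
  have d: "(\<lambda>y. Dp (Dp H) y $ i $ k) differentiable (at z within UNIV)" for i k using diff_HPP by (simp add: Dpp_nth)
  have d': "(\<lambda>y. Dx (Dp H) y $ i $ k) differentiable (at z within UNIV)" for i k using diff_HXP by (simp add: Dxp_nth)
  show "Dp (Dp (Dp H)) z $ l $ i $ k = dd UNIV (0, axis l 1) (HPP i k) z"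
    "Dx (Dp (Dp H)) z $ l $ i $ k = dd UNIV (axis l 1, 0) (HPP i k) z"
    unfolding D_snd_nth[of _ "Dp (Dp H)"] D_fst_nth[of _ "Dp (Dp H)"] dd_matrix_nth[OF thickU UNIV_I d]
    by (simp_all add: Dpp_nth)
  show "Dx (Dx (Dp H)) z $ l $ i $ k = dd UNIV (axis l 1, 0) (HXP i k) z"
    unfolding D_fst_nth[of _ "Dx (Dp H)"] dd_matrix_nth[OF thickU UNIV_I d'] by (simp add: Dxp_nth)
qed

lemma HP_bound: "\<bar>HP k (x, q)\<bar> \<le> C0 * (1 + norm q)"
  using order_trans[OF component_le_norm_cart[of _ k] H_bounds(3)] by (simp add: Dp_nth)
lemma HX_bound: "\<bar>HX k (x, q)\<bar> \<le> C0 * (1 + norm q powr (1 + \<tau>))"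
  using order_trans[OF component_le_norm_cart[of _ k] H_bounds(4)] by (simp add: Dx_nth)
lemma HXX_bound: "\<bar>HXX i k (x, q)\<bar> \<le> C0 * (1 + norm q powr (1 + \<tau>))"
  using order_trans[OF nth_le_norm2[of _ i k] H_bounds(5)] by (simp add: Dxx_nth)
lemma HXP_bound: "\<bar>HXP i k (x, q)\<bar> \<le> C0 * (1 + norm q) powr \<tau>"
  using order_trans[OF nth_le_norm2[of _ i k] H_bounds(6)] by (simp add: Dxp_nth)

lemma H_third:
  "norm (Dp (Dp (Dp H)) (x, q)) \<le> C0 * (1 + norm q) powr (-1)"
  "norm (Dx (Dx (Dp H)) (x, q)) \<le> C0 * (1 + norm q) powr \<tau>"
  "norm (Dx (Dp (Dp H)) (x, q)) \<le> C0 * (1 + norm q) powr (\<tau> - 1)"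
  "Dp H (x, q) \<bullet> q \<ge> 2 * H (x, q) - C0"
  "(1 / C0) * (v \<bullet> v) \<le> v \<bullet> (Dp (Dp H) (x, q) *v v)"
  "v \<bullet> (Dp (Dp H) (x, q) *v v) \<le> C0 * (v \<bullet> v)"
  using assm_H unfolding assumption_H_def by blast+

lemma HPPP_bound: "\<bar>dd UNIV (0, axis l 1) (HPP i k) (x, q)\<bar> \<le> C0 * (1 + norm q) powr (-1)"
  using order_trans[OF nth_le_norm3[of _ l i k] H_third(1)] by (simp only: third_nth)
lemma HXXP_bound: "\<bar>dd UNIV (axis l 1, 0) (HXP i k) (x, q)\<bar> \<le> C0 * (1 + norm q) powr \<tau>"
  using order_trans[OF nth_le_norm3[of _ l i k] H_third(2)] by (simp only: third_nth)
lemma HXPP_bound: "\<bar>dd UNIV (axis l 1, 0) (HPP i k) (x, q)\<bar> \<le> C0 * (1 + norm q) powr (\<tau> - 1)"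
  using order_trans[OF nth_le_norm3[of _ l i k] H_third(3)] by (simp only: third_nth)

lemma HP_inner: "(\<Sum>k\<in>UNIV. HP k (x, q) * q $ k) \<ge> 2 * H (x, q) - C0"
  using H_third(4)[of x q] by (simp add: inner_vec_def Dp_nth)

lemma HPP_quad:
  "(1 / C0) * (v \<bullet> v) \<le> (\<Sum>i\<in>UNIV. \<Sum>k\<in>UNIV. v $ i * v $ k * HPP i k (x, q))"
  "(\<Sum>i\<in>UNIV. \<Sum>k\<in>UNIV. v $ i * v $ k * HPP i k (x, q)) \<le> C0 * (v \<bullet> v)"
proof -
  have "v \<bullet> (Dp (Dp H) (x, q) *v v) = (\<Sum>i\<in>UNIV. \<Sum>k\<in>UNIV. v $ i * v $ k * HPP i k (x, q))"
    unfolding inner_vec_def matrix_vector_mult_def by (simp add: Dpp_nth sum_distrib_left ac_simps)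
  then show "(1 / C0) * (v \<bullet> v) \<le> (\<Sum>i\<in>UNIV. \<Sum>k\<in>UNIV. v $ i * v $ k * HPP i k (x, q))"
    "(\<Sum>i\<in>UNIV. \<Sum>k\<in>UNIV. v $ i * v $ k * HPP i k (x, q)) \<le> C0 * (v \<bullet> v)"
    using H_third(5,6)[of v x q] by simp_all
qed

text \<open>The lower and the upper ellipticity bound, tested on one unit vector, give
  \<open>1 / C0 \<le> C0\<close>.\<close>

lemma C0_ge_1: "C0 \<ge> 1"
proof -
  obtain i :: 'n where True by simp
  let ?v = "axis i 1 :: real^'n"
  have "(1 / C0) * (?v \<bullet> ?v) \<le> C0 * (?v \<bullet> ?v)"
    using order_trans[OF HPP_quad(1)[of ?v 0 0] HPP_quad(2)] .
  then have "1 / C0 \<le> C0" by (simp add: inner_axis_axis)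
  then have "1 \<le> C0 * C0" using C0_pos by (simp add: pos_divide_le_eq)
  then show ?thesis using C0_pos by (metis linorder_not_le mult_less_cancel_right2 order_less_trans mult_left_le less_imp_le not_le)
qed

lemma HPP_decomposition:
  obtains v :: "'n \<Rightarrow> real^'n" where "\<And>i k. HPP i k (x, q) = (\<Sum>m\<in>UNIV. v m $ i * v m $ k)"
proof -
  let ?P = "Dp (Dp H) (x, q)"
  have "?P $ i $ k = ?P $ k $ i" for i k unfolding Dpp_nth by (rule HPP_sym)
  moreover have "v \<bullet> (?P *v v) \<ge> 0" for v
    using order_trans[OF _ H_third(5)[of v x q]] C0_pos by simp
  ultimately obtain v :: "'n \<Rightarrow> real^'n" where "\<And>i k. ?P $ i $ k = (\<Sum>m\<in>UNIV. v m $ i * v m $ k)"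
    using psd_decomposition[of ?P] by blast
  then show ?thesis using that unfolding Dpp_nth by blast
qed

lemma conv_parts:
  "C0_norm UNIV (\<lambda>x. chi_of f (x, 0)) \<le> ennreal C0"
  "Ck_norm 1 UNIV UNIV m0 \<le> ennreal C0"
  "Ck_norm 2 pos_dom (UNIV \<times> {(INF x. m0 x)..(SUP x. m0 x)}) F \<le> ennreal C0"
proof -
  have le: "a \<le> a + b + c" "b \<le> a + b + c" "c \<le> a + b + c" for a b c :: ennreal
    by (simp_all add: add_increasing add_increasing2 add.assoc)
  have *: "C0_norm UNIV (\<lambda>x. chi_of f (x, 0)) + Ck_norm 1 UNIV UNIV m0
       + Ck_norm 2 pos_dom (UNIV \<times> {(INF x. m0 x)..(SUP x. m0 x)}) F \<le> ennreal C0"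
    using conv unfolding C0_convention_def by blast
  show "C0_norm UNIV (\<lambda>x. chi_of f (x, 0)) \<le> ennreal C0" "Ck_norm 1 UNIV UNIV m0 \<le> ennreal C0"
    "Ck_norm 2 pos_dom (UNIV \<times> {(INF x. m0 x)..(SUP x. m0 x)}) F \<le> ennreal C0"
    by (rule order_trans[OF le(1) *], rule order_trans[OF le(2) *], rule order_trans[OF le(3) *])
qed

lemma X_le: "\<mu> > 0 \<Longrightarrow> X (x, \<mu>) \<le> C0 + C0 * \<bar>F (x, \<mu>)\<bar>"
proof (rule X_growth)
  have "norm (chi_of f (x, 0)) \<le> C0" by (rule C0_norm_bound[OF conv_parts(1)]) (use C0_pos in auto)
  then show "chi_of f (x, 0) \<le> C0" by simp
qed

lemma Ck_m0: "Ck_on 4 UNIV m0" and m0_periodic: "periodic m0"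
  using assm_M by (simp_all add: assumption_M_def)

lemma dm0_bound: "b \<in> Basis \<Longrightarrow> \<bar>dd UNIV b m0 x\<bar> \<le> C0"
  using Ck_norm1_bounds(2)[OF conv_parts(2)] C0_pos by fastforce

lemma m0_range: "m0 x \<in> {(INF x. m0 x)..(SUP x. m0 x)}"
proof -
  let ?G = "\<lambda>z :: (real^'n) \<times> real. m0 (fst z)"
  have c: "continuous_on (UNIV \<times> {0}) ?G"
    by (rule continuous_on_compose2[OF Ck_on_continuous[OF Ck_m0]]) (auto intro!: continuous_intros)
  have per: "periodic_fst {0} ?G" using m0_periodic by (simp add: periodic_fst_def periodic_def)
  obtain M where M: "\<And>y. y \<in> UNIV \<times> {0} \<Longrightarrow> norm (?G y) \<le> M"
    using periodic_fst_bounded[OF finite_imp_compact[of "{0}"] c per] by blast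
  have "\<bar>m0 y\<bar> \<le> M" for y using M[of "(y, 0)"] by simp
  then have "bdd_below (range m0)" "bdd_above (range m0)"
    by (auto intro!: bdd_belowI[of _ "- M"] bdd_aboveI[of _ M] simp: abs_le_iff minus_le_iff)
  then show ?thesis by (auto intro: cINF_lower cSUP_upper)
qed

lemma f_m0_bounds: "\<bar>F (x, m0 x)\<bar> \<le> C0" "b \<in> Basis \<Longrightarrow> \<bar>dd pos_dom b F (x, m0 x)\<bar> \<le> C0"
proof -
  let ?A = "UNIV \<times> {(INF x. m0 x)..(SUP x. m0 x)} :: ((real^'n) \<times> real) set"
  have "Ck_norm 1 pos_dom ?A F \<le> Ck_norm 2 pos_dom ?A F"
    unfolding Ck_norm_def numeral_2_eq_2 One_nat_def sum.atMost_Suc[of _ "Suc 0"] by simp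
  then have *: "Ck_norm 1 pos_dom ?A F \<le> ennreal C0" using conv_parts(3) by (rule order_trans)
  have mem: "(x, m0 x) \<in> ?A" using m0_range by simp
  have C: "0 \<le> C0" using C0_pos by simp
  show "\<bar>F (x, m0 x)\<bar> \<le> C0" using Ck_norm1_bounds(1)[OF * C mem] by simp
  show "b \<in> Basis \<Longrightarrow> \<bar>dd pos_dom b F (x, m0 x)\<bar> \<le> C0" using Ck_norm1_bounds(2)[OF * C mem, of b] by simp
qed

lemma m_init: "m (x, 0) = m0 x" and u_term: "ereal (u (x, T)) = g (x, m (x, T))"
  using sol unfolding MFG_solution_def Let_def by blast+

lemma ww_init: "\<bar>ww (x, 0)\<bar> \<le> C0"
  using f_m0_bounds(1)[of x] by (simp only: ww_def mz_def fst_conv m_init)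

lemma u_term_real: "u (x, T) = g.F (x, m (x, T))"
proof -
  have "(x, T) \<in> Q" using T_pos by (simp add: mem_Q)
  from g.f_eq[OF m_pos[OF this], of x] u_term[of x] have "ereal (u (x, T)) = ereal (g.F (x, m (x, T)))" by (simp only:)
  then show ?thesis by (simp only: ereal.inject)
qed

lemma F_growth_le:
  assumes "\<mu> > 0"
  shows "F_growth \<tau> f (x, \<mu>) \<le> 3 + \<bar>F (x, \<mu>)\<bar> + X (x, \<mu>)"
proof -
  have "(if \<tau> = 0 then 1 else \<bar>F (x, \<mu>)\<bar> powr (\<tau> / 2)) \<le> 1 + \<bar>F (x, \<mu>)\<bar>"
  proof -
    have "(if \<tau> = 0 then 1 else \<bar>a\<bar> powr (\<tau> / 2)) \<le> 1 + \<bar>a\<bar>" for a :: real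
      using powr_le_one_plus[of "\<tau> / 2" "\<bar>a\<bar>"] tau by simp
    then show ?thesis .
  qed
  moreover have "\<bar>X (x, \<mu>)\<bar> powr ((1 + \<tau>) / 2) \<le> 1 + X (x, \<mu>)"
    using powr_le_one_plus[of "(1 + \<tau>) / 2" "X (x, \<mu>)"] tau X_pos[OF assms, of x] by simp
  ultimately show ?thesis unfolding F_growth_def X_def fm_def d_snd_dd by simp
qed

lemma linear_U2: assumes "z \<in> Q" shows "linear (\<lambda>a. U2 a b z)" "linear (\<lambda>b. U2 a b z)"
proof -
  show 1: "linear (\<lambda>a. U2 a b z)" for b unfolding U2_def by (rule dd_linear[OF diff_du[OF assms]])
  show "linear (\<lambda>b. U2 a b z)" using 1[of a] by (simp only: U2_sym[OF assms, of a])
qed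

definition bv :: "(real^'n) \<times> real \<Rightarrow> real^'n" where "bv z = (\<chi> k. bb k z)"

lemma bv_nth [simp]: "bv z $ k = bb k z" by (simp add: bv_def)

lemma sum_decomposition:
  fixes B :: "'n \<Rightarrow> 'n \<Rightarrow> real"
  assumes v: "\<And>i k. HPP i k y = (\<Sum>j\<in>UNIV. v j $ i * v j $ k)"
  shows "(\<Sum>j\<in>UNIV. \<Sum>i\<in>UNIV. \<Sum>k\<in>UNIV. v j $ i * v j $ k * B i k) = (\<Sum>i\<in>UNIV. \<Sum>k\<in>UNIV. B i k * HPP k i y)"
proof -
  have "(\<Sum>j\<in>UNIV. \<Sum>i\<in>UNIV. \<Sum>k\<in>UNIV. v j $ i * v j $ k * B i k)
      = (\<Sum>i\<in>UNIV. \<Sum>j\<in>UNIV. \<Sum>k\<in>UNIV. v j $ i * v j $ k * B i k)" by (rule sum.swap)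
  also have "\<dots> = (\<Sum>i\<in>UNIV. \<Sum>k\<in>UNIV. \<Sum>j\<in>UNIV. v j $ i * v j $ k * B i k)"
    by (intro sum.cong refl sum.swap)
  also have "\<dots> = (\<Sum>i\<in>UNIV. \<Sum>k\<in>UNIV. B i k * HPP k i y)"
    by (simp add: v sum_distrib_left ac_simps)
  finally show ?thesis .
qed

text \<open>All second derivatives of \<open>u\<close> are now pure and carry nonnegative weights,
  so at a maximum or minimum the second order conditions can be inserted term by term.\<close>

lemma EE_directional:
  assumes z: "z \<in> interior Q" and v: "\<And>i k. HPP i k (zp z) = (\<Sum>j\<in>UNIV. v j $ i * v j $ k)"
  shows "U2 (- bv z, 1) (- bv z, 1) z + X (mz z) * (\<Sum>j\<in>UNIV. U2 (v j, 0) (v j, 0) z)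
    + (\<Sum>i\<in>UNIV. bb i z * (HX i (zp z) - fx i (mz z))) + X (mz z) * (\<Sum>i\<in>UNIV. HXP i i (zp z)) = 0"
proof -
  have zQ: "z \<in> Q" using I_sub[OF z] .
  note ex = bilinear_expand[of "\<lambda>a b. U2 a b z", OF linear_U2[OF zQ] U2_sym[OF zQ]]
  have 1: "(\<Sum>j\<in>UNIV. U2 (v j, 0) (v j, 0) z) = (\<Sum>i\<in>UNIV. \<Sum>k\<in>UNIV. U2 (ex i) (ex k) z * HPP k i (zp z))"
    by (rule trans[OF sum.cong[OF refl ex(1)] sum_decomposition[OF v]])
  have 2: "divb z = (\<Sum>i\<in>UNIV. HXP i i (zp z)) + (\<Sum>j\<in>UNIV. U2 (v j, 0) (v j, 0) z)"
    unfolding 1 divb_def by (simp add: sum.distrib)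
  show ?thesis using EE_zero[OF z] unfolding EE_def 2 ex(2) bv_nth by (simp add: distrib_left)
qed

lemma periodic_u: "periodic_fst {0..T} u"
  using sol unfolding MFG_solution_def Let_def by simp

lemma Q_alt: "Q = UNIV \<times> {0..T}" by (simp add: QT_closure_def)

lemma periodic_dd_Q:
  fixes G :: "(real^'n) \<times> real \<Rightarrow> real"
  assumes "periodic_fst {0..T} G" "\<And>z. z \<in> Q \<Longrightarrow> G differentiable (at z within Q)"
  shows "periodic_fst {0..T} (dd Q v G)"
  using periodic_fst_dd[OF thickQ[unfolded Q_alt] assms(1)] assms(2) unfolding Q_alt differentiable_on_def by blast

lemma periodic_du: "periodic_fst {0..T} (dd Q v u)" by (rule periodic_dd_Q[OF periodic_u diff_u])
lemma periodic_U2: "periodic_fst {0..T} (U2 a b)" unfolding U2_def by (rule periodic_dd_Q[OF periodic_du diff_du])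

lemma bounded_on_Q:
  fixes G :: "(real^'n) \<times> real \<Rightarrow> real"
  assumes "continuous_on Q G" "periodic_fst {0..T} G"
  obtains M where "M > 0" "\<And>z. z \<in> Q \<Longrightarrow> \<bar>G z\<bar> \<le> M"
  using periodic_fst_bounded[OF compact_Icc assms(1)[unfolded Q_alt] assms(2)] unfolding Q_alt real_norm_def by metis

lemma max_on_Q:
  fixes G :: "(real^'n) \<times> real \<Rightarrow> real"
  assumes "continuous_on Q G" "periodic_fst {0..T} G"
  obtains z where "z \<in> Q" "\<And>y. y \<in> Q \<Longrightarrow> G y \<le> G z"
proof -
  have "{0..T} \<noteq> {}" using T_pos by simp
  from periodic_fst_attains_max[OF compact_Icc this assms(1)[unfolded Q_alt] assms(2)]
  show ?thesis using that unfolding Q_alt by metis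
qed

lemma Q_cases:
  assumes "z \<in> Q"
  obtains "z \<in> interior Q" | x where "z = (x, 0)" | x where "z = (x, T)"
  using assms by (cases z) (auto simp: mem_Q mem_I less_le)

lemma max_tangential:
  fixes V :: "(real^'n) \<times> real \<Rightarrow> real"
  assumes z: "z \<in> Q" and max: "\<And>y. y \<in> Q \<Longrightarrow> V y \<le> V z" and d: "V differentiable (at z within Q)"
  shows "dd Q (v, 0) V z = 0"
proof -
  have in_Q: "z + s *\<^sub>R (v', 0) \<in> Q" for s v' using z by (cases z) (simp add: mem_Q)
  have "dd Q (v, 0) V z \<le> 0" "dd Q (- v, 0) V z \<le> 0"
    by (rule max_one_sided[OF z d max zero_less_one in_Q]; simp)+
  moreover have "dd Q (- v, 0) V z = - dd Q (v, 0) V z"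
    using linear_neg[OF dd_linear[OF d], of "(v, 0)"] by simp
  ultimately show ?thesis by simp
qed

lemma max_initial:
  fixes V :: "(real^'n) \<times> real \<Rightarrow> real"
  assumes max: "\<And>y. y \<in> Q \<Longrightarrow> V y \<le> V (x, 0)" and d: "V differentiable (at (x, 0) within Q)"
  shows "dd Q et V (x, 0) \<le> 0"
  by (rule max_one_sided[OF _ d max T_pos]) (auto simp: mem_Q T_pos less_imp_le)

lemma max_terminal:
  fixes V :: "(real^'n) \<times> real \<Rightarrow> real"
  assumes max: "\<And>y. y \<in> Q \<Longrightarrow> V y \<le> V (x, T)" and d: "V differentiable (at (x, T) within Q)"
  shows "dd Q et V (x, T) \<ge> 0"
proof -
  have "dd Q (- et) V (x, T) \<le> 0"
    by (rule max_one_sided[OF _ d max T_pos]) (auto simp: mem_Q T_pos less_imp_le)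
  then show ?thesis using linear_neg[OF dd_linear[OF d], of et] by simp
qed

section \<open>Maximum principles for the solution and its time derivative\<close>

lemma interior_max_conditions:
  fixes V :: "(real^'n) \<times> real \<Rightarrow> real"
  assumes z: "z \<in> interior Q" and max: "\<And>y. y \<in> Q \<Longrightarrow> V y \<le> V z"
    and D: "\<And>y. y \<in> Q \<Longrightarrow> (V has_derivative (\<lambda>v. D v y)) (at y within Q)"
    and E: "(D v has_derivative E) (at z within Q)"
  shows "D w z = 0" and "E v \<le> 0"
proof -
  have zQ: "z \<in> Q" using I_sub[OF z] .
  have dif: "y \<in> Q \<Longrightarrow> V differentiable (at y within Q)" for y using D unfolding differentiable_def by blast
  have ddV: "y \<in> Q \<Longrightarrow> dd Q v V y = D v y" for v y by (rule dd_eq[OF thickQ _ D])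
  show "D w z = 0" using interior_max_first[OF z max dif[OF zQ], of w] ddV[OF zQ] by simp
  have 1: "(dd Q v V has_derivative E) (at z within Q)"
    by (rule has_derivative_transform[OF zQ ddV E])
  then have "dd Q v V differentiable (at z within Q)" unfolding differentiable_def by blast
  from interior_max_second[OF z max dif[OF I_sub] this]
  show "E v \<le> 0" unfolding dd_eq[OF thickQ zQ 1] .
qed

lemma time_derivative:
  assumes "(a has_real_derivative a') (at (snd z))"
  shows "((\<lambda>y. a (snd y)) has_derivative (\<lambda>v. snd v * a')) (at z within S)"
  by (rule DERIV_compose_FDERIV[OF assms has_derivative_snd[OF has_derivative_ident]])

text \<open>Linearity in the slots of \<open>U2\<close> follows by exchanging derivatives until the
  slot in question is the outermost direction.\<close>

lemma U3_bilinear: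
  assumes z: "z \<in> interior Q"
  shows "linear (\<lambda>b. dd Q v (U2 a b) z)" "linear (\<lambda>a. dd Q v (U2 a b) z)"
    and "dd Q v (U2 a b) z = dd Q v (U2 b a) z"
proof -
  have zQ: "z \<in> Q" using I_sub[OF z] .
  show s: "dd Q v (U2 a b) z = dd Q v (U2 b a) z" for a b by (rule U3_sym'[OF zQ])
  have "(\<lambda>a. dd Q v (U2 a b) z) = (\<lambda>a. dd Q a (U2 v b) z)" for b using U3_sym[OF z] by blast
  then show 1: "linear (\<lambda>a. dd Q v (U2 a b) z)" for b using dd_linear[OF diff_ddu[OF zQ, of v b]] by simp
  show "linear (\<lambda>b. dd Q v (U2 a b) z)" using 1[of a] by (simp only: s[of a])
qed

lemma U2_xi:
  assumes z: "z \<in> Q"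
  shows "U2 (- bv z, 1) (ex k) z = U2 et (ex k) z - (\<Sum>i\<in>UNIV. bb i z * U2 (ex i) (ex k) z)"
proof -
  note L = linear_U2(1)[OF z, of "ex k"]
  have "(- bv z, 1) = et - (\<Sum>i\<in>UNIV. bb i z *\<^sub>R ex i)"
    using vec_expand[of "bv z"] by (simp add: prod_eq_iff fst_sum snd_sum)
  then have "U2 (- bv z, 1) (ex k) z = U2 (et - (\<Sum>i\<in>UNIV. bb i z *\<^sub>R ex i)) (ex k) z" by simp
  also have "\<dots> = U2 et (ex k) z - (\<Sum>i\<in>UNIV. bb i z * U2 (ex i) (ex k) z)"
    by (simp only: linear_diff[OF L] linear_sum[OF L] linear_scale[OF L] real_scaleR_def)
  finally show ?thesis .
qed

text \<open>Where the differentiation falls on the coefficients \<open>b\<close> of the quadratic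
  part, the mixed and the purely spatial contributions combine into a single second derivative of
  \<open>u\<close> with one direction \<open>(- b, 1)\<close>.\<close>

lemma EE_deriv_directional:
  assumes z: "z \<in> interior Q" and v: "\<And>i k. HPP i k (zp z) = (\<Sum>j\<in>UNIV. v j $ i * v j $ k)"
  shows "dd Q w (U2 (- bv z, 1) (- bv z, 1)) z + X (mz z) * (\<Sum>j\<in>UNIV. dd Q w (U2 (v j, 0) (v j, 0)) z)
     - 2 * (\<Sum>k\<in>UNIV. dd Q w (bb k) z * U2 (- bv z, 1) (ex k) z)
     + (\<Sum>i\<in>UNIV. dd Q w (bb i) z * (HX i (zp z) - fx i (mz z))
          + bb i z * (dd Q w (\<lambda>y. HX i (zp y)) z - dd Q w (\<lambda>y. fx i (mz y)) z))
     + dd Q w (\<lambda>y. X (mz y)) z * divb z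
     + X (mz z) * (\<Sum>i\<in>UNIV. dd Q w (\<lambda>y. HXP i i (zp y)) z
          + (\<Sum>k\<in>UNIV. U2 (ex i) (ex k) z * dd Q w (\<lambda>y. HPP k i (zp y)) z)) = 0"
proof -
  have zQ: "z \<in> Q" using I_sub[OF z] .
  note exp = bilinear_expand[of "\<lambda>a b. dd Q w (U2 a b) z", OF U3_bilinear(2,1)[OF z] U3_bilinear(3)[OF z]]
  have 1: "(\<Sum>j\<in>UNIV. dd Q w (U2 (v j, 0) (v j, 0)) z) = (\<Sum>i\<in>UNIV. \<Sum>k\<in>UNIV. dd Q w (U2 (ex i) (ex k)) z * HPP k i (zp z))"
    by (rule trans[OF sum.cong[OF refl exp(1)] sum_decomposition[OF v]])
  have 2: "(\<Sum>i\<in>UNIV. \<Sum>k\<in>UNIV. (dd Q w (bb i) z * bb k z + bb i z * dd Q w (bb k) z) * U2 (ex i) (ex k) z)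
      = 2 * (\<Sum>k\<in>UNIV. dd Q w (bb k) z * (\<Sum>i\<in>UNIV. bb i z * U2 (ex i) (ex k) z))"
  proof -
    have "(\<Sum>i\<in>UNIV. \<Sum>k\<in>UNIV. (dd Q w (bb i) z * bb k z) * U2 (ex i) (ex k) z)
        = (\<Sum>i\<in>UNIV. dd Q w (bb i) z * (\<Sum>k\<in>UNIV. bb k z * U2 (ex k) (ex i) z))"
      using U2_sym[OF zQ] by (simp add: sum_distrib_left mult.assoc)
    moreover have "(\<Sum>i\<in>UNIV. \<Sum>k\<in>UNIV. (bb i z * dd Q w (bb k) z) * U2 (ex i) (ex k) z)
        = (\<Sum>k\<in>UNIV. dd Q w (bb k) z * (\<Sum>i\<in>UNIV. bb i z * U2 (ex i) (ex k) z))"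
      by (subst sum.swap) (simp add: sum_distrib_left ac_simps)
    ultimately show ?thesis by (simp add: distrib_right sum.distrib)
  qed
  have 3: "(\<Sum>k\<in>UNIV. dd Q w (bb k) z * U2 (- bv z, 1) (ex k) z)
     = (\<Sum>k\<in>UNIV. dd Q w (bb k) z * U2 et (ex k) z) - (\<Sum>k\<in>UNIV. dd Q w (bb k) z * (\<Sum>i\<in>UNIV. bb i z * U2 (ex i) (ex k) z))"
    unfolding U2_xi[OF zQ] by (simp add: right_diff_distrib sum_subtractf)
  have 4: "(\<Sum>i\<in>UNIV. dd Q w (\<lambda>y. HXP i i (zp y)) z
          + (\<Sum>k\<in>UNIV. dd Q w (U2 (ex i) (ex k)) z * HPP k i (zp z)
             + U2 (ex i) (ex k) z * dd Q w (\<lambda>y. HPP k i (zp y)) z))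
    = (\<Sum>i\<in>UNIV. dd Q w (\<lambda>y. HXP i i (zp y)) z
          + (\<Sum>k\<in>UNIV. U2 (ex i) (ex k) z * dd Q w (\<lambda>y. HPP k i (zp y)) z))
      + (\<Sum>i\<in>UNIV. \<Sum>k\<in>UNIV. dd Q w (U2 (ex i) (ex k)) z * HPP k i (zp z))"
    by (simp add: sum.distrib)
  show ?thesis
    using EE_deriv[OF z, of w] 2 unfolding 1 3 4 exp(2) bv_nth by (simp add: sum.distrib algebra_simps)
qed

text \<open>The diagonal entries are bounded by the quadratic form; the off-diagonal ones follow
  from the inequality of arithmetic and geometric means applied to the decomposition.\<close>

lemma HPP_entry_bound: "\<bar>HPP i k (x, q)\<bar> \<le> C0"
proof -
  obtain v :: "'n \<Rightarrow> real^'n" where v: "\<And>i k. HPP i k (x, q) = (\<Sum>j\<in>UNIV. v j $ i * v j $ k)"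
    using HPP_decomposition by metis
  have diag: "HPP i i (x, q) \<le> C0" for i
  proof -
    have "(\<Sum>a\<in>UNIV. \<Sum>b\<in>UNIV. axis i 1 $ a * axis i 1 $ b * HPP a b (x, q)) = HPP i i (x, q)"
      by (simp add: mult.assoc sum_distrib_left[symmetric] sum_axis)
    then show ?thesis using HPP_quad(2)[of "axis i 1" x q] by (simp add: inner_axis_axis)
  qed
  have "\<bar>HPP i k (x, q)\<bar> \<le> (\<Sum>j\<in>UNIV. \<bar>v j $ i * v j $ k\<bar>)" unfolding v by (rule sum_abs)
  also have "\<dots> \<le> (\<Sum>j\<in>UNIV. (v j $ i * v j $ i + v j $ k * v j $ k) / 2)"
  proof (rule sum_mono)
    fix j :: 'n
    have "0 \<le> (\<bar>v j $ i\<bar> - \<bar>v j $ k\<bar>)\<^sup>2" by simp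
    then show "\<bar>v j $ i * v j $ k\<bar> \<le> (v j $ i * v j $ i + v j $ k * v j $ k) / 2"
      by (simp add: power2_diff abs_mult power2_eq_square algebra_simps)
  qed
  also have "\<dots> = (HPP i i (x, q) + HPP k k (x, q)) / 2" unfolding v by (simp add: sum.distrib sum_divide_distrib add_divide_distrib)
  also have "\<dots> \<le> C0" using diag[of i] diag[of k] by simp
  finally show ?thesis .
qed

lemma sum_abs_bound: "(\<And>i. \<bar>G i\<bar> \<le> c) \<Longrightarrow> \<bar>\<Sum>i\<in>(UNIV::'n set). G i\<bar> \<le> real CARD('n) * c"
  by (rule order_trans[OF sum_abs]) (rule sum_bounded_above, simp)

lemma abs_mult_le: "\<bar>a\<bar> \<le> c \<Longrightarrow> \<bar>b\<bar> \<le> d \<Longrightarrow> \<bar>a * b\<bar> \<le> c * (d::real)"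
  unfolding abs_mult by (rule mult_mono) (auto intro: order_trans[OF abs_ge_zero])

section \<open>Exponential barrier for the value function\<close>

definition barrier_rate :: real where "barrier_rate = 13 * real CARD('n) * C0 ^ 4"
definition barrier_slope :: "real \<Rightarrow> real" where "barrier_slope t = (2 * C0 + 1) * exp (barrier_rate * t)"

lemma barrier_rate_pos: "barrier_rate > 0"
  unfolding barrier_rate_def using N_ge_1 C0_pos by simp

lemma barrier_slope_ge: "t \<ge> 0 \<Longrightarrow> barrier_slope t \<ge> 1"
proof -
  assume "t \<ge> 0"
  then have "exp (barrier_rate * t) \<ge> 1" using barrier_rate_pos by simp
  then have "1 * 1 \<le> barrier_slope t" unfolding barrier_slope_def using C0_pos by (intro mult_mono) auto
  then show ?thesis by simp
qed

text \<open>Where \<open>Du\<close> vanishes, \<open>H\<close> and its derivatives are controlled by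
  \<open>C0\<close>, and \<open>w = h - u\<^sub>t\<close> is at most of order \<open>\<phi>\<close>.
  Hence \<open>X\<close> and \<open>f\<^sub>x\<close> grow at most linearly in
  \<open>\<phi>\<close>, with no higher power. The count gives
  \<open>12 * N * C0 ^ 4 * \<phi>\<close>; the 13 in \<open>barrier_rate\<close> makes the
  inequality strict.\<close>

lemma rest_bound:
  assumes z: "z \<in> Q" and p0: "p z = 0" and phi: "\<bar>ut z\<bar> = \<phi>" "\<phi> \<ge> 1"
  shows "\<bar>(\<Sum>i\<in>UNIV. bb i z * (HX i (zp z) - fx i (mz z))) + X (mz z) * (\<Sum>i\<in>UNIV. HXP i i (zp z))\<bar>
    < barrier_rate * \<phi>"
proof -
  let ?N = "real CARD('n)"
  obtain x where zp: "zp z = (x, 0)" using p0 by (simp add: zp_def)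
  have mp: "m z > 0" by (rule m_pos[OF z])
  have C: "C0 \<ge> 1" by (rule C0_ge_1)
  have C2: "C0 \<le> C0^2" "1 \<le> C0^2" "1 \<le> C0^3" "C0^2 \<le> C0^4" "C0^3 \<le> C0^4" "1 \<le> C0^4"
    using C by (auto intro: power_increasing[of 1 2 C0, simplified] power_increasing one_le_power)
  have hb: "\<bar>hh z\<bar> \<le> C0" unfolding hh_def zp using H_bounds(1)[of 0 x] H_bounds(2)[of x 0] by simp
  have w: "\<bar>ww z\<bar> \<le> C0 + \<phi>" using ww_eq[OF z] hb phi by linarith
  have "C0 * 1 \<le> C0 * \<phi>" "1 * \<phi> \<le> C0 * \<phi>" using C phi by (auto intro!: mult_mono)
  then have w2: "\<bar>ww z\<bar> \<le> 2 * C0 * \<phi>" using w by linarith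
  have C2p: "C0^2 * \<phi> \<ge> C0 * \<phi>" "C0^2 * \<phi> \<ge> C0" "C0^2 * \<phi> \<ge> 1"
  proof -
    show a: "C0^2 * \<phi> \<ge> C0 * \<phi>" using C2(1) phi by (intro mult_right_mono) auto
    show "C0^2 * \<phi> \<ge> C0" using a \<open>C0 * 1 \<le> C0 * \<phi>\<close> by linarith
    then show "C0^2 * \<phi> \<ge> 1" using C by linarith
  qed
  have X0: "X (mz z) > 0" unfolding mz_def by (rule X_pos[OF mp])
  have "X (mz z) \<le> C0 + C0 * \<bar>ww z\<bar>" unfolding ww_def mz_def by (rule X_le[OF mp])
  also have "\<dots> \<le> C0 + C0 * (2 * C0 * \<phi>)" using w2 C by simp
  also have "\<dots> \<le> 3 * (C0^2 * \<phi>)" using C2p(2) by (simp add: power2_eq_square)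
  finally have Xb: "X (mz z) \<le> 3 * (C0^2 * \<phi>)" .
  have Fg: "F_growth \<tau> f (mz z) \<le> 8 * (C0^2 * \<phi>)"
    using F_growth_le[OF mp, of "fst z"] w2 Xb C2p unfolding mz_def ww_def by linarith
  have "\<bar>fx i (mz z)\<bar> \<le> C0 * F_growth \<tau> f (mz z)" for i unfolding mz_def by (rule fx_bounds(1)[OF mp])
  then have fxb: "\<bar>fx i (mz z)\<bar> \<le> C0 * (8 * (C0^2 * \<phi>))" for i
    using mult_left_mono[OF Fg, of C0] C by (meson order_trans zero_le_one)
  have HXb: "\<bar>HX i (zp z)\<bar> \<le> C0" for i using HX_bound[of i x 0] by (simp add: zp)
  have bbb: "\<bar>bb i z\<bar> \<le> C0" for i using HP_bound[of i x 0] by (simp add: bb_def zp)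
  have HXPb: "\<bar>HXP i i (zp z)\<bar> \<le> C0" for i using HXP_bound[of i i x 0] by (simp add: zp)
  have d: "\<bar>HX i (zp z) - fx i (mz z)\<bar> \<le> 9 * (C0^3 * \<phi>)" for i
  proof -
    have "C0 * 1 \<le> C0^3 * \<phi>" using C phi power_increasing[of 1 3 C0] by (intro mult_mono) auto
    moreover have "C0 * (8 * (C0^2 * \<phi>)) = 8 * (C0^3 * \<phi>)" by (simp add: power2_eq_square power3_eq_cube)
    ultimately show ?thesis using HXb[of i] fxb[of i] by linarith
  qed
  have "\<bar>\<Sum>i\<in>UNIV. bb i z * (HX i (zp z) - fx i (mz z))\<bar> \<le> ?N * (C0 * (9 * (C0^3 * \<phi>)))"
    by (intro sum_abs_bound abs_mult_le bbb d)
  moreover have "\<bar>X (mz z) * (\<Sum>i\<in>UNIV. HXP i i (zp z))\<bar> \<le> (3 * (C0^2 * \<phi>)) * (?N * C0)"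
    by (intro sum_abs_bound abs_mult_le HXPb) (use Xb X0 in simp)
  ultimately have "\<bar>(\<Sum>i\<in>UNIV. bb i z * (HX i (zp z) - fx i (mz z))) + X (mz z) * (\<Sum>i\<in>UNIV. HXP i i (zp z))\<bar>
     \<le> 9 * (?N * C0^4 * \<phi>) + 3 * (?N * C0^3 * \<phi>)"
    by (simp add: eval_nat_numeral algebra_simps)
  also have "\<dots> \<le> 12 * (?N * C0^4 * \<phi>)"
    using mult_right_mono[OF mult_left_mono[OF C2(5), of ?N], of \<phi>] phi by simp
  also have "\<dots> < barrier_rate * \<phi>"
    unfolding barrier_rate_def using N_ge_1 C0_pos phi by simp
  finally show ?thesis .
qed

text \<open>The sign \<open>s\<close> treats the upper and the lower bound at once. The first two
  conclusions say that \<open>s u\<close> is largest, up to a controlled amount, at one terminal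
  point; the third controls the coupling at this very point, from which bounds on \<open>m\<close>
  and \<open>u\<close> there follow.\<close>

lemma barrier:
  assumes s: "s = 1 \<or> s = - 1"
  obtains x where "\<And>z. z \<in> Q \<Longrightarrow> s * u z \<le> s * u (x, T) + T * barrier_slope T"
    "\<And>y. s * u (y, T) \<le> s * u (x, T)" "s * ww (x, T) \<le> C0 + barrier_slope T"
proof -
  \<comment> \<open>The slope at time 0 is normalised to \<open>2 * C0 + 1\<close>: a maximum at
    \<open>t = 0\<close> would force \<open>s w \<ge> C0 + 1\<close>, contradicting the bound
    \<open>C0\<close> on the coupling at the initial density. The rate serves the interior case,
    where differentiating the exponential once more yields \<open>barrier_rate * \<phi>\<close>,
    more than the lower order terms can balance.\<close>
  define \<psi> where "\<psi> t = - ((2 * C0 + 1) / barrier_rate) * exp (barrier_rate * t)" for t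
  define V where "V z = s * u z - \<psi> (snd z)" for z
  define D where "D v z = s * dd Q v u z + snd v * barrier_slope (snd z)" for v z
  have r: "barrier_rate > 0" by (rule barrier_rate_pos)
  have psi: "(\<psi> has_real_derivative - barrier_slope t) (at t)" for t
    unfolding \<psi>_def[abs_def] barrier_slope_def using r by (auto intro!: derivative_eq_intros)
  have slope: "(barrier_slope has_real_derivative barrier_rate * barrier_slope t) (at t)" for t
    unfolding barrier_slope_def[abs_def] by (auto intro!: derivative_eq_intros)
  have DV: "(V has_derivative (\<lambda>v. D v y)) (at y within Q)" if "y \<in> Q" for y
  proof -
    have "((\<lambda>z. s * u z - \<psi> (snd z)) has_derivative (\<lambda>v. s * dd Q v u y - snd v * (- barrier_slope (snd y)))) (at y within Q)"
      by (intro has_derivative_diff has_derivative_mult_right dd_has_derivative diff_u that time_derivative psi)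
    then show ?thesis unfolding V_def[abs_def] D_def by simp
  qed
  have DD: "(D v has_derivative (\<lambda>w. s * U2 w v y + snd v * (snd w * (barrier_rate * barrier_slope (snd y))))) (at y within Q)"
    if "y \<in> Q" for v y
    unfolding D_def[abs_def] U2_def
    by (intro has_derivative_add has_derivative_mult_right dd_has_derivative diff_du that time_derivative slope)
  have difV: "y \<in> Q \<Longrightarrow> V differentiable (at y within Q)" for y using DV unfolding differentiable_def by blast
  have ddV: "y \<in> Q \<Longrightarrow> dd Q v V y = D v y" for v y by (rule dd_eq[OF thickQ _ DV])
  have cV: "continuous_on Q V"
    unfolding V_def[abs_def] \<psi>_def by (intro continuous_intros cont_u)
  have pV: "periodic_fst {0..T} V" using periodic_u unfolding V_def periodic_fst_def periodic_def by simp
  obtain z where z: "z \<in> Q" and max: "\<And>y. y \<in> Q \<Longrightarrow> V y \<le> V z" using max_on_Q[OF cV pV] by metis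
  have zt: "0 \<le> snd z" "snd z \<le> T" using z by (cases z, simp add: mem_Q)+
  have s2: "s * s = 1" "\<bar>s\<bar> = 1" using s by auto
  have p0: "p z = 0"
  proof -
    have "s * dd Q (ex k) u z = 0" for k
      using max_tangential[OF z max difV[OF z], of "axis k 1"] unfolding ddV[OF z] D_def by simp
    then have "p z $ k = 0" for k using s unfolding p_nth by fastforce
    then show ?thesis by (simp add: vec_eq_iff)
  qed
  have hb: "\<bar>hh z\<bar> \<le> C0"
    unfolding hh_def zp_def p0 using H_bounds(1)[of 0 "fst z"] H_bounds(2)[of "fst z" 0] by simp
  have ut_z: "dd Q et u z = ut z" by (simp add: ut_def)
  from z show ?thesis
  proof (cases rule: Q_cases)
    case 1
    obtain v :: "'n \<Rightarrow> real^'n" where v: "\<And>i k. HPP i k (zp z) = (\<Sum>j\<in>UNIV. v j $ i * v j $ k)"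
      using HPP_decomposition[of "fst z" "p z"] unfolding zp_def by metis
    note first = interior_max_conditions(1)[OF 1 max DV DD[OF z]]
    note second = interior_max_conditions(2)[OF 1 max DV DD[OF z]]
    define \<phi> where "\<phi> = barrier_slope (snd z)"
    have phi1: "\<phi> \<ge> 1" unfolding \<phi>_def using zt barrier_slope_ge by blast
    have "D et z = 0" using first by blast
    then have su: "s * ut z = - \<phi>" unfolding D_def ut_z \<phi>_def by simp
    have ab: "\<bar>ut z\<bar> = \<phi>" using su s phi1 by auto
    have 2: "s * U2 (- bv z, 1) (- bv z, 1) z + barrier_rate * \<phi> \<le> 0"
      using second[of "(- bv z, 1)"] by (simp add: \<phi>_def)
    have "s * U2 (v j, 0) (v j, 0) z \<le> 0" for j using second[of "(v j, 0)"] by simp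
    then have "(\<Sum>j\<in>UNIV. s * U2 (v j, 0) (v j, 0) z) \<le> 0" by (intro sum_nonpos) simp
    moreover have "X (mz z) > 0" unfolding mz_def by (rule X_pos[OF m_pos[OF z]])
    ultimately have 3: "X (mz z) * (\<Sum>j\<in>UNIV. s * U2 (v j, 0) (v j, 0) z) \<le> 0" by (simp add: mult_le_0_iff)
    define R where "R = (\<Sum>i\<in>UNIV. bb i z * (HX i (zp z) - fx i (mz z))) + X (mz z) * (\<Sum>i\<in>UNIV. HXP i i (zp z))"
    have "s * (U2 (- bv z, 1) (- bv z, 1) z + X (mz z) * (\<Sum>j\<in>UNIV. U2 (v j, 0) (v j, 0) z) + R) = 0"
      using EE_directional[OF 1 v] unfolding R_def by simp
    then have "s * U2 (- bv z, 1) (- bv z, 1) z + X (mz z) * (\<Sum>j\<in>UNIV. s * U2 (v j, 0) (v j, 0) z) + s * R = 0"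
      by (simp add: sum_distrib_left algebra_simps)
    then have "barrier_rate * \<phi> \<le> s * R" using 2 3 by linarith
    also have "\<dots> \<le> \<bar>R\<bar>" using s by auto
    also have "\<dots> < barrier_rate * \<phi>" unfolding R_def by (rule rest_bound[OF z p0 ab phi1])
    finally show ?thesis by simp
  next
    case (2 x)
    have "D et z \<le> 0" using max_initial[OF max[unfolded 2] difV[OF z, unfolded 2]] ddV[OF z] 2 by simp
    then have "s * ut z \<le> - (2 * C0 + 1)" unfolding D_def ut_z using 2 by (simp add: barrier_slope_def)
    moreover have "s * ww z = s * hh z - s * ut z" by (simp only: ww_eq[OF z] right_diff_distrib)
    moreover have "\<bar>s * hh z\<bar> \<le> C0" "\<bar>s * ww z\<bar> \<le> C0" using hb ww_init[of x] s2 2 by (simp_all add: abs_mult)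
    ultimately show ?thesis using C0_pos by linarith
  next
    case (3 x)
    have "D et z \<ge> 0" using max_terminal[OF max[unfolded 3] difV[OF z, unfolded 3]] ddV[OF z] 3 by simp
    then have "s * ut z \<ge> - barrier_slope T" unfolding D_def ut_z using 3 by simp
    moreover have "s * ww z = s * hh z - s * ut z" by (simp only: ww_eq[OF z] right_diff_distrib)
    moreover have "\<bar>s * hh z\<bar> \<le> C0" using hb s2 by (simp add: abs_mult)
    ultimately have "s * ww (x, T) \<le> C0 + barrier_slope T" using 3 by simp
    moreover have "s * u (y, T) \<le> s * u (x, T)" for y
      using max[of "(y, T)"] T_pos unfolding V_def 3 by (simp add: mem_Q)
    moreover have "s * u y \<le> s * u (x, T) + T * barrier_slope T" if y: "y \<in> Q" for y
    proof -
      have t: "0 \<le> snd y" "snd y \<le> T" using y by (cases y, simp add: mem_Q)+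
      \<comment> \<open>The increment of the exponential between \<open>snd y\<close> and
        \<open>T\<close> is at most its final slope times the elapsed time, by convexity.\<close>
      have "1 + (barrier_rate * (snd y - T)) \<le> exp (barrier_rate * (snd y - T))" by (rule exp_ge_add_one_self)
      then have "exp (barrier_rate * T) * (1 + barrier_rate * (snd y - T)) \<le> exp (barrier_rate * T) * exp (barrier_rate * (snd y - T))"
        by (intro mult_left_mono) auto
      also have "\<dots> = exp (barrier_rate * snd y)" by (simp add: exp_add[symmetric] algebra_simps)
      finally have "exp (barrier_rate * T) - exp (barrier_rate * snd y) \<le> exp (barrier_rate * T) * (barrier_rate * (T - snd y))"
        by (simp add: algebra_simps)
      then have "((2 * C0 + 1) / barrier_rate) * (exp (barrier_rate * T) - exp (barrier_rate * snd y))
          \<le> ((2 * C0 + 1) / barrier_rate) * (exp (barrier_rate * T) * (barrier_rate * (T - snd y)))"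
        using r C0_pos by (intro mult_left_mono) auto
      also have "\<dots> = (T - snd y) * barrier_slope T" using r unfolding barrier_slope_def by simp
      also have "\<dots> \<le> T * barrier_slope T" using t barrier_slope_ge[of T] T_pos by (intro mult_right_mono) auto
      finally have "\<psi> (snd y) - \<psi> T \<le> T * barrier_slope T" unfolding \<psi>_def by (simp add: algebra_simps)
      then show ?thesis using max[OF y] unfolding V_def 3 by simp
    qed
    ultimately show ?thesis using that by blast
  qed
qed

section \<open>Maximum principle for the time derivative\<close>

lemma HXP_linear_bound: "\<bar>HXP i k (x, q)\<bar> \<le> C0 * (1 + norm q)"
proof -
  have "(1 + norm q) powr \<tau> \<le> (1 + norm q) powr 1" using tau by (intro powr_mono) auto
  also have "\<dots> = 1 + norm q" by (simp add: add_nonneg_nonneg)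
  finally show ?thesis using HXP_bound[of i k x q] mult_left_mono[of "(1 + norm q) powr \<tau>" "1 + norm q" C0] C0_pos
    by (meson less_imp_le order_trans)
qed

text \<open>A qualitative bound: \<open>G\<close> depends on the solution through the suprema of its
  derivatives. It enters only the rate of an auxiliary exponential in \<open>ut_principle\<close>,
  whose amplitude tends to 0, and so leaves no trace in the constants. The factor
  \<open>f\<^sub>m\<close> is split off because the time derivative of \<open>m\<close> is known
  there only after multiplication by \<open>f\<^sub>m\<close>.\<close>

lemma drift_bounded:
  obtains G where "G > 0" "\<And>z. z \<in> Q \<Longrightarrow>
    \<bar>(\<Sum>i\<in>UNIV. bb i z * dd pos_dom (0, 1) (fx i) (mz z)) - dd pos_dom (0, 1) X (mz z) * divb z\<bar> \<le> G * fm (mz z)"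
proof -
  have "\<exists>M. \<forall>z\<in>Q. \<bar>dd Q (ex k) u z\<bar> \<le> M" for k
    by (rule bounded_on_Q[OF Ck_on_continuous[OF Ck_du] periodic_du]) blast
  then have "\<forall>k. \<exists>M. \<forall>z\<in>Q. \<bar>p z $ k\<bar> \<le> M" unfolding p_nth by blast
  from choice[OF this] obtain Mp where Mp: "\<And>k z. z \<in> Q \<Longrightarrow> \<bar>p z $ k\<bar> \<le> Mp k" by blast
  have "\<exists>M. \<forall>z\<in>Q. \<bar>U2 (ex i) (ex k) z\<bar> \<le> M" for i k
    by (rule bounded_on_Q[OF cont_U2 periodic_U2]) blast
  then have "\<forall>ik. \<exists>M. \<forall>z\<in>Q. \<bar>U2 (ex (fst ik)) (ex (snd ik)) z\<bar> \<le> M" by blast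
  from choice[OF this] obtain MU' where MU': "\<And>ik z. z \<in> Q \<Longrightarrow> \<bar>U2 (ex (fst ik)) (ex (snd ik)) z\<bar> \<le> MU' ik" by blast
  define MU where "MU i k = MU' (i, k)" for i k
  have MU: "\<bar>U2 (ex i) (ex k) z\<bar> \<le> MU i k" if "z \<in> Q" for i k z
    using MU'[OF that, of "(i, k)"] by (simp add: MU_def)
  obtain Mt where Mt: "\<And>z. z \<in> Q \<Longrightarrow> \<bar>ut z\<bar> \<le> Mt"
    by (rule bounded_on_Q[OF cont_ut periodic_du[of et, folded ut_def]]) blast
  define R where "R = (\<Sum>k\<in>UNIV. Mp k)"
  have R: "norm (p z) \<le> R" if "z \<in> Q" for z
    unfolding R_def by (rule order_trans[OF norm_le_l1_cart sum_mono[OF Mp[OF that]]])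
  have C: "C0 \<ge> 0" using C0_pos by simp
  define W where "W = C0 * R\<^sup>2 + C0 + Mt"
  have W: "\<bar>ww z\<bar> \<le> W" if z: "z \<in> Q" for z
  proof -
    have a: "(norm (p z))\<^sup>2 \<le> R\<^sup>2" using R[OF z] by (intro power_mono) auto
    have "hh z \<le> C0 * (norm (p z))\<^sup>2 + C0" "(norm (p z))\<^sup>2 / C0 - C0 \<le> hh z" unfolding hh_def zp_def by (rule H_bounds)+
    moreover have "C0 * (norm (p z))\<^sup>2 \<le> C0 * R\<^sup>2" using a C by (intro mult_left_mono) auto
    moreover have "0 \<le> (norm (p z))\<^sup>2 / C0" "0 \<le> C0 * R\<^sup>2" using C by auto
    ultimately have "\<bar>hh z\<bar> \<le> C0 * R\<^sup>2 + C0" by linarith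
    then show ?thesis using ww_eq[OF z] Mt[OF z] unfolding W_def by linarith
  qed
  obtain c where c: "c > 0" "\<And>x \<mu>. \<mu> > 0 \<Longrightarrow> F (x, \<mu>) \<ge> - W \<Longrightarrow> X (x, \<mu>) \<ge> c" using X_lower[of W] by blast
  define Y where "Y = C0 * (C0 * (3 + W + (C0 + C0 * W)))"
  define U where "U = (\<Sum>i\<in>(UNIV::'n set). C0 * (1 + R) + (\<Sum>k\<in>(UNIV::'n set). MU i k * C0))"
  define G where "G = real CARD('n) * ((C0 * (1 + R)) * (Y / c)) + C0 * U"
  have main: "\<bar>(\<Sum>i\<in>UNIV. bb i z * dd pos_dom (0, 1) (fx i) (mz z)) - dd pos_dom (0, 1) X (mz z) * divb z\<bar> \<le> G * fm (mz z)"
    if z: "z \<in> Q" for z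
  proof -
    have mp: "m z > 0" by (rule m_pos[OF z])
    have f0: "fm (mz z) > 0" unfolding mz_def by (rule fm_pos[OF mp])
    have Wz: "\<bar>F (fst z, m z)\<bar> \<le> W" using W[OF z] by (simp only: ww_def mz_def)
    have Xc: "X (mz z) \<ge> c" unfolding mz_def by (rule c(2)[OF mp]) (use Wz in linarith)
    have "X (fst z, m z) \<le> C0 + C0 * W" by (rule order_trans[OF X_le[OF mp]]) (use Wz C in \<open>simp add: mult_left_mono\<close>)
    then have "F_growth \<tau> f (fst z, m z) \<le> 3 + W + (C0 + C0 * W)"
      using F_growth_le[OF mp, of "fst z"] Wz by linarith
    then have "C0 * (C0 * F_growth \<tau> f (fst z, m z)) \<le> Y" unfolding Y_def using C by (intro mult_left_mono) auto
    moreover have "C0 * norm (D_fst pos_dom F (fst z, m z)) \<le> C0 * (C0 * F_growth \<tau> f (fst z, m z))"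
      by (rule mult_left_mono[OF fx_bounds(4)[OF mp] C])
    ultimately have Yb: "m z * \<bar>dd pos_dom (0, 1) (fx i) (mz z)\<bar> \<le> Y" for i
      unfolding mz_def using fx_bounds(3)[OF mp, of i "fst z"] by linarith
    have Y0: "Y \<ge> 0" using order_trans[OF _ Yb] mp by simp
    \<comment> \<open>The bound on \<open>m f\<^sub>x\<^sub>m\<close> is converted into one by
      \<open>f\<^sub>m\<close> through \<open>X = m f\<^sub>m \<ge> c\<close>; the factor
      \<open>m\<close> cancels.\<close>
    have fxm: "\<bar>dd pos_dom (0, 1) (fx i) (mz z)\<bar> \<le> (Y / c) * fm (mz z)" for i
    proof -
      have "Y * c \<le> Y * X (mz z)" using Xc Y0 by (intro mult_left_mono) auto
      then have "Y \<le> (Y / c) * X (mz z)" using c(1) by (simp add: pos_le_divide_eq)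
      then have "m z * \<bar>dd pos_dom (0, 1) (fx i) (mz z)\<bar> \<le> m z * ((Y / c) * fm (mz z))"
        using Yb[of i] unfolding X_def by (simp add: mz_def ac_simps)
      then show ?thesis using mp by (rule mult_left_le_imp_le)
    qed
    have bbb: "\<bar>bb i z\<bar> \<le> C0 * (1 + R)" for i
      unfolding bb_def zp_def by (rule order_trans[OF HP_bound]) (use R[OF z] C in \<open>simp add: mult_left_mono\<close>)
    have hxp: "\<bar>HXP i i (zp z)\<bar> \<le> C0 * (1 + R)" for i
      unfolding zp_def by (rule order_trans[OF HXP_linear_bound]) (use R[OF z] C in \<open>simp add: mult_left_mono\<close>)
    have dv: "\<bar>divb z\<bar> \<le> U"
      unfolding divb_def U_def
    proof (rule order_trans[OF sum_abs], rule sum_mono)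
      fix i
      have "\<bar>\<Sum>k\<in>UNIV. U2 (ex i) (ex k) z * HPP k i (zp z)\<bar> \<le> (\<Sum>k\<in>UNIV. MU i k * C0)"
        by (rule order_trans[OF sum_abs], rule sum_mono, rule abs_mult_le[OF MU[OF z]])
          (simp add: zp_def HPP_entry_bound)
      then show "\<bar>HXP i i (zp z) + (\<Sum>k\<in>UNIV. U2 (ex i) (ex k) z * HPP k i (zp z))\<bar> \<le> C0 * (1 + R) + (\<Sum>k\<in>UNIV. MU i k * C0)"
        using hxp[of i] by linarith
    qed
    have 1: "\<bar>\<Sum>i\<in>UNIV. bb i z * dd pos_dom (0, 1) (fx i) (mz z)\<bar> \<le> real CARD('n) * ((C0 * (1 + R)) * ((Y / c) * fm (mz z)))"
      by (intro sum_abs_bound abs_mult_le bbb fxm)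
    have 2: "\<bar>dd pos_dom (0, 1) X (mz z) * divb z\<bar> \<le> (C0 * fm (mz z)) * U"
      by (rule abs_mult_le[OF _ dv]) (simp add: mz_def Xm_bound[OF mp])
    have "G * fm (mz z) = real CARD('n) * ((C0 * (1 + R)) * ((Y / c) * fm (mz z))) + (C0 * fm (mz z)) * U"
      unfolding G_def by (simp only: distrib_right mult.assoc mult.left_commute[of U] mult.commute[of U])
    then show ?thesis using 1 2 by linarith
  qed
  show ?thesis
  proof (rule that)
    show "\<bar>G\<bar> + 1 > 0" by linarith
    fix z assume z: "z \<in> Q"
    have "G * fm (mz z) \<le> (\<bar>G\<bar> + 1) * fm (mz z)"
      using fm_pos[OF m_pos[OF z], of "fst z"] unfolding mz_def by (intro mult_right_mono) auto
    then show "\<bar>(\<Sum>i\<in>UNIV. bb i z * dd pos_dom (0, 1) (fx i) (mz z)) - dd pos_dom (0, 1) X (mz z) * divb z\<bar>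
        \<le> (\<bar>G\<bar> + 1) * fm (mz z)"
      using main[OF z] by linarith
  qed
qed

text \<open>The coefficients of the elliptic equation do not depend explicitly on time, hence the time
  derivative of a solution satisfies a maximum principle.\<close>

lemma ut_principle:
  assumes s: "s = 1 \<or> s = - 1" and bd: "\<And>x. s * ut (x, 0) \<le> B" "\<And>x. s * ut (x, T) \<le> B" and y0: "y0 \<in> Q"
  shows "s * ut y0 \<le> B"
proof -
  obtain G where G: "G > 0" "\<And>z. z \<in> Q \<Longrightarrow>
    \<bar>(\<Sum>i\<in>UNIV. bb i z * dd pos_dom (0, 1) (fx i) (mz z)) - dd pos_dom (0, 1) X (mz z) * divb z\<bar> \<le> G * fm (mz z)"
    using drift_bounded by blast
  \<comment> \<open>A rate strictly above \<open>G\<close> is what contradicts an interior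
    maximum.\<close>
  define l where "l = G + 1"
  have l: "l > 0" "l > G" using G by (auto simp: l_def)
  have *: "s * ut y0 \<le> B + \<epsilon> * exp (l * T)" if e: "\<epsilon> > 0" for \<epsilon>
  proof -
    define V where "V z = s * ut z + \<epsilon> * exp (l * snd z)" for z
    define D where "D v z = s * U2 v et z + snd v * (\<epsilon> * l * exp (l * snd z))" for v z
    have ex1: "((\<lambda>t. \<epsilon> * exp (l * t)) has_real_derivative \<epsilon> * l * exp (l * t)) (at t)" for t
      by (auto intro!: derivative_eq_intros)
    have ex2: "((\<lambda>t. \<epsilon> * l * exp (l * t)) has_real_derivative \<epsilon> * l * l * exp (l * t)) (at t)" for t
      by (auto intro!: derivative_eq_intros)
    have DV: "(V has_derivative (\<lambda>v. D v y)) (at y within Q)" if "y \<in> Q" for y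
      unfolding V_def[abs_def] D_def U2_def
      by (intro has_derivative_add has_derivative_mult_right that time_derivative ex1)
        (use dd_has_derivative[OF diff_ut[OF that]] in \<open>simp add: ut_def\<close>)
    have DD: "(D v has_derivative (\<lambda>w. s * dd Q w (U2 v et) y + snd v * (snd w * (\<epsilon> * l * l * exp (l * snd y))))) (at y within Q)"
      if "y \<in> Q" for v y
      unfolding D_def[abs_def]
      by (intro has_derivative_add has_derivative_mult_right dd_has_derivative diff_ddu that time_derivative ex2)
    have cV: "continuous_on Q V" unfolding V_def[abs_def] by (intro continuous_intros cont_ut)
    have pV: "periodic_fst {0..T} V"
      using periodic_du[of et] unfolding V_def ut_def periodic_fst_def periodic_def by simp
    obtain z where z: "z \<in> Q" and max: "\<And>y. y \<in> Q \<Longrightarrow> V y \<le> V z" using max_on_Q[OF cV pV] by metis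
    have zt: "0 \<le> snd z" "snd z \<le> T" using z by (cases z, simp add: mem_Q)+
    have "V z \<le> B + \<epsilon> * exp (l * T)"
      using z
    proof (cases rule: Q_cases)
      case 1
      obtain v :: "'n \<Rightarrow> real^'n" where v: "\<And>i k. HPP i k (zp z) = (\<Sum>j\<in>UNIV. v j $ i * v j $ k)"
        using HPP_decomposition[of "fst z" "p z"] unfolding zp_def by metis
      note first = interior_max_conditions(1)[OF 1 max DV DD[OF z]]
      note second = interior_max_conditions(2)[OF 1 max DV DD[OF z]]
      define E where "E = \<epsilon> * l * exp (l * snd z)"
      have Ep: "E > 0" unfolding E_def using e l by simp
      have s0: "s \<noteq> 0" using s by auto
      have "D (ex k) z = 0" for k using first by blast
      then have r0: "U2 et (ex k) z = 0" for k
        unfolding D_def using s0 U2_sym[OF z, of et "ex k"] by simp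
      have "D et z = 0" using first by blast
      then have utt: "s * U2 et et z = - E" unfolding D_def E_def by simp
      define A where "A = (\<Sum>i\<in>UNIV. bb i z * dd pos_dom (0, 1) (fx i) (mz z)) - dd pos_dom (0, 1) X (mz z) * divb z"
      define \<mu> where "\<mu> = dd Q et m z"
      note mp = m_pos[OF z] and mzp = mz_pos[OF z]
      \<comment> \<open>At the maximum \<open>Du\<^sub>t = 0\<close>, so everything composed with
        \<open>(x, Du)\<close> has vanishing time derivative. In the equation differentiated in time
        only the dependence on the density survives.\<close>
      have c0: "dd Q et (\<lambda>y. K (zp y)) z = 0" if "K differentiable (at (zp z))" for K :: "(real^'n) \<times> (real^'n) \<Rightarrow> real"
        unfolding comp_zp(2)[OF z that] by (simp add: r0)
      have b0: "dd Q et (bb k) z = 0" for k unfolding bb_def[abs_def] by (rule c0[OF diff_HP])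
      have h0: "dd Q et hh z = 0" unfolding hh_def[abs_def] by (rule c0[OF diff_H])
      have fx0: "dd Q et (\<lambda>y. fx i (mz y)) z = \<mu> * dd pos_dom (0, 1) (fx i) (mz z)" for i
        unfolding comp_mz(2)[OF z mp diff_fx[OF mzp]] \<mu>_def by simp
      have X0: "dd Q et (\<lambda>y. X (mz y)) z = \<mu> * dd pos_dom (0, 1) X (mz z)"
        unfolding comp_mz(2)[OF z mp X_deriv(1)[OF mzp]] \<mu>_def by simp
      have f0: "fm (mz z) > 0" unfolding mz_def by (rule fm_pos[OF mp])
      \<comment> \<open>Since \<open>h\<close> is stationary in time here,
        \<open>w\<^sub>t = - u\<^sub>t\<^sub>t\<close>, and the first order condition in time
        evaluates it.\<close>
      have mu: "s * \<mu> * fm (mz z) = E"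
        using ww_deriv(1)[OF z, of et] ww_deriv(2)[OF z, of et] h0 utt
        by (simp add: \<mu>_def algebra_simps)
      define TT where "TT a = dd Q et (U2 a a) z" for a
      have eq0: "TT (- bv z, 1) + X (mz z) * (\<Sum>j\<in>UNIV. TT (v j, 0)) = \<mu> * A"
      proof -
        have "(\<Sum>i\<in>UNIV. bb i z * (\<mu> * dd pos_dom (0, 1) (fx i) (mz z)))
            = \<mu> * (\<Sum>i\<in>UNIV. bb i z * dd pos_dom (0, 1) (fx i) (mz z))"
          by (simp add: sum_distrib_left mult.left_commute)
        then show ?thesis
          using EE_deriv_directional[OF 1 v, of et]
          unfolding b0 c0[OF diff_HX] c0[OF diff_HXP] c0[OF diff_HPP] fx0 X0 TT_def[symmetric] A_def
          by (simp add: sum_negf right_diff_distrib mult.assoc)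
      qed
      have eq: "s * TT (- bv z, 1) + X (mz z) * (\<Sum>j\<in>UNIV. s * TT (v j, 0)) = s * \<mu> * A"
      proof -
        have "s * TT (- bv z, 1) + X (mz z) * (\<Sum>j\<in>UNIV. s * TT (v j, 0))
            = s * (TT (- bv z, 1) + X (mz z) * (\<Sum>j\<in>UNIV. TT (v j, 0)))"
          unfolding sum_distrib_left[symmetric] by (simp only: distrib_left mult.left_commute)
        then show ?thesis unfolding eq0 by (simp only: mult.assoc)
      qed
      have perm: "dd Q a (U2 a et) z = TT a" for a
        unfolding TT_def using U3_sym'[OF z, of a a et] U3_sym[OF 1, of a et a] by simp
      have 2: "s * TT (- bv z, 1) + l * E \<le> 0"
        using second[of "(- bv z, 1)"] unfolding perm E_def by (simp add: algebra_simps)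
      have "s * TT (v j, 0) \<le> 0" for j using second[of "(v j, 0)"] unfolding perm by simp
      then have "(\<Sum>j\<in>UNIV. s * TT (v j, 0)) \<le> 0" by (intro sum_nonpos) simp
      moreover have "X (mz z) > 0" unfolding mz_def by (rule X_pos[OF mp])
      ultimately have "X (mz z) * (\<Sum>j\<in>UNIV. s * TT (v j, 0)) \<le> 0" by (simp add: mult_le_0_iff)
      then have "s * \<mu> * A \<le> - (l * E)" using eq 2 by linarith
      then have "l * E \<le> \<bar>s * \<mu>\<bar> * \<bar>A\<bar>" by (simp add: abs_mult[symmetric])
      also have "\<dots> \<le> \<bar>s * \<mu>\<bar> * (G * fm (mz z))" using G(2)[OF z] unfolding A_def by (intro mult_left_mono) auto
      also have "\<dots> = G * \<bar>s * \<mu> * fm (mz z)\<bar>" using f0 by (simp add: abs_mult)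
      also have "\<dots> = G * E" unfolding mu using Ep by simp
      finally have "l \<le> G" using Ep by simp
      then show ?thesis using l by simp
    next
      case (2 x)
      then show ?thesis using bd(1)[of x] e l T_pos unfolding V_def
        by (smt (verit) exp_le_cancel_iff mult_left_mono mult_nonneg_nonneg mult_zero_right snd_conv)
    next
      case (3 x)
      then show ?thesis using bd(2)[of x] unfolding V_def by simp
    qed
    moreover have "s * ut y0 \<le> V y0" unfolding V_def using e by simp
    ultimately show ?thesis using max[OF y0] by linarith
  qed
  show ?thesis
  \<comment> \<open>The amplitude of the auxiliary exponential tends to 0 with its rate kept
    fixed.\<close>
  proof (rule field_le_epsilon)
    fix d :: real assume d: "d > 0"
    show "s * ut y0 \<le> B + d" using *[of "d / exp (l * T)"] d by simp
  qed
qed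

end

section \<open>The gradient estimate\<close>

text \<open>Here \<open>a\<close> and \<open>Z\<close> measure second derivatives of
  \<open>u\<close>. Three completed squares absorb the terms linear in them. The third leaves
  \<open>25 / 2 * A ^ 18 * k\<^sup>2 * y ^ 4\<close>, and \<open>k\<close> is the value for which
  this is exactly half of the good term \<open>k * y ^ 4 / (4 * A\<^sup>2)\<close>. The other errors
  add up to 614 = 121 + 288 + 205 times \<open>A ^ 18 * y ^ 3 * \<sigma>\<close>.\<close>

lemma bernstein_algebra:
  fixes A y \<sigma> k a Z :: real
  assumes A: "A \<ge> 1" and y: "y \<ge> 1" and \<sigma>: "1 \<le> \<sigma>" "\<sigma> \<le> y" and k: "k = 1 / (100 * A ^ 20)"
    and ineq: "a\<^sup>2 / A + Z\<^sup>2 / A\<^sup>2 + k * (y^4 / (4 * A\<^sup>2)) - 22 * (A^4 * (y * \<sigma>) * a)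
       - 24 * (A^8 * (y * \<sigma>) * Z) - 5 * (A^8 * k * y\<^sup>2 * Z) - 205 * (A^9 * (y^3 * \<sigma>)) \<le> 0"
  shows "y \<le> 500000 * A ^ 40 * \<sigma>"
proof -
  have Ap: "A > 0" and A0: "A \<noteq> 0" using A by auto
  have "0 \<le> (a - 11 * A^5 * (y * \<sigma>))\<^sup>2 / A" using Ap by simp
  also have "\<dots> = a\<^sup>2 / A - 22 * (A^4 * (y * \<sigma>) * a) + 121 * (A^9 * (y * \<sigma>)\<^sup>2)"
    using A0 by (simp add: field_simps power2_eq_square eval_nat_numeral)
  finally have 1: "22 * (A^4 * (y * \<sigma>) * a) \<le> a\<^sup>2 / A + 121 * (A^9 * (y * \<sigma>)\<^sup>2)" by linarith
  have "0 \<le> (Z - 24 * A^10 * (y * \<sigma>))\<^sup>2 / (2 * A\<^sup>2)" by simp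
  also have "\<dots> = Z\<^sup>2 / A\<^sup>2 / 2 - 24 * (A^8 * (y * \<sigma>) * Z) + 288 * (A^18 * (y * \<sigma>)\<^sup>2)"
    using A0 by (simp add: field_simps power2_eq_square eval_nat_numeral)
  finally have 2: "24 * (A^8 * (y * \<sigma>) * Z) \<le> Z\<^sup>2 / A\<^sup>2 / 2 + 288 * (A^18 * (y * \<sigma>)\<^sup>2)" by linarith
  have "0 \<le> (Z - 5 * A^10 * k * y\<^sup>2)\<^sup>2 / (2 * A\<^sup>2)" by simp
  also have "\<dots> = Z\<^sup>2 / A\<^sup>2 / 2 - 5 * (A^8 * k * y\<^sup>2 * Z) + 25 / 2 * (A^18 * k\<^sup>2 * y^4)"
    using A0 by (simp add: field_simps power2_eq_square eval_nat_numeral)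
  finally have 3: "5 * (A^8 * k * y\<^sup>2 * Z) \<le> Z\<^sup>2 / A\<^sup>2 / 2 + 25 / 2 * (A^18 * k\<^sup>2 * y^4)" by linarith
  have 4: "25 / 2 * (A^18 * k\<^sup>2 * y^4) = k * (y^4 / (4 * A\<^sup>2)) / 2"
    unfolding k using A0 by (simp add: field_simps eval_nat_numeral)
  have ys: "(y * \<sigma>)\<^sup>2 \<le> y^3 * \<sigma>"
  proof -
    have "y * y * \<sigma> * \<sigma> \<le> y * y * \<sigma> * y" using \<sigma> y by (intro mult_left_mono) auto
    then show ?thesis by (simp add: power2_eq_square power3_eq_cube ac_simps)
  qed
  have t3: "y^3 * \<sigma> \<ge> 0" using y \<sigma> by simp
  have "A^9 \<le> A^18" using A by (intro power_increasing) auto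
  then have "A^9 * (y * \<sigma>)\<^sup>2 \<le> A^18 * (y^3 * \<sigma>)" "A^9 * (y^3 * \<sigma>) \<le> A^18 * (y^3 * \<sigma>)"
    "A^18 * (y * \<sigma>)\<^sup>2 \<le> A^18 * (y^3 * \<sigma>)"
    using ys t3 Ap by (auto intro!: mult_mono mult_left_mono)
  note mono = this
  have "p4 / 2 \<le> 614 * r4" if "22 * p1 \<le> q1 + 121 * r1" "24 * p2 \<le> q2 / 2 + 288 * r2"
    "5 * p3 \<le> q2 / 2 + p5" "p5 = p4 / 2" "q1 + q2 + p4 - 22 * p1 - 24 * p2 - 5 * p3 - 205 * r3 \<le> 0"
    "r1 \<le> r4" "r3 \<le> r4" "r2 \<le> r4" for p1 p2 p3 p4 p5 q1 q2 r1 r2 r3 r4 :: real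
    using that by linarith
  from this[OF 1 2 3 4 ineq mono] have "k * (y^4 / (4 * A\<^sup>2)) / 2 \<le> 614 * (A^18 * (y^3 * \<sigma>))" .
  \<comment> \<open>The factor \<open>800 * A ^ 22\<close> normalises the coefficient of
    \<open>y ^ 4\<close> to 1.\<close>
  then have "k * (y^4 / (4 * A\<^sup>2)) / 2 * (800 * A^22) \<le> 614 * (A^18 * (y^3 * \<sigma>)) * (800 * A^22)"
    using Ap by (intro mult_right_mono) auto
  moreover have "k * (y^4 / (4 * A\<^sup>2)) / 2 * (800 * A^22) = y^4"
    unfolding k using A0 by (simp add: field_simps eval_nat_numeral)
  moreover have "614 * (A^18 * (y^3 * \<sigma>)) * (800 * A^22) = y^3 * (491200 * A^40 * \<sigma>)"
    by (simp add: power_add[of A 18 22, simplified])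
  moreover have "y^4 = y^3 * y" by (simp add: eval_nat_numeral)
  ultimately have "y^3 * y \<le> y^3 * (491200 * A^40 * \<sigma>)" by (simp only:)
  then have "y \<le> 491200 * A^40 * \<sigma>" using y by (simp add: mult_le_cancel_left)
  moreover have "A^40 * \<sigma> \<ge> 0" using Ap \<sigma> by simp
  ultimately show ?thesis by simp
qed

section \<open>Second order condition at an interior maximum of \<open>V\<close>\<close>

context mfg
begin

lemma hh_second:
  assumes z: "z \<in> Q"
  shows "((\<lambda>y. dd Q v hh y) has_derivative
    (\<lambda>w. (\<Sum>i\<in>UNIV. fst v $ i * dd Q w (\<lambda>y. HX i (zp y)) z)
       + (\<Sum>k\<in>UNIV. U2 v (ex k) z * dd Q w (bb k) z + dd Q w (U2 v (ex k)) z * bb k z))) (at z within Q)"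
proof -
  have d: "((\<lambda>y. (\<Sum>i\<in>UNIV. fst v $ i * HX i (zp y)) + (\<Sum>k\<in>UNIV. U2 v (ex k) y * bb k y)) has_derivative
    (\<lambda>w. (\<Sum>i\<in>UNIV. fst v $ i * dd Q w (\<lambda>y. HX i (zp y)) z)
       + (\<Sum>k\<in>UNIV. U2 v (ex k) z * dd Q w (bb k) z + dd Q w (U2 v (ex k)) z * bb k z))) (at z within Q)"
    by (intro has_derivative_add has_derivative_sum has_derivative_mult_right has_derivative_mult
        dd_has_derivative comp_zp(1)[OF z diff_HX] diff_ddu[OF z] bb_deriv(1)[OF z])
  show ?thesis by (rule has_derivative_transform[OF z hh_deriv(2) d])
qed

text \<open>The second order conditions for \<open>V\<close> along \<open>(- b, 1)\<close> and,
  weighted by \<open>X\<close>, along the vectors \<open>v m\<close> are added. The weights are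
  those of the elliptic equation, so the third derivatives of \<open>u\<close> form the principal
  part of the equation differentiated along \<open>\<beta>\<close>, and the terms with
  \<open>k * \<phi> z\<close> form the principal part of the equation itself. Both are replaced by
  lower order terms.\<close>

lemma bernstein_sum:
  fixes V \<phi> :: "(real^'n) \<times> real \<Rightarrow> real" and c e k :: real
  defines "\<phi> \<equiv> \<lambda>y. u y + c * snd y + e"
  defines "V \<equiv> \<lambda>y. hh y + (k / 2) * (\<phi> y * \<phi> y)"
  assumes k0: "k \<ge> 0" and z: "z \<in> interior Q" and max: "\<And>y. y \<in> Q \<Longrightarrow> V y \<le> V z"
    and v: "\<And>i j. HPP i j (zp z) = (\<Sum>m\<in>UNIV. v m $ i * v m $ j)"
  defines "q \<equiv> \<lambda>l. U2 (- bv z, 1) (ex l) z" and "s \<equiv> \<lambda>m l. U2 (v m, 0) (ex l) z"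
  defines "\<Delta> \<equiv> ut z + c - (\<Sum>l\<in>UNIV. bb l z * p z $ l)"
  defines "\<beta> \<equiv> (bv z, 0 :: real)"
  shows "(\<Sum>i\<in>UNIV. \<Sum>j\<in>UNIV. bb i z * bb j z * HXX j i (zp z)) - 2 * (\<Sum>i\<in>UNIV. \<Sum>l\<in>UNIV. bb i z * q l * HXP i l (zp z))
      + (\<Sum>j\<in>UNIV. \<Sum>l\<in>UNIV. q j * q l * HPP j l (zp z))
    + X (mz z) * (\<Sum>m\<in>UNIV. (\<Sum>i\<in>UNIV. \<Sum>j\<in>UNIV. v m $ i * v m $ j * HXX j i (zp z))
        + 2 * (\<Sum>i\<in>UNIV. \<Sum>l\<in>UNIV. v m $ i * s m l * HXP i l (zp z)) + (\<Sum>j\<in>UNIV. \<Sum>l\<in>UNIV. s m j * s m l * HPP j l (zp z)))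
    + (2 * (\<Sum>j\<in>UNIV. dd Q \<beta> (bb j) z * q j)
     - (\<Sum>i\<in>UNIV. dd Q \<beta> (bb i) z * (HX i (zp z) - fx i (mz z))
          + bb i z * (dd Q \<beta> (\<lambda>y. HX i (zp y)) z - dd Q \<beta> (\<lambda>y. fx i (mz y)) z))
     - dd Q \<beta> (\<lambda>y. X (mz y)) z * divb z
     - X (mz z) * (\<Sum>i\<in>UNIV. dd Q \<beta> (\<lambda>y. HXP i i (zp y)) z
          + (\<Sum>j\<in>UNIV. U2 (ex i) (ex j) z * dd Q \<beta> (\<lambda>y. HPP j i (zp y)) z)))
    + k * \<Delta>\<^sup>2 - k * \<phi> z * ((\<Sum>i\<in>UNIV. bb i z * (HX i (zp z) - fx i (mz z))) + X (mz z) * (\<Sum>i\<in>UNIV. HXP i i (zp z))) \<le> 0"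
proof -
  have zQ: "z \<in> Q" using I_sub[OF z] .
  define d\<phi> where "d\<phi> v y = dd Q v u y + snd v * c" for v y
  define D where "D v y = dd Q v hh y + (k / 2) * (\<phi> y * d\<phi> v y + d\<phi> v y * \<phi> y)" for v y
  have phi: "(\<phi> has_derivative (\<lambda>v. d\<phi> v y)) (at y within Q)" if "y \<in> Q" for y
  proof -
    have "((\<lambda>y. u y + c * snd y + e) has_derivative (\<lambda>v. dd Q v u y + c * snd v + 0)) (at y within Q)"
      by (intro has_derivative_add has_derivative_mult_right has_derivative_snd has_derivative_ident
          has_derivative_const dd_has_derivative diff_u that)
    then show ?thesis unfolding \<phi>_def d\<phi>_def by (simp add: mult.commute)
  qed
  have DV: "(V has_derivative (\<lambda>v. D v y)) (at y within Q)" if "y \<in> Q" for y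
    unfolding V_def D_def
    by (intro has_derivative_add has_derivative_mult_right has_derivative_mult phi that dd_has_derivative hh_deriv(1))
  have DD: "(D v has_derivative (\<lambda>w. ((\<Sum>i\<in>UNIV. fst v $ i * dd Q w (\<lambda>y. HX i (zp y)) z)
       + (\<Sum>j\<in>UNIV. U2 v (ex j) z * dd Q w (bb j) z + dd Q w (U2 v (ex j)) z * bb j z))
      + (k / 2) * ((\<phi> z * (U2 w v z + 0) + d\<phi> w z * d\<phi> v z) + (d\<phi> v z * d\<phi> w z + (U2 w v z + 0) * \<phi> z)))) (at z within Q)" for v
    unfolding D_def[abs_def] d\<phi>_def[of v] U2_def[of _ v]
    by (intro has_derivative_add has_derivative_mult_right has_derivative_mult phi[OF zQ] hh_second[OF zQ]
        dd_has_derivative[OF diff_du[OF zQ]] has_derivative_const)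
  note second = interior_max_conditions(2)[OF z max DV DD]
  \<comment> \<open>By symmetry of third derivatives, those arising in the second derivative of
    \<open>h\<close> along \<open>\<xi>\<close> are the \<open>\<beta>\<close>-derivative of the
    second derivative of \<open>u\<close> along \<open>\<xi>\<close>.\<close>
  have comb: "(\<Sum>j\<in>UNIV. dd Q \<xi> (U2 \<xi> (ex j)) z * bb j z) = dd Q \<beta> (U2 \<xi> \<xi>) z" for \<xi>
  proof -
    have be: "\<beta> = (\<Sum>j\<in>UNIV. bb j z *\<^sub>R ex j)"
      using vec_expand[of "bv z"] unfolding \<beta>_def by (simp add: prod_eq_iff fst_sum snd_sum)
    have "dd Q \<beta> (U2 \<xi> \<xi>) z = (\<Sum>j\<in>UNIV. bb j z * dd Q (ex j) (U2 \<xi> \<xi>) z)"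
      unfolding be by (simp only: linear_sum[OF dd_linear[OF diff_ddu[OF zQ]]] linear_scale[OF dd_linear[OF diff_ddu[OF zQ]]] real_scaleR_def)
    also have "\<dots> = (\<Sum>j\<in>UNIV. dd Q \<xi> (U2 \<xi> (ex j)) z * bb j z)"
    proof (rule sum.cong[OF refl])
      fix j
      have "dd Q (ex j) (U2 \<xi> \<xi>) z = dd Q \<xi> (U2 \<xi> (ex j)) z"
        using U3_sym[OF z, of "ex j" \<xi> \<xi>] U3_sym'[OF zQ, of \<xi> "ex j" \<xi>] by simp
      then show "bb j z * dd Q (ex j) (U2 \<xi> \<xi>) z = dd Q \<xi> (U2 \<xi> (ex j)) z * bb j z" by simp
    qed
    finally show ?thesis by simp
  qed
  define HH where "HH \<xi> = (\<Sum>i\<in>UNIV. \<Sum>j\<in>UNIV. fst \<xi> $ i * fst \<xi> $ j * HXX j i (zp z))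
     + 2 * (\<Sum>i\<in>UNIV. \<Sum>l\<in>UNIV. fst \<xi> $ i * U2 \<xi> (ex l) z * HXP i l (zp z))
     + (\<Sum>j\<in>UNIV. \<Sum>l\<in>UNIV. U2 \<xi> (ex j) z * U2 \<xi> (ex l) z * HPP j l (zp z))" for \<xi>
  have sec: "HH \<xi> + dd Q \<beta> (U2 \<xi> \<xi>) z + k * (\<phi> z * U2 \<xi> \<xi> z + (d\<phi> \<xi> z)\<^sup>2) \<le> 0" for \<xi>
  proof -
    have dHX: "dd Q \<xi> (\<lambda>y. HX i (zp y)) z = (\<Sum>j\<in>UNIV. fst \<xi> $ j * HXX j i (zp z)) + (\<Sum>l\<in>UNIV. U2 \<xi> (ex l) z * HXP i l (zp z))" for i
      unfolding comp_zp(2)[OF zQ diff_HX] HXX_def HPX ..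
    have "(\<Sum>i\<in>UNIV. fst \<xi> $ i * dd Q \<xi> (\<lambda>y. HX i (zp y)) z) + (\<Sum>j\<in>UNIV. U2 \<xi> (ex j) z * dd Q \<xi> (bb j) z) = HH \<xi>"
    proof -
      have sw: "(\<Sum>j\<in>UNIV. \<Sum>i\<in>UNIV. U2 \<xi> (ex j) z * (fst \<xi> $ i * HXP i j (zp z)))
        = (\<Sum>i\<in>UNIV. \<Sum>j\<in>UNIV. fst \<xi> $ i * U2 \<xi> (ex j) z * HXP i j (zp z))"
        by (subst sum.swap) (simp add: ac_simps)
      have a: "(\<Sum>i\<in>UNIV. fst \<xi> $ i * dd Q \<xi> (\<lambda>y. HX i (zp y)) z)
          = (\<Sum>i\<in>UNIV. \<Sum>j\<in>UNIV. fst \<xi> $ i * fst \<xi> $ j * HXX j i (zp z))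
          + (\<Sum>i\<in>UNIV. \<Sum>l\<in>UNIV. fst \<xi> $ i * U2 \<xi> (ex l) z * HXP i l (zp z))"
        unfolding dHX by (simp add: distrib_left sum.distrib sum_distrib_left mult.assoc)
      have b: "(\<Sum>j\<in>UNIV. U2 \<xi> (ex j) z * dd Q \<xi> (bb j) z)
          = (\<Sum>i\<in>UNIV. \<Sum>l\<in>UNIV. fst \<xi> $ i * U2 \<xi> (ex l) z * HXP i l (zp z))
          + (\<Sum>j\<in>UNIV. \<Sum>l\<in>UNIV. U2 \<xi> (ex j) z * U2 \<xi> (ex l) z * HPP j l (zp z))"
        unfolding bb_deriv(2)[OF zQ] distrib_left sum.distrib sum_distrib_left sw
        by (simp add: mult.assoc HPP_sym[of _ _ "zp z"])
      show ?thesis unfolding a b HH_def by simp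
    qed
    then show ?thesis using second[of \<xi>] comb[of \<xi>]
      by (simp add: sum.distrib power2_eq_square field_simps)
  qed
  have X0: "X (mz z) > 0" unfolding mz_def by (rule X_pos[OF m_pos[OF zQ]])
  define \<xi>0 where "\<xi>0 = (- bv z, 1 :: real)"
  have d\<phi>0: "d\<phi> \<xi>0 z = \<Delta>"
  proof -
    have "\<xi>0 = et - (\<Sum>j\<in>UNIV. bb j z *\<^sub>R ex j)"
      using vec_expand[of "bv z"] unfolding \<xi>0_def by (simp add: prod_eq_iff fst_sum snd_sum)
    then have "dd Q \<xi>0 u z = ut z - (\<Sum>j\<in>UNIV. bb j z * dd Q (ex j) u z)"
      unfolding ut_def by (simp only: linear_diff[OF dd_linear[OF diff_u[OF zQ]]] linear_sum[OF dd_linear[OF diff_u[OF zQ]]]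
          linear_scale[OF dd_linear[OF diff_u[OF zQ]]] real_scaleR_def)
    then show ?thesis unfolding d\<phi>_def \<Delta>_def p_nth by (simp add: \<xi>0_def)
  qed
  define TT where "TT \<xi> = dd Q \<beta> (U2 \<xi> \<xi>) z" for \<xi>
  define UU where "UU \<xi> = U2 \<xi> \<xi> z" for \<xi>
  have s0: "HH \<xi>0 + TT \<xi>0 + k * (\<phi> z * UU \<xi>0 + \<Delta>\<^sup>2) \<le> 0" using sec[of \<xi>0] unfolding d\<phi>0 TT_def UU_def .
  \<comment> \<open>Along the spatial directions the squared derivative of \<open>\<phi>\<close> is
    dropped; along \<open>(- b, 1)\<close> it has been kept as
    \<open>\<Delta>\<^sup>2\<close>.\<close>
  have sm: "HH (v m, 0) + TT (v m, 0) + k * (\<phi> z * UU (v m, 0)) \<le> 0" for m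
  proof -
    have "0 \<le> k * (d\<phi> (v m, 0) z)\<^sup>2" using k0 by simp
    then show ?thesis using sec[of "(v m, 0)"] unfolding TT_def UU_def distrib_left by linarith
  qed
  have "(\<Sum>m\<in>UNIV. HH (v m, 0) + TT (v m, 0) + k * (\<phi> z * UU (v m, 0))) \<le> 0" by (intro sum_nonpos sm)
  then have "X (mz z) * (\<Sum>m\<in>UNIV. HH (v m, 0) + TT (v m, 0) + k * (\<phi> z * UU (v m, 0))) \<le> 0"
    using X0 by (simp add: mult_le_0_iff)
  then have "X (mz z) * (\<Sum>m\<in>UNIV. HH (v m, 0)) + X (mz z) * (\<Sum>m\<in>UNIV. TT (v m, 0)) + k * \<phi> z * (X (mz z) * (\<Sum>m\<in>UNIV. UU (v m, 0))) \<le> 0"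
    by (simp add: sum.distrib sum_distrib_left[symmetric] distrib_left ac_simps)
  then have main: "HH \<xi>0 + X (mz z) * (\<Sum>m\<in>UNIV. HH (v m, 0)) + (TT \<xi>0 + X (mz z) * (\<Sum>m\<in>UNIV. TT (v m, 0)))
     + k * \<Delta>\<^sup>2 + k * \<phi> z * (UU \<xi>0 + X (mz z) * (\<Sum>m\<in>UNIV. UU (v m, 0))) \<le> 0"
    using s0 by (simp add: algebra_simps)
  have h0: "HH \<xi>0 = (\<Sum>i\<in>UNIV. \<Sum>j\<in>UNIV. bb i z * bb j z * HXX j i (zp z)) - 2 * (\<Sum>i\<in>UNIV. \<Sum>l\<in>UNIV. bb i z * q l * HXP i l (zp z))
      + (\<Sum>j\<in>UNIV. \<Sum>l\<in>UNIV. q j * q l * HPP j l (zp z))"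
    unfolding HH_def q_def \<xi>0_def by (simp add: sum_negf)
  have hm: "HH (v m, 0) = (\<Sum>i\<in>UNIV. \<Sum>j\<in>UNIV. v m $ i * v m $ j * HXX j i (zp z))
        + 2 * (\<Sum>i\<in>UNIV. \<Sum>l\<in>UNIV. v m $ i * s m l * HXP i l (zp z)) + (\<Sum>j\<in>UNIV. \<Sum>l\<in>UNIV. s m j * s m l * HPP j l (zp z))" for m
    unfolding HH_def s_def by simp
  have uu: "UU \<xi>0 + X (mz z) * (\<Sum>m\<in>UNIV. UU (v m, 0)) = - ((\<Sum>i\<in>UNIV. bb i z * (HX i (zp z) - fx i (mz z))) + X (mz z) * (\<Sum>i\<in>UNIV. HXP i i (zp z)))"
    using EE_directional[OF z v] unfolding UU_def \<xi>0_def by linarith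
  have tt: "TT \<xi>0 + X (mz z) * (\<Sum>m\<in>UNIV. TT (v m, 0)) = 2 * (\<Sum>j\<in>UNIV. dd Q \<beta> (bb j) z * q j)
     - (\<Sum>i\<in>UNIV. dd Q \<beta> (bb i) z * (HX i (zp z) - fx i (mz z))
          + bb i z * (dd Q \<beta> (\<lambda>y. HX i (zp y)) z - dd Q \<beta> (\<lambda>y. fx i (mz y)) z))
     - dd Q \<beta> (\<lambda>y. X (mz y)) z * divb z
     - X (mz z) * (\<Sum>i\<in>UNIV. dd Q \<beta> (\<lambda>y. HXP i i (zp y)) z
          + (\<Sum>j\<in>UNIV. U2 (ex i) (ex j) z * dd Q \<beta> (\<lambda>y. HPP j i (zp y)) z))"
    using EE_deriv_directional[OF z v, of \<beta>] unfolding TT_def \<xi>0_def q_def by linarith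
  show ?thesis using main unfolding h0 hm uu tt by linarith
qed

end

text \<open>Expresses the growth hypotheses through one length scale \<open>y\<close> and the
  deficit \<open>\<sigma> = y powr \<tau>\<close>. The last three items pair the negative powers
  from the third derivatives of \<open>H\<close> with the sizes of \<open>b\<close> and of the
  second derivatives of \<open>u\<close> along \<open>b\<close>.\<close>

lemma scale_facts:
  fixes P y \<sigma> \<tau> :: real
  assumes P: "0 \<le> P" "P \<le> y" and y: "1 \<le> y" and t: "0 \<le> \<tau>" "\<tau> < 1" and \<sigma>: "\<sigma> = y powr \<tau>"
  shows "1 \<le> \<sigma>" "\<sigma> \<le> y" "(1 + P) powr \<tau> \<le> 2 * \<sigma>" "P powr (1 + \<tau>) \<le> y * \<sigma>"
    and "(1 + P) powr (1 + \<tau>) * (1 + P) powr (-1) \<le> 2 * \<sigma>"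
    and "(1 + P) powr (1 + \<tau>) * (1 + P) powr (\<tau> - 1) \<le> 4 * (y * \<sigma>)"
    and "(1 + P) * (1 + P) powr (\<tau> - 1) \<le> 2 * \<sigma>"
proof -
  show s1: "1 \<le> \<sigma>" unfolding \<sigma> using y t(1) by (rule ge_one_powr_ge_zero)
  have "y powr \<tau> \<le> y powr 1" using y t by (intro powr_mono) auto
  then show s2: "\<sigma> \<le> y" unfolding \<sigma> using y by simp
  have "(1 + P) powr \<tau> \<le> (2 * y) powr \<tau>" using P y t by (intro powr_mono2) auto
  also have "\<dots> = 2 powr \<tau> * y powr \<tau>" using y by (simp add: powr_mult)
  also have "\<dots> \<le> 2 powr 1 * y powr \<tau>" using t by (intro mult_right_mono powr_mono) auto
  finally show s3: "(1 + P) powr \<tau> \<le> 2 * \<sigma>" unfolding \<sigma> by simp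
  have "P powr (1 + \<tau>) \<le> y powr (1 + \<tau>)" using P t by (intro powr_mono2) auto
  then show "P powr (1 + \<tau>) \<le> y * \<sigma>" unfolding \<sigma> using y by (simp add: powr_add)
  show "(1 + P) powr (1 + \<tau>) * (1 + P) powr (-1) \<le> 2 * \<sigma>"
  proof -
    have e: "1 + \<tau> + - 1 = \<tau>" by simp
    show ?thesis using s3 unfolding powr_add[of "1 + P" "1 + \<tau>" "- 1", symmetric] e .
  qed
  show "(1 + P) * (1 + P) powr (\<tau> - 1) \<le> 2 * \<sigma>"
    using s3 P powr_add[of "1 + P" 1 "\<tau> - 1"] by simp
  have "(1 + P) powr (1 + \<tau>) * (1 + P) powr (\<tau> - 1) = (1 + P) powr \<tau> * (1 + P) powr \<tau>"
    by (simp add: powr_add[symmetric])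
  also have "\<dots> \<le> (2 * \<sigma>) * (2 * \<sigma>)" using s3 s1 by (intro mult_mono) auto
  also have "\<dots> \<le> 4 * (y * \<sigma>)" using s2 s1 by simp
  finally show "(1 + P) powr (1 + \<tau>) * (1 + P) powr (\<tau> - 1) \<le> 4 * (y * \<sigma>)" .
qed

lemma power_mult_le: "1 \<le> A \<Longrightarrow> i \<le> j \<Longrightarrow> 0 \<le> t \<Longrightarrow> A ^ i * t \<le> A ^ j * (t::real)"
  by (intro mult_right_mono power_increasing)

context mfg
begin

lemma bernstein_first:
  fixes V \<phi> :: "(real^'n) \<times> real \<Rightarrow> real" and c e k :: real
  defines "\<phi> \<equiv> \<lambda>y. u y + c * snd y + e"
  defines "V \<equiv> \<lambda>y. hh y + (k / 2) * (\<phi> y * \<phi> y)"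
  assumes z: "z \<in> Q"
  shows "(\<phi> has_derivative (\<lambda>v. dd Q v u z + snd v * c)) (at z within Q)"
    and "V differentiable (at z within Q)"
    and "dd Q v V z = dd Q v hh z + k * \<phi> z * (dd Q v u z + snd v * c)"
proof -
  have "((\<lambda>y. u y + c * snd y + e) has_derivative (\<lambda>v. dd Q v u z + c * snd v + 0)) (at z within Q)"
    by (intro has_derivative_add has_derivative_mult_right has_derivative_snd has_derivative_ident
        has_derivative_const dd_has_derivative diff_u z)
  then show phi: "(\<phi> has_derivative (\<lambda>v. dd Q v u z + snd v * c)) (at z within Q)"
    unfolding \<phi>_def by (simp add: mult.commute)
  have V: "(V has_derivative (\<lambda>v. dd Q v hh z + (k / 2) * (\<phi> z * (dd Q v u z + snd v * c) + (dd Q v u z + snd v * c) * \<phi> z))) (at z within Q)"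
    unfolding V_def
    by (intro has_derivative_add has_derivative_mult_right has_derivative_mult phi dd_has_derivative hh_deriv(1)[OF z])
  then show "V differentiable (at z within Q)" unfolding differentiable_def by blast
  show "dd Q v V z = dd Q v hh z + k * \<phi> z * (dd Q v u z + snd v * c)"
    unfolding dd_eq[OF thickQ z V] by (simp add: algebra_simps)
qed

text \<open>At a critical point of \<open>V\<close> these identities express every second derivative
  of \<open>u\<close> with one direction \<open>(bv z, 0)\<close> by first derivatives of
  \<open>u\<close>.\<close>

lemma dd_hh_beta: "z \<in> Q \<Longrightarrow> dd Q (ex l) hh z = HX l (zp z) + U2 (bv z, 0) (ex l) z"
  and dd_hh_et: "z \<in> Q \<Longrightarrow> dd Q et hh z = U2 (bv z, 0) et z"
proof -
  assume z: "z \<in> Q"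
  have be: "(bv z, 0) = (\<Sum>j\<in>UNIV. bb j z *\<^sub>R ex j)"
    using vec_expand[of "bv z"] by (simp add: prod_eq_iff fst_sum snd_sum)
  have e: "U2 (bv z, 0) b z = (\<Sum>j\<in>UNIV. U2 b (ex j) z * bb j z)" for b
    unfolding be by (simp only: linear_sum[OF linear_U2(1)[OF z]] linear_scale[OF linear_U2(1)[OF z]]
        real_scaleR_def U2_sym[OF z, of "ex _" b] mult.commute)
  show "dd Q (ex l) hh z = HX l (zp z) + U2 (bv z, 0) (ex l) z"
    unfolding hh_deriv(2)[OF z] e by (simp add: sum_axis)
  show "dd Q et hh z = U2 (bv z, 0) et z"
    unfolding hh_deriv(2)[OF z] e by simp
qed

text \<open>The left side is the derivative of \<open>\<phi>\<close> along \<open>(- b, 1)\<close>.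
  The condition \<open>D\<^sub>pH \<cdot> p \<ge> 2 H - C0\<close> outweighs the single
  \<open>H\<close> contained in \<open>u\<^sub>t = h - w\<close>, so that coercivity of
  \<open>H\<close> makes the expression strongly negative.\<close>

lemma Delta_le:
  assumes z: "z \<in> Q"
  shows "ut z + c - (\<Sum>l\<in>UNIV. bb l z * p z $ l) \<le> - ((norm (p z))\<^sup>2 / C0) - ww z + 2 * C0 + c"
proof -
  have "(\<Sum>l\<in>UNIV. bb l z * p z $ l) \<ge> 2 * hh z - C0"
    unfolding bb_def zp_def hh_def by (rule HP_inner)
  moreover have "hh z \<ge> (norm (p z))\<^sup>2 / C0 - C0" unfolding hh_def zp_def by (rule H_bounds(1))
  ultimately show ?thesis using ww_eq[OF z] by linarith
qed

text \<open>The left side is the trace of \<open>H\<^sub>p\<^sub>p S H\<^sub>p\<^sub>p S\<close>.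
  The lower ellipticity bound is used twice, once in each index, with an exchange of summations in
  between.\<close>

lemma trace_quad_lower:
  assumes v: "\<And>i k. HPP i k (x, q) = (\<Sum>j\<in>UNIV. v j $ i * v j $ k)"
    and S: "\<And>i k. S i k = S k i"
  defines "s \<equiv> \<lambda>m l. \<Sum>i\<in>UNIV. v m $ i * S i l"
  shows "(\<Sum>m\<in>UNIV. \<Sum>j\<in>UNIV. \<Sum>l\<in>UNIV. s m j * s m l * HPP j l (x, q)) \<ge> (\<Sum>i\<in>UNIV. \<Sum>j\<in>UNIV. (S i j)\<^sup>2) / C0\<^sup>2"
proof -
  have C: "1 / C0 \<ge> 0" using C0_pos by simp
  have lower: "(1 / C0) * (\<Sum>j\<in>UNIV. (a j)\<^sup>2) \<le> (\<Sum>j\<in>UNIV. \<Sum>l\<in>UNIV. a j * a l * HPP j l (x, q))" for a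
    using HPP_quad(1)[of "\<chi> j. a j" x q] by (simp add: inner_vec_def power2_eq_square)
  have "(1 / C0) * ((1 / C0) * (\<Sum>i\<in>UNIV. \<Sum>j\<in>UNIV. (S i j)\<^sup>2))
      = (1 / C0) * (\<Sum>i\<in>UNIV. (1 / C0) * (\<Sum>j\<in>UNIV. (S i j)\<^sup>2))" by (simp add: sum_distrib_left)
  also have "\<dots> \<le> (1 / C0) * (\<Sum>i\<in>UNIV. \<Sum>j\<in>UNIV. \<Sum>l\<in>UNIV. S i j * S i l * HPP j l (x, q))"
    by (rule mult_left_mono[OF sum_mono[OF lower] C])
  also have "(\<Sum>i\<in>UNIV. \<Sum>j\<in>UNIV. \<Sum>l\<in>UNIV. S i j * S i l * HPP j l (x, q)) = (\<Sum>i\<in>UNIV. \<Sum>m\<in>UNIV. (s m i)\<^sup>2)"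
  proof (rule sum.cong[OF refl])
    fix i
    have "(\<Sum>j\<in>UNIV. \<Sum>l\<in>UNIV. S i j * S i l * HPP j l (x, q)) = (\<Sum>j\<in>UNIV. \<Sum>l\<in>UNIV. S i j * S i l * HPP l j (x, q))"
      by (simp only: HPP_sym)
    also have "\<dots> = (\<Sum>m\<in>UNIV. \<Sum>j\<in>UNIV. \<Sum>l\<in>UNIV. v m $ j * v m $ l * (S i j * S i l))"
      by (rule sum_decomposition[OF v, symmetric])
    also have "\<dots> = (\<Sum>m\<in>UNIV. (s m i)\<^sup>2)"
      unfolding s_def power2_eq_square sum_product using S by (simp add: ac_simps)
    finally show "(\<Sum>j\<in>UNIV. \<Sum>l\<in>UNIV. S i j * S i l * HPP j l (x, q)) = (\<Sum>m\<in>UNIV. (s m i)\<^sup>2)" .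
  qed
  also have "(1 / C0) * (\<Sum>i\<in>UNIV. \<Sum>m\<in>UNIV. (s m i)\<^sup>2) = (\<Sum>m\<in>UNIV. (1 / C0) * (\<Sum>i\<in>UNIV. (s m i)\<^sup>2))"
    by (subst sum.swap) (simp add: sum_distrib_left)
  also have "\<dots> \<le> (\<Sum>m\<in>UNIV. \<Sum>j\<in>UNIV. \<Sum>l\<in>UNIV. s m j * s m l * HPP j l (x, q))"
    by (rule sum_mono[OF lower])
  finally show ?thesis by (simp add: power2_eq_square)
qed

end

lemma abs_add_le: "\<bar>a\<bar> \<le> c \<Longrightarrow> \<bar>b\<bar> \<le> d \<Longrightarrow> \<bar>a + b\<bar> \<le> c + (d::real)"
  by linarith

lemma abs_diff_le: "\<bar>a\<bar> \<le> c \<Longrightarrow> \<bar>b\<bar> \<le> d \<Longrightarrow> \<bar>a - b\<bar> \<le> c + (d::real)"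
  by linarith

context mfg
begin

text \<open>One number \<open>A\<close> majorises all constants. The good terms of
  \<open>bernstein_sum\<close> are \<open>qN\<^sup>2 / A\<close>,
  \<open>Z\<^sup>2 / A\<^sup>2\<close> and a multiple of \<open>k * y ^ 4\<close>; every other term
  is bounded by powers of \<open>A\<close> times \<open>y * \<sigma> * qN\<close>,
  \<open>y * \<sigma> * Z\<close>, \<open>k * y\<^sup>2 * Z\<close> or
  \<open>y ^ 3 * \<sigma>\<close>, as \<open>bernstein_algebra\<close> requires.\<close>

lemma bernstein_interior:
  fixes V \<phi> :: "(real^'n) \<times> real \<Rightarrow> real" and c e k A W :: real
  defines "\<phi> \<equiv> \<lambda>y. u y + c * snd y + e"
  defines "V \<equiv> \<lambda>y. hh y + (k / 2) * (\<phi> y * \<phi> y)"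
  assumes z: "z \<in> interior Q" and max: "\<And>y. y \<in> Q \<Longrightarrow> V y \<le> V z"
    and A: "A \<ge> 1" "real CARD('n) \<le> A" "C0 \<le> A" "\<bar>\<phi> z\<bar> \<le> A" "0 \<le> c" "c \<le> A"
    and XA: "1 / X (mz z) \<le> A" and W: "ww z \<ge> - W" "W \<le> A" and k: "k = 1 / (100 * A ^ 20)"
  defines "y \<equiv> sqrt (1 + (norm (p z))\<^sup>2 + \<bar>ww z\<bar>)"
  shows "y \<le> 500000 * A ^ 40 * y powr \<tau>"
proof (cases "y\<^sup>2 < 12 * A\<^sup>2")
  case True
  have "0 \<le> 1 + (norm (p z))\<^sup>2 + \<bar>ww z\<bar>" "1 \<le> 1 + (norm (p z))\<^sup>2 + \<bar>ww z\<bar>" by simp_all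
  then have y1: "y \<ge> 1" unfolding y_def by simp
  have "y\<^sup>2 \<le> 16 * A\<^sup>2" using True zero_le_power2[of A] by linarith
  then have "y\<^sup>2 \<le> (4 * A)\<^sup>2" by (simp add: power_mult_distrib)
  then have "y \<le> 4 * A" using A(1) by (intro power2_le_imp_le[of y]) auto
  also have "\<dots> \<le> 500000 * A ^ 40" using power_increasing[of 1 40 A] A(1) by simp
  also have "\<dots> \<le> 500000 * A ^ 40 * y powr \<tau>"
    using mult_left_mono[OF ge_one_powr_ge_zero[OF y1 tau(1)], of "500000 * A ^ 40"] A(1) by simp
  finally show ?thesis .
next
  case False
  have zQ: "z \<in> Q" using I_sub[OF z] .
  note mp = m_pos[OF zQ] and mzp = mz_pos[OF zQ]
  define P where "P = norm (p z)"
  define \<sigma> where "\<sigma> = y powr \<tau>"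
  \<comment> \<open>The value of \<open>h_of f\<close> at the solution. It is at most
    \<open>A * y\<close> by the linear growth of \<open>\<chi>\<close> and at least
    \<open>1 / A\<close> by \<open>XA\<close>; both comparisons serve to trade
    \<open>\<kappa>\<close> against \<open>y\<close> or against constants.\<close>
  define \<kappa> where "\<kappa> = sqrt (X (mz z))"
  obtain x where zp: "zp z = (x, p z)" and mzz: "mz z = (x, m z)" by (simp add: zp_def mz_def)
  have C: "1 \<le> C0" "0 \<le> C0" using C0_ge_1 by simp_all
  have A0: "A > 0" "A \<ge> 0" using A(1) by simp_all
  have y2: "y\<^sup>2 = 1 + P\<^sup>2 + \<bar>ww z\<bar>" unfolding y_def P_def by simp
  have P0: "P \<ge> 0" by (simp add: P_def)
  have y0: "y \<ge> 0" unfolding y_def by simp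
  have y1: "1 \<le> y" by (rule power2_le_imp_le[OF _ y0]) (simp add: y2)
  have Py: "P \<le> y" by (rule power2_le_imp_le[OF _ y0]) (simp add: y2)
  have wy: "\<bar>ww z\<bar> \<le> y\<^sup>2" by (simp add: y2)
  note sc = scale_facts[OF P0 Py y1 tau \<sigma>_def]
  note s1 = sc(1) and sy = sc(2)
  have s0: "0 \<le> \<sigma>" using s1 by simp
  have ys0: "0 \<le> y * \<sigma>" using y0 s0 by simp
  have ys1: "1 \<le> y * \<sigma>" using mult_mono[OF y1 s1] y0 by simp
  have yys: "y \<le> y * \<sigma>" using mult_left_mono[OF s1 y0] by simp
  define t2 where "t2 = y\<^sup>2 * \<sigma>"
  define t3 where "t3 = y ^ 3 * \<sigma>"
  have t2_0: "0 \<le> t2" and t3_0: "0 \<le> t3" unfolding t2_def t3_def using y0 s0 by simp_all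
  have t23: "t2 \<le> t3"
  proof -
    have "y\<^sup>2 * \<sigma> * 1 \<le> y\<^sup>2 * \<sigma> * y" using y1 y0 s0 by (intro mult_left_mono) auto
    then show ?thesis unfolding t2_def t3_def by (simp add: power2_eq_square power3_eq_cube ac_simps)
  qed
  have ys_t2: "y * \<sigma> \<le> t2"
  proof -
    have "y * \<sigma> * 1 \<le> y * \<sigma> * y" using y1 ys0 by (intro mult_left_mono) auto
    then show ?thesis unfolding t2_def by (simp add: power2_eq_square ac_simps)
  qed
  have yss_t2: "y * \<sigma> * \<sigma> \<le> t2"
  proof -
    have "y * \<sigma> * \<sigma> \<le> y * \<sigma> * y" using sy ys0 by (intro mult_left_mono) auto
    then show ?thesis unfolding t2_def by (simp add: power2_eq_square ac_simps)
  qed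
  have yyss_t3: "(y * \<sigma>) * (y * \<sigma>) \<le> t3"
  proof -
    have "y * y * \<sigma> * \<sigma> \<le> y * y * \<sigma> * y" using sy y0 s0 by (intro mult_left_mono) auto
    then show ?thesis unfolding t3_def by (simp add: power3_eq_cube ac_simps)
  qed
  have yt2: "y * t2 = t3" unfolding t2_def t3_def by (simp add: power2_eq_square power3_eq_cube)
  have y2ys: "y\<^sup>2 * (y * \<sigma>) = t3" unfolding t3_def by (simp add: power2_eq_square power3_eq_cube)
  have y1P: "1 + P \<le> 2 * y" using y1 Py by simp
  note Ap = power_mult_le[OF A(1)]
  have sumA: "\<bar>\<Sum>i\<in>(UNIV::'n set). G i\<bar> \<le> A * d" if "\<And>i. \<bar>G i\<bar> \<le> d" for G d
  proof -
    have "0 \<le> d" using order_trans[OF abs_ge_zero that] .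
    then show ?thesis using sum_abs_bound[of G d, OF that] mult_right_mono[OF A(2), of d] by linarith
  qed
  have sumA2: "\<bar>\<Sum>i\<in>(UNIV::'n set). \<Sum>j\<in>(UNIV::'n set). G i j\<bar> \<le> A * (A * d)" if "\<And>i j. \<bar>G i j\<bar> \<le> d" for G d
    by (intro sumA that)

  have X0: "X (mz z) > 0" unfolding mz_def by (rule X_pos[OF mp])
  have kap2: "\<kappa> * \<kappa> = X (mz z)" unfolding \<kappa>_def using X0 by simp
  have kap0: "\<kappa> > 0" unfolding \<kappa>_def using X0 by simp
  have XA2: "X (mz z) \<le> A * y\<^sup>2"
  proof -
    have "X (mz z) \<le> C0 + C0 * \<bar>ww z\<bar>" unfolding ww_def mz_def by (rule X_le[OF mp])
    also have "\<dots> = C0 * (1 + \<bar>ww z\<bar>)" by (simp add: distrib_left)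
    also have "\<dots> \<le> A * y\<^sup>2" using A C y2 by (intro mult_mono) auto
    finally show ?thesis .
  qed
  have kapy: "\<kappa> \<le> A * y"
  proof (rule power2_le_imp_le)
    have "A * y\<^sup>2 \<le> A * A * y\<^sup>2" using A by (intro mult_right_mono) auto
    then show "\<kappa>\<^sup>2 \<le> (A * y)\<^sup>2" using XA2 kap2 by (simp add: power2_eq_square ac_simps)
  qed (use A0 y0 in simp)
  have kap1: "1 \<le> A * \<kappa>"
  proof (rule power2_le_imp_le)
    have "1 \<le> A * X (mz z)" using XA X0 by (simp add: pos_divide_le_eq)
    also have "\<dots> \<le> A * (A * X (mz z))" using A X0 by simp
    finally show "1\<^sup>2 \<le> (A * \<kappa>)\<^sup>2" unfolding kap2[symmetric] by (simp add: power2_eq_square ac_simps)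
  qed (use A0 kap0 in simp)
  have ks0: "0 \<le> \<kappa> * \<sigma>" using kap0 s0 by simp
  have b: "\<bar>bb i z\<bar> \<le> 2 * A * y" for i
  proof -
    have "\<bar>bb i z\<bar> \<le> C0 * (1 + P)" unfolding bb_def zp P_def by (rule HP_bound)
    also have "\<dots> \<le> A * (2 * y)" using A C y1P P0 by (intro mult_mono) auto
    finally show ?thesis by simp
  qed
  have pow1: "C0 * (1 + P powr (1 + \<tau>)) \<le> 2 * A * (y * \<sigma>)"
  proof -
    have "C0 * (1 + P powr (1 + \<tau>)) \<le> A * (2 * (y * \<sigma>))" using A C sc(4) ys1 by (intro mult_mono) auto
    then show ?thesis by simp
  qed
  have hx: "\<bar>HX i (zp z)\<bar> \<le> 2 * A * (y * \<sigma>)" for i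
    unfolding zp by (rule order_trans[OF HX_bound pow1[unfolded P_def]])
  have hxx: "\<bar>HXX i j (zp z)\<bar> \<le> 2 * A * (y * \<sigma>)" for i j
    unfolding zp by (rule order_trans[OF HXX_bound pow1[unfolded P_def]])
  have pow2: "C0 * (1 + P) powr \<tau> \<le> 2 * A * \<sigma>"
  proof -
    have "C0 * (1 + P) powr \<tau> \<le> A * (2 * \<sigma>)" using A C sc(3) by (intro mult_mono) auto
    then show ?thesis by simp
  qed
  have hxp: "\<bar>HXP i j (zp z)\<bar> \<le> 2 * A * \<sigma>" for i j
    unfolding zp by (rule order_trans[OF HXP_bound pow2[unfolded P_def]])
  have hxxp: "\<bar>dd UNIV (axis l 1, 0) (HXP i j) (zp z)\<bar> \<le> 2 * A * \<sigma>" for l i j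
    unfolding zp by (rule order_trans[OF HXXP_bound pow2[unfolded P_def]])
  have hpp: "\<bar>HPP i j (zp z)\<bar> \<le> A" for i j
    unfolding zp by (rule order_trans[OF HPP_entry_bound A(3)])
  have Fg: "F_growth \<tau> f (mz z) \<le> 3 * A * (\<kappa> * \<sigma>)"
  proof -
    have 1: "1 \<le> A * (\<kappa> * \<sigma>)" using mult_mono[OF kap1 s1] A0 kap0 by (simp add: mult.assoc)
    have 2: "\<sigma> \<le> A * (\<kappa> * \<sigma>)" using mult_right_mono[OF kap1 s0] by (simp add: mult.assoc)
    have 3: "(if \<tau> = 0 then 1 else \<bar>a\<bar> powr (\<tau> / 2)) \<le> \<sigma>" if "\<bar>a\<bar> \<le> y\<^sup>2" for a
    proof (cases "\<tau> = 0")
      case False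
      have "\<bar>a\<bar> powr (\<tau> / 2) \<le> (y\<^sup>2) powr (\<tau> / 2)" using that tau by (intro powr_mono2) auto
      also have "\<dots> = \<sigma>" unfolding \<sigma>_def using y1 by (simp add: powr_powr flip: powr_numeral)
      finally show ?thesis using False by simp
    qed (use s1 in simp)
    have 4: "\<bar>X (mz z)\<bar> powr ((1 + \<tau>) / 2) \<le> A * (\<kappa> * \<sigma>)"
    proof -
      have "\<bar>X (mz z)\<bar> powr ((1 + \<tau>) / 2) = (\<kappa>\<^sup>2) powr ((1 + \<tau>) / 2)" using kap2 X0 by (simp add: power2_eq_square)
      also have "\<dots> = \<kappa> powr (2 * ((1 + \<tau>) / 2))" using kap0 by (simp add: powr_powr flip: powr_numeral)
      also have "\<dots> = \<kappa> powr (1 + \<tau>)" by (simp only: times_divide_eq_right nonzero_mult_div_cancel_left[OF zero_neq_numeral[symmetric]])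
      also have "\<dots> = \<kappa> * \<kappa> powr \<tau>" using kap0 by (simp add: powr_add)
      also have "\<dots> \<le> \<kappa> * (A * y) powr \<tau>" using kapy kap0 tau by (intro mult_left_mono powr_mono2) auto
      also have "\<dots> = \<kappa> * (A powr \<tau> * \<sigma>)" unfolding \<sigma>_def using A0 y0 by (simp add: powr_mult)
      also have "\<dots> \<le> \<kappa> * (A powr 1 * \<sigma>)" using A tau kap0 s0 by (intro mult_left_mono mult_right_mono powr_mono) auto
      finally show ?thesis using A0 by (simp add: ac_simps)
    qed
    have "F_growth \<tau> f (mz z) = 1 + (if \<tau> = 0 then 1 else \<bar>ww z\<bar> powr (\<tau> / 2)) + \<bar>X (mz z)\<bar> powr ((1 + \<tau>) / 2)"
      unfolding F_growth_def X_def fm_def d_snd_dd ww_def ..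
    then show ?thesis using 1 2 3[OF wy] 4 by linarith
  qed
  have CF: "C0 * F_growth \<tau> f (x, m z) \<le> 3 * A^2 * (\<kappa> * \<sigma>)"
  proof -
    have "C0 * F_growth \<tau> f (x, m z) \<le> C0 * (3 * A * (\<kappa> * \<sigma>))" using Fg C unfolding mzz by (intro mult_left_mono) auto
    also have "\<dots> \<le> A * (3 * A * (\<kappa> * \<sigma>))" using A ks0 by (intro mult_right_mono) auto
    finally show ?thesis by (simp add: power2_eq_square)
  qed
  have fxb: "\<bar>fx i (mz z)\<bar> \<le> 3 * A^2 * (\<kappa> * \<sigma>)" for i
    unfolding mzz by (rule order_trans[OF fx_bounds(1)[OF mp] CF])
  have fxx: "\<bar>dd pos_dom (axis j 1, 0) (fx i) (mz z)\<bar> \<le> 3 * A^2 * (\<kappa> * \<sigma>)" for i j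
    unfolding mzz by (rule order_trans[OF fx_bounds(2)[OF mp] CF])
  have fxm: "m z * \<bar>dd pos_dom (0, 1) (fx i) (mz z)\<bar> \<le> 3 * A^3 * (\<kappa> * \<sigma>)" for i
  proof -
    have "m z * \<bar>dd pos_dom (0, 1) (fx i) (mz z)\<bar> \<le> C0 * norm (D_fst pos_dom F (x, m z))"
      unfolding mzz by (rule fx_bounds(3)[OF mp])
    also have "\<dots> \<le> A * (3 * A^2 * (\<kappa> * \<sigma>))"
      using order_trans[OF fx_bounds(4)[OF mp] CF] A C by (intro mult_mono) auto
    finally show ?thesis by (simp add: power2_eq_square power3_eq_cube)
  qed

  define \<beta> where "\<beta> = (bv z, 0 :: real)"
  define g where "g l = U2 \<beta> (ex l) z" for l
  define q where "q l = U2 (- bv z, 1) (ex l) z" for l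
  define \<Delta> where "\<Delta> = ut z + c - (\<Sum>l\<in>UNIV. bb l z * p z $ l)"
  have k0: "k > 0" "k \<le> 1" "k * A \<le> 1"
  proof -
    have "1 \<le> A ^ 20" "1 * A ^ 1 \<le> 100 * A ^ 20" using A(1) power_increasing[of 1 20 A] by (auto simp: one_le_power)
    then show "k > 0" "k \<le> 1" "k * A \<le> 1" unfolding k using A0 by (auto simp: pos_divide_le_eq)
  qed
  have kphi: "\<bar>k * \<phi> z\<bar> \<le> 1"
  proof -
    have "k * \<bar>\<phi> z\<bar> \<le> k * A" by (rule mult_left_mono[OF A(4)]) (use k0 in simp)
    moreover have "\<bar>k * \<phi> z\<bar> = k * \<bar>\<phi> z\<bar>" using k0 by (simp add: abs_mult)
    ultimately show ?thesis using k0 by linarith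
  qed
  have first: "V differentiable (at z within Q)"
    "\<And>v. dd Q v V z = dd Q v hh z + k * \<phi> z * (dd Q v u z + snd v * c)"
    unfolding V_def \<phi>_def by (rule bernstein_first(2,3)[OF zQ])+
  have ddV0: "dd Q w V z = 0" for w by (rule interior_max_first[OF z max first(1)])
  have p_dd: "dd Q (ex l) u z = p z $ l" for l by (simp add: p_nth)
  have ut_dd: "dd Q et u z = ut z" by (simp add: ut_def)
  \<comment> \<open>The first order condition for \<open>V\<close> in space; it makes the second
    derivatives of \<open>u\<close> along \<open>b\<close> of lower order.\<close>
  have gl: "g l = - HX l (zp z) - k * \<phi> z * p z $ l" for l
    using ddV0[of "ex l"] unfolding first(2) dd_hh_beta[OF zQ] g_def \<beta>_def p_dd by simp
  have get: "U2 \<beta> et z = - (k * \<phi> z * (ut z + c))"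
    using ddV0[of et] unfolding first(2) dd_hh_et[OF zQ] \<beta>_def ut_dd by simp
  have pl: "\<bar>p z $ l\<bar> \<le> P" for l unfolding P_def by (rule component_le_norm_cart)
  have kp: "\<bar>k * \<phi> z * p z $ l\<bar> \<le> P" for l using abs_mult_le[OF kphi pl[of l]] by simp
  have g1: "\<bar>g l\<bar> \<le> 3 * A * (y * \<sigma>)" for l
  proof -
    have "\<bar>g l\<bar> \<le> 2 * A * (y * \<sigma>) + P" unfolding gl using hx[of l] kp[of l] by linarith
    also have "P \<le> A * (y * \<sigma>)" using Py yys mult_right_mono[OF A(1) ys0] by linarith
    finally show ?thesis by linarith
  qed
  \<comment> \<open>The same quantity in powers of \<open>1 + P\<close>, because it will meet
    negative powers of \<open>1 + P\<close>, which are not controlled by negative powers of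
    \<open>y\<close>.\<close>
  have g2: "\<bar>g l\<bar> \<le> 3 * A * (1 + P) powr (1 + \<tau>)" for l
  proof -
    have a: "P \<le> (1 + P) powr (1 + \<tau>)" "1 \<le> (1 + P) powr (1 + \<tau>)"
    proof -
      have "(1 + P) powr 1 \<le> (1 + P) powr (1 + \<tau>)" using P0 tau by (intro powr_mono) auto
      then show "P \<le> (1 + P) powr (1 + \<tau>)" "1 \<le> (1 + P) powr (1 + \<tau>)" using P0 by simp_all
    qed
    have "P powr (1 + \<tau>) \<le> (1 + P) powr (1 + \<tau>)" using P0 tau by (intro powr_mono2) auto
    then have "C0 * (1 + P powr (1 + \<tau>)) \<le> A * (2 * (1 + P) powr (1 + \<tau>))" using A C a by (intro mult_mono) auto
    then have "\<bar>HX l (zp z)\<bar> \<le> A * (2 * (1 + P) powr (1 + \<tau>))" using HX_bound[of l x "p z"] unfolding zp P_def by linarith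
    moreover have "P \<le> A * (1 + P) powr (1 + \<tau>)" using a mult_right_mono[OF A(1), of "(1 + P) powr (1 + \<tau>)"] by simp
    ultimately show ?thesis unfolding gl using kp[of l] by linarith
  qed
  \<comment> \<open>The first order conditions in space and time together: along \<open>b\<close>
    the derivative of \<open>w\<close> is of order \<open>k * y\<^sup>2\<close>, up to powers of
    \<open>A\<close>.\<close>
  have dww: "dd Q \<beta> ww z = k * \<phi> z * \<Delta>"
  proof -
    have be: "\<beta> = (\<Sum>j\<in>UNIV. bb j z *\<^sub>R ex j)"
      using vec_expand[of "bv z"] unfolding \<beta>_def by (simp add: prod_eq_iff fst_sum snd_sum)
    note L = dd_linear[OF hh_deriv(1)[OF zQ]]
    have dh: "dd Q (ex j) hh z = - (k * \<phi> z * p z $ j)" for j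
      using ddV0[of "ex j"] unfolding first(2) p_dd by simp
    have "dd Q \<beta> hh z = (\<Sum>j\<in>UNIV. bb j z * dd Q (ex j) hh z)"
      unfolding be by (simp only: linear_sum[OF L] linear_scale[OF L] real_scaleR_def)
    also have "\<dots> = - (k * \<phi> z * (\<Sum>j\<in>UNIV. bb j z * p z $ j))"
      by (simp add: dh sum_negf[symmetric] sum_distrib_left ac_simps)
    finally show ?thesis unfolding ww_deriv(1)[OF zQ] get \<Delta>_def by (simp add: algebra_simps)
  qed
  have hb: "\<bar>hh z\<bar> \<le> A * y\<^sup>2"
  proof -
    have "hh z \<le> C0 * P\<^sup>2 + C0" "P\<^sup>2 / C0 - C0 \<le> hh z" unfolding hh_def zp P_def by (rule H_bounds)+
    moreover have "0 \<le> P\<^sup>2 / C0" "0 \<le> C0 * P\<^sup>2" using C by auto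
    moreover have "C0 * (1 + P\<^sup>2) \<le> A * y\<^sup>2" using A C y2 by (intro mult_mono) auto
    ultimately show ?thesis by (simp add: distrib_left)
  qed
  have y21: "1 \<le> y\<^sup>2" using y1 by (simp add: one_le_power)
  have Delta: "\<bar>\<Delta>\<bar> \<le> 5 * A^2 * y\<^sup>2"
  proof -
    have "\<bar>\<Sum>l\<in>UNIV. bb l z * p z $ l\<bar> \<le> A * ((2 * A * y) * y)"
      by (intro sumA abs_mult_le b order_trans[OF pl Py])
    then have 1: "\<bar>\<Sum>l\<in>UNIV. bb l z * p z $ l\<bar> \<le> 2 * (A^2 * y\<^sup>2)" by (simp add: power2_eq_square ac_simps)
    have 2: "A * y\<^sup>2 \<le> A^2 * y\<^sup>2" "y\<^sup>2 \<le> A * y\<^sup>2"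
      using Ap[of 1 2 "y\<^sup>2"] mult_right_mono[OF A(1), of "y\<^sup>2"] by simp_all
    have 3: "c \<le> A * y\<^sup>2" using mult_left_mono[OF y21 A0(2)] A(6) by simp
    have "\<bar>ut z\<bar> \<le> A * y\<^sup>2 + y\<^sup>2" using ww_eq[OF zQ] hb wy by linarith
    then have "\<bar>\<Delta>\<bar> \<le> (A * y\<^sup>2 + y\<^sup>2) + A * y\<^sup>2 + 2 * (A^2 * y\<^sup>2)"
      unfolding \<Delta>_def using 1 3 A(5) by linarith
    then have "\<bar>\<Delta>\<bar> \<le> 5 * (A^2 * y\<^sup>2)" using 2 by linarith
    then show ?thesis by (simp add: mult.assoc)
  qed

  have fstb: "fst \<beta> $ i = bb i z" for i by (simp add: \<beta>_def)
  note dcomp = comp_zp(2)[OF zQ, of _ \<beta>, unfolded fstb g_def[symmetric]]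
  have db: "\<bar>dd Q \<beta> (bb j) z\<bar> \<le> 7 * A^3 * (y * \<sigma>)" for j
  proof -
    have "dd Q \<beta> (bb j) z = (\<Sum>i\<in>UNIV. bb i z * HXP i j (zp z)) + (\<Sum>l\<in>UNIV. g l * HPP l j (zp z))"
      unfolding bb_deriv(2)[OF zQ] fstb g_def ..
    also have "\<bar>\<dots>\<bar> \<le> A * ((2 * A * y) * (2 * A * \<sigma>)) + A * ((3 * A * (y * \<sigma>)) * A)"
      by (intro abs_add_le sumA abs_mult_le b hxp g1 hpp)
    finally show ?thesis by (simp add: power3_eq_cube algebra_simps)
  qed
  have dHX: "\<bar>dd Q \<beta> (\<lambda>y. HX i (zp y)) z\<bar> \<le> 10 * A^3 * t2" for i
  proof -
    have "dd Q \<beta> (\<lambda>y. HX i (zp y)) z = (\<Sum>j\<in>UNIV. bb j z * HXX j i (zp z)) + (\<Sum>l\<in>UNIV. g l * HXP i l (zp z))"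
      unfolding dcomp[OF diff_HX] HXX_def HPX ..
    also have "\<bar>\<dots>\<bar> \<le> A * ((2 * A * y) * (2 * A * (y * \<sigma>))) + A * ((3 * A * (y * \<sigma>)) * (2 * A * \<sigma>))"
      by (intro abs_add_le sumA abs_mult_le b hxx g1 hxp)
    also have "\<dots> = 4 * (A^3 * t2) + 6 * (A^3 * (y * \<sigma> * \<sigma>))" unfolding t2_def by (simp add: power2_eq_square power3_eq_cube)
    also have "\<dots> \<le> 10 * (A^3 * t2)" using mult_left_mono[OF yss_t2, of "A^3"] A0 by simp
    finally show ?thesis by (simp add: mult.assoc)
  qed
  have powm: "0 \<le> (1 + P) powr a" for a by simp
  have dHXP: "\<bar>dd Q \<beta> (\<lambda>y. HXP i i (zp y)) z\<bar> \<le> 16 * A^3 * (y * \<sigma>)" for i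
  proof -
    have t: "\<bar>g l * dd UNIV (axis i 1, 0) (HPP l i) (zp z)\<bar> \<le> 12 * A^2 * (y * \<sigma>)" for l
    proof -
      have "\<bar>dd UNIV (axis i 1, 0) (HPP l i) (zp z)\<bar> \<le> A * (1 + P) powr (\<tau> - 1)"
        unfolding zp P_def by (rule order_trans[OF HXPP_bound mult_right_mono[OF A(3)]]) simp
      from abs_mult_le[OF g2[of l] this]
      have "\<bar>g l * dd UNIV (axis i 1, 0) (HPP l i) (zp z)\<bar> \<le> 3 * A * A * ((1 + P) powr (1 + \<tau>) * (1 + P) powr (\<tau> - 1))"
        by (simp add: ac_simps)
      also have "\<dots> \<le> 3 * A * A * (4 * (y * \<sigma>))" using sc(6) A0 by (intro mult_left_mono) auto
      finally show ?thesis by (simp add: power2_eq_square)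
    qed
    have "dd Q \<beta> (\<lambda>y. HXP i i (zp y)) z = (\<Sum>j\<in>UNIV. bb j z * dd UNIV (axis j 1, 0) (HXP i i) (zp z))
        + (\<Sum>l\<in>UNIV. g l * dd UNIV (axis i 1, 0) (HPP l i) (zp z))"
      unfolding dcomp[OF diff_HXP] HPXP ..
    also have "\<bar>\<dots>\<bar> \<le> A * ((2 * A * y) * (2 * A * \<sigma>)) + A * (12 * A^2 * (y * \<sigma>))"
      by (intro abs_add_le sumA abs_mult_le[OF b hxxp] t)
    finally show ?thesis by (simp add: power2_eq_square power3_eq_cube algebra_simps)
  qed
  have dHPP: "\<bar>dd Q \<beta> (\<lambda>y. HPP j i (zp y)) z\<bar> \<le> 8 * A^3 * \<sigma>" for i j
  proof -
    have t1: "\<bar>bb l z * dd UNIV (axis l 1, 0) (HPP j i) (zp z)\<bar> \<le> 2 * A^2 * \<sigma>" for l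
    proof -
      have b': "\<bar>bb l z\<bar> \<le> A * (1 + P)"
        unfolding bb_def zp P_def by (rule order_trans[OF HP_bound mult_right_mono[OF A(3)]]) simp
      have "\<bar>dd UNIV (axis l 1, 0) (HPP j i) (zp z)\<bar> \<le> A * (1 + P) powr (\<tau> - 1)"
        unfolding zp P_def by (rule order_trans[OF HXPP_bound mult_right_mono[OF A(3)]]) simp
      from abs_mult_le[OF b' this]
      have "\<bar>bb l z * dd UNIV (axis l 1, 0) (HPP j i) (zp z)\<bar> \<le> A * A * ((1 + P) * (1 + P) powr (\<tau> - 1))"
        by (simp add: ac_simps)
      also have "\<dots> \<le> A * A * (2 * \<sigma>)" using sc(7) A0 by (intro mult_left_mono) auto
      finally show ?thesis by (simp add: power2_eq_square)
    qed
    have t2: "\<bar>g l * dd UNIV (0, axis l 1) (HPP j i) (zp z)\<bar> \<le> 6 * A^2 * \<sigma>" for l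
    proof -
      have "\<bar>dd UNIV (0, axis l 1) (HPP j i) (zp z)\<bar> \<le> A * (1 + P) powr (-1)"
        unfolding zp P_def by (rule order_trans[OF HPPP_bound mult_right_mono[OF A(3)]]) simp
      from abs_mult_le[OF g2[of l] this]
      have "\<bar>g l * dd UNIV (0, axis l 1) (HPP j i) (zp z)\<bar> \<le> 3 * A * A * ((1 + P) powr (1 + \<tau>) * (1 + P) powr (-1))"
        by (simp add: ac_simps)
      also have "\<dots> \<le> 3 * A * A * (2 * \<sigma>)" using sc(5) A0 by (intro mult_left_mono) auto
      finally show ?thesis by (simp add: power2_eq_square)
    qed
    have "\<bar>dd Q \<beta> (\<lambda>y. HPP j i (zp y)) z\<bar> \<le> A * (2 * A^2 * \<sigma>) + A * (6 * A^2 * \<sigma>)"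
      unfolding dcomp[OF diff_HPP] by (intro abs_add_le sumA t1 t2)
    then show ?thesis by (simp add: power2_eq_square power3_eq_cube algebra_simps)
  qed
  have f0: "fm (mz z) > 0" unfolding mz_def by (rule fm_pos[OF mp])
  define \<mu> where "\<mu> = dd Q \<beta> m z"
  have mu: "\<bar>\<mu> * fm (mz z)\<bar> \<le> 5 * A^3 * k * y\<^sup>2 + 6 * A^4 * (y * (\<kappa> * \<sigma>))"
  proof -
    have "\<mu> * fm (mz z) = k * \<phi> z * \<Delta> - (\<Sum>i\<in>UNIV. bb i z * fx i (mz z))"
      using ww_deriv(2)[OF zQ, of \<beta>] unfolding dww fstb \<mu>_def by simp
    also have "\<bar>\<dots>\<bar> \<le> (k * A) * (5 * A^2 * y\<^sup>2) + A * ((2 * A * y) * (3 * A^2 * (\<kappa> * \<sigma>)))"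
    proof (intro abs_diff_le sumA abs_mult_le b fxb Delta)
      show "\<bar>k\<bar> \<le> k" using k0 by simp
      show "\<bar>\<phi> z\<bar> \<le> A" by (rule A(4))
    qed
    finally show ?thesis by (simp add: eval_nat_numeral algebra_simps)
  qed
  define E where "E = 5 * A^3 * k * y\<^sup>2 + 6 * A^4 * (y * (\<kappa> * \<sigma>))"
  have E0: "0 \<le> E" using mu unfolding E_def by linarith
  have dX: "\<bar>dd Q \<beta> (\<lambda>y. X (mz y)) z\<bar> \<le> 12 * A^5 * (y * (\<kappa> * \<sigma>)) + 5 * A^4 * k * y\<^sup>2"
  proof -
    have Xi: "\<bar>dd pos_dom (axis i 1, 0) X (mz z)\<bar> \<le> 3 * A^3 * (\<kappa> * \<sigma>)" for i
      unfolding X_deriv(2)[OF mzp] fxm_commute[OF mzp] using fxm[of i] mp by (simp add: mz_def abs_mult)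
    have "\<bar>\<mu> * dd pos_dom (0, 1) X (mz z)\<bar> \<le> \<bar>\<mu>\<bar> * (C0 * fm (mz z))"
      unfolding abs_mult mz_def by (rule mult_left_mono[OF Xm_bound[OF mp]]) simp
    also have "\<dots> = C0 * \<bar>\<mu> * fm (mz z)\<bar>" using f0 by (simp add: abs_mult)
    also have "\<dots> \<le> A * E" using mu[folded E_def] A C by (intro mult_mono) auto
    finally have Xm: "\<bar>\<mu> * dd pos_dom (0, 1) X (mz z)\<bar> \<le> A * E" .
    have "\<bar>dd Q \<beta> (\<lambda>y. X (mz y)) z\<bar> \<le> A * ((2 * A * y) * (3 * A^3 * (\<kappa> * \<sigma>))) + A * E"
      unfolding comp_mz(2)[OF zQ mp X_deriv(1)[OF mzp]] fstb \<mu>_def[symmetric]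
      by (intro abs_add_le sumA abs_mult_le[OF b Xi] Xm)
    then show ?thesis unfolding E_def by (simp add: eval_nat_numeral algebra_simps)
  qed
  have dfx: "\<bar>dd Q \<beta> (\<lambda>y. fx i (mz y)) z\<bar> \<le> 39 * A^7 * t2" for i
  proof -
    \<comment> \<open>Multiplied by \<open>X = m f\<^sub>m\<close>, the product splits into
      \<open>\<mu> f\<^sub>m\<close> and \<open>m f\<^sub>x\<^sub>m\<close>, both of which are
      bounded; the factor \<open>X\<close> is cancelled afterwards.\<close>
    have c1: "X (mz z) * \<bar>\<mu> * dd pos_dom (0, 1) (fx i) (mz z)\<bar> \<le> E * (3 * A^3 * (\<kappa> * \<sigma>))"
    proof -
      have "X (mz z) * \<bar>\<mu> * dd pos_dom (0, 1) (fx i) (mz z)\<bar> = \<bar>\<mu> * fm (mz z)\<bar> * (m z * \<bar>dd pos_dom (0, 1) (fx i) (mz z)\<bar>)"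
        unfolding X_def using f0 by (simp add: mz_def abs_mult)
      also have "\<dots> \<le> E * (3 * A^3 * (\<kappa> * \<sigma>))"
        by (rule mult_mono[OF mu[folded E_def] fxm E0]) (use mp in simp)
      finally show ?thesis .
    qed
    have c2: "E * (3 * A^3 * (\<kappa> * \<sigma>)) \<le> X (mz z) * (33 * A^7 * t2)"
    proof -
      have e1: "5 * A^3 * k * y\<^sup>2 * (3 * A^3 * (\<kappa> * \<sigma>)) \<le> \<kappa> * \<kappa> * (15 * A^7 * t2)"
      proof -
        have "5 * A^3 * k * y\<^sup>2 * (3 * A^3 * (\<kappa> * \<sigma>)) = (15 * A^6 * t2 * \<kappa>) * k"
          unfolding t2_def by (simp add: eval_nat_numeral ac_simps)
        also have "\<dots> \<le> (15 * A^6 * t2 * \<kappa>) * (A * \<kappa>)"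
          using k0 kap1 A0 t2_0 kap0 by (intro mult_left_mono) auto
        finally show ?thesis by (simp add: eval_nat_numeral ac_simps)
      qed
      have e2: "6 * A^4 * (y * (\<kappa> * \<sigma>)) * (3 * A^3 * (\<kappa> * \<sigma>)) \<le> \<kappa> * \<kappa> * (18 * A^7 * t2)"
      proof -
        have "6 * A^4 * (y * (\<kappa> * \<sigma>)) * (3 * A^3 * (\<kappa> * \<sigma>)) = (18 * A^7 * (\<kappa> * \<kappa>)) * (y * \<sigma> * \<sigma>)"
          by (simp add: eval_nat_numeral ac_simps)
        also have "\<dots> \<le> (18 * A^7 * (\<kappa> * \<kappa>)) * t2" using yss_t2 A0 kap0 by (intro mult_left_mono) auto
        finally show ?thesis by (simp add: ac_simps)
      qed
      show ?thesis unfolding E_def kap2[symmetric] distrib_right using e1 e2 by (simp add: algebra_simps)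
    qed
    have mm: "\<bar>\<mu> * dd pos_dom (0, 1) (fx i) (mz z)\<bar> \<le> 33 * A^7 * t2"
      using order_trans[OF c1 c2] X0 by (rule mult_left_le_imp_le)
    have kst: "y * (\<kappa> * \<sigma>) \<le> A * t2"
    proof -
      have "\<kappa> * (y * \<sigma>) \<le> (A * y) * (y * \<sigma>)" using kapy ys0 by (rule mult_right_mono)
      then show ?thesis unfolding t2_def by (simp add: power2_eq_square ac_simps)
    qed
    have "\<bar>dd Q \<beta> (\<lambda>y. fx i (mz y)) z\<bar> \<le> A * ((2 * A * y) * (3 * A^2 * (\<kappa> * \<sigma>))) + 33 * A^7 * t2"
      unfolding comp_mz(2)[OF zQ mp diff_fx[OF mzp]] fstb \<mu>_def[symmetric]
      by (intro abs_add_le sumA abs_mult_le[OF b fxx] mm)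
    also have "A * ((2 * A * y) * (3 * A^2 * (\<kappa> * \<sigma>))) = 6 * A^4 * (y * (\<kappa> * \<sigma>))" by (simp add: eval_nat_numeral)
    also have "\<dots> \<le> 6 * A^4 * (A * t2)" using kst A0 by (intro mult_left_mono) auto
    also have "\<dots> = 6 * (A^5 * t2)" by (simp add: eval_nat_numeral)
    also have "\<dots> \<le> 6 * (A^7 * t2)" using Ap[of 5 7 t2] t2_0 by simp
    finally show ?thesis unfolding mult.assoc by linarith
  qed

  obtain v :: "'n \<Rightarrow> real^'n" where v: "\<And>i j. HPP i j (zp z) = (\<Sum>m\<in>UNIV. v m $ i * v m $ j)"
    using HPP_decomposition[of x "p z"] unfolding zp by metis
  define S where "S i j = U2 (ex i) (ex j) z" for i j
  define s where "s m l = U2 (v m, 0) (ex l) z" for m l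
  define sN where "sN = sqrt (\<Sum>i\<in>UNIV. \<Sum>j\<in>UNIV. (S i j)\<^sup>2)"
  define qN where "qN = sqrt (\<Sum>j\<in>UNIV. (q j)\<^sup>2)"
  \<comment> \<open>The good Hessian term carries the weight \<open>X = \<kappa>\<^sup>2\<close>,
    hence the Hessian is measured after multiplication by \<open>\<kappa>\<close>.\<close>
  define Z where "Z = \<kappa> * sN"
  have sN2: "sN\<^sup>2 = (\<Sum>i\<in>UNIV. \<Sum>j\<in>UNIV. (S i j)\<^sup>2)" unfolding sN_def by (simp add: sum_nonneg)
  have qN2: "qN\<^sup>2 = (\<Sum>j\<in>UNIV. (q j)\<^sup>2)" unfolding qN_def by (simp add: sum_nonneg)
  have sN0: "0 \<le> sN" and qN0: "0 \<le> qN" unfolding sN_def qN_def by (simp_all add: sum_nonneg)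
  have Z0: "0 \<le> Z" unfolding Z_def using kap0 sN0 by simp
  have Sb: "\<bar>S i j\<bar> \<le> sN" for i j
  proof (rule power2_le_imp_le[OF _ sN0])
    have "(S i j)\<^sup>2 \<le> (\<Sum>j\<in>UNIV. (S i j)\<^sup>2)" by (rule member_le_sum) auto
    also have "\<dots> \<le> (\<Sum>i\<in>UNIV. \<Sum>j\<in>UNIV. (S i j)\<^sup>2)"
      by (rule member_le_sum[of i UNIV "\<lambda>i. \<Sum>j\<in>UNIV. (S i j)\<^sup>2"]) (auto intro: sum_nonneg)
    finally show "\<bar>S i j\<bar>\<^sup>2 \<le> sN\<^sup>2" unfolding sN2 by simp
  qed
  have qb: "\<bar>q j\<bar> \<le> qN" for j
  proof (rule power2_le_imp_le[OF _ qN0])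
    have "(q j)\<^sup>2 \<le> (\<Sum>j\<in>UNIV. (q j)\<^sup>2)" by (rule member_le_sum) auto
    then show "\<bar>q j\<bar>\<^sup>2 \<le> qN\<^sup>2" unfolding qN2 by simp
  qed
  have vb: "\<bar>v m $ i\<bar> \<le> A" for m i
  proof (rule power2_le_imp_le[OF _ A0(2)])
    have "(v m $ i)\<^sup>2 \<le> (\<Sum>m\<in>UNIV. (v m $ i)\<^sup>2)" by (rule member_le_sum) auto
    also have "\<dots> = HPP i i (zp z)" unfolding v by (simp add: power2_eq_square)
    also have "\<dots> \<le> A" using hpp[of i i] by simp
    also have "\<dots> \<le> A\<^sup>2" using A(1) by (simp add: power2_eq_square)
    finally show "\<bar>v m $ i\<bar>\<^sup>2 \<le> A\<^sup>2" by simp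
  qed
  have s_eq: "s m l = (\<Sum>i\<in>UNIV. v m $ i * S i l)" for m l
  proof -
    have "(v m, 0) = (\<Sum>i\<in>UNIV. v m $ i *\<^sub>R ex i)"
      using vec_expand[of "v m"] by (simp add: prod_eq_iff fst_sum snd_sum)
    then show ?thesis unfolding s_def S_def
      by (simp only: linear_sum[OF linear_U2(1)[OF zQ]] linear_scale[OF linear_U2(1)[OF zQ]] real_scaleR_def)
  qed
  have sb: "\<bar>s m l\<bar> \<le> A^2 * sN" for m l
  proof -
    have "\<bar>s m l\<bar> \<le> A * (A * sN)" unfolding s_eq by (intro sumA abs_mult_le vb Sb)
    then show ?thesis by (simp add: power2_eq_square)
  qed
  define T1 where "T1 = (\<Sum>i\<in>UNIV. \<Sum>j\<in>UNIV. bb i z * bb j z * HXX j i (zp z))"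
  define T2 where "T2 = (\<Sum>i\<in>UNIV. \<Sum>l\<in>UNIV. bb i z * q l * HXP i l (zp z))"
  define T3 where "T3 = (\<Sum>j\<in>UNIV. \<Sum>l\<in>UNIV. q j * q l * HPP j l (zp z))"
  define Ta where "Ta = (\<Sum>m\<in>UNIV. \<Sum>i\<in>UNIV. \<Sum>j\<in>UNIV. v m $ i * v m $ j * HXX j i (zp z))"
  define Tb where "Tb = (\<Sum>m\<in>UNIV. \<Sum>i\<in>UNIV. \<Sum>l\<in>UNIV. v m $ i * s m l * HXP i l (zp z))"
  define Tc where "Tc = (\<Sum>m\<in>UNIV. \<Sum>j\<in>UNIV. \<Sum>l\<in>UNIV. s m j * s m l * HPP j l (zp z))"
  define T5 where "T5 = (\<Sum>j\<in>UNIV. dd Q \<beta> (bb j) z * q j)"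
  define T6 where "T6 = (\<Sum>i\<in>UNIV. dd Q \<beta> (bb i) z * (HX i (zp z) - fx i (mz z))
          + bb i z * (dd Q \<beta> (\<lambda>y. HX i (zp y)) z - dd Q \<beta> (\<lambda>y. fx i (mz y)) z))"
  define T7 where "T7 = dd Q \<beta> (\<lambda>y. X (mz y)) z * divb z"
  define T8 where "T8 = (\<Sum>i\<in>UNIV. dd Q \<beta> (\<lambda>y. HXP i i (zp y)) z
          + (\<Sum>j\<in>UNIV. U2 (ex i) (ex j) z * dd Q \<beta> (\<lambda>y. HPP j i (zp y)) z))"
  define T9 where "T9 = (\<Sum>i\<in>UNIV. bb i z * (HX i (zp z) - fx i (mz z))) + X (mz z) * (\<Sum>i\<in>UNIV. HXP i i (zp z))"
  have main: "T1 - 2 * T2 + T3 + X (mz z) * (Ta + 2 * Tb + Tc) + (2 * T5 - T6 - T7 - X (mz z) * T8)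
      + k * \<Delta>\<^sup>2 - k * \<phi> z * T9 \<le> 0"
  proof -
    have Tm: "Ta + 2 * Tb + Tc = (\<Sum>m\<in>UNIV. (\<Sum>i\<in>UNIV. \<Sum>j\<in>UNIV. v m $ i * v m $ j * HXX j i (zp z))
        + 2 * (\<Sum>i\<in>UNIV. \<Sum>l\<in>UNIV. v m $ i * s m l * HXP i l (zp z)) + (\<Sum>j\<in>UNIV. \<Sum>l\<in>UNIV. s m j * s m l * HPP j l (zp z)))"
      unfolding Ta_def Tb_def Tc_def by (simp only: sum.distrib sum_distrib_left)
    show ?thesis
      unfolding Tm T1_def T2_def T3_def T5_def T6_def T7_def T8_def T9_def q_def s_def \<Delta>_def \<beta>_def \<phi>_def
      by (rule bernstein_sum[OF less_imp_le[OF k0(1)] z max[unfolded V_def \<phi>_def] v])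
  qed
  have kst: "\<kappa> * \<sigma> \<le> A * (y * \<sigma>)" using mult_right_mono[OF kapy s0] by (simp add: mult.assoc)
  have b1: "\<bar>T1\<bar> \<le> 8 * (A^5 * t3)"
  proof -
    have "\<bar>T1\<bar> \<le> A * (A * ((2 * A * y) * (2 * A * y) * (2 * A * (y * \<sigma>))))"
      unfolding T1_def by (intro sumA2 abs_mult_le b hxx)
    then show ?thesis unfolding t3_def by (simp add: eval_nat_numeral ac_simps)
  qed
  have b2: "\<bar>T2\<bar> \<le> 4 * (A^4 * (y * \<sigma>) * qN)"
  proof -
    have "\<bar>T2\<bar> \<le> A * (A * ((2 * A * y) * qN * (2 * A * \<sigma>)))"
      unfolding T2_def by (intro sumA2 abs_mult_le b qb hxp)
    then show ?thesis by (simp add: eval_nat_numeral ac_simps)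
  qed
  have b3: "qN\<^sup>2 / A \<le> T3"
  proof -
    have "qN\<^sup>2 / A \<le> qN\<^sup>2 / C0" using A C by (intro divide_left_mono) auto
    also have "\<dots> \<le> T3"
      using HPP_quad(1)[of "\<chi> j. q j" x "p z"] unfolding T3_def qN2 zp
      by (simp add: inner_vec_def power2_eq_square)
    finally show ?thesis .
  qed
  have ba: "\<bar>X (mz z) * Ta\<bar> \<le> 2 * (A^7 * t3)"
  proof -
    have "\<bar>Ta\<bar> \<le> A * (A * (A * (A * A * (2 * A * (y * \<sigma>)))))"
      unfolding Ta_def by (intro sumA sumA2 abs_mult_le vb hxx)
    then have "\<bar>X (mz z) * Ta\<bar> \<le> (A * y\<^sup>2) * (A * (A * (A * (A * A * (2 * A * (y * \<sigma>))))))"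
      using XA2 X0 by (intro abs_mult_le) simp_all
    then show ?thesis unfolding y2ys[symmetric] by (simp add: eval_nat_numeral ac_simps)
  qed
  have kZ: "X (mz z) * (sN * \<sigma>) \<le> A * ((y * \<sigma>) * Z)"
  proof -
    have "(\<kappa> * \<sigma>) * Z \<le> (A * (y * \<sigma>)) * Z" by (rule mult_right_mono[OF kst Z0])
    then show ?thesis unfolding kap2[symmetric] Z_def by (simp add: ac_simps)
  qed
  have bb': "\<bar>X (mz z) * Tb\<bar> \<le> 2 * (A^8 * (y * \<sigma>) * Z)"
  proof -
    have "\<bar>Tb\<bar> \<le> A * (A * (A * (A * (A^2 * sN) * (2 * A * \<sigma>))))"
      unfolding Tb_def by (intro sumA sumA2 abs_mult_le vb sb hxp)
    then have "\<bar>Tb\<bar> \<le> 2 * A^7 * (sN * \<sigma>)" by (simp add: eval_nat_numeral ac_simps)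
    then have "X (mz z) * \<bar>Tb\<bar> \<le> X (mz z) * (2 * A^7 * (sN * \<sigma>))" using X0 by (intro mult_left_mono) auto
    also have "\<dots> = 2 * A^7 * (X (mz z) * (sN * \<sigma>))" by simp
    also have "\<dots> \<le> 2 * A^7 * (A * ((y * \<sigma>) * Z))" using kZ A0 by (intro mult_left_mono) auto
    finally show ?thesis using X0 by (simp add: abs_mult eval_nat_numeral ac_simps)
  qed
  have bc: "Z\<^sup>2 / A\<^sup>2 \<le> X (mz z) * Tc"
  proof -
    have Ss: "S i j = S j i" for i j unfolding S_def by (rule U2_sym[OF zQ])
    have "sN\<^sup>2 / C0\<^sup>2 \<le> Tc"
      unfolding Tc_def sN2 s_eq zp using v unfolding zp by (intro trace_quad_lower Ss)
    moreover have "sN\<^sup>2 / A\<^sup>2 \<le> sN\<^sup>2 / C0\<^sup>2" using A C by (intro divide_left_mono power_mono) auto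
    ultimately have "X (mz z) * (sN\<^sup>2 / A\<^sup>2) \<le> X (mz z) * Tc" using X0 by (intro mult_left_mono) auto
    then show ?thesis unfolding Z_def kap2[symmetric] by (simp add: power2_eq_square ac_simps)
  qed
  have b5: "\<bar>T5\<bar> \<le> 7 * (A^4 * (y * \<sigma>) * qN)"
  proof -
    have "\<bar>T5\<bar> \<le> A * (7 * A^3 * (y * \<sigma>) * qN)" unfolding T5_def by (intro sumA abs_mult_le db qb)
    then show ?thesis by (simp add: eval_nat_numeral ac_simps)
  qed
  have hxfx: "\<bar>HX i (zp z) - fx i (mz z)\<bar> \<le> 5 * A^3 * (y * \<sigma>)" for i
  proof -
    have "\<bar>HX i (zp z) - fx i (mz z)\<bar> \<le> 2 * A * (y * \<sigma>) + 3 * A^2 * (\<kappa> * \<sigma>)" by (intro abs_diff_le hx fxb)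
    also have "3 * A^2 * (\<kappa> * \<sigma>) \<le> 3 * A^2 * (A * (y * \<sigma>))" using kst A0 by (intro mult_left_mono) auto
    also have "\<dots> = 3 * (A^3 * (y * \<sigma>))" by (simp add: eval_nat_numeral)
    finally show ?thesis using Ap[of 1 3 "y * \<sigma>"] ys0 by (simp add: mult.assoc)
  qed
  have A5: "A^5 * t3 \<le> A^9 * t3" "A^7 * t3 \<le> A^9 * t3" using Ap[of 5 9 t3] Ap[of 7 9 t3] t3_0 by simp_all
  have A5': "A^5 * t2 \<le> A^9 * t2" "A^3 * t2 \<le> A^9 * t2" using Ap[of 5 9 t2] Ap[of 3 9 t2] t2_0 by simp_all
  have b6: "\<bar>T6\<bar> \<le> 133 * (A^9 * t3)"
  proof -
    have "\<bar>T6\<bar> \<le> A * ((7 * A^3 * (y * \<sigma>)) * (5 * A^3 * (y * \<sigma>)) + (2 * A * y) * (10 * A^3 * t2 + 39 * A^7 * t2))"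
      unfolding T6_def by (intro sumA abs_add_le abs_diff_le abs_mult_le db hxfx b dHX dfx)
    also have "\<dots> = 35 * (A^7 * ((y * \<sigma>) * (y * \<sigma>))) + 20 * (A^5 * t3) + 78 * (A^9 * t3)"
      unfolding yt2[symmetric] by (simp add: eval_nat_numeral algebra_simps)
    also have "\<dots> \<le> 35 * (A^7 * t3) + 20 * (A^5 * t3) + 78 * (A^9 * t3)"
      using mult_left_mono[OF yyss_t3, of "A^7"] A0 by simp
    also have "\<dots> \<le> 133 * (A^9 * t3)" using A5 by linarith
    finally show ?thesis .
  qed
  have divb_b: "\<bar>divb z\<bar> \<le> 2 * A^2 * \<sigma> + A^3 * sN"
  proof -
    have "\<bar>divb z\<bar> \<le> A * (2 * A * \<sigma> + A * (sN * A))"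
      unfolding divb_def by (intro sumA abs_add_le abs_mult_le hxp hpp Sb[unfolded S_def])
    then show ?thesis by (simp add: eval_nat_numeral algebra_simps)
  qed
  \<comment> \<open>The derivative of \<open>\<chi>\<close> along \<open>b\<close> meets the full
    Hessian in \<open>divb\<close>. Its part of order \<open>k * y\<^sup>2\<close> yields
    \<open>k * y\<^sup>2 * Z\<close>, which has no deficit \<open>\<sigma>\<close>; it is absorbed
    because \<open>k\<close> is small.\<close>
  have b7: "\<bar>T7\<bar> \<le> 34 * (A^9 * t3) + 12 * (A^8 * (y * \<sigma>) * Z) + 5 * (A^8 * k * y\<^sup>2 * Z)"
  proof -
    have "\<bar>T7\<bar> \<le> (12 * A^5 * (y * (\<kappa> * \<sigma>)) + 5 * A^4 * k * y\<^sup>2) * (2 * A^2 * \<sigma> + A^3 * sN)"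
      unfolding T7_def by (rule abs_mult_le[OF dX divb_b])
    also have "\<dots> = 24 * A^7 * ((y * \<sigma>) * (\<kappa> * \<sigma>)) + 12 * (A^8 * (y * \<sigma>) * Z) + 10 * A^6 * t2 * k + 5 * A^7 * k * y\<^sup>2 * sN"
      unfolding Z_def t2_def by (simp add: eval_nat_numeral algebra_simps)
    also have "24 * A^7 * ((y * \<sigma>) * (\<kappa> * \<sigma>)) \<le> 24 * (A^9 * t3)"
    proof -
      have "(y * \<sigma>) * (\<kappa> * \<sigma>) \<le> (y * \<sigma>) * (A * (y * \<sigma>))" by (rule mult_left_mono[OF kst ys0])
      also have "\<dots> \<le> A * t3" using mult_left_mono[OF yyss_t3 A0(2)] by (simp add: ac_simps)
      finally have "24 * A^7 * ((y * \<sigma>) * (\<kappa> * \<sigma>)) \<le> 24 * A^7 * (A * t3)" using A0 by (intro mult_left_mono) auto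
      also have "\<dots> = 24 * (A^8 * t3)" by (simp add: eval_nat_numeral)
      also have "\<dots> \<le> 24 * (A^9 * t3)" using Ap[of 8 9 t3] t3_0 by simp
      finally show ?thesis .
    qed
    also have "10 * A^6 * t2 * k \<le> 10 * (A^9 * t3)"
    proof -
      have "10 * A^6 * t2 * k \<le> 10 * A^6 * t2 * 1" using k0 A0 t2_0 by (intro mult_left_mono) auto
      also have "\<dots> \<le> 10 * (A^6 * t3)" using mult_left_mono[OF t23, of "A^6"] A0 by simp
      also have "\<dots> \<le> 10 * (A^9 * t3)" using Ap[of 6 9 t3] t3_0 by simp
      finally show ?thesis .
    qed
    also have "5 * A^7 * k * y\<^sup>2 * sN \<le> 5 * (A^8 * k * y\<^sup>2 * Z)"
    proof -
      have "5 * A^7 * k * y\<^sup>2 * sN * 1 \<le> 5 * A^7 * k * y\<^sup>2 * sN * (A * \<kappa>)"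
        using kap1 A0 k0 sN0 by (intro mult_left_mono) auto
      then show ?thesis unfolding Z_def by (simp add: eval_nat_numeral ac_simps)
    qed
    finally show ?thesis by linarith
  qed
  have b8: "\<bar>X (mz z) * T8\<bar> \<le> 16 * (A^5 * t3) + 8 * (A^6 * (y * \<sigma>) * Z)"
  proof -
    have "\<bar>T8\<bar> \<le> A * (16 * A^3 * (y * \<sigma>) + A * (sN * (8 * A^3 * \<sigma>)))"
      unfolding T8_def by (intro sumA abs_add_le abs_mult_le dHXP dHPP Sb[unfolded S_def])
    then have "X (mz z) * \<bar>T8\<bar> \<le> X (mz z) * (A * (16 * A^3 * (y * \<sigma>) + A * (sN * (8 * A^3 * \<sigma>))))"
      using X0 by (intro mult_left_mono) auto
    also have "\<dots> = 16 * A^4 * (y * \<sigma>) * X (mz z) + 8 * A^5 * (X (mz z) * (sN * \<sigma>))"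
      by (simp add: eval_nat_numeral algebra_simps)
    also have "16 * A^4 * (y * \<sigma>) * X (mz z) \<le> 16 * A^4 * (y * \<sigma>) * (A * y\<^sup>2)"
      using XA2 A0 ys0 by (intro mult_left_mono) auto
    also have "16 * A^4 * (y * \<sigma>) * (A * y\<^sup>2) = 16 * (A^5 * t3)" unfolding y2ys[symmetric] by (simp add: eval_nat_numeral ac_simps)
    also have "8 * A^5 * (X (mz z) * (sN * \<sigma>)) \<le> 8 * A^5 * (A * ((y * \<sigma>) * Z))"
      using kZ A0 by (intro mult_left_mono) auto
    also have "8 * A^5 * (A * ((y * \<sigma>) * Z)) = 8 * (A^6 * (y * \<sigma>) * Z)" by (simp add: eval_nat_numeral)
    finally show ?thesis using X0 by (simp add: abs_mult)
  qed
  have b9: "\<bar>k * \<phi> z * T9\<bar> \<le> 12 * (A^9 * t3)"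
  proof -
    have "\<bar>X (mz z) * (\<Sum>i\<in>UNIV. HXP i i (zp z))\<bar> \<le> (A * y\<^sup>2) * (A * (2 * A * \<sigma>))"
      using XA2 X0 by (intro abs_mult_le sumA hxp) simp
    moreover have "\<bar>\<Sum>i\<in>UNIV. bb i z * (HX i (zp z) - fx i (mz z))\<bar> \<le> A * ((2 * A * y) * (5 * A^3 * (y * \<sigma>)))"
      by (intro sumA abs_mult_le b hxfx)
    ultimately have "\<bar>T9\<bar> \<le> A * ((2 * A * y) * (5 * A^3 * (y * \<sigma>))) + (A * y\<^sup>2) * (A * (2 * A * \<sigma>))"
      unfolding T9_def by linarith
    also have "\<dots> = 10 * (A^5 * t2) + 2 * (A^3 * t2)" unfolding t2_def by (simp add: eval_nat_numeral algebra_simps)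
    also have "\<dots> \<le> 12 * (A^9 * t2)" using A5' by linarith
    also have "\<dots> \<le> 12 * (A^9 * t3)" using mult_left_mono[OF t23, of "A^9"] A0 by simp
    finally have "\<bar>T9\<bar> \<le> 12 * (A^9 * t3)" .
    from abs_mult_le[OF kphi this] show ?thesis by simp
  qed
  have b10: "k * (y^4 / (4 * A\<^sup>2)) \<le> k * \<Delta>\<^sup>2"
  proof -
    have "\<Delta> \<le> - (P\<^sup>2 / C0) - ww z + 2 * C0 + c" unfolding \<Delta>_def P_def by (rule Delta_le[OF zQ])
    moreover have "P\<^sup>2 / A \<le> P\<^sup>2 / C0" using A C by (intro divide_left_mono) auto
    moreover have "\<bar>ww z\<bar> / A \<le> \<bar>ww z\<bar>" using A by (simp add: pos_divide_le_eq mult_le_cancel_left1)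
    moreover have "\<bar>ww z\<bar> \<le> ww z + 2 * A" using W A0 by linarith
    moreover have "y\<^sup>2 / A = 1 / A + P\<^sup>2 / A + \<bar>ww z\<bar> / A" unfolding y2 by (simp add: add_divide_distrib)
    moreover have "1 / A \<le> A" using A by (simp add: pos_divide_le_eq mult_ge1_I)
    ultimately have d1: "y\<^sup>2 / A - 6 * A \<le> - \<Delta>" using A by linarith
    \<comment> \<open>This is the purpose of the initial case distinction: the additive
      \<open>6 * A\<close> costs at most half of \<open>y\<^sup>2 / A\<close>.\<close>
    have "12 * A\<^sup>2 \<le> y\<^sup>2" using False by simp
    then have "6 * A \<le> y\<^sup>2 / (2 * A)" using A0 by (simp add: pos_le_divide_eq power2_eq_square)
    moreover have "y\<^sup>2 / A = y\<^sup>2 / (2 * A) + y\<^sup>2 / (2 * A)" by simp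
    ultimately have "y\<^sup>2 / (2 * A) \<le> - \<Delta>" using d1 by linarith
    then have "(y\<^sup>2 / (2 * A))\<^sup>2 \<le> (- \<Delta>)\<^sup>2" using A0 by (intro power_mono) auto
    then have "y^4 / (4 * A\<^sup>2) \<le> \<Delta>\<^sup>2" by (simp add: power_divide power_mult_distrib flip: power_mult)
    then show ?thesis using k0 by (intro mult_left_mono) auto
  qed
  have A6: "A^6 * (y * \<sigma>) * Z \<le> A^8 * (y * \<sigma>) * Z"
    using Ap[of 6 8 "y * \<sigma> * Z", OF _ mult_nonneg_nonneg[OF ys0 Z0]] by (simp add: mult.assoc)
  have split: "X (mz z) * (Ta + 2 * Tb + Tc) = X (mz z) * Ta + 2 * (X (mz z) * Tb) + X (mz z) * Tc"
    by (simp add: distrib_left)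
  \<comment> \<open>The bookkeeping of coefficients: 22 = 2 * 4 + 2 * 7, 24 = 2 * 2 + 12 + 8 and 205
    = 8 + 2 + 133 + 34 + 16 + 12. Fresh variables keep it linear.\<close>
  have arith: "q2 + z2 + kd - 22 * aq - 24 * az - 5 * akz - 205 * a9 \<le> 0"
    if "t1 - 2 * t2' + t3' + (xa + 2 * xb + xc) + (2 * t5 - t6 - t7 - x8) + kdd - p9 \<le> 0"
      "\<bar>t1\<bar> \<le> 8 * a5" "\<bar>t2'\<bar> \<le> 4 * aq" "q2 \<le> t3'" "\<bar>xa\<bar> \<le> 2 * a7" "\<bar>xb\<bar> \<le> 2 * az" "z2 \<le> xc"
      "\<bar>t5\<bar> \<le> 7 * aq" "\<bar>t6\<bar> \<le> 133 * a9" "\<bar>t7\<bar> \<le> 34 * a9 + 12 * az + 5 * akz" "\<bar>x8\<bar> \<le> 16 * a5 + 8 * a6"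
      "\<bar>p9\<bar> \<le> 12 * a9" "kd \<le> kdd" "a5 \<le> a9" "a7 \<le> a9" "a6 \<le> az"
    for q2 z2 kd aq az akz a9 t1 t2' t3' xa xb xc t5 t6 t7 x8 kdd p9 a5 a7 a6 :: real
    using that by linarith
  have "qN\<^sup>2 / A + Z\<^sup>2 / A\<^sup>2 + k * (y^4 / (4 * A\<^sup>2)) - 22 * (A^4 * (y * \<sigma>) * qN)
       - 24 * (A^8 * (y * \<sigma>) * Z) - 5 * (A^8 * k * y\<^sup>2 * Z) - 205 * (A^9 * t3) \<le> 0"
    by (rule arith[OF main[unfolded split] b1 b2 b3 ba bb' bc b5 b6 b7 b8 b9 b10 A5 A6])
  from bernstein_algebra[OF A(1) y1 s1 sy k this[unfolded t3_def]] show ?thesis unfolding \<sigma>_def .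
qed

end

section \<open>Maxima of \<open>V\<close> at the initial and terminal time, and the full gradient
  bound\<close>

lemma quadratic_root_bound:
  fixes P c :: real
  assumes "P\<^sup>2 \<le> c + d * P" "0 \<le> c" "0 \<le> d" "1 \<le> c + d"
  shows "P \<le> c + d"
proof (rule ccontr)
  assume "\<not> ?thesis"
  then have P: "P > c + d" "P > 1" using assms(4) by linarith+
  have "c * 1 \<le> c * P" using P assms by (intro mult_left_mono) auto
  then have "P * P \<le> (c + d) * P" using assms(1) by (simp add: power2_eq_square algebra_simps)
  then have "P \<le> c + d" using P by simp
  then show False using P by simp
qed

context mfg
begin

lemma slice_derivative:
  fixes G :: "(real^'n) \<times> real \<Rightarrow> real"
  assumes z: "(x, t) \<in> Q" and G: "G differentiable (at (x, t) within Q)"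
  shows "((\<lambda>x. G (x, t)) has_derivative (\<lambda>h. dd Q (h, 0) G (x, t))) (at x)"
proof -
  have 1: "((\<lambda>x :: real^'n. (x, t)) has_derivative (\<lambda>h. (h, 0))) (at x)" by (auto intro!: derivative_eq_intros)
  have "range (\<lambda>x :: real^'n. (x, t)) \<subseteq> Q" using z by (auto simp: mem_Q)
  from has_derivative_subset[OF dd_has_derivative[OF G] this]
  show ?thesis by (rule has_derivative_in_compose[OF 1])
qed

lemma dm_initial: "dd Q (ex l) m (x, 0) = dd UNIV (axis l 1) m0 x"
proof -
  have z: "(x, 0) \<in> Q" using T_pos by (simp add: mem_Q)
  have "(m0 has_derivative (\<lambda>h. dd Q (h, 0) m (x, 0))) (at x)"
    using slice_derivative[OF z diff_m[OF z]] by (simp only: m_init)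
  from dd_eq[OF thickU UNIV_I this] show ?thesis by simp
qed

text \<open>The terminal condition differentiated along the torus. It determines the gradient of
  \<open>m\<close> at \<open>t = T\<close> from that of \<open>u\<close>.\<close>

lemma p_terminal:
  "p (x, T) $ l = g.fx l (mz (x, T)) + dd Q (ex l) m (x, T) * g.fm (mz (x, T))"
proof -
  have z: "(x, T) \<in> Q" using T_pos by (simp add: mem_Q)
  note C = comp_mz[OF z m_pos[OF z] g.diff_F[OF mz_pos[OF z]]]
  have e: "(\<lambda>x. u (x, T)) = (\<lambda>x. g.F (mz (x, T)))" by (simp add: u_term_real mz_def)
  have "(\<lambda>h. dd Q (h, 0) u (x, T)) = (\<lambda>h. dd Q (h, 0) (\<lambda>y. g.F (mz y)) (x, T))"
    by (rule has_derivative_unique[OF slice_derivative[OF z diff_u[OF z]] slice_derivative[OF z C(1), folded e]])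
  from fun_cong[OF this, of "axis l 1"] show ?thesis
    unfolding p_nth C(2) g.fx_def g.fm_def by (simp add: sum_axis)
qed

lemma dww_boundary:
  assumes z: "z \<in> Q"
  shows "dd Q (ex l) ww z = fx l (mz z) + dd Q (ex l) m z * fm (mz z)"
  using ww_deriv(2)[OF z, of "ex l"] by (simp add: sum_axis)

text \<open>The spatial derivatives of \<open>V\<close> vanish at a maximum even at the two ends.
  Combined with \<open>Du\<^sub>t = Dh - Dw\<close>, this replaces the mixed second derivatives of
  \<open>u\<close> by the gradient of \<open>w\<close>, which the boundary conditions
  control.\<close>

lemma dV_time:
  fixes V \<phi> :: "(real^'n) \<times> real \<Rightarrow> real" and c e k :: real
  defines "\<phi> \<equiv> \<lambda>y. u y + c * snd y + e"
  defines "V \<equiv> \<lambda>y. hh y + (k / 2) * (\<phi> y * \<phi> y)"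
  assumes z: "z \<in> Q" and max: "\<And>y. y \<in> Q \<Longrightarrow> V y \<le> V z"
  shows "dd Q et V z = k * \<phi> z * (ut z + c - (\<Sum>l\<in>UNIV. bb l z * p z $ l)) - (\<Sum>l\<in>UNIV. bb l z * dd Q (ex l) ww z)"
proof -
  have first: "V differentiable (at z within Q)"
    "\<And>v. dd Q v V z = dd Q v hh z + k * \<phi> z * (dd Q v u z + snd v * c)"
    unfolding V_def \<phi>_def by (rule bernstein_first(2,3)[OF z])+
  have t: "U2 et (ex l) z = - (k * \<phi> z * p z $ l) - dd Q (ex l) ww z" for l
    using max_tangential[OF z max first(1), of "axis l 1"] ww_deriv(1)[OF z, of "ex l"] U2_sym[OF z, of et "ex l"]
    unfolding first(2) by (simp add: p_nth)
  have "dd Q et hh z = (\<Sum>l\<in>UNIV. U2 et (ex l) z * bb l z)"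
    unfolding hh_deriv(2)[OF z] by simp
  also have "\<dots> = - (k * \<phi> z * (\<Sum>l\<in>UNIV. bb l z * p z $ l)) - (\<Sum>l\<in>UNIV. bb l z * dd Q (ex l) ww z)"
    unfolding t left_diff_distrib sum_subtractf by (simp add: sum_negf sum_distrib_left mult.assoc mult.commute[of "bb _ z"])
  finally show ?thesis unfolding first(2) by (simp add: ut_def algebra_simps)
qed

text \<open>The hypotheses on \<open>W\<close> and \<open>XB\<close> are arranged so that the lower
  bound for \<open>w\<close> at the maximum of \<open>V\<close> needs information at the two ends
  only; ellipticity is assumed just where that bound holds.\<close>

lemma gradient_estimate:
  fixes L W B A \<kappa> :: real
  assumes uL: "\<And>z. z \<in> Q \<Longrightarrow> \<bar>u z\<bar> \<le> L" and L: "L \<ge> 1"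
    and W: "C0 \<le> W" "\<And>x. - W \<le> ww (x, T)"
    and XB: "\<And>z. z \<in> Q \<Longrightarrow> ww z \<ge> - (W + 1) \<Longrightarrow> 1 / X (mz z) \<le> A"
    and gB: "\<And>x l. \<bar>g.fx l (mz (x, T))\<bar> \<le> A" and wB: "\<And>x. \<bar>ww (x, T)\<bar> \<le> A"
    and A: "A \<ge> 1" "real CARD('n) \<le> A" "2 * L + 1 \<le> A" "2 * (L + 1) / T \<le> A" "W + 1 \<le> A"
    and kappa: "1 / (1 - \<tau>) \<le> \<kappa>"
    and z: "z \<in> Q"
  shows "norm (D_full T u z) \<le> 6 * A * ((500000 * A ^ 40) powr \<kappa>)\<^sup>2"
proof -
  \<comment> \<open>With \<open>\<bar>u\<bar> \<le> L\<close>, these \<open>c\<close> and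
    \<open>e\<close> give \<open>\<phi>\<close> the sign needed at each end, with absolute value at
    least 1, while \<open>\<bar>\<phi>\<bar> \<le> 2 * L + 1 \<le> A\<close> inside.\<close>
  define c where "c = 2 * (L + 1) / T"
  define e where "e = - (L + 1)"
  define k where "k = 1 / (100 * A ^ 20)"
  define \<phi> where "\<phi> y = u y + c * snd y + e" for y
  define V where "V y = hh y + (k / 2) * (\<phi> y * \<phi> y)" for y
  define Y where "Y = (500000 * A ^ 40) powr \<kappa>"
  have CA: "C0 \<le> A" using W(1) A(5) by linarith
  have C: "1 \<le> C0" "0 \<le> C0" using C0_ge_1 by simp_all
  have A0: "0 < A" "0 \<le> A" using A(1) by simp_all
  have c: "0 \<le> c" "c \<le> A" "c * T = 2 * (L + 1)" using L T_pos A(4) unfolding c_def by simp_all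
  have phi_b: "\<bar>\<phi> y\<bar> \<le> A" if y: "y \<in> Q" for y
  proof -
    have "0 \<le> snd y" "snd y \<le> T" using y by (cases y, simp add: mem_Q)+
    then have cs: "0 \<le> c * snd y" "c * snd y \<le> 2 * (L + 1)" using c(1) unfolding c(3)[symmetric] by (simp_all add: mult_left_mono)
    have "u y \<le> L" "- L \<le> u y" using uL[OF y] by (simp_all add: abs_le_iff)
    moreover have "\<bar>a + b + - (L + 1)\<bar> \<le> A" if "a \<le> L" "- L \<le> a" "0 \<le> b" "b \<le> 2 * (L + 1)" for a b
      using that A(3) by (simp add: abs_le_iff)
    ultimately show ?thesis using cs unfolding \<phi>_def e_def by blast
  qed
  have phi_0: "\<phi> (x, 0) \<le> - 1" and phi_T: "\<phi> (x, T) \<ge> 1" for x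
    using uL[of "(x, 0)"] uL[of "(x, T)"] T_pos c(3) unfolding \<phi>_def e_def by (simp_all add: mem_Q abs_le_iff)
  have A20: "A\<^sup>2 \<le> A ^ 20" using A(1) by (intro power_increasing) auto
  have k0: "k > 0" unfolding k_def using A0 by simp
  have kphi: "0 \<le> (k / 2) * (\<phi> y * \<phi> y)" "(k / 2) * (\<phi> y * \<phi> y) \<le> 1" if y: "y \<in> Q" for y
  proof -
    show "0 \<le> (k / 2) * (\<phi> y * \<phi> y)" using k0 by simp
    have "\<bar>\<phi> y * \<phi> y\<bar> \<le> A * A" by (intro abs_mult_le phi_b y)
    then have "(k / 2) * (\<phi> y * \<phi> y) \<le> (k / 2) * A ^ 20"
      using A20 k0 by (intro mult_left_mono) (auto simp: power2_eq_square)
    also have "\<dots> \<le> 1" unfolding k_def using A0 by simp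
    finally show "(k / 2) * (\<phi> y * \<phi> y) \<le> 1" .
  qed
  have hV: "hh y \<le> V y" "V y \<le> hh y + 1" if "y \<in> Q" for y
    using kphi[OF that] unfolding V_def by linarith+
  have cV: "continuous_on Q V"
    unfolding V_def[abs_def] \<phi>_def[abs_def] by (intro continuous_intros cont_hh cont_u)
  have pV: "periodic_fst {0..T} V"
  proof -
    have "p (x + axis i 1, t) = p (x, t)" if "t \<in> {0..T}" for x i t
      using periodic_du that unfolding vec_eq_iff p_nth periodic_fst_def periodic_def by blast
    moreover have "H (x + axis i 1, q) = H (x, q)" for x i q
      using assm_H unfolding assumption_H_def periodic_fst_def periodic_def by blast
    ultimately show ?thesis using periodic_u
      unfolding V_def \<phi>_def hh_def zp_def periodic_fst_def periodic_def by simp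
  qed
  obtain z0 where z0: "z0 \<in> Q" and max: "\<And>y. y \<in> Q \<Longrightarrow> V y \<le> V z0" using max_on_Q[OF cV pV] by blast
  have V_fun: "V = (\<lambda>y. hh y + (k / 2) * ((u y + c * snd y + e) * (u y + c * snd y + e)))"
    unfolding V_def \<phi>_def by (rule refl)
  have phi_fun: "\<phi> y = u y + c * snd y + e" for y by (rule \<phi>_def)
  define P where "P = norm (p z0)"
  have P0: "0 \<le> P" by (simp add: P_def)
  define M where "M = 500000 * A ^ 40"
  have M1: "1 \<le> A ^ 40" "A ^ 26 \<le> A ^ 40" "A ^ 4 \<le> A ^ 40" "A ^ 26 \<ge> 1" "A ^ 4 \<ge> 1"
    using A(1) by (auto intro: power_increasing one_le_power)
  have kap1: "1 \<le> \<kappa>" using kappa tau order_trans[of 1 "1 / (1 - \<tau>)" \<kappa>] by (simp add: pos_le_divide_eq)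
  have MY: "M \<le> Y"
  proof -
    have "M powr 1 \<le> M powr \<kappa>" using M1 kap1 unfolding M_def by (intro powr_mono) auto
    then show ?thesis unfolding Y_def M_def using M1 by simp
  qed
  have w0: "\<bar>ww (x, 0)\<bar> \<le> W" for x using ww_init[of x] W(1) by linarith
  define D where "D = ut z0 + c - (\<Sum>l\<in>UNIV. bb l z0 * p z0 $ l)"
  have Dle: "P\<^sup>2 / A - 4 * A \<le> - D" if "- A \<le> ww z0"
  proof -
    have "D \<le> - (P\<^sup>2 / C0) - ww z0 + 2 * C0 + c" unfolding D_def P_def by (rule Delta_le[OF z0])
    moreover have "P\<^sup>2 / A \<le> P\<^sup>2 / C0" using CA C by (intro divide_left_mono) auto
    ultimately show ?thesis using that CA c(2) by linarith
  qed
  have bb: "\<bar>bb l z0\<bar> \<le> A * (1 + P)" for l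
    unfolding bb_def zp_def P_def by (rule order_trans[OF HP_bound mult_right_mono[OF CA]]) simp
  have sumA: "\<bar>\<Sum>i\<in>(UNIV::'n set). G i\<bar> \<le> A * d" if "\<And>i. \<bar>G i\<bar> \<le> d" for G d
  proof -
    have "0 \<le> d" using order_trans[OF abs_ge_zero that] .
    then show ?thesis using sum_abs_bound[of G d, OF that] mult_right_mono[OF A(2), of d] by linarith
  qed
  have dV: "dd Q et V z0 = k * \<phi> z0 * D - (\<Sum>l\<in>UNIV. bb l z0 * dd Q (ex l) ww z0)"
    unfolding V_fun D_def phi_fun by (rule dV_time[OF z0 max[unfolded V_fun]])
  have difV: "V differentiable (at z0 within Q)" unfolding V_fun by (rule bernstein_first(2)[OF z0])
  \<comment> \<open>The factor \<open>1 / k\<close> costs \<open>100 * A ^ 20\<close>; the quadratic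
    inequality then gives \<open>P \<le> 1204 * A ^ 26\<close>.\<close>
  have solve: "P \<le> M" if q: "k * (P\<^sup>2 / A - 4 * A) \<le> 6 * A ^ 5 * (1 + P)"
  proof -
    have "(100 * A ^ 21) * (k * (P\<^sup>2 / A - 4 * A)) \<le> (100 * A ^ 21) * (6 * A ^ 5 * (1 + P))"
      using q A0 by (intro mult_left_mono) auto
    moreover have "(100 * A ^ 21) * (k * (P\<^sup>2 / A - 4 * A)) = P\<^sup>2 - 4 * A\<^sup>2"
      unfolding k_def using A0 by (simp add: field_simps eval_nat_numeral)
    moreover have "(100 * A ^ 21) * (6 * A ^ 5 * (1 + P)) = 600 * A ^ 26 + 600 * A ^ 26 * P"
      by (simp add: algebra_simps flip: power_add)
    moreover have "A\<^sup>2 \<le> A ^ 26" using A(1) by (intro power_increasing) auto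
    ultimately have "P\<^sup>2 \<le> 604 * A ^ 26 + 600 * A ^ 26 * P" by linarith
    then have "P \<le> 604 * A ^ 26 + 600 * A ^ 26" by (rule quadratic_root_bound) (use M1 in auto)
    then show ?thesis using M1 unfolding M_def by linarith
  qed
  have P_le: "P \<le> Y"
    using z0
  proof (cases rule: Q_cases)
    case 1
    \<comment> \<open>At both ends \<open>u\<^sub>t = h - w\<close>, where
      \<open>h \<le> V \<le> V z0 \<le> hh z0 + 1\<close> and \<open>w \<ge> - W\<close>. The
      maximum principle carries this to \<open>z0\<close>, where \<open>hh z0\<close> cancels and a
      lower bound for \<open>w\<close> remains.\<close>
    have "1 * ut z0 \<le> hh z0 + 1 + W"
    proof (rule ut_principle)
      fix x
      have a: "(x, 0) \<in> Q" "(x, T) \<in> Q" using T_pos by (simp_all add: mem_Q)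
      show "1 * ut (x, 0) \<le> hh z0 + 1 + W"
        using ww_eq[OF a(1)] hV(1)[OF a(1)] max[OF a(1)] hV(2)[OF z0] w0[of x] by linarith
      show "1 * ut (x, T) \<le> hh z0 + 1 + W"
        using ww_eq[OF a(2)] hV(1)[OF a(2)] max[OF a(2)] hV(2)[OF z0] W(2)[of x] by linarith
    qed (use z0 in simp_all)
    then have w: "ww z0 \<ge> - (W + 1)" using ww_eq[OF z0] by linarith
    define y where "y = sqrt (1 + (norm (p z0))\<^sup>2 + \<bar>ww z0\<bar>)"
    have y1: "1 \<le> y" unfolding y_def by simp
    have "y \<le> M * y powr \<tau>"
      unfolding M_def y_def
      by (rule bernstein_interior[OF 1 max[unfolded V_fun] A(1,2) CA phi_b[OF z0, unfolded phi_fun] c(1,2) XB[OF z0 w] w A(5) k_def])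
    \<comment> \<open>Division by \<open>y powr \<tau>\<close> uses \<open>\<tau> < 1\<close>;
      taking the root of order \<open>1 - \<tau>\<close> introduces the dependence on
      \<open>1 / (1 - \<tau>)\<close>.\<close>
    then have "y * y powr (- \<tau>) \<le> M * y powr \<tau> * y powr (- \<tau>)" by (intro mult_right_mono) auto
    moreover have "M * y powr \<tau> * y powr (- \<tau>) = M" using y1 powr_add[of y \<tau> "- \<tau>"] by (simp add: mult.assoc)
    moreover have "y * y powr (- \<tau>) = y powr (1 - \<tau>)" using y1 powr_add[of y 1 "- \<tau>"] by simp
    ultimately have "y powr (1 - \<tau>) \<le> M" by (simp only:)
    then have "(y powr (1 - \<tau>)) powr (1 / (1 - \<tau>)) \<le> M powr (1 / (1 - \<tau>))" using tau by (intro powr_mono2) auto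
    also have "(y powr (1 - \<tau>)) powr (1 / (1 - \<tau>)) = y" using tau y1 by (simp add: powr_powr)
    also have "M powr (1 / (1 - \<tau>)) \<le> M powr \<kappa>" using kappa M1 unfolding M_def by (intro powr_mono) auto
    finally have yY: "y \<le> Y" unfolding Y_def M_def .
    have "P \<le> y" unfolding P_def y_def by (rule real_le_rsqrt) simp
    then show ?thesis using yY by linarith
  next
    case (2 x)
    have le: "dd Q et V z0 \<le> 0" using max_initial[OF max[unfolded 2] difV[unfolded 2]] 2 by simp
    have dw: "\<bar>dd Q (ex l) ww z0\<bar> \<le> 2 * A\<^sup>2" for l
    proof -
      have B: "ex l \<in> Basis" "et \<in> (Basis :: ((real^'n) \<times> real) set)" "axis l 1 \<in> (Basis :: (real^'n) set)"
        by (auto simp: Basis_prod_def Basis_vec_def)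
      have m0: "mz z0 = (x, m0 x)" by (simp add: 2 mz_def m_init)
      have "\<bar>fx l (mz z0)\<bar> \<le> C0" "\<bar>fm (mz z0)\<bar> \<le> C0" unfolding m0 fx_def fm_def by (rule f_m0_bounds(2)[OF B(1)], rule f_m0_bounds(2)[OF B(2)])
      moreover have "\<bar>dd Q (ex l) m z0\<bar> \<le> C0" unfolding 2 dm_initial by (rule dm0_bound[OF B(3)])
      ultimately have "\<bar>dd Q (ex l) ww z0\<bar> \<le> A + A * A"
        unfolding dww_boundary[OF z0] using CA by (intro abs_add_le abs_mult_le) linarith+
      moreover have "A * 1 \<le> A * A" using A by (intro mult_left_mono) auto
      ultimately show ?thesis unfolding power2_eq_square by linarith
    qed
    have "\<bar>\<Sum>l\<in>UNIV. bb l z0 * dd Q (ex l) ww z0\<bar> \<le> A * (A * (1 + P) * (2 * A\<^sup>2))"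
      by (intro sumA abs_mult_le bb dw)
    also have "\<dots> = 2 * A ^ 4 * (1 + P)" by (simp add: eval_nat_numeral)
    also have "\<dots> \<le> 6 * A ^ 5 * (1 + P)"
    proof (rule mult_right_mono)
      have "A ^ 4 \<le> A ^ 5" "0 \<le> A ^ 5" using A(1) by (auto intro: power_increasing)
      then show "2 * A ^ 4 \<le> 6 * A ^ 5" by linarith
    qed (use P0 in simp)
    finally have "k * \<phi> z0 * D \<le> 6 * A ^ 5 * (1 + P)" using le unfolding dV by linarith
    \<comment> \<open>Since \<open>\<phi> \<le> - 1\<close> at the initial time, the sign of the
      time derivative of \<open>V\<close> bounds \<open>- D\<close>, which is of order
      \<open>P\<^sup>2\<close>. If \<open>- D\<close> is negative, \<open>Dle\<close> already makes
      the left side nonpositive.\<close>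
    moreover have "k * (P\<^sup>2 / A - 4 * A) \<le> k * \<phi> z0 * D \<or> - D < 0"
    proof (cases "- D < 0")
      case False
      have "- A \<le> ww z0" using w0[of x] A(5) 2 by (auto simp: abs_le_iff)
      then have "P\<^sup>2 / A - 4 * A \<le> - D" by (rule Dle)
      also have "- D \<le> - \<phi> z0 * - D" using phi_0[of x] False 2 mult_right_mono[of 1 "- \<phi> z0" "- D"] by simp
      finally have "k * (P\<^sup>2 / A - 4 * A) \<le> k * (- \<phi> z0 * - D)" using k0 by (intro mult_left_mono) auto
      then show ?thesis by (simp add: mult.assoc)
    qed simp
    moreover have "k * (P\<^sup>2 / A - 4 * A) \<le> 6 * A ^ 5 * (1 + P)" if "- D < 0"
    proof -
      have "- A \<le> ww z0" using w0[of x] A(5) 2 by (auto simp: abs_le_iff)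
      then have "P\<^sup>2 / A - 4 * A \<le> 0" using Dle that by linarith
      then have "k * (P\<^sup>2 / A - 4 * A) \<le> 0" using k0 by (simp add: mult_le_0_iff)
      also have "0 \<le> 6 * A ^ 5 * (1 + P)" using A0 P0 by simp
      finally show ?thesis .
    qed
    ultimately have "k * (P\<^sup>2 / A - 4 * A) \<le> 6 * A ^ 5 * (1 + P)" by linarith
    then show ?thesis using solve MY by linarith
  next
    case (3 x)
    have ge: "dd Q et V z0 \<ge> 0" using max_terminal[OF max[unfolded 3] difV[unfolded 3]] 3 by simp
    have zT: "(x, T) \<in> Q" using z0 3 by simp
    have mp: "m z0 > 0" by (rule m_pos[OF z0])
    have wz: "\<bar>ww z0\<bar> \<le> A" using wB[of x] 3 by simp
    have fx_b: "\<bar>fx l (mz z0)\<bar> \<le> 6 * A ^ 3" for l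
    proof -
      have FW: "\<bar>F (fst z0, m z0)\<bar> \<le> A" using wz by (simp only: ww_def mz_def)
      have "X (fst z0, m z0) \<le> C0 + C0 * \<bar>F (fst z0, m z0)\<bar>" by (rule X_le[OF mp])
      also have "\<dots> \<le> A + A * A" by (intro add_mono mult_mono CA FW A0(2)) (rule abs_ge_zero)
      finally have "F_growth \<tau> f (fst z0, m z0) \<le> 3 + A + (A + A * A)" using F_growth_le[OF mp, of "fst z0"] FW by linarith
      also have "\<dots> \<le> 6 * (A * A)" using mult_mono[OF A(1) A(1)] mult_left_mono[OF A(1) A0(2)] A0 by linarith
      finally have "C0 * F_growth \<tau> f (fst z0, m z0) \<le> C0 * (6 * (A * A))" using C by (intro mult_left_mono) auto
      also have "\<dots> \<le> A * (6 * (A * A))" using CA A0 by (intro mult_right_mono) auto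
      finally show ?thesis using fx_bounds(1)[OF mp, of l "fst z0"] unfolding mz_def by (simp add: power3_eq_cube)
    qed
    define G where "G = fm (mz z0) / g.fm (mz z0)"
    have gm: "g.fm (mz z0) > 0" unfolding mz_def by (rule g.fm_pos[OF mp])
    have G0: "G > 0" unfolding G_def using gm fm_pos[OF mp, of "fst z0"] by (simp add: mz_def)
    define J where "J = (\<Sum>l\<in>UNIV. bb l z0 * (p z0 $ l - g.fx l (mz z0)))"
    have "dd Q (ex l) ww z0 = fx l (mz z0) + G * (p z0 $ l - g.fx l (mz z0))" for l
      unfolding dww_boundary[OF z0] using p_terminal[of x l, folded 3] gm by (simp add: G_def)
    then have sm: "(\<Sum>l\<in>UNIV. bb l z0 * dd Q (ex l) ww z0) = (\<Sum>l\<in>UNIV. bb l z0 * fx l (mz z0)) + G * J"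
      unfolding J_def by (simp add: distrib_left sum.distrib sum_distrib_left mult.left_commute)
    have b1: "\<bar>\<Sum>l\<in>UNIV. bb l z0 * fx l (mz z0)\<bar> \<le> 6 * A ^ 5 * (1 + P)"
    proof -
      have "\<bar>\<Sum>l\<in>UNIV. bb l z0 * fx l (mz z0)\<bar> \<le> A * (A * (1 + P) * (6 * A ^ 3))"
        by (intro sumA abs_mult_le bb fx_b)
      also have "\<dots> = 6 * A ^ 5 * (1 + P)" by (simp add: eval_nat_numeral ac_simps)
      finally show ?thesis .
    qed
    \<comment> \<open>If \<open>J\<close> is nonnegative, the term \<open>G * J\<close> can be
      discarded in the sign condition for the time derivative of \<open>V\<close>. If
      \<open>J < 0\<close>, then \<open>b \<cdot> p\<close> is below
      \<open>b \<cdot> g\<^sub>x\<close>; the former grows quadratically in \<open>P\<close>, the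
      latter linearly, so \<open>P\<close> is bounded at once. In neither case is \<open>G\<close>
      estimated.\<close>
    show ?thesis
    proof (cases "J < 0")
      case True
      have "J = (\<Sum>l\<in>UNIV. bb l z0 * p z0 $ l) - (\<Sum>l\<in>UNIV. bb l z0 * g.fx l (mz z0))"
        unfolding J_def by (simp add: right_diff_distrib sum_subtractf)
      moreover have "\<bar>\<Sum>l\<in>UNIV. bb l z0 * g.fx l (mz z0)\<bar> \<le> A * (A * (1 + P) * A)"
        by (intro sumA abs_mult_le bb) (use gB[of _ x] 3 in simp)
      moreover have "(\<Sum>l\<in>UNIV. bb l z0 * p z0 $ l) \<ge> 2 * hh z0 - C0"
        unfolding bb_def zp_def hh_def by (rule HP_inner)
      moreover have "hh z0 \<ge> P\<^sup>2 / C0 - C0" unfolding hh_def zp_def P_def by (rule H_bounds(1))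
      moreover have "P\<^sup>2 / A \<le> P\<^sup>2 / C0" using CA C by (intro divide_left_mono) auto
      ultimately have "2 * (P\<^sup>2 / A) \<le> 3 * A + A * (A * (1 + P) * A)" using True CA by linarith
      then have "A * (2 * (P\<^sup>2 / A)) \<le> A * (3 * A + A * (A * (1 + P) * A))" using A0 by (intro mult_left_mono) auto
      moreover have "A * (2 * (P\<^sup>2 / A)) = 2 * P\<^sup>2" using A0 by simp
      moreover have "A * (3 * A + A * (A * (1 + P) * A)) = 3 * A\<^sup>2 + A ^ 4 + A ^ 4 * P"
        by (simp add: eval_nat_numeral algebra_simps)
      moreover have "A\<^sup>2 \<le> A ^ 4" using A(1) by (intro power_increasing) auto
      ultimately have "P\<^sup>2 \<le> 2 * A ^ 4 + A ^ 4 / 2 * P" by linarith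
      then have "P \<le> 2 * A ^ 4 + A ^ 4 / 2" by (rule quadratic_root_bound) (use M1 in auto)
      then show ?thesis using M1 MY unfolding M_def by linarith
    next
      case False
      then have "0 \<le> G * J" using G0 by simp
      then have kD: "- (k * \<phi> z0 * D) \<le> 6 * A ^ 5 * (1 + P)" using ge b1 unfolding dV sm by linarith
      have Dz: "P\<^sup>2 / A - 4 * A \<le> - D" using wz by (intro Dle) linarith
      have "k * (P\<^sup>2 / A - 4 * A) \<le> 6 * A ^ 5 * (1 + P)"
      proof (cases "- D < 0")
        case True
        then have "k * (P\<^sup>2 / A - 4 * A) \<le> 0" using k0 Dz by (simp add: mult_le_0_iff)
        also have "0 \<le> 6 * A ^ 5 * (1 + P)" using A0 P0 by simp
        finally show ?thesis .
      next
        case False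
        have "- D \<le> \<phi> z0 * - D" using phi_T[of x] False 3 mult_right_mono[of 1 "\<phi> z0" "- D"] by simp
        then have "k * (P\<^sup>2 / A - 4 * A) \<le> k * (\<phi> z0 * - D)" using k0 Dz by (intro mult_left_mono) auto
        then show ?thesis using kD by (simp add: mult.assoc)
      qed
      then show ?thesis using solve MY by linarith
    qed
  qed
  have Y1: "1 \<le> Y" using MY M1 unfolding M_def by linarith
  have YY: "Y \<le> Y\<^sup>2" "1 \<le> Y\<^sup>2" using Y1 by (auto simp: power2_eq_square mult_le_cancel_left1 one_le_power intro: mult_ge1_I)
  have AY: "A \<le> A * Y\<^sup>2" "A * Y \<le> A * Y\<^sup>2" using mult_left_mono[OF YY(2) A0(2)] mult_left_mono[OF YY(1) A0(2)] by simp_all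
  \<comment> \<open>From the maximum point to all points: \<open>hh\<close> and \<open>V\<close>
    differ by at most 1, and coercivity of \<open>H\<close> then turns a bound on \<open>hh\<close>
    into one on \<open>Du\<close>.\<close>
  have hmax: "hh y \<le> A * Y\<^sup>2 + 2 * A" if y: "y \<in> Q" for y
  proof -
    have "hh z0 \<le> C0 * P\<^sup>2 + C0" unfolding hh_def zp_def P_def by (rule H_bounds(2))
    also have "\<dots> \<le> A * Y\<^sup>2 + A" using CA C A0 P_le P0 by (intro add_mono mult_mono power_mono) auto
    finally show ?thesis using hV(1)[OF y] max[OF y] hV(2)[OF z0] A(1) by linarith
  qed
  have p_le: "norm (p z) \<le> 2 * A * Y"
  proof (rule power2_le_imp_le)
    have "(norm (p z))\<^sup>2 / C0 - C0 \<le> hh z" unfolding hh_def zp_def by (rule H_bounds(1))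
    then have "(norm (p z))\<^sup>2 / C0 \<le> A * Y\<^sup>2 + 3 * A" using hmax[OF z] CA by linarith
    also have "\<dots> \<le> 4 * (A * Y\<^sup>2)" using AY by linarith
    finally have "(norm (p z))\<^sup>2 \<le> 4 * (A * Y\<^sup>2) * C0" using C by (simp add: pos_divide_le_eq)
    also have "\<dots> \<le> 4 * (A * Y\<^sup>2) * A" using CA A0 by (intro mult_left_mono) auto
    finally show "(norm (p z))\<^sup>2 \<le> (2 * A * Y)\<^sup>2" by (simp add: power_mult_distrib power2_eq_square ac_simps)
  qed (use A0 Y1 in simp)
  have bd: "(x, 0) \<in> Q" "(x, T) \<in> Q" for x using T_pos by (simp_all add: mem_Q)
  \<comment> \<open>Both bounds on \<open>u\<^sub>t\<close> come from the ends, where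
    \<open>w\<close> and \<open>hh\<close> are controlled.\<close>
  have up: "1 * ut z \<le> 4 * (A * Y\<^sup>2)"
  proof (rule ut_principle[OF _ _ _ z])
    fix x
    show "1 * ut (x, 0) \<le> 4 * (A * Y\<^sup>2)" using ww_eq[OF bd(1)[of x]] hmax[OF bd(1)[of x]] w0[of x] A(5) AY by linarith
    show "1 * ut (x, T) \<le> 4 * (A * Y\<^sup>2)" using ww_eq[OF bd(2)[of x]] hmax[OF bd(2)[of x]] W(2)[of x] A(5) AY by linarith
  qed simp
  have hlow: "- C0 \<le> hh y" for y
  proof -
    have "(norm (p y))\<^sup>2 / C0 - C0 \<le> hh y" unfolding hh_def zp_def by (rule H_bounds(1))
    moreover have "0 \<le> (norm (p y))\<^sup>2 / C0" using C by simp
    ultimately show ?thesis by linarith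
  qed
  have dn: "(- 1) * ut z \<le> 4 * (A * Y\<^sup>2)"
  proof (rule ut_principle[OF _ _ _ z])
    fix x
    show "(- 1) * ut (x, 0) \<le> 4 * (A * Y\<^sup>2)" using ww_eq[OF bd(1)[of x]] hlow[of "(x, 0)"] w0[of x] A(5) CA AY by linarith
    show "(- 1) * ut (x, T) \<le> 4 * (A * Y\<^sup>2)" using ww_eq[OF bd(2)[of x]] hlow[of "(x, T)"] wB[of x] CA AY by linarith
  qed simp
  have "D_full T u z = (p z, ut z)" unfolding D_full_def p_def ut_def d_snd_dd ..
  then have "norm (D_full T u z) \<le> norm (p z) + norm (ut z)" using norm_Pair_le[of "p z" "ut z"] by simp
  also have "\<dots> \<le> 2 * (A * Y) + 4 * (A * Y\<^sup>2)" using p_le up dn by simp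
  also have "\<dots> \<le> 6 * (A * Y\<^sup>2)" using AY by linarith
  finally show ?thesis unfolding Y_def by (simp add: mult.assoc)
qed

end

section \<open>The constants\<close>

text \<open>With \<open>n\<close> the dimension, \<open>13 * n * c ^ 4\<close> is
  \<open>barrier_rate\<close> and the exponential term is \<open>barrier_slope T\<close>. The other
  summands make the value exceed \<open>C0\<close>, \<open>T\<close> and 1.\<close>

definition L1_const :: "real \<Rightarrow> real \<times> real \<Rightarrow> real" where
  "L1_const n = (\<lambda>(c, t). c + (2 * c + 1) * exp (13 * n * c ^ 4 * t) + t + 1)"

text \<open>The product \<open>l * l\<close> majorises \<open>T * barrier_slope T\<close>, by which
  \<open>u\<close> inside the cylinder may exceed its terminal extremes.\<close>

definition L_const :: "real \<times> real \<times> real \<times> real \<times> real \<Rightarrow> real" where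
  "L_const = (\<lambda>(l, a, b, c, e). 1 + l + l * l + a + b + c + e)"

text \<open>With \<open>t = 1 / T\<close>, the product \<open>(2 * l + 2) * (1 + t)\<close> covers
  both the size \<open>2 * L + 1\<close> of \<open>\<phi>\<close> and its slope
  \<open>2 * (L + 1) / T\<close>; \<open>k\<close> is \<open>1 / (1 - \<tau>)\<close>.\<close>

definition K1_const :: "real \<times> real \<times> real \<times> real \<Rightarrow> real" where
  "K1_const = (\<lambda>(l, t, k, w). (2 * l + 2) * (1 + t) + k + w + 1)"

text \<open>\<open>n + k + b\<close> is the number \<open>A\<close> of
  \<open>gradient_estimate\<close>, and \<open>k\<close> also serves as the exponent there, being at
  least \<open>1 / (1 - \<tau>)\<close>.\<close>

definition K_const :: "real \<Rightarrow> real \<times> real \<Rightarrow> real" where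
  "K_const n = (\<lambda>(k, b). 6 * (n + k + b) * ((500000 * (n + k + b) ^ 40) powr k)\<^sup>2)"

lemma monotone_L1_const: "n \<ge> 0 \<Longrightarrow> monotone_constant (L1_const n)"
  unfolding monotone_constant_def
proof (intro conjI allI impI mono_onI)
  fix a :: "real \<times> real" assume "n \<ge> 0" "a \<ge> 0"
  then show "L1_const n a > 0"
    by (cases a) (auto simp: L1_const_def zero_prod_def intro!: add_nonneg_pos add_nonneg_nonneg mult_nonneg_nonneg)
next
  fix a b :: "real \<times> real" assume "n \<ge> 0" "a \<in> {0..}" "b \<in> {0..}" "a \<le> b"
  then show "L1_const n a \<le> L1_const n b"
    by (cases a, cases b)
      (auto simp: L1_const_def zero_prod_def intro!: add_mono mult_mono power_mono mult_nonneg_nonneg)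
qed

lemma monotone_L_const: "monotone_constant L_const"
  unfolding monotone_constant_def
proof (intro conjI allI impI mono_onI)
  fix a :: "real \<times> real \<times> real \<times> real \<times> real" assume "a \<ge> 0"
  then show "L_const a > 0"
    by (cases a) (auto simp: L_const_def zero_prod_def intro!: add_pos_nonneg)
next
  fix a b :: "real \<times> real \<times> real \<times> real \<times> real" assume "a \<in> {0..}" "b \<in> {0..}" "a \<le> b"
  then show "L_const a \<le> L_const b"
    by (cases a, cases b) (auto simp: L_const_def zero_prod_def intro!: add_mono mult_mono)
qed

lemma monotone_K1_const: "monotone_constant K1_const"
  unfolding monotone_constant_def
proof (intro conjI allI impI mono_onI)
  fix a :: "real \<times> real \<times> real \<times> real" assume "a \<ge> 0"
  then show "K1_const a > 0"
    by (cases a) (auto simp: K1_const_def zero_prod_def intro!: add_nonneg_pos add_nonneg_nonneg)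
next
  fix a b :: "real \<times> real \<times> real \<times> real" assume "a \<in> {0..}" "b \<in> {0..}" "a \<le> b"
  then show "K1_const a \<le> K1_const b"
    by (cases a, cases b) (auto simp: K1_const_def zero_prod_def intro!: add_mono mult_mono)
qed

lemma monotone_K_const: "n \<ge> 1 \<Longrightarrow> monotone_constant (K_const n)"
  unfolding monotone_constant_def
proof (intro conjI allI impI mono_onI)
  fix a :: "real \<times> real" assume "n \<ge> 1" "a \<ge> 0"
  then show "K_const n a > 0"
    by (cases a) (auto simp: K_const_def zero_prod_def intro!: mult_pos_pos add_pos_nonneg)
next
  fix a b :: "real \<times> real" assume n: "n \<ge> 1" and "a \<in> {0..}" "b \<in> {0..}" "a \<le> b"
  then obtain k d k' d' where ab: "a = (k, d)" "b = (k', d')" and le: "0 \<le> k" "0 \<le> d" "k \<le> k'" "d \<le> d'"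
    by (cases a, cases b) (auto simp: zero_prod_def)
  define A where "A = n + k + d"
  define B where "B = n + k' + d'"
  have AB: "1 \<le> A" "A \<le> B" using n le unfolding A_def B_def by linarith+
  have "1 \<le> A ^ 40" "A ^ 40 \<le> B ^ 40" using AB by (auto intro: one_le_power power_mono)
  then have "(500000 * A ^ 40) powr k \<le> (500000 * B ^ 40) powr k'"
    using le by (intro powr_mono_both) linarith+
  then have "6 * A * ((500000 * A ^ 40) powr k)\<^sup>2 \<le> 6 * B * ((500000 * B ^ 40) powr k')\<^sup>2"
    using AB by (intro mult_mono power_mono) auto
  then show "K_const n a \<le> K_const n b" unfolding K_const_def ab A_def B_def by simp
qed

section \<open>Bounds in terms of the data\<close>

context mfg
begin

text \<open>By (G) all slices of \<open>g\<close> increase from the same infimum to the same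
  supremum, so a value at positive density lies strictly inside the range of every slice. With
  \<open>g_below\<close> this makes the inverses of the extremal slices of \<open>g\<close>
  meaningful at such values.\<close>

lemma g_above: "\<mu> > 0 \<Longrightarrow> \<exists>\<nu>>0. g.F (x, \<nu>) > g.F (y, \<mu>)"
proof -
  assume m: "\<mu> > 0"
  have "g (y, \<mu>) < g (y, \<mu> + 1)" using m by (intro g.f_strict) auto
  also have "\<dots> \<le> (SUP z\<in>nonneg_dom. g z)" using m by (intro SUP_upper) (simp add: nonneg_dom_def)
  finally have lt: "g (y, \<mu>) < (SUP z\<in>nonneg_dom. g z)" .
  have "((\<lambda>\<nu>. g (x, \<nu>)) \<longlongrightarrow> (SUP z\<in>nonneg_dom. g z)) at_top"
    using assm_G unfolding assumption_G_def by blast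
  then have "eventually (\<lambda>\<nu>. g (y, \<mu>) < g (x, \<nu>)) at_top" using lt by (rule order_tendstoD)
  then obtain \<nu> where n: "\<nu> \<ge> 1" "g (y, \<mu>) < g (x, \<nu>)"
    unfolding eventually_at_top_linorder by (metis max.cobounded1 max.cobounded2)
  then have "ereal (g.F (y, \<mu>)) < ereal (g.F (x, \<nu>))" using g.f_eq[OF m, of y] g.f_eq[of \<nu> x] by (metis less_le_trans zero_less_one)
  then have "g.F (y, \<mu>) < g.F (x, \<nu>)" by (simp only: less_ereal.simps)
  moreover have "0 < \<nu>" using n(1) by linarith
  ultimately show ?thesis by blast
qed

lemma g_below: "\<mu> > 0 \<Longrightarrow> \<exists>\<nu>>0. g.F (x, \<nu>) < g.F (y, \<mu>)"
proof (rule g.below_of_zero)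
  assume m: "\<mu> > 0"
  have "g (x, 0) = (INF z\<in>nonneg_dom. g z)" using assm_G unfolding assumption_G_def by blast
  also have "\<dots> \<le> g (y, 0)" by (intro INF_lower) (simp add: nonneg_dom_def)
  also have "\<dots> < g (y, \<mu>)" using m by (intro g.f_strict) auto
  also have "\<dots> = ereal (g.F (y, \<mu>))" by (rule g.f_eq[OF m])
  finally show "g (x, 0) < ereal (g.F (y, \<mu>))" .
qed

text \<open>At the terminal point \<open>y\<close> from \<open>barrier\<close> one has
  \<open>f(y, m) \<le> l = f\<^sub>0(\<mu>) \<le> f(y, \<mu>)\<close>, so
  \<open>m \<le> \<mu>\<close> there and \<open>u(y, T) \<le> g\<^sub>1(\<mu>) = a\<close>. As
  \<open>y\<close> maximises \<open>u\<close> at time \<open>T\<close>,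
  \<open>g\<^sub>0(m) \<le> u \<le> a\<close> holds at all terminal points.\<close>

lemma upper_bounds:
  fixes l :: real
  assumes l: "C0 + barrier_slope T \<le> l"
  defines "a \<equiv> x_max g (inv_pos (x_min f) l)"
  shows "z \<in> Q \<Longrightarrow> u z \<le> a + T * barrier_slope T"
    and "m (x, T) \<le> inv_pos (x_min g) a"
proof -
  define \<mu> where "\<mu> = inv_pos (x_min f) l"
  have mu: "\<mu> > 0" "x_min f \<mu> = l" unfolding \<mu>_def by (rule inv_pos_x_min[OF below above])+
  have a: "a = x_max g \<mu>" by (simp add: a_def \<mu>_def)
  obtain y where y: "\<And>z. z \<in> Q \<Longrightarrow> 1 * u z \<le> 1 * u (y, T) + T * barrier_slope T"
    "\<And>x. 1 * u (x, T) \<le> 1 * u (y, T)" "1 * ww (y, T) \<le> C0 + barrier_slope T" using barrier[of 1] by blast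
  have mT: "m (x, T) > 0" for x using T_pos by (intro m_pos) (simp add: mem_Q)
  have "F (y, m (y, T)) \<le> F (y, \<mu>)"
    using y(3) l mu(2) x_min_le[OF mu(1), of y] unfolding ww_def mz_def fst_conv by linarith
  then have "m (y, T) \<le> \<mu>" by (simp only: F_le_iff[OF mT mu(1)])
  then have "g.F (y, m (y, T)) \<le> g.F (y, \<mu>)" by (rule g.F_mono[OF mT])
  then have uT: "u (y, T) \<le> a" using g.x_max_ge[OF mu(1), of y] unfolding a u_term_real by linarith
  then show "z \<in> Q \<Longrightarrow> u z \<le> a + T * barrier_slope T" using y(1)[of z] by linarith
  obtain b where b: "a = g.F (b, \<mu>)" using g.max_attained[OF mu(1)] a by metis
  have lo: "\<exists>\<nu>>0. g.F (x, \<nu>) < a" and hi: "\<exists>\<nu>>0. g.F (x, \<nu>) > a" for x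
    unfolding b by (rule g_below[OF mu(1)], rule g_above[OF mu(1)])
  note inv = g.inv_pos_x_min[OF lo hi]
  have "x_min g (m (x, T)) \<le> g.F (x, m (x, T))" by (rule g.x_min_le[OF mT])
  also have "\<dots> \<le> a" using y(2)[of x] uT unfolding u_term_real by linarith
  finally have "x_min g (m (x, T)) \<le> x_min g (inv_pos (x_min g) a)" unfolding inv(2) .
  then show "m (x, T) \<le> inv_pos (x_min g) a" by (simp only: g.x_min_le_iff[OF mT inv(1)])
qed

lemma lower_bounds:
  fixes l :: real
  assumes l: "C0 + barrier_slope T \<le> l"
  defines "b \<equiv> x_min g (inv_pos (x_max f) (- l))"
  shows "z \<in> Q \<Longrightarrow> b - T * barrier_slope T \<le> u z"
    and "inv_pos (x_max g) b > 0" "inv_pos (x_max g) b \<le> m (x, T)"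
proof -
  define \<mu> where "\<mu> = inv_pos (x_max f) (- l)"
  have mu: "\<mu> > 0" "x_max f \<mu> = - l" unfolding \<mu>_def by (rule inv_pos_x_max[OF below above])+
  have b: "b = x_min g \<mu>" by (simp add: b_def \<mu>_def)
  obtain y where y: "\<And>z. z \<in> Q \<Longrightarrow> -1 * u z \<le> -1 * u (y, T) + T * barrier_slope T"
    "\<And>x. -1 * u (x, T) \<le> -1 * u (y, T)" "-1 * ww (y, T) \<le> C0 + barrier_slope T" using barrier[of "-1"] by blast
  have mT: "m (x, T) > 0" for x using T_pos by (intro m_pos) (simp add: mem_Q)
  have "F (y, \<mu>) \<le> F (y, m (y, T))"
    using y(3) l mu(2) x_max_ge[OF mu(1), of y] unfolding ww_def mz_def fst_conv by linarith
  then have "\<mu> \<le> m (y, T)" by (simp only: F_le_iff[OF mu(1) mT])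
  then have "g.F (y, \<mu>) \<le> g.F (y, m (y, T))" by (rule g.F_mono[OF mu(1)])
  then have uT: "b \<le> u (y, T)" using g.x_min_le[OF mu(1), of y] unfolding b u_term_real by linarith
  then show "z \<in> Q \<Longrightarrow> b - T * barrier_slope T \<le> u z" using y(1)[of z] by linarith
  obtain c where c: "b = g.F (c, \<mu>)" using g.min_attained[OF mu(1)] b by metis
  have lo: "\<exists>\<nu>>0. g.F (x, \<nu>) < b" and hi: "\<exists>\<nu>>0. g.F (x, \<nu>) > b" for x
    unfolding c by (rule g_below[OF mu(1)], rule g_above[OF mu(1)])
  note inv = g.inv_pos_x_max[OF lo hi]
  show "inv_pos (x_max g) b > 0" by (rule inv(1))
  have "b \<le> g.F (x, m (x, T))" using y(2)[of x] uT unfolding u_term_real by linarith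
  also have "\<dots> \<le> x_max g (m (x, T))" by (rule g.x_max_ge[OF mT])
  finally have "x_max g (inv_pos (x_max g) b) \<le> x_max g (m (x, T))" unfolding inv(2) .
  then show "inv_pos (x_max g) b \<le> m (x, T)" by (simp only: g.x_max_le_iff[OF inv(1) mT])
qed

lemma size_bounds:
  defines "l \<equiv> L1_const (real CARD('n)) (C0, T)"
  defines "a \<equiv> x_max g (inv_pos (x_min f) l)" and "b \<equiv> x_min g (inv_pos (x_max f) (- l))"
  defines "L \<equiv> L_const (l, \<bar>a\<bar>, \<bar>b\<bar>, inv_pos (x_min g) a, 1 / inv_pos (x_max g) b)"
  shows "C0_norm Q u + C0_norm UNIV (\<lambda>x. m (x, T)) + C0_norm UNIV (\<lambda>x. 1 / m (x, T)) \<le> ennreal L"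
    and "z \<in> Q \<Longrightarrow> \<bar>u z\<bar> \<le> L" and "m (x, T) \<in> {1 / L..L}" and "1 \<le> L" and "C0 \<le> L"
proof -
  define c where "c = inv_pos (x_min g) a"
  define e where "e = 1 / inv_pos (x_max g) b"
  have L: "L = 1 + l + l * l + \<bar>a\<bar> + \<bar>b\<bar> + c + e" by (simp add: L_def L_const_def c_def e_def)
  have bs: "barrier_slope T \<ge> 1" using T_pos by (intro barrier_slope_ge) simp
  have l: "l = C0 + barrier_slope T + T + 1"
    by (simp add: l_def L1_const_def barrier_slope_def barrier_rate_def)
  have l1: "C0 + barrier_slope T \<le> l" "C0 \<le> l" "0 \<le> l" using T_pos C0_pos bs unfolding l by linarith+
  have mT: "m (x, T) > 0" for x using T_pos by (intro m_pos) (simp add: mem_Q)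
  \<comment> \<open>Both factors are summands of \<open>l\<close>.\<close>
  have sl: "T * barrier_slope T \<le> l * l" "0 \<le> T * barrier_slope T"
    using T_pos C0_pos bs unfolding l by (intro mult_mono, linarith+, simp)
  have u_le: "\<bar>u z\<bar> \<le> \<bar>a\<bar> + \<bar>b\<bar> + l * l" if "z \<in> Q" for z
  proof -
    have "u z \<le> a + T * barrier_slope T" unfolding a_def by (rule upper_bounds(1)[OF l1(1) that])
    moreover have "b - T * barrier_slope T \<le> u z" unfolding b_def by (rule lower_bounds(1)[OF l1(1) that])
    ultimately show ?thesis using sl by (intro abs_leI) linarith+
  qed
  have m_le: "m (x, T) \<le> c" for x unfolding c_def a_def by (rule upper_bounds(2)[OF l1(1)])
  have "inv_pos (x_max g) b > 0" "inv_pos (x_max g) b \<le> m (x, T)" for x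
    unfolding b_def by (rule lower_bounds(2,3)[OF l1(1)])+
  then have e0: "0 \<le> e" and inv_le: "1 / m (x, T) \<le> e" for x
    unfolding e_def by (simp_all add: divide_left_mono mT)
  have c0: "0 \<le> c" using m_le[of undefined] mT[of undefined] by linarith
  have ll: "0 \<le> l * l" by simp
  show L1: "1 \<le> L" and "C0 \<le> L" using l1 ll c0 e0 unfolding L by linarith+
  show "\<bar>u z\<bar> \<le> L" if "z \<in> Q" using u_le[OF that] l1 c0 e0 unfolding L by linarith
  have "m (x, T) \<le> L" "1 / m (x, T) \<le> L" using m_le[of x] inv_le[of x] l1 ll c0 e0 unfolding L by linarith+
  moreover then have "1 / L \<le> m (x, T)" using mT[of x] L1 by (simp add: field_simps)
  ultimately show "m (x, T) \<in> {1 / L..L}" by simp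
  have "C0_norm Q u \<le> ennreal (\<bar>a\<bar> + \<bar>b\<bar> + l * l)" by (rule C0_norm_le) (simp add: u_le)
  moreover have "C0_norm UNIV (\<lambda>x. m (x, T)) \<le> ennreal c" using mT m_le by (intro C0_norm_le) (simp add: less_imp_le)
  moreover have "C0_norm UNIV (\<lambda>x. 1 / m (x, T)) \<le> ennreal e" using mT inv_le by (intro C0_norm_le) (simp add: less_imp_le)
  ultimately have "C0_norm Q u + C0_norm UNIV (\<lambda>x. m (x, T)) + C0_norm UNIV (\<lambda>x. 1 / m (x, T))
      \<le> ennreal (\<bar>a\<bar> + \<bar>b\<bar> + l * l) + ennreal c + ennreal e" by (intro add_mono)
  also have "\<dots> = ennreal (\<bar>a\<bar> + \<bar>b\<bar> + l * l + c + e)" using c0 e0 by (simp add: ennreal_plus)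
  also have "\<dots> \<le> ennreal L" using l1(3) unfolding L by (intro ennreal_leI) linarith
  finally show "C0_norm Q u + C0_norm UNIV (\<lambda>x. m (x, T)) + C0_norm UNIV (\<lambda>x. 1 / m (x, T)) \<le> ennreal L" .
qed

text \<open>The argument \<open>k\<close> of \<open>beta\<close> is large enough for both uses of
  it: the terminal densities lie in \<open>{1 / k..k}\<close>, and \<open>w \<ge> - (W + 1)\<close>
  implies \<open>w \<ge> - k\<close>, where \<open>1 / \<chi>\<close> is bounded.\<close>

lemma gradient_bound:
  fixes L :: real
  assumes uL: "\<And>z. z \<in> Q \<Longrightarrow> \<bar>u z\<bar> \<le> L" and mL: "\<And>x. m (x, T) \<in> {1 / L..L}" and L: "1 \<le> L" "C0 \<le> L"
  defines "k \<equiv> K1_const (L, 1 / T, 1 / (1 - \<tau>), max 0 (- x_min f (1 / L)))"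
  shows "C0_norm Q (D_full T u) \<le> ennreal (K_const (real CARD('n)) (k, enn2real (beta f g k)))"
proof -
  define w where "w = max 0 (- x_min f (1 / L))"
  define B where "B = enn2real (beta f g k)"
  define A where "A = real CARD('n) + k + B"
  \<comment> \<open>\<open>L\<close> accounts for \<open>C0\<close>, hence for the initial time;
    \<open>w\<close> bounds the coupling from below at the terminal time, where the density is at
    least \<open>1 / L\<close>.\<close>
  define W where "W = L + w"
  have w: "0 \<le> w" "- w \<le> x_min f (1 / L)" unfolding w_def by linarith+
  have kap: "0 \<le> 1 / (1 - \<tau>)" using tau by simp
  have iT: "0 \<le> 1 / T" using T_pos by simp
  have k: "k = (2 * L + 2) + (2 * L + 2) * (1 / T) + 1 / (1 - \<tau>) + w + 1"
    unfolding k_def K1_const_def w_def prod.case by (simp only: distrib_left mult_1_right)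
  have pr: "0 \<le> (2 * L + 2) * (1 / T)" using L iT by (intro mult_nonneg_nonneg) auto
  have kL: "L \<le> k" "k \<ge> 1" "2 * L + 1 \<le> k" "W + 1 \<le> k" "1 / (1 - \<tau>) \<le> k" "(2 * L + 2) * (1 / T) \<le> k"
    using L w kap pr unfolding k W_def by linarith+
  have k0: "k > 0" using kL(2) by linarith
  note bd = beta_bounds[OF g.regular k0 B_def]
  have A: "A \<ge> k" "A \<ge> B" "A \<ge> real CARD('n)" using bd(4) kL(2) N_ge_1 unfolding A_def by linarith+
  have zT: "(x, T) \<in> Q" for x using T_pos by (simp add: mem_Q)
  have "1 / k \<le> 1 / L" using kL L by (intro divide_left_mono) auto
  then have mk: "m (x, T) \<in> {1 / k..k}" for x using mL[of x] kL(1) by simp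
  have "norm (D_full T u z) \<le> 6 * A * ((500000 * A ^ 40) powr k)\<^sup>2" if z: "z \<in> Q" for z
  proof (rule gradient_estimate[where W = W and L = L])
    show "- W \<le> ww (x, T)" for x
    proof -
      have "x_min f (1 / L) \<le> F (x, 1 / L)" using L by (intro x_min_le) simp
      also have "\<dots> \<le> F (x, m (x, T))" using L mL[of x] by (intro F_mono) simp_all
      finally show ?thesis using w L unfolding W_def ww_def mz_def fst_conv by linarith
    qed
    show "1 / X (mz y) \<le> A" if y: "y \<in> Q" "ww y \<ge> - (W + 1)" for y
    proof -
      have "F (fst y, m y) \<ge> - k" using y(2) kL(4) unfolding ww_def mz_def by linarith
      from bd(3)[OF m_pos[OF y(1)] this] show ?thesis using A(2) unfolding mz_def by linarith
    qed
    show "\<bar>g.fx i (mz (x, T))\<bar> \<le> A" for x i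
      using component_le_norm_cart[of "D_fst pos_dom g.F (x, m (x, T))" i] bd(2)[OF mk, of x x] A(2)
      unfolding g.D_fst_F_nth mz_def fst_conv by linarith
    show "\<bar>ww (x, T)\<bar> \<le> A" for x
      using bd(1)[OF mk, of x x] A(2) unfolding ww_def mz_def fst_conv by linarith
    show "2 * (L + 1) / T \<le> A" using kL(6) A(1) by (simp add: distrib_left)
  qed (use uL L w kL A z in \<open>simp_all add: W_def\<close>)
  then show ?thesis unfolding K_const_def prod.case A_def[symmetric] B_def[symmetric] by (intro C0_norm_le) simp
qed

end

theorem theorem3p9:
  "\<exists>(L1_fun :: real \<times> real \<Rightarrow> real)
     (L_fun :: real \<times> real \<times> real \<times> real \<times> real \<Rightarrow> real)
     (K1_fun :: real \<times> real \<times> real \<times> real \<Rightarrow> real)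
     (K_fun :: real \<times> real \<Rightarrow> real).
     monotone_constant L1_fun \<and> monotone_constant L_fun \<and>
     monotone_constant K1_fun \<and> monotone_constant K_fun \<and>
     (\<forall>C0 \<tau> T (H :: (real^'n) \<times> (real^'n) \<Rightarrow> real) (f :: (real^'n) \<times> real \<Rightarrow> ereal)
        (g :: (real^'n) \<times> real \<Rightarrow> ereal) (m0 :: real^'n \<Rightarrow> real)
        (u :: (real^'n) \<times> real \<Rightarrow> real) (m :: (real^'n) \<times> real \<Rightarrow> real).
        C0 > 0 \<longrightarrow> 0 \<le> \<tau> \<longrightarrow> \<tau> < 1 \<longrightarrow> T > 0 \<longrightarrow>
        assumption_M m0 \<longrightarrow> assumption_H C0 \<tau> H \<longrightarrow> assumption_F C0 \<tau> f \<longrightarrow>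
        assumption_G g \<longrightarrow> assumption_SE f \<longrightarrow> C0_convention C0 \<tau> H f m0 \<longrightarrow>
        MFG_solution T H f g m0 u m \<longrightarrow>
        (let f\<^sub>0 = x_min f; f\<^sub>1 = x_max f; g\<^sub>0 = x_min g; g\<^sub>1 = x_max g;
             L\<^sub>1 = L1_fun (C0, T);
             L = L_fun (L\<^sub>1,
                        \<bar>g\<^sub>1 (inv_pos f\<^sub>0 L\<^sub>1)\<bar>,
                        \<bar>g\<^sub>0 (inv_pos f\<^sub>1 (- L\<^sub>1))\<bar>,
                        inv_pos g\<^sub>0 (g\<^sub>1 (inv_pos f\<^sub>0 L\<^sub>1)),
                        1 / inv_pos g\<^sub>1 (g\<^sub>0 (inv_pos f\<^sub>1 (- L\<^sub>1))));
             K\<^sub>1 = K1_fun (L, 1 / T, 1 / (1 - \<tau>), max 0 (- f\<^sub>0 (1 / L)));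
             K = K_fun (K\<^sub>1, enn2real (beta f g K\<^sub>1))
         in (\<forall>x. m (x, T) > 0) \<and>
            C0_norm (QT_closure T) u
              + C0_norm UNIV (\<lambda>x. m (x, T)) + C0_norm UNIV (\<lambda>x. 1 / m (x, T)) \<le> ennreal L \<and>
            C0_norm (QT_closure T) (D_full T u) \<le> ennreal K))"
proof (intro exI conjI allI impI)
  \<comment> \<open>The dimension is fixed, so it may enter the constants as a parameter.\<close>
  show "monotone_constant (L1_const (real CARD('n)))" by (rule monotone_L1_const) simp
  show "monotone_constant (K_const (real CARD('n)))" by (rule monotone_K_const) (simp add: Suc_leI)
  fix C0 \<tau> T :: real and H :: "(real^'n) \<times> (real^'n) \<Rightarrow> real" and f g :: "(real^'n) \<times> real \<Rightarrow> ereal"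
    and m0 :: "real^'n \<Rightarrow> real" and u m :: "(real^'n) \<times> real \<Rightarrow> real"
  assume "C0 > 0" "0 \<le> \<tau>" "\<tau> < 1" "T > 0" "assumption_M m0" "assumption_H C0 \<tau> H" "assumption_F C0 \<tau> f"
    "assumption_G g" "assumption_SE f" "C0_convention C0 \<tau> H f m0" "MFG_solution T H f g m0 u m"
  then interpret mfg f C0 \<tau> g T H m0 u m
    by unfold_locales (auto simp: assumption_F_def assumption_G_def)
  have m: "\<forall>x. m (x, T) > 0" using T_pos by (simp add: m_pos mem_Q)
  show "let f\<^sub>0 = x_min f; f\<^sub>1 = x_max f; g\<^sub>0 = x_min g; g\<^sub>1 = x_max g;
      L\<^sub>1 = L1_const (real CARD('n)) (C0, T);
      L = L_const (L\<^sub>1, \<bar>g\<^sub>1 (inv_pos f\<^sub>0 L\<^sub>1)\<bar>, \<bar>g\<^sub>0 (inv_pos f\<^sub>1 (- L\<^sub>1))\<bar>,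
        inv_pos g\<^sub>0 (g\<^sub>1 (inv_pos f\<^sub>0 L\<^sub>1)), 1 / inv_pos g\<^sub>1 (g\<^sub>0 (inv_pos f\<^sub>1 (- L\<^sub>1))));
      K\<^sub>1 = K1_const (L, 1 / T, 1 / (1 - \<tau>), max 0 (- f\<^sub>0 (1 / L)));
      K = K_const (real CARD('n)) (K\<^sub>1, enn2real (beta f g K\<^sub>1))
    in (\<forall>x. m (x, T) > 0) \<and>
      C0_norm (QT_closure T) u + C0_norm UNIV (\<lambda>x. m (x, T)) + C0_norm UNIV (\<lambda>x. 1 / m (x, T)) \<le> ennreal L \<and>
      C0_norm (QT_closure T) (D_full T u) \<le> ennreal K"
    unfolding Let_def using m by (intro conjI size_bounds gradient_bound)
qed (rule monotone_L_const monotone_K1_const)+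

end
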